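(* Let $R$ be an $F$-finite regular ring containing a field $k\supseteq\mathbb{F}_q$, let $f\in R$, and let $M$ be the $\gamma$-sheaf on $\operatorname{Spec}R$ given by $R\xrightarrow{\,f\cdot\,}R\cong\sigma^*R$. Then $$M_{\min}=\tau\bigl(f^{(1+q+q^2+\cdots+q^{e-1})/q^e}\bigr)\quad\text{for } e\gg0 .$$ In particular, $M_{\min}\supseteq\tau(f^{\frac{1}{q-1}})$, and the $F$-pure threshold of $f$ is $\geq\frac{1}{q-1}$ if and only if $M$ is minimal.
   Context: $R$ is noetherian of characteristic $p>0$, $q$ is a fixed power of $p$, $\sigma$ is the Frobenius $r\mapsto r^q$, and $F$-finite means that $\sigma$ is finite. A coherent $\gamma$-sheaf on $\operatorname{Spec}R$ is a finitely generated $R$-module $M$ with an $R$-linear map $\gamma\colon M\to\sigma^*M$; morphisms commute with the structural maps. Put $\gamma^n=\sigma^{(n-1)*}\gamma\circ\cdots\circ\sigma^*\gamma\circ\gamma$. $M$ is nilpotent if $\gamma^n=0$ for some $n>0$; a morphism of coherent $\gamma$-sheaves is a nil-isomorphism if its kernel and cokernel are nilpotent. $M$ is minimal if it has no nonzero nilpotent $\gamma$-subsheaves and no nonzero nilpotent quotients. $\overline{M}$ is the image of $M$ in $\varinjlim(M\to\sigma^*M\to\sigma^{2*}M\to\cdots)$; $\underline{M}$ is the smallest $\gamma$-subsheaf of $M$ whose inclusion in $M$ is a nil-isomorphism (it exists); $M_{\min}=\underline{(\overline{M})}$. Ideals of $R$ are regarded as submodules of $M=R$. For an ideal $J$, $J^{[p^e]}$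 is the ideal generated by the $p^e$-th powers of elements of $J$. Generalized test ideals: for real $\alpha\ge0$, $\tau(f^\alpha)$ is the smallest ideal $J$ with $f^{\lceil\alpha p^{e}\rceil}\in J^{[p^{e}]}$, for $e\gg0$ (this ideal is independent of $e\gg0$); when $\alpha=m/q^e$, $\tau(f^{\alpha})$ is the smallest ideal $J$ with $f^m\in J^{[q^e]}$. The $F$-pure threshold of $f$ is $\sup\{\alpha\ge 0 : \tau(f^\alpha)=R\}$. *)

theory Defs
  imports Complex_Main "HOL-Library.Extended_Nat" "HOL-Library.Extended_Real"
    "HOL-Computational_Algebra.Primes" "HOL-Algebra.QuotRing"
    "HOL-Algebra.Module" "HOL-Algebra.Subrings" "HOL-Algebra.Ring_Divisibility"
begin

section \<open>Regular rings\<close>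

text \<open>The fraction $a/s$ in $S^{-1}R$, as an equivalence class of pairs.\<close>

definition fraction :: "('a, 'x) ring_scheme \<Rightarrow> 'a set \<Rightarrow> 'a \<Rightarrow> 'a \<Rightarrow> ('a \<times> 'a) set" where
  "fraction R S a s = {(b, t). b \<in> carrier R \<and> t \<in> S \<and>
     (\<exists>u\<in>S. u \<otimes>\<^bsub>R\<^esub> (t \<otimes>\<^bsub>R\<^esub> a \<ominus>\<^bsub>R\<^esub> s \<otimes>\<^bsub>R\<^esub> b) = \<zero>\<^bsub>R\<^esub>)}"

text \<open>In this definition and in several below, an operation on classes is written as a union over
  all representatives; all members of the union are the same class.\<close>

definition localization :: "('a, 'x) ring_scheme \<Rightarrow> 'a set \<Rightarrow> ('a \<times> 'a) set ring" where
  "localization R S =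
    \<lparr>carrier = {fraction R S a s | a s. a \<in> carrier R \<and> s \<in> S},
     monoid.mult = (\<lambda>U V. \<Union>(a, s)\<in>U. \<Union>(b, t)\<in>V. fraction R S (a \<otimes>\<^bsub>R\<^esub> b) (s \<otimes>\<^bsub>R\<^esub> t)),
     one = fraction R S \<one>\<^bsub>R\<^esub> \<one>\<^bsub>R\<^esub>,
     zero = fraction R S \<zero>\<^bsub>R\<^esub> \<one>\<^bsub>R\<^esub>,
     add = (\<lambda>U V. \<Union>(a, s)\<in>U. \<Union>(b, t)\<in>V.
              fraction R S (t \<otimes>\<^bsub>R\<^esub> a \<oplus>\<^bsub>R\<^esub> s \<otimes>\<^bsub>R\<^esub> b) (s \<otimes>\<^bsub>R\<^esub> t))\<rparr>"

definition krull_dim :: "('a, 'x) ring_scheme \<Rightarrow> enat" where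
  "krull_dim A = Sup {enat n | n. \<exists>P. (\<forall>i\<le>n. primeideal (P i) A) \<and> (\<forall>i<n. P i \<subset> P (Suc i))}"

definition regular_local_ring :: "('a, 'x) ring_scheme \<Rightarrow> bool" where
  "regular_local_ring A \<longleftrightarrow> cring A \<and> noetherian_ring A \<and> (\<exists>!\<mm>. maximalideal \<mm> A) \<and>
     (\<exists>G \<subseteq> carrier A. finite G \<and> enat (card G) = krull_dim A \<and> maximalideal (genideal A G) A)"

definition regular_ring :: "('a, 'x) ring_scheme \<Rightarrow> bool" where
  "regular_ring R \<longleftrightarrow> cring R \<and> noetherian_ring R \<and>
     (\<forall>P. primeideal P R \<longrightarrow> regular_local_ring (localization R (carrier R - P)))"


section \<open>Modules\<close>

text \<open>A \<^typ>\<open>('a, 'b) module\<close> record carries the multiplicative fields of a ring; the locale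
  \<^locale>\<open>module\<close> ignores them, and so does everything below.\<close>

definition ring_module :: "('a, 'x) ring_scheme \<Rightarrow> ('a, 'a) module" where
  "ring_module R = \<lparr>carrier = carrier R, monoid.mult = monoid.mult R, one = \<one>\<^bsub>R\<^esub>, zero = \<zero>\<^bsub>R\<^esub>,
     add = ring.add R, smult = monoid.mult R\<rparr>"

definition linear_maps ::
  "('a, 'x) ring_scheme \<Rightarrow> ('a, 'b, 'y) module_scheme \<Rightarrow> ('a, 'c, 'z) module_scheme \<Rightarrow> ('b \<Rightarrow> 'c) set" where
  "linear_maps R M N = {g \<in> carrier M \<rightarrow> carrier N.
     (\<forall>x\<in>carrier M. \<forall>y\<in>carrier M. g (x \<oplus>\<^bsub>M\<^esub> y) = g x \<oplus>\<^bsub>N\<^esub> g y) \<and>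
     (\<forall>a\<in>carrier R. \<forall>x\<in>carrier M. g (a \<odot>\<^bsub>M\<^esub> x) = a \<odot>\<^bsub>N\<^esub> g x)}"

definition submodule_gen ::
  "('a, 'x) ring_scheme \<Rightarrow> ('a, 'b, 'y) module_scheme \<Rightarrow> 'b set \<Rightarrow> 'b set" where
  "submodule_gen R M S = \<Inter>{N. submodule N R M \<and> S \<subseteq> N}"

definition fg_module :: "('a, 'x) ring_scheme \<Rightarrow> ('a, 'b, 'y) module_scheme \<Rightarrow> bool" where
  "fg_module R M \<longleftrightarrow> module R M \<and>
     (\<exists>S \<subseteq> carrier M. finite S \<and> submodule_gen R M S = carrier M)"

definition quot_module :: "('a, 'b, 'y) module_scheme \<Rightarrow> 'b set \<Rightarrow> ('a, 'b set) module" where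
  "quot_module M N = \<lparr>carrier = a_rcosets\<^bsub>M\<^esub> N, monoid.mult = undefined, one = undefined,
     zero = N, add = set_add M, smult = (\<lambda>a U. \<Union>x\<in>U. N +>\<^bsub>M\<^esub> (a \<odot>\<^bsub>M\<^esub> x))\<rparr>"

definition free_module :: "('a, 'x) ring_scheme \<Rightarrow> 'b set \<Rightarrow> ('a, 'b \<Rightarrow> 'a) module" where
  "free_module R B = \<lparr>carrier = {v. (\<forall>m\<in>B. v m \<in> carrier R) \<and> (\<forall>m. m \<notin> B \<longrightarrow> v m = \<zero>\<^bsub>R\<^esub>) \<and>
       finite {m. v m \<noteq> \<zero>\<^bsub>R\<^esub>}},
     monoid.mult = undefined, one = undefined, zero = (\<lambda>_. \<zero>\<^bsub>R\<^esub>),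
     add = (\<lambda>v w m. v m \<oplus>\<^bsub>R\<^esub> w m), smult = (\<lambda>a v m. a \<otimes>\<^bsub>R\<^esub> v m)\<rparr>"

definition single :: "('a, 'x) ring_scheme \<Rightarrow> 'b \<Rightarrow> 'a \<Rightarrow> 'b \<Rightarrow> 'a" where
  "single R m a = (\<lambda>x. if x = m then a else \<zero>\<^bsub>R\<^esub>)"


section \<open>Base change along a ring endomorphism\<close>

text \<open>For a ring endomorphism \<open>s\<close> of \<open>R\<close>, the module $s^*M = R \otimes_{s} M$ is presented with
  one generator $1 \otimes m$ for each $m \in M$ and the relations
  $1 \otimes (m + m') = 1 \otimes m + 1 \otimes m'$ and $1 \otimes rm = s(r) \otimes m$.\<close>

definition base_change_rels ::
  "('a, 'x) ring_scheme \<Rightarrow> ('a \<Rightarrow> 'a) \<Rightarrow> ('a, 'b, 'y) module_scheme \<Rightarrow> ('b \<Rightarrow> 'a) set" where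
  "base_change_rels R s M = (let F = free_module R (carrier M); e = (\<lambda>m. single R m \<one>\<^bsub>R\<^esub>) in
     submodule_gen R F
      ({e (m \<oplus>\<^bsub>M\<^esub> m') \<ominus>\<^bsub>F\<^esub> (e m \<oplus>\<^bsub>F\<^esub> e m') | m m'. m \<in> carrier M \<and> m' \<in> carrier M} \<union>
       {e (r \<odot>\<^bsub>M\<^esub> m) \<ominus>\<^bsub>F\<^esub> (s r \<odot>\<^bsub>F\<^esub> e m) | r m. r \<in> carrier R \<and> m \<in> carrier M}))"

definition base_change ::
  "('a, 'x) ring_scheme \<Rightarrow> ('a \<Rightarrow> 'a) \<Rightarrow> ('a, 'b, 'y) module_scheme \<Rightarrow> ('a, ('b \<Rightarrow> 'a) set) module" where
  "base_change R s M = quot_module (free_module R (carrier M)) (base_change_rels R s M)"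

text \<open>The element $a \otimes m$ of $s^*M$.\<close>

definition tensor ::
  "('a, 'x) ring_scheme \<Rightarrow> ('a \<Rightarrow> 'a) \<Rightarrow> ('a, 'b, 'y) module_scheme \<Rightarrow> 'a \<Rightarrow> 'b \<Rightarrow> ('b \<Rightarrow> 'a) set" where
  "tensor R s M a m = base_change_rels R s M +>\<^bsub>free_module R (carrier M)\<^esub> single R m a"

text \<open>The additive map from a base change to \<open>T\<close> sending $a \otimes m$ to \<open>k a m\<close>, for a
  biadditive and balanced \<open>k\<close> (for which the choice of a representative is immaterial).\<close>

definition tensor_ext ::
  "('a, 'x) ring_scheme \<Rightarrow> ('a, 'c, 'z) module_scheme \<Rightarrow> ('a \<Rightarrow> 'b \<Rightarrow> 'c) \<Rightarrow> ('b \<Rightarrow> 'a) set \<Rightarrow> 'c" where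
  "tensor_ext R T k U = (let v = (SOME v. v \<in> U) in
     finsum T (\<lambda>m. k (v m) m) {m. v m \<noteq> \<zero>\<^bsub>R\<^esub>})"

text \<open>$s^*g \colon s^*M \to s^*N$ for $g \colon M \to N$.\<close>

definition base_change_map ::
  "('a, 'x) ring_scheme \<Rightarrow> ('a \<Rightarrow> 'a) \<Rightarrow> ('a, 'c, 'z) module_scheme \<Rightarrow> ('b \<Rightarrow> 'c) \<Rightarrow>
     ('b \<Rightarrow> 'a) set \<Rightarrow> ('c \<Rightarrow> 'a) set" where
  "base_change_map R s N g = tensor_ext R (base_change R s N) (\<lambda>a m. tensor R s N a (g m))"

text \<open>The canonical isomorphism $s^*(t^*M) \to (s \circ t)^*M$,
  $a \otimes (b \otimes m) \mapsto a\,s(b) \otimes m$.\<close>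

definition base_change_comp ::
  "('a, 'x) ring_scheme \<Rightarrow> ('a \<Rightarrow> 'a) \<Rightarrow> ('a \<Rightarrow> 'a) \<Rightarrow> ('a, 'b, 'y) module_scheme \<Rightarrow>
     (('b \<Rightarrow> 'a) set \<Rightarrow> 'a) set \<Rightarrow> ('b \<Rightarrow> 'a) set" where
  "base_change_comp R s t M = (let T = base_change R (s \<circ> t) M in
     tensor_ext R T (\<lambda>a V. a \<odot>\<^bsub>T\<^esub> tensor_ext R T (\<lambda>b m. tensor R (s \<circ> t) M (s b) m) V))"


section \<open>Direct limits of sequences of modules\<close>

text \<open>\<open>push t n i\<close> is the composite transition map from stage \<open>n\<close> to stage \<open>n + i\<close>.\<close>

primrec push :: "(nat \<Rightarrow> 'b \<Rightarrow> 'b) \<Rightarrow> nat \<Rightarrow> nat \<Rightarrow> 'b \<Rightarrow> 'b" where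
  "push t n 0 x = x"
| "push t n (Suc i) x = t (n + i) (push t n i x)"

definition limit_class ::
  "(nat \<Rightarrow> ('a, 'b, 'y) module_scheme) \<Rightarrow> (nat \<Rightarrow> 'b \<Rightarrow> 'b) \<Rightarrow> nat \<Rightarrow> 'b \<Rightarrow> (nat \<times> 'b) set" where
  "limit_class T t n x = {(m, y). y \<in> carrier (T m) \<and>
     (\<exists>i j. n + i = m + j \<and> push t n i x = push t m j y)}"

definition direct_limit ::
  "(nat \<Rightarrow> ('a, 'b, 'y) module_scheme) \<Rightarrow> (nat \<Rightarrow> 'b \<Rightarrow> 'b) \<Rightarrow> ('a, (nat \<times> 'b) set) module" where
  "direct_limit T t = \<lparr>carrier = {limit_class T t n x | n x. x \<in> carrier (T n)},
     monoid.mult = undefined, one = undefined, zero = limit_class T t 0 \<zero>\<^bsub>T 0\<^esub>,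
     add = (\<lambda>U V. \<Union>(n, x)\<in>U. \<Union>(m, y)\<in>V.
              limit_class T t (n + m) (push t n m x \<oplus>\<^bsub>T (n + m)\<^esub> push t m n y)),
     smult = (\<lambda>a U. \<Union>(n, x)\<in>U. limit_class T t n (a \<odot>\<^bsub>T n\<^esub> x))\<rparr>"


section \<open>$\gamma$-sheaves\<close>

text \<open>The endomorphism \<open>s\<close> plays the role of the Frobenius $\sigma$.\<close>

record ('a, 'b) gamma_sheaf = "('a, 'b) module" +
  gam :: "'b \<Rightarrow> ('b \<Rightarrow> 'a) set"

definition coherent_gamma_sheaf ::
  "('a, 'x) ring_scheme \<Rightarrow> ('a \<Rightarrow> 'a) \<Rightarrow> ('a, 'b) gamma_sheaf \<Rightarrow> bool" where
  "coherent_gamma_sheaf R s M \<longleftrightarrow> fg_module R M \<and> gam M \<in> linear_maps R M (base_change R s M)"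

definition gamma_morphism ::
  "('a, 'x) ring_scheme \<Rightarrow> ('a \<Rightarrow> 'a) \<Rightarrow> ('a, 'b) gamma_sheaf \<Rightarrow> ('a, 'c) gamma_sheaf \<Rightarrow> ('b \<Rightarrow> 'c) \<Rightarrow> bool" where
  "gamma_morphism R s M N g \<longleftrightarrow> g \<in> linear_maps R M N \<and>
     (\<forall>m\<in>carrier M. gam N (g m) = base_change_map R s N g (gam M m))"

text \<open>$s^{n*}\gamma \colon s^{n*}M \to s^{(n+1)*}M$, using \<open>(s ^^ n) \<circ> s = s ^^ Suc n\<close>.\<close>

definition gamma_step ::
  "('a, 'x) ring_scheme \<Rightarrow> ('a \<Rightarrow> 'a) \<Rightarrow> ('a, 'b) gamma_sheaf \<Rightarrow> nat \<Rightarrow> ('b \<Rightarrow> 'a) set \<Rightarrow> ('b \<Rightarrow> 'a) set" where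
  "gamma_step R s M n =
     base_change_comp R (s ^^ n) s M \<circ> base_change_map R (s ^^ n) (base_change R s M) (gam M)"

primrec gamma_power ::
  "('a, 'x) ring_scheme \<Rightarrow> ('a \<Rightarrow> 'a) \<Rightarrow> ('a, 'b) gamma_sheaf \<Rightarrow> nat \<Rightarrow> 'b \<Rightarrow> ('b \<Rightarrow> 'a) set" where
  "gamma_power R s M 0 = tensor R (s ^^ 0) M \<one>\<^bsub>R\<^esub>"
| "gamma_power R s M (Suc n) = gamma_step R s M n \<circ> gamma_power R s M n"

definition nilpotent_sheaf ::
  "('a, 'x) ring_scheme \<Rightarrow> ('a \<Rightarrow> 'a) \<Rightarrow> ('a, 'b) gamma_sheaf \<Rightarrow> bool" where
  "nilpotent_sheaf R s M \<longleftrightarrow>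
     (\<exists>n>0. \<forall>m\<in>carrier M. gamma_power R s M n m = \<zero>\<^bsub>base_change R (s ^^ n) M\<^esub>)"

text \<open>The submodule \<open>N\<close> of \<open>M\<close> with the restriction of $\gamma$. As \<open>R\<close> is regular, \<open>s\<close> is flat
  and $s^*N \to s^*M$ is injective, so the inverse image below is unique if it exists. If $\gamma$
  does not map \<open>N\<close> into $s^*N$, then the inclusion fails to be a morphism.\<close>

definition sub_sheaf ::
  "('a, 'x) ring_scheme \<Rightarrow> ('a \<Rightarrow> 'a) \<Rightarrow> ('a, 'b) gamma_sheaf \<Rightarrow> 'b set \<Rightarrow> ('a, 'b) gamma_sheaf" where
  "sub_sheaf R s M N = M\<lparr>carrier := N,
     gam := (\<lambda>x. inv_into (carrier (base_change R s (M\<lparr>carrier := N\<rparr>)))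
                   (base_change_map R s M id) (gam M x))\<rparr>"

definition gamma_subsheaf ::
  "('a, 'x) ring_scheme \<Rightarrow> ('a \<Rightarrow> 'a) \<Rightarrow> ('a, 'b) gamma_sheaf \<Rightarrow> 'b set \<Rightarrow> bool" where
  "gamma_subsheaf R s M N \<longleftrightarrow> submodule N R M \<and> coherent_gamma_sheaf R s (sub_sheaf R s M N) \<and>
     gamma_morphism R s (sub_sheaf R s M N) M id"

text \<open>The image of a linear map $h \colon M \to T$ whose kernel is a $\gamma$-subsheaf, with the
  structural map that makes $M \to h(M)$ a morphism.\<close>

definition image_sheaf ::
  "('a, 'x) ring_scheme \<Rightarrow> ('a \<Rightarrow> 'a) \<Rightarrow> ('a, 'b) gamma_sheaf \<Rightarrow> ('a, 'c) module \<Rightarrow> ('b \<Rightarrow> 'c) \<Rightarrow>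
     ('a, 'c) gamma_sheaf" where
  "image_sheaf R s M T h = (let I = T\<lparr>carrier := h ` carrier M\<rparr> in
     module.extend I (gamma_sheaf.fields
       (\<lambda>y. base_change_map R s I h (gam M (inv_into (carrier M) h y)))))"

definition quot_sheaf ::
  "('a, 'x) ring_scheme \<Rightarrow> ('a \<Rightarrow> 'a) \<Rightarrow> ('a, 'b) gamma_sheaf \<Rightarrow> 'b set \<Rightarrow> ('a, 'b set) gamma_sheaf" where
  "quot_sheaf R s M N = image_sheaf R s M (quot_module M N) (\<lambda>x. N +>\<^bsub>M\<^esub> x)"

definition nil_isomorphism ::
  "('a, 'x) ring_scheme \<Rightarrow> ('a \<Rightarrow> 'a) \<Rightarrow> ('a, 'b) gamma_sheaf \<Rightarrow> ('a, 'c) gamma_sheaf \<Rightarrow> ('b \<Rightarrow> 'c) \<Rightarrow> bool" where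
  "nil_isomorphism R s M N g \<longleftrightarrow> gamma_morphism R s M N g \<and>
     nilpotent_sheaf R s (sub_sheaf R s M {x \<in> carrier M. g x = \<zero>\<^bsub>N\<^esub>}) \<and>
     nilpotent_sheaf R s (quot_sheaf R s N (g ` carrier M))"

definition minimal_sheaf ::
  "('a, 'x) ring_scheme \<Rightarrow> ('a \<Rightarrow> 'a) \<Rightarrow> ('a, 'b) gamma_sheaf \<Rightarrow> bool" where
  "minimal_sheaf R s M \<longleftrightarrow> coherent_gamma_sheaf R s M \<and>
     (\<forall>N. gamma_subsheaf R s M N \<and> nilpotent_sheaf R s (sub_sheaf R s M N) \<longrightarrow> N = {\<zero>\<^bsub>M\<^esub>}) \<and>
     (\<forall>N. gamma_subsheaf R s M N \<and> nilpotent_sheaf R s (quot_sheaf R s M N) \<longrightarrow> N = carrier M)"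

text \<open>$\varinjlim (M \to s^*M \to s^{2*}M \to \cdots)$ and the canonical map from \<open>M\<close> to it.\<close>

definition gamma_colimit ::
  "('a, 'x) ring_scheme \<Rightarrow> ('a \<Rightarrow> 'a) \<Rightarrow> ('a, 'b) gamma_sheaf \<Rightarrow>
     ('a, (nat \<times> ('b \<Rightarrow> 'a) set) set) module" where
  "gamma_colimit R s M = direct_limit (\<lambda>n. base_change R (s ^^ n) M) (gamma_step R s M)"

definition to_colimit ::
  "('a, 'x) ring_scheme \<Rightarrow> ('a \<Rightarrow> 'a) \<Rightarrow> ('a, 'b) gamma_sheaf \<Rightarrow> 'b \<Rightarrow> (nat \<times> ('b \<Rightarrow> 'a) set) set" where
  "to_colimit R s M m = limit_class (\<lambda>n. base_change R (s ^^ n) M) (gamma_step R s M) 0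
     (tensor R (s ^^ 0) M \<one>\<^bsub>R\<^esub> m)"

text \<open>$\overline M$, $\underline M$ and $M_{\min}$.\<close>

definition upper_sheaf ::
  "('a, 'x) ring_scheme \<Rightarrow> ('a \<Rightarrow> 'a) \<Rightarrow> ('a, 'b) gamma_sheaf \<Rightarrow>
     ('a, (nat \<times> ('b \<Rightarrow> 'a) set) set) gamma_sheaf" where
  "upper_sheaf R s M = image_sheaf R s M (gamma_colimit R s M) (to_colimit R s M)"

definition lower_sheaf ::
  "('a, 'x) ring_scheme \<Rightarrow> ('a \<Rightarrow> 'a) \<Rightarrow> ('a, 'b) gamma_sheaf \<Rightarrow> ('a, 'b) gamma_sheaf" where
  "lower_sheaf R s M = sub_sheaf R s M
     (LEAST N. gamma_subsheaf R s M N \<and> nil_isomorphism R s (sub_sheaf R s M N) M id)"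

definition min_sheaf ::
  "('a, 'x) ring_scheme \<Rightarrow> ('a \<Rightarrow> 'a) \<Rightarrow> ('a, 'b) gamma_sheaf \<Rightarrow>
     ('a, (nat \<times> ('b \<Rightarrow> 'a) set) set) gamma_sheaf" where
  "min_sheaf R s M = lower_sheaf R s (upper_sheaf R s M)"


section \<open>Frobenius, test ideals and the $F$-pure threshold\<close>

definition frobenius :: "('a, 'x) ring_scheme \<Rightarrow> nat \<Rightarrow> 'a \<Rightarrow> 'a" where
  "frobenius R q x = x [^]\<^bsub>R\<^esub> q"

definition finite_endomorphism :: "('a, 'x) ring_scheme \<Rightarrow> ('a \<Rightarrow> 'a) \<Rightarrow> bool" where
  "finite_endomorphism R s \<longleftrightarrow>
     fg_module R ((ring_module R)\<lparr>smult := (\<lambda>a x. s a \<otimes>\<^bsub>R\<^esub> x)\<rparr>)"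

text \<open>$R \xrightarrow{f} R \cong s^*R$, where the isomorphism sends \<open>r\<close> to $r \otimes 1$.\<close>

definition principal_sheaf ::
  "('a, 'x) ring_scheme \<Rightarrow> ('a \<Rightarrow> 'a) \<Rightarrow> 'a \<Rightarrow> ('a, 'a) gamma_sheaf" where
  "principal_sheaf R s f = module.extend (ring_module R) (gamma_sheaf.fields
     (\<lambda>r. tensor R s (ring_module R) (f \<otimes>\<^bsub>R\<^esub> r) \<one>\<^bsub>R\<^esub>))"

definition bracket_power :: "('a, 'x) ring_scheme \<Rightarrow> 'a set \<Rightarrow> nat \<Rightarrow> 'a set" where
  "bracket_power R J n = genideal R {x [^]\<^bsub>R\<^esub> n | x. x \<in> J}"

definition is_smallest_root :: "('a, 'x) ring_scheme \<Rightarrow> 'a \<Rightarrow> nat \<Rightarrow> 'a set \<Rightarrow> bool" where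
  "is_smallest_root R g n J \<longleftrightarrow> ideal J R \<and> g \<in> bracket_power R J n \<and>
     (\<forall>J'. ideal J' R \<and> g \<in> bracket_power R J' n \<longrightarrow> J \<subseteq> J')"

text \<open>Here \<open>p\<close> is the characteristic of \<open>R\<close>.\<close>

definition test_ideal :: "('a, 'x) ring_scheme \<Rightarrow> nat \<Rightarrow> 'a \<Rightarrow> real \<Rightarrow> 'a set" where
  "test_ideal R p f \<alpha> = (THE J. \<forall>\<^sub>F e in sequentially.
     is_smallest_root R (f [^]\<^bsub>R\<^esub> nat \<lceil>\<alpha> * real p ^ e\<rceil>) (p ^ e) J)"

text \<open>The \<open>F\<close>-pure threshold of a unit is \<open>\<infinity>\<close>.\<close>

definition f_pure_threshold :: "('a, 'x) ring_scheme \<Rightarrow> nat \<Rightarrow> 'a \<Rightarrow> ereal" where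
  "f_pure_threshold R p f = Sup {ereal \<alpha> | \<alpha>. \<alpha> \<ge> 0 \<and> test_ideal R p f \<alpha> = carrier R}"

end

theory Submission
  imports Defs
begin

text \<open>
  A Frobenius power \<open>\<sigma>\<close> of an \<open>F\<close>-finite regular ring is finite projective (Kunz), so there are
  finitely many \<open>\<sigma>\<close>-inverse-linear \<open>\<phi>\<close> and elements \<open>g\<close> with \<open>x = \<Sum>\<sigma>(\<phi> x) g\<close>. Consequently
  \<open>x \<in> J\<^bsup>[q]\<^esup>\<close> iff all \<open>\<phi> x \<in> J\<close>: smallest roots exist, bracket powers commute with colons, and
  \<open>\<sigma>\<^sup>*(J/K)\<close> embeds into \<open>R/K\<^bsup>[q]\<^esup>\<close>. Gamma subquotients of \<open>M\<close> thus become ideals \<open>J\<close> with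
  \<open>fJ \<subseteq> J\<^bsup>[q]\<^esup>\<close>, and \<open>\<gamma>\<^sup>n\<close> becomes multiplication by \<open>f\<close> to the power \<open>1 + q + \<dots> + q^(n-1)\<close>. The roots of
  these powers of \<open>f\<close> are test ideals; they form a descending chain, stationary by an argument of
  Gabber, and its limit is the smallest \<open>J\<close> with nilpotent quotient. The limit meets the torsion of \<open>f\<close>
  trivially because \<open>R\<close> is reduced, so it survives in the colimit.
\<close>

section \<open>Noetherian commutative rings\<close>

text \<open>Regularity is given through Krull dimensions of local rings, and this shapes the road to
  Kunz's theorem: by the principal ideal theorem every subset of a minimal generating set of the
  maximal ideal generates a prime, so the generators and all their powers form regular sequences in
  every order, and this makes a minimal generating set over the n-th powers independent.
  Projectivity is expressed by a finite dual basis, because that form descends from the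
  localizations and turns questions on bracket powers into questions on functionals. Kunz's theorem
  is proved for the p-th power although \<sigma> is the q-th, since test ideals at arbitrary
  exponents involve all p^e. A noetherian ring does not stop descending chains; what helps here is
  that x^q is divisible by x^2, so annihilators of successive quotients grow and their squares kill
  whole tails. The minimal sheaf lives inside a colimit, so its equality with an ideal means that
  the canonical map restricts to a bijection. The exponents equal (1 - q^(-e))/(q-1): strictly below
  1/(q-1) and converging to it, hence the threshold.\<close>

lemma (in cring) ideal_intro:
  assumes "I \<subseteq> carrier R" "\<zero> \<in> I" "\<And>a b. a \<in> I \<Longrightarrow> b \<in> I \<Longrightarrow> a \<oplus> b \<in> I"
    "\<And>a r. a \<in> I \<Longrightarrow> r \<in> carrier R \<Longrightarrow> r \<otimes> a \<in> I"
  shows "ideal I R"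
proof (rule idealI)
  show "ring R" by (rule ring_axioms)
  show "subgroup I (add_monoid R)"
  proof
    show "I \<subseteq> carrier (add_monoid R)" using assms by simp
    fix x y assume "x \<in> I" "y \<in> I" then show "x \<otimes>\<^bsub>add_monoid R\<^esub> y \<in> I" using assms by simp
  next
    show "\<one>\<^bsub>add_monoid R\<^esub> \<in> I" using assms by simp
    fix x assume x: "x \<in> I"
    then have "\<ominus> x = (\<ominus> \<one>) \<otimes> x" using assms(1) by (simp add: l_minus subset_iff)
    then show "inv\<^bsub>add_monoid R\<^esub> x \<in> I" using assms(4)[OF x, of "\<ominus> \<one>"] by (simp add: a_inv_def)
  qed
  fix a x assume "a \<in> I" "x \<in> carrier R"
  then show "x \<otimes> a \<in> I" "a \<otimes> x \<in> I"
    using assms(4) assms(1) m_comm by (metis subsetD)+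
qed

lemma (in cring) idealD:
  assumes "ideal I R"
  shows "I \<subseteq> carrier R" "\<And>a. a \<in> I \<Longrightarrow> a \<in> carrier R" "\<zero> \<in> I" "\<And>a b. a \<in> I \<Longrightarrow> b \<in> I \<Longrightarrow> a \<oplus> b \<in> I"
    "\<And>a. a \<in> I \<Longrightarrow> \<ominus> a \<in> I" "\<And>a b. a \<in> I \<Longrightarrow> b \<in> I \<Longrightarrow> a \<ominus> b \<in> I"
    "\<And>a r. a \<in> I \<Longrightarrow> r \<in> carrier R \<Longrightarrow> r \<otimes> a \<in> I" "\<And>a r. a \<in> I \<Longrightarrow> r \<in> carrier R \<Longrightarrow> a \<otimes> r \<in> I"
proof -
  interpret ideal I R by fact
  show "I \<subseteq> carrier R" "\<And>a. a \<in> I \<Longrightarrow> a \<in> carrier R" "\<zero> \<in> I" "\<And>a b. a \<in> I \<Longrightarrow> b \<in> I \<Longrightarrow> a \<oplus> b \<in> I"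
    "\<And>a. a \<in> I \<Longrightarrow> \<ominus> a \<in> I"  "\<And>a b. a \<in> I \<Longrightarrow> b \<in> I \<Longrightarrow> a \<ominus> b \<in> I"
    "\<And>a r. a \<in> I \<Longrightarrow> r \<in> carrier R \<Longrightarrow> r \<otimes> a \<in> I" "\<And>a r. a \<in> I \<Longrightarrow> r \<in> carrier R \<Longrightarrow> a \<otimes> r \<in> I"
    by (auto simp: a_subset I_l_closed I_r_closed minus_eq)
qed

lemma (in cring) ideal_cancel:
  assumes "ideal I R" "a \<in> I" "b \<in> carrier R" shows "a \<oplus> b \<in> I \<longleftrightarrow> b \<in> I" "b \<oplus> a \<in> I \<longleftrightarrow> b \<in> I"
    "b \<ominus> a \<in> I \<longleftrightarrow> b \<in> I"
proof -
  have a: "a \<in> carrier R" using assms idealD by blast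
  have *: "b = (a \<oplus> b) \<oplus> \<ominus> a" "b = (b \<ominus> a) \<oplus> a" using a assms(3) by algebra+
  show "a \<oplus> b \<in> I \<longleftrightarrow> b \<in> I" using *(1) idealD(4,5)[OF assms(1)] assms(2) by metis
  then show "b \<oplus> a \<in> I \<longleftrightarrow> b \<in> I" using a assms(3) a_comm by simp
  show "b \<ominus> a \<in> I \<longleftrightarrow> b \<in> I" using *(2) idealD(4,6)[OF assms(1)] assms(2) by metis
qed

lemma (in cring) primeD:
  assumes "primeideal P R"
  shows "ideal P R" "\<one> \<notin> P" "\<And>a b. \<lbrakk>a \<in> carrier R; b \<in> carrier R; a \<otimes> b \<in> P; a \<notin> P\<rbrakk> \<Longrightarrow> b \<in> P"
proof -
  interpret primeideal P R by fact
  show "ideal P R" by (rule is_ideal)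
  show "\<one> \<notin> P" using I_notcarr one_imp_carrier by blast
  show "\<And>a b. \<lbrakk>a \<in> carrier R; b \<in> carrier R; a \<otimes> b \<in> P; a \<notin> P\<rbrakk> \<Longrightarrow> b \<in> P" using I_prime by blast
qed

lemma (in cring) primeI:
  assumes "ideal P R" "\<one> \<notin> P" "\<And>a b. \<lbrakk>a \<in> carrier R; b \<in> carrier R; a \<otimes> b \<in> P; a \<notin> P\<rbrakk> \<Longrightarrow> b \<in> P"
  shows "primeideal P R"
proof (rule primeidealI[OF assms(1) is_cring])
  show "carrier R \<noteq> P" using assms(2) by blast
  show "a \<in> P \<or> b \<in> P" if "a \<in> carrier R" "b \<in> carrier R" "a \<otimes> b \<in> P" for a b
    using assms(3)[OF that] by blast
qed

definition (in ring) adjoin :: "'a set \<Rightarrow> 'a \<Rightarrow> 'a set" where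
  "adjoin I x = {i \<oplus> r \<otimes> x | i r. i \<in> I \<and> r \<in> carrier R}"

lemma (in cring) adjoin_ideal:
  assumes "ideal I R" "x \<in> carrier R" shows "ideal (adjoin I x) R"
proof (rule ideal_intro)
  note I = idealD[OF assms(1)]
  show "adjoin I x \<subseteq> carrier R" using I(2) assms(2) by (auto simp: adjoin_def)
  have "\<zero> = \<zero> \<oplus> \<zero> \<otimes> x" using assms(2) by simp
  then show "\<zero> \<in> adjoin I x" using I(3) unfolding adjoin_def by blast
  fix a assume "a \<in> adjoin I x"
  then obtain i r where a: "a = i \<oplus> r \<otimes> x" "i \<in> I" "r \<in> carrier R" unfolding adjoin_def by blast
  have ic: "i \<in> carrier R" using a I by blast
  { fix b assume "b \<in> adjoin I x"
    then obtain j s where b: "b = j \<oplus> s \<otimes> x" "j \<in> I" "s \<in> carrier R" unfolding adjoin_def by blast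
    have jc: "j \<in> carrier R" using b I by blast
    have "a \<oplus> b = (i \<oplus> j) \<oplus> (r \<oplus> s) \<otimes> x" using a b ic jc assms(2) by algebra
    then show "a \<oplus> b \<in> adjoin I x" using a b I(4) unfolding adjoin_def by blast }
  fix s assume s: "s \<in> carrier R"
  have "s \<otimes> a = s \<otimes> i \<oplus> (s \<otimes> r) \<otimes> x" using a ic s assms(2) by algebra
  then show "s \<otimes> a \<in> adjoin I x" using a s I(7) unfolding adjoin_def by blast
qed

lemma (in cring) adjoinI: "i \<in> I \<Longrightarrow> r \<in> carrier R \<Longrightarrow> i \<oplus> r \<otimes> x \<in> adjoin I x"
  unfolding adjoin_def by blast

lemma (in cring) adjoin_mem:
  assumes "ideal I R" "x \<in> carrier R" shows "I \<subseteq> adjoin I x" "x \<in> adjoin I x"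
proof -
  note I = idealD[OF assms(1)]
  show "I \<subseteq> adjoin I x"
  proof
    fix i assume i: "i \<in> I"
    then have "i = i \<oplus> \<zero> \<otimes> x" using I assms(2) by simp
    then show "i \<in> adjoin I x" using adjoinI[OF i zero_closed, of x] by simp
  qed
  show "x \<in> adjoin I x" using adjoinI[OF I(3) one_closed, of x] assms(2) by simp
qed

lemma (in cring) adjoin_le:
  assumes "ideal J R" "I \<subseteq> J" "x \<in> J" shows "adjoin I x \<subseteq> J"
  using idealD[OF assms(1)] assms(2,3) by (auto simp: adjoin_def subset_iff)

lemma (in cring) Idl_insert:
  assumes "T \<subseteq> carrier R" "x \<in> carrier R" shows "Idl (insert x T) = adjoin (Idl T) x"
proof
  have I: "ideal (Idl T) R" using assms genideal_ideal by blast
  show "Idl (insert x T) \<subseteq> adjoin (Idl T) x"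
    using adjoin_mem[OF I assms(2)] genideal_self[OF assms(1)]
    by (intro genideal_minimal adjoin_ideal I assms) auto
  show "adjoin (Idl T) x \<subseteq> Idl (insert x T)"
    using assms genideal_self[of "insert x T"]
    by (intro adjoin_le genideal_ideal genideal_minimal) auto
qed

lemma (in cring) Idl_empty: "Idl {} = {\<zero>}"
  using genideal_minimal[OF zeroideal, of "{}"] genideal_ideal[of "{}"] idealD(3) by blast

section \<open>Consequences of the ascending chain condition\<close>

locale noetherian_cring = cring + noetherian_ring

text \<open>A nonempty chain of ideals contains its own union, so Zorn's lemma applies to any family
  of ideals without a closure condition. Noetherian induction mostly takes this form below: a
  maximal member of a tailor-made family \<open>S\<close>.\<close>

lemma (in noetherian_ring) maximal_member:
  assumes "I0 \<in> S" "\<And>I. I \<in> S \<Longrightarrow> ideal I R"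
  obtains M where "M \<in> S" "I0 \<subseteq> M" "\<forall>I\<in>S. M \<subseteq> I \<longrightarrow> I = M"
proof -
  have "\<exists>M\<in>{I \<in> S. I0 \<subseteq> I}. \<forall>X\<in>{I \<in> S. I0 \<subseteq> I}. M \<subseteq> X \<longrightarrow> X = M"
  proof (rule subset_Zorn_nonempty)
    show "{I \<in> S. I0 \<subseteq> I} \<noteq> {}" using assms(1) by blast
    fix C assume C: "C \<noteq> {}" "subset.chain {I \<in> S. I0 \<subseteq> I} C"
    then have "subset.chain {I. ideal I R} C" using assms(2) by (auto simp: pred_on.chain_def)
    then have "\<Union>C \<in> C" using ideal_chain_is_trivial C(1) by blast
    then show "\<Union>C \<in> {I \<in> S. I0 \<subseteq> I}" using C(2) unfolding pred_on.chain_def by blast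
  qed
  then obtain M where "M \<in> S" "I0 \<subseteq> M" "\<forall>X\<in>{I \<in> S. I0 \<subseteq> I}. M \<subseteq> X \<longrightarrow> X = M" by blast
  then show ?thesis by (intro that[of M]) auto
qed

lemma (in noetherian_ring) ascending_stable:
  assumes "\<And>n::nat. ideal (A n) R" "\<And>n. A n \<subseteq> A (Suc n)"
  obtains N where "\<And>n. n \<ge> N \<Longrightarrow> A n = A N"
proof -
  obtain M where M: "M \<in> range A" "\<forall>I\<in>range A. M \<subseteq> I \<longrightarrow> I = M"
    by (rule maximal_member[of "A 0" "range A"]) (use assms(1) in auto)
  then obtain N where "M = A N" by blast
  have "A n = A N" if "n \<ge> N" for n
    using M(2) lift_Suc_mono_le[of A, OF assms(2) that] \<open>M = A N\<close> by simp
  then show ?thesis by (rule that)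
qed

lemma (in noetherian_cring) exists_maximalideal:
  assumes "ideal I R" "\<one> \<notin> I"
  obtains \<mm> where "maximalideal \<mm> R" "I \<subseteq> \<mm>"
proof -
  obtain M where M: "M \<in> {J. ideal J R \<and> \<one> \<notin> J}" "I \<subseteq> M"
      "\<forall>J\<in>{J. ideal J R \<and> \<one> \<notin> J}. M \<subseteq> J \<longrightarrow> J = M"
    by (rule maximal_member[of I "{J. ideal J R \<and> \<one> \<notin> J}"]) (use assms in auto)
  have "maximalideal M R"
  proof (rule maximalidealI)
    show "ideal M R" "carrier R \<noteq> M" using M by auto
    fix J assume "ideal J R" "M \<subseteq> J"
    then show "J = M \<or> J = carrier R" using M(3) ideal.one_imp_carrier by blast
  qed
  then show ?thesis using that M(2) by blast
qed

section \<open>Minimal primes over an ideal\<close>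

definition (in ring) minimal_prime_over :: "'a set \<Rightarrow> 'a set \<Rightarrow> bool" where
  "minimal_prime_over I P \<longleftrightarrow> primeideal P R \<and> I \<subseteq> P \<and> (\<forall>Q. primeideal Q R \<and> I \<subseteq> Q \<and> Q \<subseteq> P \<longrightarrow> Q = P)"

lemma (in cring) exists_minimal_prime:
  assumes "I \<subseteq> P'" "primeideal P' R"
  obtains P where "minimal_prime_over I P" "P \<subseteq> P'"
proof -
  \<comment> \<open>Zorn's lemma produces maximal elements, so primes are replaced by their
    complements. The union of a chain of complements is the complement of the intersection
    \<open>D\<close>, which is prime because two elements outside \<open>D\<close> lie in a common
    member of the chain.\<close>
  define \<C> where "\<C> = {carrier R - Q | Q. primeideal Q R \<and> I \<subseteq> Q \<and> Q \<subseteq> P'}"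
  have "\<exists>M\<in>\<C>. \<forall>X\<in>\<C>. M \<subseteq> X \<longrightarrow> X = M"
  proof (rule subset_Zorn_nonempty)
    show "\<C> \<noteq> {}" using assms unfolding \<C>_def by blast
    fix C assume C: "C \<noteq> {}" "subset.chain \<C> C"
    define D where "D = carrier R - \<Union>C"
    have CC: "C \<subseteq> \<C>" and ch: "\<And>X Y. X \<in> C \<Longrightarrow> Y \<in> C \<Longrightarrow> X \<subseteq> Y \<or> Y \<subseteq> X"
      using C(2) unfolding pred_on.chain_def by auto
    have Q: "\<exists>Q. X = carrier R - Q \<and> primeideal Q R \<and> I \<subseteq> Q \<and> Q \<subseteq> P'" if "X \<in> C" for X
      using that CC unfolding \<C>_def by blast
    obtain X0 Q0 where Q0: "X0 \<in> C" "X0 = carrier R - Q0" "primeideal Q0 R" "I \<subseteq> Q0" "Q0 \<subseteq> P'"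
      using C(1) Q by blast
    have "primeideal D R"
    proof (rule primeI)
      show "ideal D R"
      proof (rule ideal_intro)
        show "D \<subseteq> carrier R" unfolding D_def by blast
        show "\<zero> \<in> D" unfolding D_def using Q idealD(3) primeD(1) by fastforce
        fix a assume a: "a \<in> D"
        { fix b assume b: "b \<in> D"
          show "a \<oplus> b \<in> D" using a b Q unfolding D_def
            by (auto, metis Diff_iff UnionI idealD(4) primeD(1)) }
        fix r assume "r \<in> carrier R"
        then show "r \<otimes> a \<in> D" using a Q unfolding D_def
          by (auto, metis Diff_iff UnionI idealD(7) primeD(1))
      qed
      show "\<one> \<notin> D" using Q0 primeD(2)[OF Q0(3)] unfolding D_def by blast
      fix a b assume ab: "a \<in> carrier R" "b \<in> carrier R" "a \<otimes> b \<in> D" "a \<notin> D"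
      then obtain X where X: "X \<in> C" "a \<in> X" unfolding D_def by blast
      show "b \<in> D"
      proof (rule ccontr)
        assume "b \<notin> D"
        then obtain Y where Y: "Y \<in> C" "b \<in> Y" using ab unfolding D_def by blast
        obtain Z where Z: "Z \<in> C" "a \<in> Z" "b \<in> Z" using ch[OF X(1) Y(1)] X Y by blast
        obtain Q' where Q': "Z = carrier R - Q'" "primeideal Q' R" using Q[OF Z(1)] by blast
        have "a \<otimes> b \<in> Q'" using ab Z Q' unfolding D_def by blast
        then show False using primeD(3)[OF Q'(2) ab(1,2)] Z Q' by blast
      qed
    qed
    moreover have "\<Union>C = carrier R - D"
      using CC unfolding D_def \<C>_def by blast
    moreover have "I \<subseteq> D" using Q idealD(1)[OF primeD(1)[OF Q0(3)]] Q0(4) unfolding D_def by blast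
    moreover have "D \<subseteq> P'" using Q0 unfolding D_def by blast
    ultimately show "\<Union>C \<in> \<C>" unfolding \<C>_def by blast
  qed
  then obtain P where P: "primeideal P R" "I \<subseteq> P" "P \<subseteq> P'"
    "\<forall>X\<in>\<C>. carrier R - P \<subseteq> X \<longrightarrow> X = carrier R - P" unfolding \<C>_def by blast
  have "minimal_prime_over I P" unfolding minimal_prime_over_def
  proof (intro conjI allI impI P, elim conjE)
    fix Q assume Q: "primeideal Q R" "I \<subseteq> Q" "Q \<subseteq> P"
    have "Q \<subseteq> P'" using Q(3) P(3) by blast
    then have "carrier R - Q \<in> \<C>" using Q(1,2) unfolding \<C>_def by blast
    moreover have "carrier R - P \<subseteq> carrier R - Q" using Q(3) by blast
    ultimately have "carrier R - Q = carrier R - P" using P(4) by blast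
    then show "Q = P"
      using idealD(1)[OF primeD(1)[OF P(1)]] idealD(1)[OF primeD(1)[OF Q(1)]] by blast
  qed
  then show ?thesis using that P(3) by blast
qed

section \<open>Colon ideals and associated primes\<close>

definition (in ring) colon :: "'a set \<Rightarrow> 'a \<Rightarrow> 'a set" where
  "colon I x = {r \<in> carrier R. r \<otimes> x \<in> I}"

lemma (in cring) colon_ideal:
  assumes "ideal I R" "x \<in> carrier R" shows "ideal (colon I x) R"
  using idealD[OF assms(1)] assms(2)
  by (intro ideal_intro) (auto simp: colon_def l_distr m_assoc)

text \<open>A proper colon ideal that is maximal among them is prime.\<close>

lemma (in noetherian_cring) exists_associated_prime:
  assumes "ideal L R" "y \<in> M - L" "ideal M R"
  obtains z where "z \<in> M" "z \<notin> L" "primeideal (colon L z) R"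
proof -
  note L = idealD[OF assms(1)] and M = idealD[OF assms(3)]
  define S where "S = {colon L z | z. z \<in> M - L}"
  have "\<And>I. I \<in> S \<Longrightarrow> ideal I R" using assms M(2) unfolding S_def by (auto intro!: colon_ideal)
  moreover have "colon L y \<in> S" using assms unfolding S_def by blast
  ultimately obtain Q where Q: "Q \<in> S" "\<forall>I\<in>S. Q \<subseteq> I \<longrightarrow> I = Q"
    using maximal_member[of "colon L y" S] by metis
  then obtain z where z: "z \<in> M" "z \<notin> L" "Q = colon L z" unfolding S_def by blast
  have zc: "z \<in> carrier R" using z M by blast
  have "primeideal Q R"
  proof (rule primeI)
    show "ideal Q R" using z(3) assms zc colon_ideal by blast
    show "\<one> \<notin> Q" using z zc unfolding colon_def by simp
    fix a b assume ab: "a \<in> carrier R" "b \<in> carrier R" "a \<otimes> b \<in> Q" "a \<notin> Q"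
    have "colon L (a \<otimes> z) \<in> S" using ab z zc M(7) unfolding S_def colon_def by blast
    \<comment> \<open>The multiple a z is outside \<open>L\<close> and its colon ideal contains
      \<open>Q\<close>, so maximality makes the two equal; \<open>b\<close> lies in the former
      because a b is in \<open>Q\<close>.\<close>
    moreover have "Q \<subseteq> colon L (a \<otimes> z)"
    proof
      fix r assume r: "r \<in> Q"
      have "r \<otimes> (a \<otimes> z) = a \<otimes> (r \<otimes> z)" using r z zc ab(1) unfolding z(3) colon_def by (simp add: m_lcomm)
      then show "r \<in> colon L (a \<otimes> z)" using r ab z L(7) unfolding z(3) colon_def by simp
    qed
    ultimately have "colon L (a \<otimes> z) = Q" using Q by blast
    moreover have "b \<in> colon L (a \<otimes> z)" using ab zc unfolding z(3) colon_def
      by (simp add: m_assoc m_lcomm)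
    ultimately show "b \<in> Q" by simp
  qed
  then show ?thesis using that z by blast
qed

section \<open>Contraction of ideals from the localization at a prime\<close>

definition (in ring) saturated :: "'a set \<Rightarrow> 'a set \<Rightarrow> bool" where
  "saturated P I \<longleftrightarrow> (\<forall>u\<in>carrier R - P. \<forall>a\<in>carrier R. u \<otimes> a \<in> I \<longrightarrow> a \<in> I)"

text \<open>The preimage in R of the extension of \<open>I\<close> to the localization at
  \<open>P\<close>; the saturated ideals are those equal to their own preimage. Working with them
  keeps the local arguments inside R.\<close>

definition (in ring) saturation :: "'a set \<Rightarrow> 'a set \<Rightarrow> 'a set" where
  "saturation P I = {a \<in> carrier R. \<exists>u\<in>carrier R - P. u \<otimes> a \<in> I}"

lemma (in ring) saturationI:
  "a \<in> carrier R \<Longrightarrow> u \<in> carrier R - P \<Longrightarrow> u \<otimes> a \<in> I \<Longrightarrow> a \<in> saturation P I"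
  unfolding saturation_def by blast

lemma (in cring) prime_compl_mult:
  assumes "primeideal P R" "u \<in> carrier R - P" "v \<in> carrier R - P" shows "u \<otimes> v \<in> carrier R - P"
  using primeD(3)[OF assms(1)] assms by blast

lemma (in cring) saturation_props:
  assumes "primeideal P R" "ideal I R"
  shows "ideal (saturation P I) R" "saturated P (saturation P I)" "I \<subseteq> saturation P I"
proof -
  note I = idealD[OF assms(2)]
  show sub: "I \<subseteq> saturation P I"
  proof
    fix a assume "a \<in> I"
    then have "a \<in> carrier R" "\<one> \<otimes> a \<in> I" using I by auto
    then show "a \<in> saturation P I" using primeD(2)[OF assms(1)] unfolding saturation_def by blast
  qed
  show "ideal (saturation P I) R"
  proof (rule ideal_intro)
    show "saturation P I \<subseteq> carrier R" unfolding saturation_def by blast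
    show "\<zero> \<in> saturation P I" using I(3) sub by blast
    fix a assume "a \<in> saturation P I"
    then obtain u where u: "a \<in> carrier R" "u \<in> carrier R - P" "u \<otimes> a \<in> I" unfolding saturation_def by blast
    { fix b assume "b \<in> saturation P I"
      then obtain v where v: "b \<in> carrier R" "v \<in> carrier R - P" "v \<otimes> b \<in> I" unfolding saturation_def by blast
      have "(u \<otimes> v) \<otimes> (a \<oplus> b) = v \<otimes> (u \<otimes> a) \<oplus> u \<otimes> (v \<otimes> b)" using u v
        by (simp add: r_distr m_assoc m_lcomm)
      moreover have "\<dots> \<in> I" using I(4,7) u v by blast
      ultimately show "a \<oplus> b \<in> saturation P I" using prime_compl_mult[OF assms(1) u(2) v(2)] u(1) v(1)
        by (intro saturationI[of _ "u \<otimes> v"]) simp_all }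
    fix r assume r: "r \<in> carrier R"
    have "u \<otimes> (r \<otimes> a) = r \<otimes> (u \<otimes> a)" using u r by (simp add: m_lcomm)
    then show "r \<otimes> a \<in> saturation P I" using I(7)[OF u(3) r] u r by (intro saturationI[of _ u]) simp_all
  qed
  show "saturated P (saturation P I)" unfolding saturated_def saturation_def
  proof (intro ballI impI CollectI conjI, assumption)
    fix u a assume u: "u \<in> carrier R - P" "a \<in> carrier R"
      and "u \<otimes> a \<in> {a \<in> carrier R. \<exists>u\<in>carrier R - P. u \<otimes> a \<in> I}"
    then obtain v where v: "v \<in> carrier R - P" "v \<otimes> (u \<otimes> a) \<in> I" by blast
    then have "(v \<otimes> u) \<otimes> a \<in> I" using u by (simp add: m_assoc)
    then show "\<exists>u\<in>carrier R - P. u \<otimes> a \<in> I" using prime_compl_mult[OF assms(1) v(1) u(1)] by blast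
  qed
qed

text \<open>A saturated ideal containing \<open>N\<close> and maximal among those not containing \<open>Q\<close> absorbs \<open>PQ\<close>;
  this replaces the usual determinant argument for Nakayama's lemma in the localization at \<open>P\<close>.\<close>

lemma (in noetherian_cring) nakayama:
  assumes P: "primeideal P R" and N: "ideal N R" "saturated P N" and Q: "ideal Q R"
    and step: "\<And>z L. z \<in> Q \<Longrightarrow> ideal L R \<Longrightarrow> N \<subseteq> L \<Longrightarrow> (\<forall>a\<in>P. \<forall>y\<in>Q. a \<otimes> y \<in> L) \<Longrightarrow>
      \<exists>s\<in>carrier R - P. s \<otimes> z \<in> L"
  shows "Q \<subseteq> N"
proof (rule ccontr)
  assume "\<not> Q \<subseteq> N"
  define S where "S = {L. ideal L R \<and> N \<subseteq> L \<and> saturated P L \<and> \<not> Q \<subseteq> L}"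
  have NS: "N \<in> S" using N \<open>\<not> Q \<subseteq> N\<close> unfolding S_def by blast
  obtain L where L: "L \<in> S" "\<forall>I\<in>S. L \<subseteq> I \<longrightarrow> I = L"
    by (rule maximal_member[OF NS]) (auto simp: S_def)
  have Li: "ideal L R" and Ls: "saturated P L" and LN: "N \<subseteq> L" and LQ: "\<not> Q \<subseteq> L" using L(1) unfolding S_def by auto
  note Pi = idealD[OF primeD(1)[OF P]] and Qi = idealD[OF Q] and Li' = idealD[OF Li]
  have "a \<otimes> y \<in> L" if a: "a \<in> P" and y: "y \<in> Q" for a y
  proof (rule ccontr)
    assume n: "a \<otimes> y \<notin> L"
    have c: "a \<in> carrier R" "y \<in> carrier R" "a \<otimes> y \<in> carrier R" using a y Pi Qi by auto
    \<comment> \<open>A strictly larger saturated ideal over \<open>N\<close>, so the maximality of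
      \<open>L\<close> forces \<open>Q\<close> into it.\<close>
    define L' where "L' = saturation P (adjoin L (a \<otimes> y))"
    have adj: "ideal (adjoin L (a \<otimes> y)) R" using adjoin_ideal[OF Li c(3)] .
    have "ideal L' R" "saturated P L'" "adjoin L (a \<otimes> y) \<subseteq> L'"
      unfolding L'_def using saturation_props[OF P adj] by auto
    moreover note adjoin_mem[OF Li c(3)]
    moreover have "L' \<noteq> L" using calculation n by blast
    ultimately have "Q \<subseteq> L'" using L(2) LN unfolding S_def by blast
    then obtain u where u: "u \<in> carrier R - P" "u \<otimes> y \<in> adjoin L (a \<otimes> y)" using y
      unfolding L'_def saturation_def by blast
    then obtain l r where lr: "u \<otimes> y = l \<oplus> r \<otimes> (a \<otimes> y)" "l \<in> L" "r \<in> carrier R"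
      unfolding adjoin_def by blast
    have lc: "l \<in> carrier R" "u \<in> carrier R" using lr u Li' by auto
    \<comment> \<open>As \<open>a\<close> is in \<open>P\<close> and \<open>u\<close> is not, the
      factor u - r a stays outside \<open>P\<close>; saturation of \<open>L\<close> then cancels it
      and puts \<open>y\<close> into \<open>L\<close>.\<close>
    have "(u \<ominus> r \<otimes> a) \<otimes> y = u \<otimes> y \<ominus> r \<otimes> (a \<otimes> y)" using lc lr(3) c by algebra
    also have "\<dots> = l" unfolding lr(1) using lc lr(3) c by algebra
    finally have "(u \<ominus> r \<otimes> a) \<otimes> y \<in> L" using lr by simp
    moreover have "u \<ominus> r \<otimes> a \<notin> P" using u ideal_cancel(3)[OF primeD(1)[OF P] Pi(7)[OF a lr(3)]] by blast
    ultimately have "y \<in> L" using Ls c lc lr(3) unfolding saturated_def by blast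
    then show False using n Li'(7) c by blast
  qed
  \<comment> \<open>The hypothesis \<open>step\<close> expresses that Q lies in N + P Q after
    localization. Quantifying over all \<open>L\<close> that absorb P Q avoids forming the product
    ideal.\<close>
  then have "\<And>z. z \<in> Q \<Longrightarrow> z \<in> L" using step[OF _ Li LN] Ls Qi(2) unfolding saturated_def by blast
  then show False using LQ by blast
qed

text \<open>Artinian behaviour of \<open>M/B\<close> after localization at \<open>P\<close>: descending chains of ideals between
  \<open>B\<close> and \<open>M\<close> become locally stationary.\<close>

definition (in ring) locally_artinian :: "'a set \<Rightarrow> 'a set \<Rightarrow> 'a set \<Rightarrow> bool" where
  "locally_artinian P B M \<longleftrightarrow>
    (\<forall>N::nat \<Rightarrow> 'a set. (\<forall>n. ideal (N n) R \<and> B \<subseteq> N n \<and> N n \<subseteq> M \<and> N (Suc n) \<subseteq> N n) \<longrightarrow>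
      (\<exists>n0. \<forall>n\<ge>n0. N n \<subseteq> saturation P (N (Suc n))))"

lemma (in ring) locally_artinianE:
  assumes "locally_artinian P B M" "\<And>n. ideal (N n) R" "\<And>n. B \<subseteq> N n" "\<And>n. N n \<subseteq> M" "\<And>n. N (Suc n) \<subseteq> N n"
  obtains n0 :: nat where "\<forall>n\<ge>n0. N n \<subseteq> saturation P (N (Suc n))"
  using assms unfolding locally_artinian_def by metis

text \<open>\<open>L\<close> and \<open>adjoin L y\<close> have the same localization at
  \<open>P\<close>, where \<open>s\<close> becomes a unit. Multiplication by \<open>s\<close> moves
  every term of a chain into \<open>L\<close>, so the chain is controlled by its intersections with
  \<open>L\<close>.\<close>

lemma (in cring) locally_artinian_adjoin_inverted:
  assumes P: "primeideal P R" and L: "ideal L R" "B \<subseteq> L" "locally_artinian P B L"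
    and y: "y \<in> carrier R" "s \<in> carrier R - P" "s \<otimes> y \<in> L"
  shows "locally_artinian P B (adjoin L y)"
  unfolding locally_artinian_def
proof (intro allI impI)
  fix N :: "nat \<Rightarrow> 'a set"
  assume N: "\<forall>n. ideal (N n) R \<and> B \<subseteq> N n \<and> N n \<subseteq> adjoin L y \<and> N (Suc n) \<subseteq> N n"
  obtain n0 where n0: "\<forall>n\<ge>n0. N n \<inter> L \<subseteq> saturation P (N (Suc n) \<inter> L)"
    by (rule locally_artinianE[OF L(3), of "\<lambda>n. N n \<inter> L"]) (use N L i_intersect in blast)+
  have "N n \<subseteq> saturation P (N (Suc n))" if n: "n \<ge> n0" for n
  proof
    fix z assume z: "z \<in> N n"
    have "z \<in> adjoin L y" using z N by blast
    then obtain l r where lr: "z = l \<oplus> r \<otimes> y" "l \<in> L" "r \<in> carrier R" unfolding adjoin_def by blast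
    have c: "l \<in> carrier R" "s \<in> carrier R" "z \<in> carrier R" using lr y idealD(2)[OF L(1)] by auto
    have "s \<otimes> z = s \<otimes> l \<oplus> r \<otimes> (s \<otimes> y)" using lr(1,3) c(1,2) y(1) by (simp add: r_distr m_lcomm)
    then have "s \<otimes> z \<in> L" using lr c y(3) idealD(4,7)[OF L(1)] by simp
    moreover have "s \<otimes> z \<in> N n" using idealD(7)[of "N n" z s] N z c by blast
    ultimately have "s \<otimes> z \<in> saturation P (N (Suc n) \<inter> L)" using n0 n by blast
    then obtain u where u: "u \<in> carrier R - P" "u \<otimes> (s \<otimes> z) \<in> N (Suc n)" unfolding saturation_def by blast
    then have "(u \<otimes> s) \<otimes> z \<in> N (Suc n)" using c by (simp add: m_assoc)
    then show "z \<in> saturation P (N (Suc n))" using prime_compl_mult[OF P u(1) y(2)] c(3)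
      by (intro saturationI)
  qed
  then show "\<exists>n0. \<forall>n\<ge>n0. N n \<subseteq> saturation P (N (Suc n))" by blast
qed

text \<open>Locally \<open>adjoin L y\<close> modulo \<open>L\<close> is a vector space of dimension
  at most one over the residue field of \<open>P\<close>, so the image of the chain in it can drop
  only once. \<open>hit n\<close> expresses that the image of \<open>N n\<close> is still the whole
  space.\<close>

lemma (in cring) locally_artinian_adjoin_killed:
  assumes P: "primeideal P R" and L: "ideal L R" "B \<subseteq> L" "locally_artinian P B L"
    and y: "y \<in> carrier R" "\<forall>a\<in>P. a \<otimes> y \<in> L"
  shows "locally_artinian P B (adjoin L y)"
  unfolding locally_artinian_def
proof (intro allI impI)
  fix N :: "nat \<Rightarrow> 'a set"
  assume N: "\<forall>n. ideal (N n) R \<and> B \<subseteq> N n \<and> N n \<subseteq> adjoin L y \<and> N (Suc n) \<subseteq> N n"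
  note L' = idealD[OF L(1)]
  obtain n0 where n0: "\<forall>n\<ge>n0. N n \<inter> L \<subseteq> saturation P (N (Suc n) \<inter> L)"
    by (rule locally_artinianE[OF L(3), of "\<lambda>n. N n \<inter> L"]) (use N L i_intersect in blast)+
  define hit where "hit n \<longleftrightarrow> (\<exists>u\<in>carrier R - P. \<exists>w\<in>L. u \<otimes> y \<oplus> w \<in> N n)" for n
  obtain n1 where n1: "(\<forall>n. hit n) \<or> (\<forall>n\<ge>n1. \<not> hit n)"
  proof (cases "\<forall>n. hit n")
    case False
    then obtain k where k: "\<not> hit k" by blast
    have "N n \<subseteq> N k" if "n \<ge> k" for n by (rule lift_Suc_antimono_le[OF _ that]) (use N in blast)
    then have "\<forall>n\<ge>k. \<not> hit n" using k unfolding hit_def by blast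
    then show ?thesis using that by blast
  qed (use that in blast)
  have "N n \<subseteq> saturation P (N (Suc n))" if n: "n \<ge> max n0 n1" for n
  proof
    fix z assume z: "z \<in> N n"
    have Nn: "ideal (N n) R" "ideal (N (Suc n)) R" "N (Suc n) \<subseteq> N n" using N by auto
    have "z \<in> adjoin L y" using z N by blast
    then obtain l r where lr: "z = l \<oplus> r \<otimes> y" "l \<in> L" "r \<in> carrier R" unfolding adjoin_def by blast
    have c: "l \<in> carrier R" "z \<in> carrier R" using lr y(1) L'(2) by auto
    have stab: "w \<in> saturation P (N (Suc n))" if "w \<in> N n" "w \<in> L" for w
    proof -
      have "w \<in> saturation P (N (Suc n) \<inter> L)" using that n0 n by auto
      then show ?thesis unfolding saturation_def by blast
    qed
    show "z \<in> saturation P (N (Suc n))"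
    proof (cases "hit (Suc n)")
      case True
      then obtain u w where u: "u \<in> carrier R - P" "w \<in> L" "u \<otimes> y \<oplus> w \<in> N (Suc n)" unfolding hit_def by blast
      have uc: "u \<in> carrier R" "w \<in> carrier R" using u L'(2) by auto
      \<comment> \<open>Subtracting a multiple of the witness of \<open>hit (Suc n)\<close> cancels
        the \<open>y\<close>-part of u z. The difference lies in \<open>L\<close>, where the chain
        is stationary, and the subtracted term is already in \<open>N (Suc n)\<close>.\<close>
      have eq: "u \<otimes> z \<ominus> r \<otimes> (u \<otimes> y \<oplus> w) = u \<otimes> l \<ominus> r \<otimes> w"
        unfolding lr(1) using uc c(1) lr(3) y(1) by algebra
      have "u \<otimes> l \<ominus> r \<otimes> w \<in> L" using L'(6,7) uc lr u by blast
      moreover have "u \<otimes> z \<ominus> r \<otimes> (u \<otimes> y \<oplus> w) \<in> N n"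
        using idealD(6,7)[OF Nn(1)] z uc u(3) Nn(3) lr(3) by blast
      ultimately have "u \<otimes> z \<ominus> r \<otimes> (u \<otimes> y \<oplus> w) \<in> saturation P (N (Suc n))" using stab eq by simp
      then obtain v where v: "v \<in> carrier R - P" "v \<otimes> (u \<otimes> z \<ominus> r \<otimes> (u \<otimes> y \<oplus> w)) \<in> N (Suc n)"
        unfolding saturation_def by blast
      have vc: "v \<in> carrier R" "u \<otimes> y \<oplus> w \<in> carrier R" using v uc y(1) by auto
      have "(v \<otimes> u) \<otimes> z = v \<otimes> (u \<otimes> z \<ominus> r \<otimes> (u \<otimes> y \<oplus> w)) \<oplus> (v \<otimes> r) \<otimes> (u \<otimes> y \<oplus> w)"
        using vc uc(1) c(2) lr(3) by algebra
      then have "(v \<otimes> u) \<otimes> z \<in> N (Suc n)"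
        using idealD(4,7)[OF Nn(2)] v(2) u(3) vc(1) lr(3) m_closed by metis
      then show ?thesis using prime_compl_mult[OF P v(1) u(1)] c(2) by (intro saturationI)
    next
      case False
      then have nh: "\<not> hit n" using n1 n by auto
      \<comment> \<open>Otherwise \<open>z\<close> itself would witness
        \<open>hit n\<close>.\<close>
      have "r \<in> P"
      proof (rule ccontr)
        assume "r \<notin> P"
        moreover have "r \<otimes> y \<oplus> l \<in> N n" using z lr c y(1) by (simp add: a_comm)
        ultimately show False using nh lr(2,3) unfolding hit_def by blast
      qed
      then have "z \<in> L" using lr y(2) L'(4) by blast
      then show ?thesis using stab z by blast
    qed
  qed
  then show "\<exists>n0. \<forall>n\<ge>n0. N n \<subseteq> saturation P (N (Suc n))" by blast
qed

text \<open>By \<open>minimal\<close>, no prime strictly inside \<open>P\<close> contains the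
  annihilator of M/B. Climbing from \<open>B\<close> to \<open>M\<close> along associated primes,
  each prime met contains this annihilator, so it equals \<open>P\<close> or is not contained in
  \<open>P\<close>; the two preceding lemmas treat these cases.\<close>

lemma (in noetherian_cring) locally_artinianI:
  assumes P: "primeideal P R" and B: "ideal B R" "B \<subseteq> M" and M: "ideal M R"
    and minimal: "\<And>Q. primeideal Q R \<Longrightarrow> Q \<subseteq> P \<Longrightarrow> (\<forall>r\<in>carrier R. (\<forall>m\<in>M. r \<otimes> m \<in> B) \<longrightarrow> r \<in> Q) \<Longrightarrow> Q = P"
  shows "locally_artinian P B M"
proof -
  define S where "S = {L. ideal L R \<and> B \<subseteq> L \<and> L \<subseteq> M \<and> locally_artinian P B L}"
  have "locally_artinian P B B" unfolding locally_artinian_def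
  proof (intro allI impI)
    fix N :: "nat \<Rightarrow> 'a set"
    assume N: "\<forall>n. ideal (N n) R \<and> B \<subseteq> N n \<and> N n \<subseteq> B \<and> N (Suc n) \<subseteq> N n"
    then have "N n \<subseteq> saturation P (N (Suc n))" for n
      using saturation_props(3)[OF P B(1)] by (metis subset_antisym)
    then show "\<exists>n0. \<forall>n\<ge>n0. N n \<subseteq> saturation P (N (Suc n))" by blast
  qed
  then have "B \<in> S" using B unfolding S_def by blast
  then obtain L where L: "L \<in> S" "\<forall>I\<in>S. L \<subseteq> I \<longrightarrow> I = L"
    by (rule maximal_member) (auto simp: S_def)
  then have Li: "ideal L R" "B \<subseteq> L" "L \<subseteq> M" "locally_artinian P B L" unfolding S_def by auto
  have "L = M"
  proof (rule ccontr)
    assume "L \<noteq> M"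
    then obtain y where "y \<in> M - L" using Li by blast
    then obtain z where z: "z \<in> M" "z \<notin> L" "primeideal (colon L z) R"
      using exists_associated_prime[OF Li(1) _ M] by metis
    have zc: "z \<in> carrier R" using z idealD(2)[OF M] by blast
    have "locally_artinian P B (adjoin L z)"
    proof (cases "colon L z \<subseteq> P")
      case True
      have "\<forall>r\<in>carrier R. (\<forall>m\<in>M. r \<otimes> m \<in> B) \<longrightarrow> r \<in> colon L z" using Li(2) z(1) unfolding colon_def by blast
      then have "colon L z = P" using minimal[OF z(3) True] by simp
      then have "\<forall>a\<in>P. a \<otimes> z \<in> L" unfolding colon_def by blast
      then show ?thesis using locally_artinian_adjoin_killed[OF P Li(1,2,4) zc] by blast
    next
      case False
      then obtain s where "s \<in> carrier R - P" "s \<otimes> z \<in> L" unfolding colon_def by blast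
      then show ?thesis using locally_artinian_adjoin_inverted[OF P Li(1,2,4) zc] by blast
    qed
    moreover have "L \<subseteq> adjoin L z" "z \<in> adjoin L z" "ideal (adjoin L z) R" "adjoin L z \<subseteq> M"
      using adjoin_mem[OF Li(1) zc] adjoin_ideal[OF Li(1) zc] adjoin_le[OF M Li(3) z(1)] by auto
    ultimately show False using L(2) Li(2) z(2) unfolding S_def by blast
  qed
  then show ?thesis using Li by simp
qed

section \<open>Prime chains and Krull's principal ideal theorem\<close>

text \<open>Krull's theorem for the domain R modulo \<open>P\<^sub>0\<close>. As
  \<open>P\<^sub>2\<close> is minimal over \<open>x\<close>, the symbolic powers of
  \<open>P\<^sub>1\<close> become stationary modulo \<open>x\<close> locally at
  \<open>P\<^sub>2\<close>. Nakayama's lemma at \<open>P\<^sub>2\<close> removes the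
  \<open>x\<close>, and at \<open>P\<^sub>1\<close> it shows that some symbolic power vanishes,
  which is absurd for a nonzero prime of a domain.\<close>

lemma (in noetherian_cring) principal_ideal_theorem:
  assumes P0: "primeideal P\<^sub>0 R" and P1: "primeideal P\<^sub>1 R" and less: "P\<^sub>0 \<subset> P\<^sub>1" "P\<^sub>1 \<subseteq> P\<^sub>2"
    and x: "x \<in> carrier R" "x \<notin> P\<^sub>1" and min: "minimal_prime_over (adjoin P\<^sub>0 x) P\<^sub>2"
  shows False
proof -
  have P2: "primeideal P\<^sub>2 R" and xP2: "adjoin P\<^sub>0 x \<subseteq> P\<^sub>2"
    and mini: "\<And>Q. primeideal Q R \<Longrightarrow> adjoin P\<^sub>0 x \<subseteq> Q \<Longrightarrow> Q \<subseteq> P\<^sub>2 \<Longrightarrow> Q = P\<^sub>2"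
    using min unfolding minimal_prime_over_def by auto
  note P0i = primeD(1)[OF P0] and P1i = primeD(1)[OF P1] and P2i = primeD(1)[OF P2]
  have x2: "x \<in> P\<^sub>2" using adjoin_mem(2)[OF P0i x(1)] xP2 by blast
  \<comment> \<open>This is \<open>P\<^sub>1 I + P\<^sub>0\<close>; the summand
    \<open>P\<^sub>0\<close> replaces the passage to the quotient domain.\<close>
  define gen where "gen I = Idl ({a \<otimes> y | a y. a \<in> P\<^sub>1 \<and> y \<in> I} \<union> P\<^sub>0)" for I
  have gsub: "{a \<otimes> y | a y. a \<in> P\<^sub>1 \<and> y \<in> I} \<union> P\<^sub>0 \<subseteq> carrier R" if "ideal I R" for I
    using that idealD(2)[OF P1i] idealD(2)[OF P0i] idealD(2)[OF that] by blast
  have gen: "ideal (gen I) R" "{a \<otimes> y | a y. a \<in> P\<^sub>1 \<and> y \<in> I} \<union> P\<^sub>0 \<subseteq> gen I"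
    "\<And>L. ideal L R \<Longrightarrow> (\<forall>a\<in>P\<^sub>1. \<forall>y\<in>I. a \<otimes> y \<in> L) \<Longrightarrow> P\<^sub>0 \<subseteq> L \<Longrightarrow> gen I \<subseteq> L" if "ideal I R" for I
  proof -
    show "ideal (gen I) R" unfolding gen_def by (rule genideal_ideal[OF gsub[OF that]])
    show "{a \<otimes> y | a y. a \<in> P\<^sub>1 \<and> y \<in> I} \<union> P\<^sub>0 \<subseteq> gen I" unfolding gen_def by (rule genideal_self[OF gsub[OF that]])
    show "gen I \<subseteq> L" if "ideal L R" "\<forall>a\<in>P\<^sub>1. \<forall>y\<in>I. a \<otimes> y \<in> L" "P\<^sub>0 \<subseteq> L" for L
      unfolding gen_def by (rule genideal_minimal[OF that(1)]) (use that in blast)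
  qed
  text \<open>The symbolic powers of \<open>P\<^sub>1/P\<^sub>0\<close>.\<close>
  define Q where "Q n = ((\<lambda>I. saturation P\<^sub>1 (gen I)) ^^ n) (carrier R)" for n
  have Q0: "Q 0 = carrier R" and QS: "Q (Suc n) = saturation P\<^sub>1 (gen (Q n))" for n
    unfolding Q_def by simp_all
  have Qi: "ideal (Q n) R" for n
  proof (induction n)
    case 0 show ?case unfolding Q0 by (rule oneideal)
  next
    case (Suc n) show ?case unfolding QS using saturation_props(1)[OF P1 gen(1)[OF Suc]] .
  qed
  have Qsat: "saturated P\<^sub>1 (Q n)" for n
  proof (cases n)
    case 0 then show ?thesis using Q0 unfolding saturated_def by simp
  next
    case (Suc k) show ?thesis unfolding Suc QS using saturation_props(2)[OF P1 gen(1)[OF Qi]] .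
  qed
  have QP0: "P\<^sub>0 \<subseteq> Q n" for n
  proof (cases n)
    case 0 then show ?thesis using Q0 idealD(1)[OF P0i] by simp
  next
    case (Suc k) show ?thesis unfolding Suc QS
      using saturation_props(3)[OF P1 gen(1)[OF Qi]] gen(2)[OF Qi] by blast
  qed
  have Qdec: "Q (Suc n) \<subseteq> Q n" for n
  proof -
    have "gen (Q n) \<subseteq> Q n"
      using idealD(7)[OF Qi] idealD(2)[OF P1i] by (intro gen(3) Qi QP0) blast
    then show ?thesis using Qsat[of n] unfolding QS saturation_def saturated_def by blast
  qed
  have "locally_artinian P\<^sub>2 (adjoin P\<^sub>0 x) (carrier R)"
  proof (rule locally_artinianI[OF P2 adjoin_ideal[OF P0i x(1)] _ oneideal])
    show "adjoin P\<^sub>0 x \<subseteq> carrier R" using idealD(1)[OF adjoin_ideal[OF P0i x(1)]] .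
    fix W assume W: "primeideal W R" "W \<subseteq> P\<^sub>2" "\<forall>r\<in>carrier R. (\<forall>m\<in>carrier R. r \<otimes> m \<in> adjoin P\<^sub>0 x) \<longrightarrow> r \<in> W"
    have "adjoin P\<^sub>0 x \<subseteq> W" using W(3) idealD(2,8)[OF adjoin_ideal[OF P0i x(1)]] by blast
    then show "W = P\<^sub>2" using mini W by blast
  qed
  then obtain n where n: "\<forall>k\<ge>n. adjoin (Q k) x \<subseteq> saturation P\<^sub>2 (adjoin (Q (Suc k)) x)"
  proof (rule locally_artinianE[of _ _ _ "\<lambda>n. adjoin (Q n) x"])
    fix n
    show "ideal (adjoin (Q n) x) R" using adjoin_ideal[OF Qi x(1)] .
    then show "adjoin (Q n) x \<subseteq> carrier R" using idealD(1) by blast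
    show "adjoin P\<^sub>0 x \<subseteq> adjoin (Q n) x" using QP0 unfolding adjoin_def by blast
    show "adjoin (Q (Suc n)) x \<subseteq> adjoin (Q n) x" using Qdec unfolding adjoin_def by blast
  qed
  \<comment> \<open>Stationarity gives u z = b + r x with \<open>b\<close> in
    \<open>Q (Suc n)\<close>. Then r x is in \<open>Q n\<close>, and so is \<open>r\<close>, because
    \<open>x\<close> is outside \<open>P\<^sub>1\<close> and \<open>Q n\<close> is saturated there.
    Hence r x lies in \<open>P\<^sub>2\<close> times \<open>Q n\<close>, and Nakayama's lemma
    applies.\<close>
  have "Q n \<subseteq> Q (Suc n)"
  proof (rule nakayama[OF P2 Qi _ Qi])
    show "saturated P\<^sub>2 (Q (Suc n))" using Qsat less(2) unfolding saturated_def by blast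
    fix z L assume z: "z \<in> Q n" and L: "ideal L R" "Q (Suc n) \<subseteq> L" "\<forall>a\<in>P\<^sub>2. \<forall>y\<in>Q n. a \<otimes> y \<in> L"
    have "z \<in> saturation P\<^sub>2 (adjoin (Q (Suc n)) x)"
      using n z adjoin_mem(1)[OF Qi x(1)] by blast
    then obtain u where u: "u \<in> carrier R - P\<^sub>2" "u \<otimes> z \<in> adjoin (Q (Suc n)) x" unfolding saturation_def by blast
    then obtain b r where br: "u \<otimes> z = b \<oplus> r \<otimes> x" "b \<in> Q (Suc n)" "r \<in> carrier R" unfolding adjoin_def by blast
    have bQ: "b \<in> Q n" using br Qdec by blast
    have "b \<oplus> r \<otimes> x \<in> Q n" unfolding br(1)[symmetric] using idealD(7)[OF Qi z] u(1) by blast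
    then have "r \<otimes> x \<in> Q n" using ideal_cancel(1)[OF Qi bQ] br(3) x(1) by simp
    then have "x \<otimes> r \<in> Q n" using br(3) x(1) m_comm by simp
    then have "r \<in> Q n" using Qsat br(3) x unfolding saturated_def by blast
    then have "x \<otimes> r \<in> L" using L(3) x2 by blast
    then have "u \<otimes> z \<in> L" unfolding br(1) using idealD(4)[OF L(1)] br L(2) x(1) m_comm by auto
    then show "\<exists>s\<in>carrier R - P\<^sub>2. s \<otimes> z \<in> L" using u(1) by blast
  qed
  \<comment> \<open>Localized at \<open>P\<^sub>1\<close>, stationarity of the symbolic powers reads
    \<open>Q n = P\<^sub>1 (Q n) + P\<^sub>0\<close>.\<close>
  have "Q n \<subseteq> P\<^sub>0"
  proof (rule nakayama[OF P1 P0i _ Qi])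
    show "saturated P\<^sub>1 P\<^sub>0" using primeD(3)[OF P0] less(1) unfolding saturated_def by blast
    fix z L assume z: "z \<in> Q n" and L: "ideal L R" "P\<^sub>0 \<subseteq> L" "\<forall>a\<in>P\<^sub>1. \<forall>y\<in>Q n. a \<otimes> y \<in> L"
    have "z \<in> saturation P\<^sub>1 (gen (Q n))" using z \<open>Q n \<subseteq> Q (Suc n)\<close> unfolding QS by blast
    moreover have "gen (Q n) \<subseteq> L" using gen(3)[OF Qi L(1,3,2)] .
    ultimately show "\<exists>s\<in>carrier R - P\<^sub>1. s \<otimes> z \<in> L" unfolding saturation_def by blast
  qed
  \<comment> \<open>An element of \<open>P\<^sub>1\<close> outside the prime
    \<open>P\<^sub>0\<close> can be cancelled, so containment in \<open>P\<^sub>0\<close> climbs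
    back through the symbolic powers to \<open>Q 0\<close>, the whole ring.\<close>
  obtain p where p: "p \<in> P\<^sub>1" "p \<notin> P\<^sub>0" using less(1) by blast
  have "Q k \<subseteq> P\<^sub>0" if "Q (Suc k) \<subseteq> P\<^sub>0" for k
  proof
    fix y assume y: "y \<in> Q k"
    have "p \<otimes> y \<in> gen (Q k)" using gen(2)[OF Qi] p y by blast
    then have "p \<otimes> y \<in> P\<^sub>0" using saturation_props(3)[OF P1 gen(1)[OF Qi]] that unfolding QS by blast
    then show "y \<in> P\<^sub>0" using primeD(3)[OF P0] p idealD(2)[OF P1i] idealD(2)[OF Qi] y by blast
  qed
  then have "Q 0 \<subseteq> P\<^sub>0" using \<open>Q n \<subseteq> P\<^sub>0\<close> by (induction n) auto
  then show False using primeD(2)[OF P0] Q0 by auto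
qed

text \<open>When \<open>x\<close> is not in the given middle prime, a minimal prime over
  \<open>P\<^sub>0\<close> and \<open>x\<close> inside \<open>P\<^sub>2\<close> takes its place; the
  principal ideal theorem says that it is not \<open>P\<^sub>2\<close>.\<close>

lemma (in noetherian_cring) prime_between:
  assumes "primeideal P\<^sub>0 R" "primeideal P\<^sub>1 R" "primeideal P\<^sub>2 R" "P\<^sub>0 \<subset> P\<^sub>1" "P\<^sub>1 \<subset> P\<^sub>2" "x \<in> P\<^sub>2"
  obtains P' where "primeideal P' R" "P\<^sub>0 \<subset> P'" "P' \<subset> P\<^sub>2" "x \<in> P'"
proof (cases "x \<in> P\<^sub>1")
  case True then show ?thesis using that assms by blast
next
  case False
  have xc: "x \<in> carrier R" using idealD(2)[OF primeD(1)[OF assms(3)] assms(6)] .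
  have sub: "adjoin P\<^sub>0 x \<subseteq> P\<^sub>2" using assms by (intro adjoin_le primeD(1)) auto
  obtain P' where P': "minimal_prime_over (adjoin P\<^sub>0 x) P'" "P' \<subseteq> P\<^sub>2"
    using exists_minimal_prime[OF sub assms(3)] by blast
  then have pr: "primeideal P' R" "adjoin P\<^sub>0 x \<subseteq> P'" unfolding minimal_prime_over_def by auto
  have "P' \<noteq> P\<^sub>2"
    using principal_ideal_theorem[OF assms(1,2,4) _ xc False] P' assms(5) by blast
  moreover have "P\<^sub>0 \<subseteq> P'" "x \<in> P'" using pr(2) adjoin_mem[OF primeD(1)[OF assms(1)] xc] by auto
  moreover have "x \<notin> P\<^sub>0" using False assms(4) by blast
  ultimately show ?thesis using that pr(1) P'(2) by blast
qed

section \<open>Chains of primes through a given element\<close>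

definition (in ring) prime_chain :: "(nat \<Rightarrow> 'a set) \<Rightarrow> nat \<Rightarrow> bool" where
  "prime_chain P n \<longleftrightarrow> (\<forall>i\<le>n. primeideal (P i) R) \<and> (\<forall>i<n. P i \<subset> P (Suc i))"

lemma (in ring) prime_chain_mono: "prime_chain P n \<Longrightarrow> i \<le> j \<Longrightarrow> j \<le> n \<Longrightarrow> P i \<subseteq> P j"
proof (induction j)
  case (Suc j)
  have "P j \<subseteq> P (Suc j)" using Suc.prems unfolding prime_chain_def by (simp add: psubset_imp_subset Suc_le_eq)
  then show ?case using Suc by (auto simp: le_Suc_eq)
qed simp

text \<open>From the top downwards, \<open>prime_between\<close> replaces each inner prime by one
  containing \<open>x\<close>; then the lowest prime is dropped. Passing to R/(x) thus lowers the
  dimension by at most one.\<close>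

lemma (in noetherian_cring) shorten_chain:
  assumes "prime_chain P (Suc n)" "x \<in> P (Suc n)"
  shows "\<exists>P'. prime_chain P' n \<and> P 0 \<subseteq> P' 0 \<and> x \<in> P' 0 \<and> P' n = P (Suc n)"
  using assms
proof (induction n arbitrary: P)
  case 0
  have "prime_chain (\<lambda>i. P (Suc i)) 0" "P 0 \<subseteq> P (Suc 0)" using 0 unfolding prime_chain_def by auto
  then show ?case using 0 by blast
next
  case (Suc n)
  have ch: "\<And>i. i \<le> Suc (Suc n) \<Longrightarrow> primeideal (P i) R" "\<And>i. i < Suc (Suc n) \<Longrightarrow> P i \<subset> P (Suc i)"
    using Suc.prems unfolding prime_chain_def by auto
  obtain P' where P': "primeideal P' R" "P n \<subset> P'" "P' \<subset> P (Suc (Suc n))" "x \<in> P'"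
    by (rule prime_between[OF ch(1)[of n] ch(1)[of "Suc n"] ch(1)[of "Suc (Suc n)"] ch(2)[of n] ch(2)[of "Suc n"] Suc.prems(2)])
      auto
  have c1: "prime_chain (P(Suc n := P')) (Suc n)"
    unfolding prime_chain_def using ch P' by (auto simp: less_Suc_eq)
  obtain W where W: "prime_chain W n" "(P(Suc n := P')) 0 \<subseteq> W 0" "x \<in> W 0" "W n = P'"
    using Suc.IH[OF c1] P'(4) by auto
  have "prime_chain (W(Suc n := P (Suc (Suc n)))) (Suc n)"
    using W(1,4) P'(3) ch(1) unfolding prime_chain_def by (auto simp: less_Suc_eq)
  moreover have "P 0 \<subseteq> (W(Suc n := P (Suc (Suc n)))) 0" "x \<in> (W(Suc n := P (Suc (Suc n)))) 0"
    "(W(Suc n := P (Suc (Suc n)))) (Suc n) = P (Suc (Suc n))" using W by auto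
  ultimately show ?case by blast
qed

section \<open>Regular local rings\<close>

locale local_noetherian = noetherian_cring +
  fixes \<mm> assumes max: "maximalideal \<mm> R" and max_unique: "\<And>\<nn>. maximalideal \<nn> R \<Longrightarrow> \<nn> = \<mm>"
begin

lemma mm_prime: "primeideal \<mm> R" by (rule maximalideal_prime[OF max])

lemma mm_ideal: "ideal \<mm> R" by (rule primeD(1)[OF mm_prime])

lemma proper_le: "ideal I R \<Longrightarrow> \<one> \<notin> I \<Longrightarrow> I \<subseteq> \<mm>"
  using exists_maximalideal max_unique by metis

lemma inverse_exists:
  assumes "u \<in> carrier R - \<mm>" obtains v where "v \<in> carrier R" "v \<otimes> u = \<one>"
proof -
  have "ideal (PIdl u) R" "u \<in> PIdl u" using assms cgenideal_ideal cgenideal_self by auto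
  then have "\<one> \<in> PIdl u" using proper_le assms by blast
  then show ?thesis using that unfolding cgenideal_def by force
qed

lemma saturated_mm: "ideal I R \<Longrightarrow> saturated \<mm> I"
  unfolding saturated_def
proof (intro ballI impI)
  fix u a assume I: "ideal I R" and ua: "u \<in> carrier R - \<mm>" "a \<in> carrier R" "u \<otimes> a \<in> I"
  obtain v where v: "v \<in> carrier R" "v \<otimes> u = \<one>" using inverse_exists ua(1) by blast
  have "v \<otimes> (u \<otimes> a) \<in> I" using idealD(7)[OF I ua(3) v(1)] .
  then show "a \<in> I" using v ua by (simp add: m_assoc[symmetric])
qed

text \<open>That is, dim R/I is at least \<open>n\<close>. A chain that ends at \<open>\<mm>\<close>
  allows \<open>shorten_chain\<close> to be applied to any element of \<open>\<mm>\<close>.\<close>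

definition chain_over :: "'a set \<Rightarrow> nat \<Rightarrow> bool" where
  "chain_over I n \<longleftrightarrow> (\<exists>P. prime_chain P n \<and> I \<subseteq> P 0 \<and> P n = \<mm>)"

text \<open>Moving one generator from \<open>H\<close> to \<open>T\<close> shortens the chain by at
  most one, and once \<open>H\<close> is exhausted only the trivial chain at \<open>\<mm>\<close>
  remains. This bounds dim R/(T) by the number of generators of \<open>\<mm>\<close> modulo
  \<open>T\<close>.\<close>

lemma chain_over_le_generators:
  assumes "finite H" "H \<subseteq> carrier R" "T \<subseteq> carrier R" "Idl (T \<union> H) = \<mm>" "chain_over (Idl T) n"
  shows "n \<le> card H"
  using assms
proof (induction H arbitrary: T n)
  case empty
  then obtain P where P: "prime_chain P n" "\<mm> \<subseteq> P 0" "P n = \<mm>" unfolding chain_over_def by auto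
  have "n = 0"
  proof (rule ccontr)
    assume "n \<noteq> 0"
    then have "P 0 \<subset> P 1" "P 1 \<subseteq> P n" using P(1) prime_chain_mono[OF P(1), of 1 n] unfolding prime_chain_def by auto
    then show False using P by blast
  qed
  then show ?case by simp
next
  case (insert h H)
  show ?case
  proof (cases n)
    case (Suc k)
    obtain P where P: "prime_chain P (Suc k)" "Idl T \<subseteq> P 0" "P (Suc k) = \<mm>" using insert.prems Suc unfolding chain_over_def by auto
    have "h \<in> \<mm>" using insert.prems(1,2,3) genideal_self[of "T \<union> insert h H"] by auto
    then obtain P' where P': "prime_chain P' k" "P 0 \<subseteq> P' 0" "h \<in> P' 0" "P' k = \<mm>"
      using shorten_chain[OF P(1), unfolded P(3), OF \<open>h \<in> \<mm>\<close>] by blast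
    have "primeideal (P' 0) R" using P'(1) unfolding prime_chain_def by blast
    then have "Idl (insert h T) \<subseteq> P' 0"
      using P(2) P'(2,3) genideal_self[of T] insert.prems(2) by (intro genideal_minimal primeD(1)) auto
    then have "chain_over (Idl (insert h T)) k" using P' unfolding chain_over_def by blast
    then have "k \<le> card H" using insert.IH[of "insert h T" k] insert.prems by auto
    then show ?thesis using Suc insert.hyps by simp
  qed simp
qed

end

locale regular_local = local_noetherian +
  fixes G assumes fin: "finite G" and G_carr: "G \<subseteq> carrier R" and G_gen: "Idl G = \<mm>"
    and dim: "chain_over {} (card G)"
begin

lemma Idl_sub_ideal: "T \<subseteq> G \<Longrightarrow> ideal (Idl T) R" using G_carr genideal_ideal by blast

text \<open>Each element of \<open>T\<close> costs at most one step of the chain provided by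
  \<open>dim\<close>. Together with \<open>chain_over_subset_le\<close>, the dimension of R/(T) is
  exactly \<open>card (G - T)\<close>.\<close>

lemma chain_over_subset:
  assumes "T \<subseteq> G" shows "chain_over (Idl T) (card (G - T))"
proof -
  have "finite T" using assms fin finite_subset by blast
  then show ?thesis using assms
  proof (induction T)
    case empty
    obtain P where P: "prime_chain P (card G)" "P (card G) = \<mm>" using dim unfolding chain_over_def by blast
    have "primeideal (P 0) R" using P(1) unfolding prime_chain_def by blast
    then have "Idl {} \<subseteq> P 0" by (intro genideal_minimal primeD(1)) auto
    then show ?case using P unfolding chain_over_def by auto
  next
    case (insert x T)
    have "card (G - T) = Suc (card (G - insert x T))"
      using insert.prems insert.hyps fin card_Suc_Diff1[of "G - T" x] by (simp add: Diff_insert[symmetric])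
    moreover have "chain_over (Idl T) (card (G - T))" using insert by blast
    ultimately obtain P where P: "prime_chain P (Suc (card (G - insert x T)))" "Idl T \<subseteq> P 0"
        "P (Suc (card (G - insert x T))) = \<mm>"
      unfolding chain_over_def by metis
    have "x \<in> \<mm>" using insert.prems genideal_self[OF G_carr] G_gen by blast
    then obtain P' where P': "prime_chain P' (card (G - insert x T))" "P 0 \<subseteq> P' 0" "x \<in> P' 0" "P' (card (G - insert x T)) = \<mm>"
      using shorten_chain[OF P(1), unfolded P(3), OF \<open>x \<in> \<mm>\<close>] by blast
    have "primeideal (P' 0) R" using P'(1) unfolding prime_chain_def by blast
    then have "Idl (insert x T) \<subseteq> P' 0"
      using P(2) P'(2,3) genideal_self[of T] insert.prems G_carr by (intro genideal_minimal primeD(1)) auto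
    then show ?case using P' unfolding chain_over_def by blast
  qed
qed

lemma chain_over_subset_le:
  assumes "T \<subseteq> G" "chain_over (Idl T) n" shows "n \<le> card (G - T)"
  using chain_over_le_generators[of "G - T" T n] assms fin G_carr G_gen by (auto simp: Un_absorb1)

text \<open>The proof that a regular local ring is a domain, run downwards from T = G. The bottom
  prime \<open>P 0\<close> of a longest chain over (T) misses some generator \<open>h\<close>, and a
  dimension count puts \<open>P 0\<close> inside the prime (T, h). Since \<open>h\<close> cancels
  modulo \<open>P 0\<close>, this gives P 0 = (T) + h (P 0), and Nakayama's lemma yields P 0 =
  (T).\<close>

lemma Idl_subset_prime:
  assumes "T \<subseteq> G" shows "primeideal (Idl T) R"
  using assms
proof (induction "card (G - T)" arbitrary: T)
  case 0
  then have "T = G" using fin by (simp add: subset_antisym)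
  then show ?case using G_gen mm_prime by simp
next
  case (Suc n)
  obtain P where P: "prime_chain P (Suc n)" "Idl T \<subseteq> P 0" "P (Suc n) = \<mm>"
    using chain_over_subset[OF Suc.prems] Suc.hyps(2) unfolding chain_over_def by auto
  have pr: "primeideal (P 0) R" "P 0 \<subset> P 1" "P 1 \<subseteq> \<mm>"
    using P(1,3) prime_chain_mono[OF P(1), of 1 "Suc n"] unfolding prime_chain_def by auto
  note P0i = idealD[OF primeD(1)[OF pr(1)]]
  have "\<not> G \<subseteq> P 0"
  proof
    assume "G \<subseteq> P 0"
    then have "\<mm> \<subseteq> P 0" using genideal_minimal[OF primeD(1)[OF pr(1)]] G_gen by blast
    then show False using pr by blast
  qed
  then obtain h where h: "h \<in> G" "h \<notin> P 0" by blast
  have hT: "h \<notin> T" using h P(2) genideal_self[of T] Suc.prems G_carr by auto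
  have hm: "h \<in> \<mm>" "h \<in> carrier R" using h genideal_self[OF G_carr] G_gen G_carr by auto
  have cn: "card (G - insert h T) = n"
    using Suc.hyps(2) h hT fin by (metis Diff_iff Diff_insert card_Diff_singleton diff_Suc_1)
  have sub: "insert h T \<subseteq> G" using h Suc.prems by blast
  have ins: "primeideal (Idl (insert h T)) R" using Suc.hyps(1)[OF cn[symmetric] sub] .
  have Tc: "T \<subseteq> carrier R" using Suc.prems G_carr by blast
  obtain P' where P': "prime_chain P' n" "P 0 \<subseteq> P' 0" "h \<in> P' 0" "P' n = \<mm>"
    using shorten_chain[OF P(1), unfolded P(3), OF hm(1)] by blast
  have pr': "primeideal (P' 0) R" using P'(1) unfolding prime_chain_def by blast
  have le: "Idl (insert h T) \<subseteq> P' 0"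
    using P(2) P'(2,3) genideal_self[OF Tc] pr' by (intro genideal_minimal primeD(1)) auto
  \<comment> \<open>A proper inclusion would put \<open>Idl (insert h T)\<close> below the chain
    \<open>P'\<close>, producing a chain one longer than \<open>chain_over_subset_le\<close>
    allows.\<close>
  have "Idl (insert h T) = P' 0"
  proof (rule ccontr)
    assume ne: "Idl (insert h T) \<noteq> P' 0"
    define W where "W i = (case i of 0 \<Rightarrow> Idl (insert h T) | Suc j \<Rightarrow> P' j)" for i
    have "prime_chain W (Suc n)"
      using P'(1) ins le ne unfolding prime_chain_def W_def by (auto split: nat.splits simp: less_Suc_eq_le)
    then have "chain_over (Idl (insert h T)) (Suc n)" using P'(4) unfolding chain_over_def
      by (intro exI[of _ W]) (auto simp: W_def)
    then show False using chain_over_subset_le[OF sub] cn by fastforce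
  qed
  then have PT: "P 0 \<subseteq> adjoin (Idl T) h" using P'(2) Idl_insert[OF Tc hm(2)] by simp
  have "P 0 \<subseteq> Idl T"
  proof (rule nakayama[OF mm_prime Idl_sub_ideal saturated_mm primeD(1)[OF pr(1)]])
    show "T \<subseteq> G" by fact
    show "ideal (Idl T) R" using Idl_sub_ideal Suc.prems by blast
    fix z L assume z: "z \<in> P 0" and L: "ideal L R" "Idl T \<subseteq> L" "\<forall>a\<in>\<mm>. \<forall>y\<in>P 0. a \<otimes> y \<in> L"
    obtain t r where tr: "z = t \<oplus> r \<otimes> h" "t \<in> Idl T" "r \<in> carrier R" using PT z unfolding adjoin_def by blast
    have "r \<otimes> h \<in> P 0" using z tr ideal_cancel(1)[OF primeD(1)[OF pr(1)], of t "r \<otimes> h"] P(2) hm(2) by auto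
    then have "h \<otimes> r \<in> P 0" using tr(3) hm(2) m_comm by simp
    then have "r \<in> P 0" using primeD(3)[OF pr(1)] tr(3) hm(2) h(2) by blast
    then have "h \<otimes> r \<in> L" using L(3) hm(1) by blast
    then have "z \<in> L" unfolding tr(1) using idealD(4)[OF L(1)] tr L(2) hm(2) m_comm by auto
    moreover have "\<one> \<in> carrier R - \<mm>" using primeD(2)[OF mm_prime] by simp
    ultimately show "\<exists>s\<in>carrier R - \<mm>. s \<otimes> z \<in> L" using idealD(2)[OF L(1)] by (metis l_one)
  qed
  then show ?case using P(2) pr(1) by simp
qed

text \<open>Otherwise \<open>G - {z}\<close> would generate \<open>\<mm>\<close> with fewer elements
  than the dimension.\<close>

lemma generator_notin:
  assumes "T \<subseteq> G" "z \<in> G" "z \<notin> T" shows "z \<notin> Idl T"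
proof
  assume z: "z \<in> Idl T"
  have c: "G - {z} \<subseteq> carrier R" using G_carr by blast
  have "Idl T \<subseteq> Idl (G - {z})" by (rule subset_Idl_subset[OF c]) (use assms in blast)
  then have "G \<subseteq> Idl (G - {z})" using z genideal_self[OF c] by blast
  then have "\<mm> \<subseteq> Idl (G - {z})" unfolding G_gen[symmetric] by (rule genideal_minimal[OF genideal_ideal[OF c]])
  moreover have "Idl (G - {z}) \<subseteq> \<mm>" unfolding G_gen[symmetric] by (rule subset_Idl_subset[OF G_carr]) blast
  ultimately have "Idl ({} \<union> (G - {z})) = \<mm>" by auto
  moreover have "chain_over (Idl {}) (card G)" using chain_over_subset[of "{}"] by simp
  ultimately have "card G \<le> card (G - {z})" using chain_over_le_generators[of "G - {z}" "{}" "card G"] fin c by simp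
  moreover have "card (G - {z}) < card G" using assms(2) fin by (rule card_Diff1_less[rotated])
  ultimately show False by simp
qed

end

section \<open>Endomorphisms and dual bases\<close>

locale ring_endo = cring +
  fixes s :: "'a \<Rightarrow> 'a"
  assumes endo: "s \<in> ring_hom R R"
begin

lemma s_closed [simp, intro]: "x \<in> carrier R \<Longrightarrow> s x \<in> carrier R"
  using ring_hom_closed[OF endo] .

lemma s_add: "x \<in> carrier R \<Longrightarrow> y \<in> carrier R \<Longrightarrow> s (x \<oplus> y) = s x \<oplus> s y"
  using ring_hom_add[OF endo] .

lemma s_mult: "x \<in> carrier R \<Longrightarrow> y \<in> carrier R \<Longrightarrow> s (x \<otimes> y) = s x \<otimes> s y"
  using ring_hom_mult[OF endo] .

lemma s_one [simp]: "s \<one> = \<one>"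
  using ring_hom_one[OF endo] .

lemma s_zero [simp]: "s \<zero> = \<zero>"
  using ring_hom_zero[OF endo ring_axioms ring_axioms] .

lemma s_neg: "x \<in> carrier R \<Longrightarrow> s (\<ominus> x) = \<ominus> s x"
  by (metis a_inv_closed l_neg minus_equality s_add s_closed s_zero)

lemma s_minus: "x \<in> carrier R \<Longrightarrow> y \<in> carrier R \<Longrightarrow> s (x \<ominus> y) = s x \<ominus> s y"
  by (simp add: minus_eq s_add s_neg)

lemma preimage_ideal:
  assumes "ideal J R" shows "ideal {x \<in> carrier R. s x \<in> J} R"
  using idealD[OF assms] by (intro ideal_intro) (auto simp: s_add s_mult)

text \<open>A linear combination in \<open>R\<close> regarded as a module over itself through
  \<open>s\<close>: coefficients act after \<open>s\<close>, and the generators index their own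
  coefficients.\<close>

definition combination :: "'a set \<Rightarrow> ('a \<Rightarrow> 'a) \<Rightarrow> 'a" where
  "combination \<Gamma> a = (\<Oplus>g\<in>\<Gamma>. s (a g) \<otimes> g)"

lemma combination_closed [simp, intro]:
  "\<Gamma> \<subseteq> carrier R \<Longrightarrow> a \<in> \<Gamma> \<rightarrow> carrier R \<Longrightarrow> combination \<Gamma> a \<in> carrier R"
  unfolding combination_def by (intro finsum_closed) auto

lemma combination_add:
  assumes "\<Gamma> \<subseteq> carrier R" "a \<in> \<Gamma> \<rightarrow> carrier R" "b \<in> \<Gamma> \<rightarrow> carrier R"
  shows "combination \<Gamma> (\<lambda>g. a g \<oplus> b g) = combination \<Gamma> a \<oplus> combination \<Gamma> b"
proof -
  have "combination \<Gamma> (\<lambda>g. a g \<oplus> b g) = (\<Oplus>g\<in>\<Gamma>. s (a g) \<otimes> g \<oplus> s (b g) \<otimes> g)"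
    unfolding combination_def using assms
    by (intro finsum_cong') (auto simp: s_add l_distr Pi_iff subset_iff)
  also have "\<dots> = combination \<Gamma> a \<oplus> combination \<Gamma> b"
    unfolding combination_def using assms by (intro finsum_addf) (auto simp: Pi_iff subset_iff)
  finally show ?thesis .
qed

lemma combination_scale:
  assumes "finite \<Gamma>" "\<Gamma> \<subseteq> carrier R" "a \<in> \<Gamma> \<rightarrow> carrier R" "r \<in> carrier R"
  shows "combination \<Gamma> (\<lambda>g. r \<otimes> a g) = s r \<otimes> combination \<Gamma> a"
proof -
  have "combination \<Gamma> (\<lambda>g. r \<otimes> a g) = (\<Oplus>g\<in>\<Gamma>. s r \<otimes> (s (a g) \<otimes> g))"
    unfolding combination_def using assms
    by (intro finsum_cong') (auto simp: s_mult m_assoc Pi_iff subset_iff)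
  also have "\<dots> = s r \<otimes> combination \<Gamma> a"
    unfolding combination_def using assms by (intro finsum_rdistr[symmetric]) auto
  finally show ?thesis .
qed

lemma combination_minus:
  assumes "finite \<Gamma>" "\<Gamma> \<subseteq> carrier R" "a \<in> \<Gamma> \<rightarrow> carrier R" "b \<in> \<Gamma> \<rightarrow> carrier R"
  shows "combination \<Gamma> (\<lambda>g. a g \<ominus> b g) = combination \<Gamma> a \<ominus> combination \<Gamma> b"
proof -
  have m: "(\<lambda>g. \<ominus> \<one> \<otimes> b g) \<in> \<Gamma> \<rightarrow> carrier R" using assms by auto
  have "combination \<Gamma> (\<lambda>g. a g \<ominus> b g) = combination \<Gamma> (\<lambda>g. a g \<oplus> \<ominus> \<one> \<otimes> b g)"
    unfolding combination_def using assms
    by (intro finsum_cong') (auto simp: minus_eq l_minus Pi_iff subset_iff)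
  also have "\<dots> = combination \<Gamma> a \<oplus> s (\<ominus> \<one>) \<otimes> combination \<Gamma> b"
    unfolding combination_add[OF assms(2,3) m] using assms by (simp add: combination_scale)
  also have "\<dots> = combination \<Gamma> a \<ominus> combination \<Gamma> b" using assms by (simp add: s_neg l_minus minus_eq)
  finally show ?thesis .
qed

definition generates :: "'a set \<Rightarrow> bool" where
  "generates \<Gamma> \<longleftrightarrow> finite \<Gamma> \<and> \<Gamma> \<subseteq> carrier R \<and> (\<forall>x\<in>carrier R. \<exists>a\<in>\<Gamma> \<rightarrow> carrier R. x = combination \<Gamma> a)"

text \<open>The maps \<open>\<phi>\<close> are the \<open>R\<close>-linear functionals on the restriction of scalars \<open>s\<^sub>*R\<close>.\<close>

definition functional :: "('a \<Rightarrow> 'a) \<Rightarrow> bool" where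
  "functional \<phi> \<longleftrightarrow> \<phi> \<in> carrier R \<rightarrow> carrier R \<and>
    (\<forall>x\<in>carrier R. \<forall>y\<in>carrier R. \<phi> (x \<oplus> y) = \<phi> x \<oplus> \<phi> y) \<and>
    (\<forall>r\<in>carrier R. \<forall>x\<in>carrier R. \<phi> (s r \<otimes> x) = r \<otimes> \<phi> x)"

text \<open>The maps x \<mapsto> \<Sum> s(\<phi> x) g, that is, the endomorphisms of the restriction
  of scalars that factor through a finite free module. Building them one summand at a time gives an
  induction rule in place of indexed families.\<close>

inductive dual_sum :: "('a \<Rightarrow> 'a) \<Rightarrow> bool" where
  zero: "dual_sum (\<lambda>_. \<zero>)"
| add: "dual_sum \<theta> \<Longrightarrow> functional \<phi> \<Longrightarrow> g \<in> carrier R \<Longrightarrow> dual_sum (\<lambda>x. s (\<phi> x) \<otimes> g \<oplus> \<theta> x)"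

text \<open>By the dual basis lemma this says that \<open>s\<^sub>*R\<close> is finitely generated projective.\<close>

definition projective :: bool where
  "projective \<longleftrightarrow> (\<exists>\<theta>. dual_sum \<theta> \<and> (\<forall>x\<in>carrier R. \<theta> x = x))"

lemma functionalD:
  assumes "functional \<phi>"
  shows "\<And>x. x \<in> carrier R \<Longrightarrow> \<phi> x \<in> carrier R"
    "\<And>x y. x \<in> carrier R \<Longrightarrow> y \<in> carrier R \<Longrightarrow> \<phi> (x \<oplus> y) = \<phi> x \<oplus> \<phi> y"
    "\<And>r x. r \<in> carrier R \<Longrightarrow> x \<in> carrier R \<Longrightarrow> \<phi> (s r \<otimes> x) = r \<otimes> \<phi> x"
    "\<phi> \<zero> = \<zero>"
proof -
  show *: "\<And>x. x \<in> carrier R \<Longrightarrow> \<phi> x \<in> carrier R"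
    "\<And>x y. x \<in> carrier R \<Longrightarrow> y \<in> carrier R \<Longrightarrow> \<phi> (x \<oplus> y) = \<phi> x \<oplus> \<phi> y"
    "\<And>r x. r \<in> carrier R \<Longrightarrow> x \<in> carrier R \<Longrightarrow> \<phi> (s r \<otimes> x) = r \<otimes> \<phi> x"
    using assms unfolding functional_def by auto
  show "\<phi> \<zero> = \<zero>" using *(3)[of \<zero> \<zero>] *(1)[of \<zero>] by simp
qed

lemma dual_sum_closed: "dual_sum \<theta> \<Longrightarrow> x \<in> carrier R \<Longrightarrow> \<theta> x \<in> carrier R"
  by (induction rule: dual_sum.induct) (auto simp: functionalD)

lemma dual_sum_plus:
  assumes "dual_sum \<theta>" "dual_sum \<eta>"
  shows "\<exists>\<zeta>. dual_sum \<zeta> \<and> (\<forall>x\<in>carrier R. \<zeta> x = \<theta> x \<oplus> \<eta> x)"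
  using assms
proof (induction rule: dual_sum.induct)
  case zero then show ?case using dual_sum_closed by (intro exI[of _ \<eta>]) auto
next
  case (add \<theta> \<phi> g)
  then obtain \<zeta> where z: "dual_sum \<zeta>" "\<forall>x\<in>carrier R. \<zeta> x = \<theta> x \<oplus> \<eta> x" by blast
  then show ?case using dual_sum.add[OF z(1) add(2,3)] add functionalD(1)[OF add(2)] dual_sum_closed
    by (intro exI[of _ "\<lambda>x. s (\<phi> x) \<otimes> g \<oplus> \<zeta> x"]) (auto simp: a_assoc)
qed

lemma dual_sum_scale:
  assumes "dual_sum \<theta>" "r \<in> carrier R"
  shows "\<exists>\<zeta>. dual_sum \<zeta> \<and> (\<forall>x\<in>carrier R. \<zeta> x = r \<otimes> \<theta> x)"
  using assms
proof (induction rule: dual_sum.induct)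
  case zero then show ?case using dual_sum.zero by (intro exI[of _ "\<lambda>_. \<zero>"]) auto
next
  case (add \<theta> \<phi> g)
  then obtain \<zeta> where z: "dual_sum \<zeta>" "\<forall>x\<in>carrier R. \<zeta> x = r \<otimes> \<theta> x" by blast
  have "r \<otimes> g \<in> carrier R" using add by simp
  then show ?case using dual_sum.add[OF z(1) add(2)] add z functionalD(1)[OF add(2)] dual_sum_closed
    by (intro exI[of _ "\<lambda>x. s (\<phi> x) \<otimes> (r \<otimes> g) \<oplus> \<zeta> x"]) (auto simp: r_distr m_lcomm)
qed

lemma projective_of_basis:
  assumes gen: "generates \<Gamma>"
    and indep: "\<And>a. a \<in> \<Gamma> \<rightarrow> carrier R \<Longrightarrow> combination \<Gamma> a = \<zero> \<Longrightarrow> \<forall>g\<in>\<Gamma>. a g = \<zero>"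
  shows "projective"
proof -
  have \<Gamma>: "finite \<Gamma>" "\<Gamma> \<subseteq> carrier R" using gen unfolding generates_def by auto
  define coord where "coord x = (SOME a. a \<in> \<Gamma> \<rightarrow> carrier R \<and> x = combination \<Gamma> a)" for x
  have co: "coord x \<in> \<Gamma> \<rightarrow> carrier R" "combination \<Gamma> (coord x) = x" if "x \<in> carrier R" for x
  proof -
    have "\<exists>a. a \<in> \<Gamma> \<rightarrow> carrier R \<and> x = combination \<Gamma> a" using gen that unfolding generates_def by blast
    then have "coord x \<in> \<Gamma> \<rightarrow> carrier R \<and> x = combination \<Gamma> (coord x)" unfolding coord_def by (rule someI_ex)
    then show "coord x \<in> \<Gamma> \<rightarrow> carrier R" "combination \<Gamma> (coord x) = x" by auto
  qed
  have uniq: "a g = b g" if "a \<in> \<Gamma> \<rightarrow> carrier R" "b \<in> \<Gamma> \<rightarrow> carrier R" "combination \<Gamma> a = combination \<Gamma> b" "g \<in> \<Gamma>" for a b g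
  proof -
    have "combination \<Gamma> (\<lambda>g. a g \<ominus> b g) = \<zero>" 
      unfolding combination_minus[OF \<Gamma> that(1,2)] that(3) using that(2) \<Gamma> by (simp add: r_right_minus_eq)
    moreover have "(\<lambda>g. a g \<ominus> b g) \<in> \<Gamma> \<rightarrow> carrier R" using that by auto
    ultimately have "a g \<ominus> b g = \<zero>" using indep that(4) by blast
    then show ?thesis using that by (metis PiE r_right_minus_eq)
  qed
  have coord_functional: "functional (\<lambda>x. coord x g)" if g: "g \<in> \<Gamma>" for g
    unfolding functional_def
  proof (intro conjI ballI)
    show "(\<lambda>x. coord x g) \<in> carrier R \<rightarrow> carrier R" using co g by blast
    fix x assume x: "x \<in> carrier R"
    { fix y assume y: "y \<in> carrier R"
      show "coord (x \<oplus> y) g = coord x g \<oplus> coord y g"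
      proof (rule uniq[OF co(1) _ _ g])
        show "(\<lambda>g. coord x g \<oplus> coord y g) \<in> \<Gamma> \<rightarrow> carrier R" using co(1)[OF x] co(1)[OF y] by auto
        show "combination \<Gamma> (coord (x \<oplus> y)) = combination \<Gamma> (\<lambda>g. coord x g \<oplus> coord y g)"
          using x y co \<Gamma> by (simp add: combination_add)
      qed (use x y in simp) }
    { fix r assume r: "r \<in> carrier R"
      show "coord (s r \<otimes> x) g = r \<otimes> coord x g"
      proof (rule uniq[OF co(1) _ _ g])
        show "(\<lambda>g. r \<otimes> coord x g) \<in> \<Gamma> \<rightarrow> carrier R" using co(1)[OF x] r by auto
        show "combination \<Gamma> (coord (s r \<otimes> x)) = combination \<Gamma> (\<lambda>g. r \<otimes> coord x g)"
          using x r co \<Gamma> by (simp add: combination_scale)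
      qed (use x r in simp) }
  qed
  have "\<exists>\<theta>. dual_sum \<theta> \<and> (\<forall>x\<in>carrier R. \<theta> x = combination \<Delta> (coord x))" if "\<Delta> \<subseteq> \<Gamma>" for \<Delta>
  proof -
    have "finite \<Delta>" using that \<Gamma> finite_subset by blast
    then show ?thesis using that
    proof (induction \<Delta>)
      case empty then show ?case using dual_sum.zero by (intro exI[of _ "\<lambda>_. \<zero>"]) (simp add: combination_def)
    next
      case (insert g \<Delta>)
      then obtain \<theta> where t: "dual_sum \<theta>" "\<forall>x\<in>carrier R. \<theta> x = combination \<Delta> (coord x)" by blast
      have g: "g \<in> \<Gamma>" "g \<in> carrier R" using insert.prems \<Gamma> by auto
      have "combination (insert g \<Delta>) (coord x) = s (coord x g) \<otimes> g \<oplus> \<theta> x" if x: "x \<in> carrier R" for x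
        unfolding t(2)[rule_format, OF x] unfolding combination_def
        using insert co(1)[OF x] \<Gamma>(2) by (intro finsum_insert) (auto simp: Pi_iff subset_iff)
      then show ?case using dual_sum.add[OF t(1) coord_functional[OF g(1)] g(2)] by (metis (no_types, lifting))
    qed
  qed
  from this[of \<Gamma>] show ?thesis unfolding projective_def using co by auto
qed

end

section \<open>Kunz's theorem for regular local rings\<close>

locale power_endo = regular_local +
  fixes n :: nat
  assumes n_pos: "n > 0" and power_endo: "(\<lambda>x. x [^] n) \<in> ring_hom R R"
begin

sublocale ring_endo R "\<lambda>x. x [^] n"
  by unfold_locales (rule power_endo)

section \<open>Powers of a regular system of parameters\<close>

definition powers :: "'a set \<Rightarrow> ('a \<Rightarrow> nat) \<Rightarrow> 'a set" where
  "powers T e = Idl ((\<lambda>x. x [^] e x) ` T)"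

lemma powers_carr: "T \<subseteq> G \<Longrightarrow> (\<lambda>x. x [^] (e x :: nat)) ` T \<subseteq> carrier R"
  using G_carr by (auto simp: subset_iff)

lemma powers_ideal: "T \<subseteq> G \<Longrightarrow> ideal (powers T (e :: 'a \<Rightarrow> nat)) R"
  unfolding powers_def by (rule genideal_ideal[OF powers_carr])

lemma powers_insert:
  "insert x T \<subseteq> G \<Longrightarrow> powers (insert x T) e = adjoin (powers T e) (x [^] (e x :: nat))"
  unfolding powers_def image_insert using G_carr powers_carr[of T e] by (intro Idl_insert) auto

lemma powers_cong: "(\<And>x. x \<in> T \<Longrightarrow> e x = e' x) \<Longrightarrow> powers T e = powers T e'"
  unfolding powers_def by (metis (mono_tags, lifting) image_cong)

text \<open>If all exponents are one, \<open>Idl T\<close> is a prime not containing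
  \<open>z\<close>. Otherwise some \<open>x\<close> has exponent a + 1 with a \<ge> 1; let
  \<open>J\<close> be generated by the powers of the others. Then R/(J, x^(a+1)) is built from R/(J,
  x^a) and R/(J, x), and \<open>z\<close> is regular on both by induction on the sum of the
  exponents.\<close>

lemma generator_regular:
  assumes "T \<subseteq> G" "z \<in> G" "z \<notin> T" "\<forall>x\<in>T. e x \<ge> 1" "w \<in> carrier R" "z \<otimes> w \<in> powers T e"
  shows "w \<in> powers T e"
  using assms
proof (induction "sum e T" arbitrary: T z e w rule: less_induct)
  case less
  note T = less.prems(1)
  have finT: "finite T" using T fin finite_subset by blast
  have zc: "z \<in> carrier R" using less.prems G_carr by blast
  show ?case
  proof (cases "\<forall>x\<in>T. e x = 1")
    case True
    then have "(\<lambda>x. x [^] e x) ` T = T" using T G_carr by (auto simp: image_def subset_iff)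
    then have "powers T e = Idl T" unfolding powers_def by simp
    then show ?thesis using primeD(3)[OF Idl_subset_prime[OF T] zc less.prems(5)]
        generator_notin[OF less.prems(1-3)] less.prems(6) by simp
  next
    case False
    then obtain x where x: "x \<in> T" "e x \<noteq> 1" by blast
    then have "e x \<ge> 2" using less.prems(4) by force
    then obtain a where a: "e x = Suc a" "a \<ge> 1" by (metis Suc_le_D Suc_le_mono numeral_2_eq_2 One_nat_def)
    define T' where "T' = T - {x}"
    have T': "T = insert x T'" "x \<notin> T'" "T' \<subseteq> G" "finite T'" using x T finT unfolding T'_def by auto
    have xG: "x \<in> G" "x \<in> carrier R" using x T G_carr by auto
    define J where "J = powers T' e"
    have J: "ideal J R" unfolding J_def using powers_ideal[OF T'(3)] .
    note Ji = idealD[OF J]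
    have upd: "powers T (e(x := k)) = adjoin J (x [^] k)" for k
    proof -
      have "powers T' (e(x := k)) = J" unfolding J_def using T'(2) by (intro powers_cong) auto
      then show ?thesis using powers_insert[of x T' "e(x := k)"] T T'(1) by simp
    qed
    have Te: "powers T e = adjoin J (x [^] Suc a)" using upd[of "Suc a"] a(1) by (simp add: fun_upd_idem)
    have less_upd: "sum (e(x := k)) T < sum e T" if "k < e x" for k
    proof -
      have "sum (e(x := k)) T' = sum e T'" using T'(2) by (intro sum.cong) auto
      then show ?thesis using T'(1,2,4) that by simp
    qed
    have reg: "v \<in> powers T (e(x := k))" if "v \<in> carrier R" "k \<ge> 1" "k < e x" "z \<otimes> v \<in> powers T (e(x := k))" for k v
      using less.hyps[OF less_upd[OF that(3)] less.prems(1-3) _ that(1,4)] less.prems(4) that by auto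
    have regx: "v \<in> J" if "v \<in> carrier R" "x \<otimes> v \<in> J" for v
    proof -
      have "sum e T' < sum e T" using T'(1,2,4) a by simp
      then show ?thesis
        using less.hyps[of e T' x v] T' xG(1) that less.prems(4) unfolding J_def by auto
    qed
    have regx': "v \<in> J" if "v \<in> carrier R" "x [^] k \<otimes> v \<in> J" for v and k :: nat
      using that
    proof (induction k arbitrary: v)
      case (Suc k)
      have "x \<otimes> (x [^] k \<otimes> v) \<in> J" using Suc.prems xG by (simp add: m_ac)
      then have "x [^] k \<otimes> v \<in> J" by (rule regx[OF m_closed[OF nat_pow_closed[OF xG(2)] Suc.prems(1)]])
      then show ?case by (rule Suc.IH[OF Suc.prems(1)])
    qed simp
    have xa: "x [^] a \<in> carrier R" using xG by simp
    have xS: "x [^] Suc a = x [^] a \<otimes> x" by simp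
    note w = less.prems(5)
    obtain j1 r where 1: "z \<otimes> w = j1 \<oplus> r \<otimes> x [^] Suc a" "j1 \<in> J" "r \<in> carrier R"
      using less.prems(6) unfolding Te adjoin_def by blast
    have j1: "j1 \<in> carrier R" using 1 Ji by blast
    have "z \<otimes> w = j1 \<oplus> (r \<otimes> x) \<otimes> x [^] a" using 1 xG xa j1 unfolding xS by (simp add: m_ac)
    then have "z \<otimes> w \<in> powers T (e(x := a))" unfolding upd using 1 xG adjoinI by simp
    then have "w \<in> powers T (e(x := a))" using reg[of w a] w a by simp
    then obtain j2 v where 2: "w = j2 \<oplus> v \<otimes> x [^] a" "j2 \<in> J" "v \<in> carrier R"
      unfolding upd adjoin_def by blast
    have j2: "j2 \<in> carrier R" using 2 Ji by blast
    \<comment> \<open>With w = j2 + v x^a, the regularity of \<open>x\<close> modulo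
      \<open>J\<close> cancels x^a and moves the question to \<open>v\<close> modulo (J, x).\<close>
    have "x [^] a \<otimes> (z \<otimes> v \<ominus> r \<otimes> x) = z \<otimes> w \<ominus> z \<otimes> j2 \<ominus> r \<otimes> x [^] Suc a"
      unfolding 2(1) xS using xG xa zc 1(3) 2(3) j2 by algebra
    also have "\<dots> = j1 \<ominus> z \<otimes> j2" unfolding 1(1) xS using xG xa zc 1(3) j1 j2 by algebra
    also have "\<dots> \<in> J" using Ji(6)[OF 1(2) Ji(7)[OF 2(2) zc]] .
    finally have 3: "z \<otimes> v \<ominus> r \<otimes> x \<in> J" using regx' xG zc 1 2 by simp
    have "z \<otimes> v = (z \<otimes> v \<ominus> r \<otimes> x) \<oplus> r \<otimes> x [^] (1::nat)" using xG zc 1(3) 2(3) by (simp, algebra)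
    then have "z \<otimes> v \<in> powers T (e(x := 1))" unfolding upd using adjoinI[OF 3 1(3)] by metis
    then have "v \<in> powers T (e(x := 1))" using reg[of v 1] 2(3) a by simp
    then obtain j4 v' where 4: "v = j4 \<oplus> v' \<otimes> x" "j4 \<in> J" "v' \<in> carrier R"
      unfolding upd adjoin_def using xG by auto
    have j4: "j4 \<in> carrier R" using 4 Ji by blast
    have "w = (j2 \<oplus> x [^] a \<otimes> j4) \<oplus> v' \<otimes> x [^] Suc a" unfolding 2(1) 4(1) xS
      using j2 j4 xa xG 4(3) by algebra
    moreover have "j2 \<oplus> x [^] a \<otimes> j4 \<in> J" using Ji(4)[OF 2(2) Ji(7)[OF 4(2) xa]] .
    ultimately show ?thesis unfolding Te using adjoinI 4(3) by metis
  qed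
qed

lemma generator_power_regular:
  fixes k :: nat
  assumes "T \<subseteq> G" "z \<in> G" "z \<notin> T" "w \<in> carrier R" "z [^] k \<otimes> w \<in> powers T (\<lambda>_. n)"
  shows "w \<in> powers T (\<lambda>_. n)"
  using assms(4,5)
proof (induction k arbitrary: w)
  case (Suc k)
  have zc: "z \<in> carrier R" using assms G_carr by blast
  have "z \<otimes> (z [^] k \<otimes> w) \<in> powers T (\<lambda>_. n)" using Suc.prems zc by (simp add: m_ac)
  then have "z [^] k \<otimes> w \<in> powers T (\<lambda>_. n)"
    using generator_regular[OF assms(1-3), of "\<lambda>_. n" "z [^] k \<otimes> w"] n_pos Suc.prems zc by auto
  then show ?case using Suc by simp
qed simp

lemma power_mem_powers: "T \<subseteq> G \<Longrightarrow> b \<in> Idl T \<Longrightarrow> b [^] n \<in> powers T (\<lambda>_. n)"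
proof -
  assume T: "T \<subseteq> G" and b: "b \<in> Idl T"
  have "(\<lambda>x. x [^] n) ` T \<subseteq> powers T (\<lambda>_. n)"
    unfolding powers_def by (rule genideal_self[OF powers_carr[OF T]])
  then have "Idl T \<subseteq> {x \<in> carrier R. x [^] n \<in> powers T (\<lambda>_. n)}"
    using T G_carr by (intro genideal_minimal preimage_ideal powers_ideal) auto
  then show ?thesis using b by blast
qed

text \<open>Freeness is lifted from the residue field along the regular sequence \<open>G\<close>: a relation modulo
  \<open>powers T\<close> is divided by one further generator at a time, and Nakayama's lemma applies.\<close>

lemma relation_coefficients:
  assumes \<Gamma>: "finite \<Gamma>" "\<Gamma> \<subseteq> carrier R"
    and min: "\<And>a. a \<in> \<Gamma> \<rightarrow> carrier R \<Longrightarrow> combination \<Gamma> a \<in> powers G (\<lambda>_. n) \<Longrightarrow> \<forall>g\<in>\<Gamma>. a g \<in> \<mm>"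
    and T: "T \<subseteq> G" and a: "a \<in> \<Gamma> \<rightarrow> carrier R" "combination \<Gamma> a \<in> powers T (\<lambda>_. n)" "g \<in> \<Gamma>"
  shows "a g \<in> Idl T"
  using T a
proof (induction "card (G - T)" arbitrary: T a g)
  case 0
  then have "T = G" using fin by (simp add: subset_antisym)
  then show ?case using min 0 G_gen by blast
next
  case (Suc k)
  then have "G - T \<noteq> {}" by force
  then obtain h where h: "h \<in> G" "h \<notin> T" by blast
  have sub: "insert h T \<subseteq> G" and Tc: "T \<subseteq> carrier R" and hc: "h \<in> carrier R" and hm: "h \<in> \<mm>"
    using h Suc.prems(1) G_carr genideal_self[OF G_carr] G_gen by auto
  have k: "k = card (G - insert h T)"
    using Suc.hyps(2) h by (metis Diff_iff Diff_insert card_Diff_singleton diff_Suc_1)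
  define J where "J = powers T (\<lambda>_. n)"
  have J: "ideal J R" unfolding J_def using powers_ideal[OF Suc.prems(1)] .
  have J': "J \<subseteq> powers (insert h T) (\<lambda>_. n)"
    unfolding powers_insert[OF sub] J_def using adjoin_mem(1)[OF powers_ideal[OF Suc.prems(1)]] hc by simp
  define Rel where "Rel = {a \<in> \<Gamma> \<rightarrow> carrier R. combination \<Gamma> a \<in> J}"
  \<comment> \<open>The values at \<open>g\<close> of all relations modulo \<open>J\<close> form an
    ideal, and Nakayama's lemma is applied to this ideal rather than to a single relation.\<close>
  define A where "A = {a g | a. a \<in> Rel}"
  have A: "ideal A R"
  proof (rule ideal_intro)
    show "A \<subseteq> carrier R" unfolding A_def Rel_def using Suc.prems(4) by auto
    have "combination \<Gamma> (\<lambda>_. \<zero>) = \<zero>" unfolding combination_def using \<Gamma> n_pos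
      by (intro trans[OF finsum_cong' finsum_zero]) (auto simp: nat_pow_zero)
    then have "(\<lambda>_. \<zero>) \<in> Rel" unfolding Rel_def using idealD(3)[OF J] by auto
    then show "\<zero> \<in> A" unfolding A_def by force
    fix x assume "x \<in> A"
    then obtain a where a: "a \<in> Rel" "x = a g" unfolding A_def by blast
    { fix y assume "y \<in> A"
      then obtain b where b: "b \<in> Rel" "y = b g" unfolding A_def by blast
      have "(\<lambda>g. a g \<oplus> b g) \<in> Rel" using a b combination_add[OF \<Gamma>(2)] idealD(4)[OF J] unfolding Rel_def by auto
      then show "x \<oplus> y \<in> A" unfolding A_def a b by force }
    fix r assume r: "r \<in> carrier R"
    have "(\<lambda>g. r \<otimes> a g) \<in> Rel" using a r combination_scale[OF \<Gamma>] idealD(7)[OF J] unfolding Rel_def by auto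
    then show "r \<otimes> x \<in> A" unfolding A_def a by force
  qed
  have TI: "ideal (Idl T) R" using genideal_ideal[OF Tc] .
  have "A \<subseteq> Idl T"
  proof (rule nakayama[OF mm_prime TI saturated_mm[OF TI] A])
    fix z L assume z: "z \<in> A" and L: "ideal L R" "Idl T \<subseteq> L" "\<forall>a\<in>\<mm>. \<forall>y\<in>A. a \<otimes> y \<in> L"
    obtain a where a: "a \<in> \<Gamma> \<rightarrow> carrier R" "combination \<Gamma> a \<in> J" "z = a g" using z unfolding A_def Rel_def by blast
    have "\<forall>g\<in>\<Gamma>. a g \<in> adjoin (Idl T) h"
      using Suc.hyps(1)[OF k sub a(1)] a(2) J' Idl_insert[OF Tc hc] by auto
    then have "\<forall>g\<in>\<Gamma>. \<exists>b c. b \<in> Idl T \<and> c \<in> carrier R \<and> a g = b \<oplus> c \<otimes> h" unfolding adjoin_def by blast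
    then obtain b c where bc: "\<forall>g\<in>\<Gamma>. b g \<in> Idl T \<and> c g \<in> carrier R \<and> a g = b g \<oplus> c g \<otimes> h" by metis
    have bG: "b \<in> \<Gamma> \<rightarrow> carrier R" and cG: "c \<in> \<Gamma> \<rightarrow> carrier R" and hcG: "(\<lambda>g. h \<otimes> c g) \<in> \<Gamma> \<rightarrow> carrier R"
      using bc idealD(2)[OF TI] hc by auto
    have "combination \<Gamma> a = combination \<Gamma> (\<lambda>g. b g \<oplus> h \<otimes> c g)"
      unfolding combination_def using bc bG cG hc \<Gamma> by (intro finsum_cong') (auto simp: m_comm Pi_iff subset_iff)
    also have "\<dots> = combination \<Gamma> b \<oplus> h [^] n \<otimes> combination \<Gamma> c"
      using combination_add[OF \<Gamma>(2) bG hcG] combination_scale[OF \<Gamma> cG hc] by simp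
    finally have eq: "combination \<Gamma> b \<oplus> h [^] n \<otimes> combination \<Gamma> c \<in> J" using a by simp
    have "\<And>\<Delta>. \<Delta> \<subseteq> \<Gamma> \<Longrightarrow> combination \<Delta> b \<in> J"
    proof -
      fix \<Delta> assume d: "\<Delta> \<subseteq> \<Gamma>"
      then have "finite \<Delta>" using \<Gamma> finite_subset by blast
      then show "combination \<Delta> b \<in> J" using d
      proof (induction \<Delta>)
        case empty show ?case unfolding combination_def using idealD(3)[OF J] by simp
      next
        case (insert x \<Delta>)
        then have bx: "b x [^] n \<in> J" "x \<in> carrier R" unfolding J_def using power_mem_powers[OF Suc.prems(1)] bc \<Gamma> by auto
        have "combination (insert x \<Delta>) b = b x [^] n \<otimes> x \<oplus> combination \<Delta> b"
          unfolding combination_def using insert bG \<Gamma>(2) by (intro finsum_insert) (auto simp: Pi_iff subset_iff)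
        then show ?case using insert bx idealD(4,8)[OF J] by auto
      qed
    qed
    \<comment> \<open>The part with coefficients \<open>b\<close> in (T) vanishes modulo
      \<open>J\<close>, since the n-th powers of the \<open>b g\<close> lie in \<open>J\<close>.
      Cancelling h^n shows that \<open>c\<close> is itself a relation, so A lies in (T) + h
      A.\<close>
    then have "h [^] n \<otimes> combination \<Gamma> c \<in> J"
      using eq ideal_cancel(1)[OF J, of "combination \<Gamma> b" "h [^] n \<otimes> combination \<Gamma> c"] hc cG \<Gamma> by auto
    then have "combination \<Gamma> c \<in> J"
      unfolding J_def using generator_power_regular[OF Suc.prems(1) h] cG \<Gamma> by auto
    then have "c g \<in> A" unfolding A_def Rel_def using cG by blast
    then have "h \<otimes> c g \<in> L" using L(3) hm by blast
    moreover have "z = b g \<oplus> h \<otimes> c g" "b g \<in> L" using bc Suc.prems(4) L(2) a(3) hc m_comm by auto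
    ultimately have "z \<in> L" using idealD(4)[OF L(1)] by simp
    moreover have "\<one> \<in> carrier R - \<mm>" using primeD(2)[OF mm_prime] by simp
    ultimately show "\<exists>s\<in>carrier R - \<mm>. s \<otimes> z \<in> L" using idealD(2)[OF L(1)] by (metis l_one)
  qed
  moreover have "a g \<in> A" using Suc.prems unfolding A_def Rel_def J_def by blast
  ultimately show ?case by blast
qed

text \<open>Multiplication by h^n is the scalar action of \<open>h\<close>, so it puts a factor
  \<open>h\<close> from \<open>\<mm>\<close> on every coefficient. This allows a relation modulo the
  powers of \<open>G\<close> to be corrected into an exact relation.\<close>

lemma powers_mem_combination:
  assumes "generates \<Gamma>" "T \<subseteq> G" "x \<in> powers T (\<lambda>_. n)"
  shows "\<exists>y\<in>\<Gamma> \<rightarrow> \<mm>. x = combination \<Gamma> y"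
proof -
  have \<Gamma>: "finite \<Gamma>" "\<Gamma> \<subseteq> carrier R" using assms(1) unfolding generates_def by auto
  have mc: "\<Gamma> \<rightarrow> \<mm> \<subseteq> \<Gamma> \<rightarrow> carrier R" using idealD(1)[OF mm_ideal] by auto
  have "finite T" using assms(2) fin finite_subset by blast
  then show ?thesis using assms(2,3)
  proof (induction T arbitrary: x)
    case empty
    have "combination \<Gamma> (\<lambda>_. \<zero>) = \<zero>" unfolding combination_def using \<Gamma> n_pos
      by (intro trans[OF finsum_cong' finsum_zero]) (auto simp: nat_pow_zero)
    then show ?case using empty idealD(3)[OF mm_ideal] unfolding powers_def by (auto simp: Idl_empty intro!: bexI[of _ "\<lambda>_. \<zero>"])
  next
    case (insert h T)
    have h: "h \<in> \<mm>" "h \<in> carrier R" using insert.prems genideal_self[OF G_carr] G_gen G_carr by auto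
    obtain j r where jr: "x = j \<oplus> r \<otimes> h [^] n" "j \<in> powers T (\<lambda>_. n)" "r \<in> carrier R"
      using insert.prems unfolding powers_insert[OF insert.prems(1)] adjoin_def by blast
    obtain y where y: "y \<in> \<Gamma> \<rightarrow> \<mm>" "j = combination \<Gamma> y" using insert jr by blast
    obtain t where t: "t \<in> \<Gamma> \<rightarrow> carrier R" "r = combination \<Gamma> t" using assms(1) jr(3) unfolding generates_def by blast
    have ht: "(\<lambda>g. h \<otimes> t g) \<in> \<Gamma> \<rightarrow> \<mm>" using t(1) idealD(8)[OF mm_ideal h(1)] by auto
    have yc: "y \<in> \<Gamma> \<rightarrow> carrier R" and htc: "(\<lambda>g. h \<otimes> t g) \<in> \<Gamma> \<rightarrow> carrier R" using y ht mc by auto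
    have "x = combination \<Gamma> y \<oplus> h [^] n \<otimes> combination \<Gamma> t" using jr y t h \<Gamma> by (simp add: m_comm)
    also have "\<dots> = combination \<Gamma> (\<lambda>g. y g \<oplus> h \<otimes> t g)"
      unfolding combination_add[OF \<Gamma>(2) yc htc] using combination_scale[OF \<Gamma> t(1) h(2)] by simp
    finally show ?case using y ht idealD(4)[OF mm_ideal] by (intro bexI[of _ "\<lambda>g. y g \<oplus> h \<otimes> t g"]) auto
  qed
qed

text \<open>For a generating set of least size, every relation modulo the powers of \<open>G\<close>
  has all coefficients in \<open>\<mm>\<close>. \<open>relation_coefficients\<close> carries this
  down to T = {}, where relations are exact and their coefficients vanish, so the generating set is
  a basis.\<close>

theorem projective_if_finite:
  assumes "generates \<Gamma>\<^sub>0" shows "projective"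
proof -
  define \<Gamma> where "\<Gamma> = (ARG_MIN card \<Gamma>. generates \<Gamma>)"
  have gen: "generates \<Gamma>" and least: "\<And>\<Delta>. generates \<Delta> \<Longrightarrow> card \<Gamma> \<le> card \<Delta>"
    using arg_min_nat_lemma[of generates \<Gamma>\<^sub>0 card] assms unfolding \<Gamma>_def by auto
  have \<Gamma>: "finite \<Gamma>" "\<Gamma> \<subseteq> carrier R" using gen unfolding generates_def by auto
  have mc: "\<Gamma> \<rightarrow> \<mm> \<subseteq> \<Gamma> \<rightarrow> carrier R" using idealD(1)[OF mm_ideal] by auto
  have min: "\<forall>g\<in>\<Gamma>. a g \<in> \<mm>" if a: "a \<in> \<Gamma> \<rightarrow> carrier R" "combination \<Gamma> a \<in> powers G (\<lambda>_. n)" for a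
  proof (rule ccontr)
    assume "\<not> ?thesis"
    then obtain k where k: "k \<in> \<Gamma>" "a k \<notin> \<mm>" by blast
    obtain y where y: "y \<in> \<Gamma> \<rightarrow> \<mm>" "combination \<Gamma> a = combination \<Gamma> y"
      using powers_mem_combination[OF gen subset_refl a(2)] by blast
    have yc: "y \<in> \<Gamma> \<rightarrow> carrier R" using y mc by blast
    \<comment> \<open>Subtracting \<open>y\<close> makes the relation exact, and since
      \<open>y k\<close> is in \<open>\<mm>\<close> the coefficient at \<open>k\<close> stays a
      unit. Hence \<open>k\<close> is redundant, against the minimal size of the generating
      set.\<close>
    have diff: "combination \<Gamma> (\<lambda>g. a g \<ominus> y g) = \<zero>" using combination_minus[OF \<Gamma> a(1) yc] y \<Gamma> yc
      by (simp add: minus_eq r_neg)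
    have dc: "(\<lambda>g. a g \<ominus> y g) \<in> \<Gamma> \<rightarrow> carrier R" using a yc by auto
    have "y k \<in> \<mm>" "a k \<in> carrier R" using y k a by auto
    then have "a k \<ominus> y k \<in> carrier R - \<mm>" using k ideal_cancel(3)[OF mm_ideal] idealD(2)[OF mm_ideal] by blast
    then obtain v where v: "v \<in> carrier R" "v \<otimes> (a k \<ominus> y k) = \<one>" using inverse_exists by blast
    define c where "c g = v \<otimes> (a g \<ominus> y g)" for g
    have c: "c \<in> \<Gamma> \<rightarrow> carrier R" "c k = \<one>" "combination \<Gamma> c = \<zero>"
      unfolding c_def using dc v combination_scale[OF \<Gamma> dc v(1)] diff by auto
    have "generates (\<Gamma> - {k})" unfolding generates_def
    proof (intro conjI ballI)
      show "finite (\<Gamma> - {k})" "\<Gamma> - {k} \<subseteq> carrier R" using \<Gamma> by auto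
      fix x assume "x \<in> carrier R"
      then obtain t where t: "t \<in> \<Gamma> \<rightarrow> carrier R" "x = combination \<Gamma> t" using gen unfolding generates_def by blast
      have tk: "t k \<in> carrier R" using t k by blast
      define t' where "t' g = t g \<ominus> t k \<otimes> c g" for g
      have t': "t' \<in> \<Gamma> \<rightarrow> carrier R" "t' k = \<zero>" unfolding t'_def using t(1) c tk by (auto simp: minus_eq r_neg Pi_iff)
      have sc: "(\<lambda>g. t k \<otimes> c g) \<in> \<Gamma> \<rightarrow> carrier R" using c tk by auto
      have "combination \<Gamma> t' = x" unfolding t'_def combination_minus[OF \<Gamma> t(1) sc] combination_scale[OF \<Gamma> c(1) tk]
        using c t \<Gamma> tk by (simp add: minus_eq)
      also have "combination \<Gamma> t' = combination (insert k (\<Gamma> - {k})) t'" using k by (simp add: insert_absorb)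
      also have "\<dots> = t' k [^] n \<otimes> k \<oplus> combination (\<Gamma> - {k}) t'"
        unfolding combination_def using t' \<Gamma> k by (intro finsum_insert) (auto simp: Pi_iff subset_iff)
      also have "\<dots> = combination (\<Gamma> - {k}) t'" using t' \<Gamma> k n_pos combination_closed[of "\<Gamma> - {k}" t']
        by (auto simp: nat_pow_zero Pi_iff subset_iff)
      finally show "\<exists>a\<in>\<Gamma> - {k} \<rightarrow> carrier R. x = combination (\<Gamma> - {k}) a" using t'(1) by (intro bexI[of _ t']) auto
    qed
    then have "card \<Gamma> \<le> card (\<Gamma> - {k})" by (rule least)
    moreover have "card (\<Gamma> - {k}) < card \<Gamma>" using k \<Gamma> by (intro card_Diff1_less) auto
    ultimately show False by simp
  qed
  show ?thesis
  proof (rule projective_of_basis[OF gen])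
    fix a assume a: "a \<in> \<Gamma> \<rightarrow> carrier R" "combination \<Gamma> a = \<zero>"
    have "combination \<Gamma> a \<in> powers {} (\<lambda>_. n)" unfolding powers_def using a Idl_empty by simp
    then show "\<forall>g\<in>\<Gamma>. a g = \<zero>" using relation_coefficients[OF \<Gamma> min empty_subsetI a(1)] Idl_empty by simp
  qed
qed

end

section \<open>The Frobenius endomorphism\<close>

lemma (in cring) binomial:
  assumes x: "x \<in> carrier R" and y: "y \<in> carrier R"
  shows "(x \<oplus> y) [^] (n::nat) = (\<Oplus>k\<in>{..n}. [(n choose k)] \<cdot> (x [^] k \<otimes> y [^] (n - k)))"
proof (induction n)
  case 0 then show ?case using x y by simp
next
  case (Suc n)
  let ?t = "\<lambda>c i j. [(c::nat)] \<cdot> (x [^] (i::nat) \<otimes> y [^] (j::nat))"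
  have c: "?t c i j \<in> carrier R" for c i j using x y by simp
  have "(\<Oplus>k\<in>{..n}. ?t (n choose k) k (n - k)) \<otimes> x = (\<Oplus>k\<in>{..n}. ?t (n choose k) (Suc k) (n - k))"
    using x y by (subst finsum_ldistr) (auto simp: Pi_def add_pow_ldistr add_pow_rdistr m_ac intro!: finsum_cong')
  moreover
  have "(\<Oplus>k\<in>{..n}. ?t (n choose k) k (n - k)) \<otimes> y = (\<Oplus>k\<in>{..n}. ?t (n choose k) k (Suc n - k))"
    using x y by (subst finsum_ldistr) (auto simp: Pi_def add_pow_ldistr add_pow_rdistr m_ac Suc_diff_le intro!: finsum_cong')
  moreover have "(\<Oplus>k\<in>{..n}. ?t (n choose k) k (Suc n - k)) = (\<Oplus>k\<in>{..Suc n}. ?t (n choose k) k (Suc n - k))"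
    using x y by (simp add: Pi_def binomial_eq_0)
  moreover have "\<dots> = (\<Oplus>k\<in>{..n}. ?t (n choose Suc k) (Suc k) (n - k)) \<oplus> ?t 1 0 (Suc n)"
    using x y by (subst finsum_Suc2) (auto simp: Pi_def)
  ultimately have "(x \<oplus> y) [^] Suc n = (\<Oplus>k\<in>{..n}. ?t (n choose k) (Suc k) (n - k))
     \<oplus> ((\<Oplus>k\<in>{..n}. ?t (n choose Suc k) (Suc k) (n - k)) \<oplus> ?t 1 0 (Suc n))"
    using Suc x y c by (simp add: r_distr finsum_closed Pi_def)
  also have "\<dots> = (\<Oplus>k\<in>{..n}. ?t (n choose k) (Suc k) (n - k) \<oplus> ?t (n choose Suc k) (Suc k) (n - k)) \<oplus> ?t 1 0 (Suc n)"
    using c x y by (subst finsum_addf) (auto simp: a_assoc finsum_closed Pi_def)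
  also have "\<dots> = (\<Oplus>k\<in>{..n}. ?t (Suc n choose Suc k) (Suc k) (n - k)) \<oplus> ?t 1 0 (Suc n)"
    using x y by (intro arg_cong2[where f = "(\<oplus>)"] finsum_cong') (auto simp: add.nat_pow_mult)
  also have "\<dots> = (\<Oplus>k\<in>{..Suc n}. ?t (Suc n choose k) k (Suc n - k))"
    using x y by (subst finsum_Suc2) (auto simp: Pi_def)
  finally show ?case .
qed

lemma (in cring) frobenius_hom:
  assumes p: "normalization_semidom_class.prime (p::nat)" and char: "[p] \<cdot> \<one> = \<zero>"
  shows "(\<lambda>x. x [^] p) \<in> ring_hom R R"
proof (rule ring_hom_memI)
  fix x y assume x: "x \<in> carrier R" and y: "y \<in> carrier R"
  show "(x \<otimes> y) [^] p = x [^] p \<otimes> y [^] p" using x y by (rule nat_pow_distrib)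
  \<comment> \<open>Writing p as m + 2 exposes both end terms of the binomial sum; \<open>p\<close>
    divides every coefficient in between.\<close>
  obtain m where m: "p = Suc (Suc m)" using prime_ge_2_nat[OF p] by (metis add_2_eq_Suc le_iff_add)
  let ?t = "\<lambda>k. [(p choose k)] \<cdot> (x [^] k \<otimes> y [^] (p - k))"
  have t: "?t k \<in> carrier R" for k using x y by simp
  have z: "?t (Suc k) = \<zero>" if "k \<le> m" for k
  proof -
    have "p dvd (p choose Suc k)" using dvd_choose_prime[of "Suc k" p] p that m by simp
    then obtain c where c: "p choose Suc k = c * p" by (metis dvdE mult.commute)
    have "[(c * p)] \<cdot> v = \<zero>" if v: "v \<in> carrier R" for v
    proof -
      have "[p] \<cdot> v = [p] \<cdot> (\<one> \<otimes> v)" using v by simp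
      also have "\<dots> = ([p] \<cdot> \<one>) \<otimes> v" using v by (simp add: add_pow_ldistr del: l_one)
      finally have "[p] \<cdot> v = \<zero>" using v char by simp
      then show ?thesis using v add.nat_pow_pow[of v c p] by (simp add: mult.commute)
    qed
    then show ?thesis unfolding c using x y by simp
  qed
  have "(x \<oplus> y) [^] p = (\<Oplus>k\<in>{..Suc (Suc m)}. ?t k)" using binomial[OF x y, of p] m by simp
  also have "\<dots> = ?t (Suc (Suc m)) \<oplus> ((\<Oplus>k\<in>{..m}. ?t (Suc k)) \<oplus> ?t 0)"
    using t by (subst finsum_Suc, simp add: Pi_def, subst finsum_Suc2) (auto simp: Pi_def)
  also have "(\<Oplus>k\<in>{..m}. ?t (Suc k)) = (\<Oplus>k\<in>{..m}. \<zero>)" using z by (intro finsum_cong') auto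
  finally show "(x \<oplus> y) [^] p = x [^] p \<oplus> y [^] p" using x y m by simp
qed (use assms in auto)

lemma (in cring) power_hom:
  assumes "(\<lambda>x. x [^] (p::nat)) \<in> ring_hom R R"
  shows "(\<lambda>x. x [^] (p ^ e)) \<in> ring_hom R R"
proof (induction e)
  case 0 show ?case by (rule ring_hom_memI) auto
next
  case (Suc e)
  have eq: "x [^] (p ^ Suc e) = (x [^] (p ^ e)) [^] p" if "x \<in> carrier R" for x
    using that by (simp add: nat_pow_pow mult.commute)
  show ?case
  proof (rule ring_hom_memI)
    fix x y assume xy: "x \<in> carrier R" "y \<in> carrier R"
    show "(x \<otimes> y) [^] p ^ Suc e = x [^] p ^ Suc e \<otimes> y [^] p ^ Suc e" using xy by (rule nat_pow_distrib)
    show "(x \<oplus> y) [^] p ^ Suc e = x [^] p ^ Suc e \<oplus> y [^] p ^ Suc e"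
      using xy eq ring_hom_add[OF Suc xy] ring_hom_add[OF assms] by simp
  qed auto
qed

section \<open>Localization at a prime\<close>

text \<open>Operations on fractions are unions over representatives; this reduces them to a single
  value once independence of the representatives is shown.\<close>

lemma UN_const2:
  assumes "x0 \<in> A" "y0 \<in> B" "\<And>x y. x \<in> A \<Longrightarrow> y \<in> B \<Longrightarrow> F x y = C"
  shows "(\<Union>x\<in>A. \<Union>y\<in>B. F x y) = C"
  using assms by blast

locale localization_at = cring +
  fixes P assumes P: "primeideal P R"
begin

abbreviation "frc a t \<equiv> fraction R (carrier R - P) a t"
abbreviation "Loc \<equiv> localization R (carrier R - P)"

lemma one_S: "\<one> \<in> carrier R - P" using primeD(2)[OF P] by simp

lemma S_carr: "t \<in> carrier R - P \<Longrightarrow> t \<in> carrier R" by simp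

lemma frac_rel:
  assumes "a \<in> carrier R" "b \<in> carrier R" "s \<in> carrier R" "t \<in> carrier R" "u \<in> carrier R"
  shows "u \<otimes> (t \<otimes> a \<ominus> s \<otimes> b) = \<zero> \<longleftrightarrow> u \<otimes> (t \<otimes> a) = u \<otimes> (s \<otimes> b)"
proof -
  have "u \<otimes> (t \<otimes> a \<ominus> s \<otimes> b) = u \<otimes> (t \<otimes> a) \<ominus> u \<otimes> (s \<otimes> b)" using assms by algebra
  then show ?thesis using assms by (simp add: r_right_minus_eq)
qed

lemma mem_frac:
  assumes "a \<in> carrier R" "s \<in> carrier R - P"
  shows "(b, t) \<in> frc a s \<longleftrightarrow> b \<in> carrier R \<and> t \<in> carrier R - P \<and>
    (\<exists>u\<in>carrier R - P. u \<otimes> (t \<otimes> a) = u \<otimes> (s \<otimes> b))"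
  unfolding fraction_def using assms by (auto simp: frac_rel)

lemma frac_sub:
  assumes a: "a \<in> carrier R" "s \<in> carrier R - P" and b: "b \<in> carrier R" "t \<in> carrier R - P"
    and u: "u \<in> carrier R - P" "u \<otimes> (t \<otimes> a) = u \<otimes> (s \<otimes> b)"
  shows "frc a s \<subseteq> frc b t"
proof (intro subrelI)
  fix c r assume cr: "(c, r) \<in> frc a s"
  then have c: "c \<in> carrier R" "r \<in> carrier R - P" using mem_frac[OF a] by auto
  obtain v where v: "v \<in> carrier R - P" "v \<otimes> (r \<otimes> a) = v \<otimes> (s \<otimes> c)" using cr mem_frac[OF a] by auto
  note cc = a(1) b(1) c(1) S_carr[OF a(2)] S_carr[OF b(2)] S_carr[OF c(2)] S_carr[OF u(1)] S_carr[OF v(1)]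
  have "(u \<otimes> v \<otimes> s) \<otimes> (r \<otimes> b) = (v \<otimes> r) \<otimes> (u \<otimes> (s \<otimes> b))" using cc by (simp add: m_ac)
  also have "\<dots> = (u \<otimes> t) \<otimes> (v \<otimes> (r \<otimes> a))" unfolding u(2)[symmetric] using cc by (simp add: m_ac)
  also have "\<dots> = (u \<otimes> v \<otimes> s) \<otimes> (t \<otimes> c)" unfolding v(2) using cc by (simp add: m_ac)
  finally show "(c, r) \<in> frc b t"
    using mem_frac[OF b] c prime_compl_mult[OF P prime_compl_mult[OF P u(1) v(1)] a(2)] by blast
qed

lemma frac_eq:
  assumes a: "a \<in> carrier R" "s \<in> carrier R - P" and b: "b \<in> carrier R" "t \<in> carrier R - P"
  shows "frc a s = frc b t \<longleftrightarrow> (\<exists>u\<in>carrier R - P. u \<otimes> (t \<otimes> a) = u \<otimes> (s \<otimes> b))"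
proof
  assume "frc a s = frc b t"
  moreover have "(b, t) \<in> frc b t" using mem_frac[OF b] b one_S by blast
  ultimately show "\<exists>u\<in>carrier R - P. u \<otimes> (t \<otimes> a) = u \<otimes> (s \<otimes> b)" using mem_frac[OF a] by blast
next
  assume "\<exists>u\<in>carrier R - P. u \<otimes> (t \<otimes> a) = u \<otimes> (s \<otimes> b)"
  then obtain u where u: "u \<in> carrier R - P" "u \<otimes> (t \<otimes> a) = u \<otimes> (s \<otimes> b)" by blast
  show "frc a s = frc b t" using frac_sub[OF a b u] frac_sub[OF b a u(1) u(2)[symmetric]] by blast
qed

lemmas frac_eqI = iffD2[OF frac_eq, OF _ _ _ _ bexI]

lemma frac_nonempty: "a \<in> carrier R \<Longrightarrow> s \<in> carrier R - P \<Longrightarrow> (a, s) \<in> frc a s"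
  using mem_frac one_S by blast

lemma frac_rep: "a \<in> carrier R \<Longrightarrow> s \<in> carrier R - P \<Longrightarrow> (b, t) \<in> frc a s \<Longrightarrow>
    b \<in> carrier R \<and> t \<in> carrier R - P \<and> frc b t = frc a s"
  using mem_frac frac_eq by metis

lemma loc_mult:
  assumes a: "a \<in> carrier R" "s \<in> carrier R - P" and b: "b \<in> carrier R" "t \<in> carrier R - P"
  shows "frc a s \<otimes>\<^bsub>Loc\<^esub> frc b t = frc (a \<otimes> b) (s \<otimes> t)"
proof -
  have "(\<Union>x\<in>frc a s. \<Union>y\<in>frc b t. (case x of (a, s) \<Rightarrow> case y of (b, t) \<Rightarrow> frc (a \<otimes> b) (s \<otimes> t)))
    = frc (a \<otimes> b) (s \<otimes> t)"
  proof (rule UN_const2[OF frac_nonempty[OF a] frac_nonempty[OF b]])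
    fix x y assume xy: "x \<in> frc a s" "y \<in> frc b t"
    obtain a' s' b' t' where x: "x = (a', s')" and y: "y = (b', t')" by (cases x, cases y)
    have xy': "(a', s') \<in> frc a s" "(b', t') \<in> frc b t" using xy x y by simp_all
    have a': "a' \<in> carrier R" "s' \<in> carrier R - P" and b': "b' \<in> carrier R" "t' \<in> carrier R - P"
      using frac_rep[OF a xy'(1)] frac_rep[OF b xy'(2)] by blast+
    obtain u where u: "u \<in> carrier R - P" "u \<otimes> (s' \<otimes> a) = u \<otimes> (s \<otimes> a')" using mem_frac[OF a, of a' s'] xy'(1) by blast
    obtain v where v: "v \<in> carrier R - P" "v \<otimes> (t' \<otimes> b) = v \<otimes> (t \<otimes> b')" using mem_frac[OF b, of b' t'] xy'(2) by blast
    note cc = a(1) b(1) a'(1) b'(1) S_carr[OF a(2)] S_carr[OF b(2)] S_carr[OF a'(2)] S_carr[OF b'(2)] S_carr[OF u(1)] S_carr[OF v(1)]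
    have "(u \<otimes> v) \<otimes> ((s' \<otimes> t') \<otimes> (a \<otimes> b)) = (u \<otimes> (s' \<otimes> a)) \<otimes> (v \<otimes> (t' \<otimes> b))" using cc by (simp add: m_ac)
    also have "\<dots> = (u \<otimes> v) \<otimes> ((s \<otimes> t) \<otimes> (a' \<otimes> b'))" unfolding u(2) v(2) using cc by (simp add: m_ac)
    finally have "frc (a \<otimes> b) (s \<otimes> t) = frc (a' \<otimes> b') (s' \<otimes> t')"
      by (rule frac_eqI[OF m_closed[OF a(1) b(1)] prime_compl_mult[OF P a(2) b(2)]
          m_closed[OF a'(1) b'(1)] prime_compl_mult[OF P a'(2) b'(2)] _ prime_compl_mult[OF P u(1) v(1)]])
    then show "(case x of (a, s) \<Rightarrow> case y of (b, t) \<Rightarrow> frc (a \<otimes> b) (s \<otimes> t)) = frc (a \<otimes> b) (s \<otimes> t)"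
      using x y by simp
  qed
  then show ?thesis unfolding localization_def by (simp add: case_prod_unfold)
qed

lemma loc_add:
  assumes a: "a \<in> carrier R" "s \<in> carrier R - P" and b: "b \<in> carrier R" "t \<in> carrier R - P"
  shows "frc a s \<oplus>\<^bsub>Loc\<^esub> frc b t = frc (t \<otimes> a \<oplus> s \<otimes> b) (s \<otimes> t)"
proof -
  have "(\<Union>x\<in>frc a s. \<Union>y\<in>frc b t. (case x of (a, s) \<Rightarrow> case y of (b, t) \<Rightarrow> frc (t \<otimes> a \<oplus> s \<otimes> b) (s \<otimes> t)))
    = frc (t \<otimes> a \<oplus> s \<otimes> b) (s \<otimes> t)"
  proof (rule UN_const2[OF frac_nonempty[OF a] frac_nonempty[OF b]])
    fix x y assume xy: "x \<in> frc a s" "y \<in> frc b t"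
    obtain a' s' b' t' where x: "x = (a', s')" and y: "y = (b', t')" by (cases x, cases y)
    have xy': "(a', s') \<in> frc a s" "(b', t') \<in> frc b t" using xy x y by simp_all
    have a': "a' \<in> carrier R" "s' \<in> carrier R - P" and b': "b' \<in> carrier R" "t' \<in> carrier R - P"
      using frac_rep[OF a xy'(1)] frac_rep[OF b xy'(2)] by blast+
    obtain u where u: "u \<in> carrier R - P" "u \<otimes> (s' \<otimes> a) = u \<otimes> (s \<otimes> a')" using mem_frac[OF a, of a' s'] xy'(1) by blast
    obtain v where v: "v \<in> carrier R - P" "v \<otimes> (t' \<otimes> b) = v \<otimes> (t \<otimes> b')" using mem_frac[OF b, of b' t'] xy'(2) by blast
    note cc = a(1) b(1) a'(1) b'(1) S_carr[OF a(2)] S_carr[OF b(2)] S_carr[OF a'(2)] S_carr[OF b'(2)] S_carr[OF u(1)] S_carr[OF v(1)]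
    have "(u \<otimes> v) \<otimes> ((s' \<otimes> t') \<otimes> (t \<otimes> a \<oplus> s \<otimes> b))
        = (v \<otimes> t \<otimes> t') \<otimes> (u \<otimes> (s' \<otimes> a)) \<oplus> (u \<otimes> s \<otimes> s') \<otimes> (v \<otimes> (t' \<otimes> b))" using cc by algebra
    also have "\<dots> = (u \<otimes> v) \<otimes> ((s \<otimes> t) \<otimes> (t' \<otimes> a' \<oplus> s' \<otimes> b'))" unfolding u(2) v(2) using cc by algebra
    finally have "frc (t \<otimes> a \<oplus> s \<otimes> b) (s \<otimes> t) = frc (t' \<otimes> a' \<oplus> s' \<otimes> b') (s' \<otimes> t')"
      by (intro frac_eqI[OF _ prime_compl_mult[OF P a(2) b(2)]
          _ prime_compl_mult[OF P a'(2) b'(2)] _ prime_compl_mult[OF P u(1) v(1)]]) (use cc in simp_all)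
    then show "(case x of (a, s) \<Rightarrow> case y of (b, t) \<Rightarrow> frc (t \<otimes> a \<oplus> s \<otimes> b) (s \<otimes> t)) = frc (t \<otimes> a \<oplus> s \<otimes> b) (s \<otimes> t)"
      using x y by simp
  qed
  then show ?thesis unfolding localization_def by (simp add: case_prod_unfold)
qed

definition to_loc :: "'a \<Rightarrow> ('a \<times> 'a) set" where "to_loc a = frc a \<one>"

lemma loc_carrier: "carrier Loc = {frc a s | a s. a \<in> carrier R \<and> s \<in> carrier R - P}"
  unfolding localization_def by simp

lemma to_loc_hom: "to_loc \<in> ring_hom R Loc"
proof (rule ring_hom_memI)
  fix x assume x: "x \<in> carrier R"
  then show "to_loc x \<in> carrier Loc" unfolding to_loc_def loc_carrier using one_S by blast
  fix y assume y: "y \<in> carrier R"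
  show "to_loc (x \<otimes> y) = to_loc x \<otimes>\<^bsub>Loc\<^esub> to_loc y" unfolding to_loc_def using loc_mult[OF x one_S y one_S] by simp
  show "to_loc (x \<oplus> y) = to_loc x \<oplus>\<^bsub>Loc\<^esub> to_loc y" unfolding to_loc_def using loc_add[OF x one_S y one_S] x y by simp
next
  show "to_loc \<one> = \<one>\<^bsub>Loc\<^esub>" unfolding to_loc_def localization_def by simp
qed

lemma to_loc_eq_iff:
  "a \<in> carrier R \<Longrightarrow> b \<in> carrier R \<Longrightarrow> to_loc a = to_loc b \<longleftrightarrow> (\<exists>u\<in>carrier R - P. u \<otimes> a = u \<otimes> b)"
  unfolding to_loc_def using frac_eq[OF _ one_S _ one_S] by auto

lemma loc_elem:
  assumes "x \<in> carrier Loc"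
  obtains a s where "a \<in> carrier R" "s \<in> carrier R - P" "to_loc s \<otimes>\<^bsub>Loc\<^esub> x = to_loc a"
proof -
  obtain a s where as: "a \<in> carrier R" "s \<in> carrier R - P" "x = frc a s" using assms loc_carrier by auto
  have "to_loc s \<otimes>\<^bsub>Loc\<^esub> x = frc (s \<otimes> a) (\<one> \<otimes> s)"
    unfolding as(3) to_loc_def using loc_mult[OF S_carr[OF as(2)] one_S as(1,2)] .
  also have "\<dots> = to_loc a" unfolding to_loc_def using as one_S by (subst frac_eq) auto
  finally show ?thesis using that as by blast
qed

lemma to_loc_unit:
  assumes "s \<in> carrier R - P" obtains v where "v \<in> carrier Loc" "v \<otimes>\<^bsub>Loc\<^esub> to_loc s = \<one>\<^bsub>Loc\<^esub>"
proof -
  have "frc \<one> s \<otimes>\<^bsub>Loc\<^esub> to_loc s = frc (\<one> \<otimes> s) (s \<otimes> \<one>)"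
    unfolding to_loc_def using loc_mult[OF one_closed assms S_carr[OF assms] one_S] .
  also have "\<dots> = frc \<one> \<one>" using assms one_S by (subst frac_eq) auto
  finally have "frc \<one> s \<otimes>\<^bsub>Loc\<^esub> to_loc s = \<one>\<^bsub>Loc\<^esub>" unfolding localization_def by simp
  moreover have "frc \<one> s \<in> carrier Loc" unfolding loc_carrier using assms by blast
  ultimately show ?thesis using that by blast
qed

end

lemma (in cring) hom_pow:
  assumes "cring S" "h \<in> ring_hom R S" "x \<in> carrier R"
  shows "h (x [^] (n::nat)) = h x [^]\<^bsub>S\<^esub> n"
proof -
  interpret S: cring S by fact
  show ?thesis using assms(3) ring_hom_one[OF assms(2)] ring_hom_mult[OF assms(2)] by (induction n) auto
qed

lemma (in cring) hom_add_pow_one: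
  fixes n :: nat
  assumes "cring S" "h \<in> ring_hom R S"
  shows "h ([n] \<cdot> \<one>) = [n] \<cdot>\<^bsub>S\<^esub> \<one>\<^bsub>S\<^esub>"
proof -
  interpret S: cring S by fact
  show ?thesis using ring_hom_one[OF assms(2)] ring_hom_add[OF assms(2)] 
      ring_hom_zero[OF assms(2) ring_axioms S.ring_axioms] by (induction n) auto
qed

section \<open>Kunz's theorem: Frobenius of a regular ring is projective\<close>

lemma regular_local_ring_imp_regular_local:
  assumes "regular_local_ring A" shows "\<exists>\<mm> G. regular_local A \<mm> G"
proof -
  interpret cring A using assms unfolding regular_local_ring_def by blast
  interpret noetherian_ring A using assms unfolding regular_local_ring_def by blast
  interpret noetherian_cring A by unfold_locales
  have "\<exists>!\<mm>. maximalideal \<mm> A" using assms unfolding regular_local_ring_def by blast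
  then obtain \<mm> where m: "maximalideal \<mm> A" "\<And>\<nn>. maximalideal \<nn> A \<Longrightarrow> \<nn> = \<mm>"
    by metis
  obtain G where G: "G \<subseteq> carrier A" "finite G" "enat (card G) = krull_dim A" "maximalideal (genideal A G) A"
    using assms unfolding regular_local_ring_def by blast
  interpret local_noetherian A \<mm>
    by (intro local_noetherian.intro noetherian_cring_axioms local_noetherian_axioms.intro m)
  define X where "X = {enat n | n. \<exists>P. (\<forall>i\<le>n. primeideal (P i) A) \<and> (\<forall>i<n. P i \<subset> P (Suc i))}"
  have "enat 0 \<in> X" unfolding X_def using mm_prime by auto
  then have "X \<noteq> {}" by blast
  moreover have "Sup X = enat (card G)" using G(3) unfolding krull_dim_def X_def by simp
  \<comment> \<open>A finite supremum of a nonempty set in \<open>enat\<close> is attained, so a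
    chain of full length exists.\<close>
  ultimately have "enat (card G) \<in> X" unfolding Sup_enat_def by (metis Max_in enat.distinct(1))
  then obtain P where P: "\<forall>i\<le>card G. primeideal (P i) A" "\<forall>i<card G. P i \<subset> P (Suc i)" unfolding X_def by auto
  have Pm: "P i \<subseteq> \<mm>" if "i \<le> card G" for i
    using P(1) that proper_le primeD(1,2) by blast
  have "P i \<subset> \<mm>" if "Suc i = card G" for i
    using P(2)[rule_format, of i] Pm[of "Suc i"] that by auto
  \<comment> \<open>All primes lie in \<open>\<mm>\<close>, so the top of the chain may be replaced
    by \<open>\<mm>\<close> without losing strictness.\<close>
  then have "prime_chain (P(card G := \<mm>)) (card G)"
    using P mm_prime unfolding prime_chain_def by (auto simp: less_Suc_eq)
  then have "chain_over {} (card G)" unfolding chain_over_def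
    by (intro exI[of _ "P(card G := \<mm>)"]) auto
  then have "regular_local A \<mm> G" by unfold_locales (use G m in auto)
  then show ?thesis by blast
qed

text \<open>Finitely many generators of \<open>I\<close> have finitely many denominators, whose
  product serves for all of \<open>I\<close>.\<close>

lemma (in noetherian_cring) uniform_denominator:
  assumes P: "primeideal P R" and I: "ideal I R" "ideal J R" "I \<subseteq> saturation P J"
  obtains u where "u \<in> carrier R - P" "\<forall>x\<in>I. u \<otimes> x \<in> J"
proof -
  obtain A where A: "A \<subseteq> carrier R" "finite A" "I = Idl A" using finetely_gen[OF I(1)] by blast
  note J = idealD[OF I(2)]
  have AI: "A \<subseteq> I" using A genideal_self by blast
  have "\<exists>u\<in>carrier R - P. \<forall>x\<in>A. u \<otimes> x \<in> J" using A(2,1) AI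
  proof (induction A)
    case empty then show ?case using primeD(2)[OF P] by blast
  next
    case (insert a A)
    then obtain u where u: "u \<in> carrier R - P" "\<forall>x\<in>A. u \<otimes> x \<in> J" by auto
    obtain v where v: "v \<in> carrier R - P" "v \<otimes> a \<in> J" using insert.prems I(3) unfolding saturation_def by blast
    have "(u \<otimes> v) \<otimes> x \<in> J" if x: "x \<in> insert a A" for x
    proof (cases "x = a")
      case True
      then have "(u \<otimes> v) \<otimes> x = u \<otimes> (v \<otimes> a)" using u v insert.prems by (simp add: m_assoc)
      then show ?thesis using J(7)[OF v(2)] u by simp
    next
      case False
      have xc: "x \<in> carrier R" using insert.prems x by auto
      then have "(u \<otimes> v) \<otimes> x = v \<otimes> (u \<otimes> x)" using u(1) v(1) by (simp add: m_ac)
      then show ?thesis using J(7)[of "u \<otimes> x" v] u v x False by auto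
    qed
    then show ?case using prime_compl_mult[OF P u(1) v(1)] by blast
  qed
  then obtain u where u: "u \<in> carrier R - P" "\<forall>x\<in>A. u \<otimes> x \<in> J" by blast
  have "ideal {x \<in> carrier R. u \<otimes> x \<in> J} R"
    using u(1) J by (intro ideal_intro) (auto simp: r_distr m_lcomm)
  then have "I \<subseteq> {x \<in> carrier R. u \<otimes> x \<in> J}" unfolding A(3) using u A(1) by (intro genideal_minimal) auto
  then show ?thesis using that u(1) by blast
qed

context ring_endo
begin

lemma combination_single:
  assumes "finite \<Gamma>" "\<Gamma> \<subseteq> carrier R" "g \<in> \<Gamma>" "c \<in> carrier R"
  shows "combination \<Gamma> (\<lambda>k. if k = g then c else \<zero>) = s c \<otimes> g"
proof -
  have "combination \<Gamma> (\<lambda>k. if k = g then c else \<zero>) = (\<Oplus>k\<in>\<Gamma>. if g = k then s c \<otimes> k else \<zero>)"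
    unfolding combination_def using assms by (intro finsum_cong') auto
  also have "\<dots> = s c \<otimes> g" using assms by (intro finsum_singleton) auto
  finally show ?thesis .
qed

lemma generates_induct:
  assumes gen: "generates \<Gamma>" and x: "x \<in> carrier R"
    and step: "Q \<zero>" "\<And>g. g \<in> \<Gamma> \<Longrightarrow> Q g"
    "\<And>x y. \<lbrakk>x \<in> carrier R; y \<in> carrier R; Q x; Q y\<rbrakk> \<Longrightarrow> Q (x \<oplus> y)"
    "\<And>r x. \<lbrakk>r \<in> carrier R; x \<in> carrier R; Q x\<rbrakk> \<Longrightarrow> Q (s r \<otimes> x)"
  shows "Q x"
proof -
  have \<Gamma>: "finite \<Gamma>" "\<Gamma> \<subseteq> carrier R" using gen unfolding generates_def by auto
  obtain a where a: "a \<in> \<Gamma> \<rightarrow> carrier R" "x = combination \<Gamma> a" using gen x unfolding generates_def by blast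
  have "Q (combination \<Delta> a)" if "\<Delta> \<subseteq> \<Gamma>" for \<Delta>
  proof -
    have "finite \<Delta>" using that \<Gamma> finite_subset by blast
    then show ?thesis using that
    proof (induction \<Delta>)
      case empty show ?case unfolding combination_def using step(1) by simp
    next
      case (insert g \<Delta>)
      have g: "g \<in> \<Gamma>" "g \<in> carrier R" "a g \<in> carrier R" using insert.prems \<Gamma> a by auto
      have d: "\<Delta> \<subseteq> carrier R" "a \<in> \<Delta> \<rightarrow> carrier R" using insert.prems \<Gamma> a by auto
      have "combination (insert g \<Delta>) a = s (a g) \<otimes> g \<oplus> combination \<Delta> a"
        unfolding combination_def using insert.hyps g d by (intro finsum_insert) (auto simp: Pi_iff subset_iff)
      then show ?case using step(3)[OF _ combination_closed[OF d] step(4)[OF g(3,2) step(2)[OF g(1)]]]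
          insert g by simp
    qed
  qed
  then show ?thesis using a by blast
qed

text \<open>The ideal of those \<open>c\<close> for which multiplication by \<open>c\<close> factors through a finite free module.\<close>

definition trace_ideal :: "'a set" where
  "trace_ideal = {c \<in> carrier R. \<exists>\<theta>. dual_sum \<theta> \<and> (\<forall>x\<in>carrier R. \<theta> x = c \<otimes> x)}"

lemma trace_ideal_ideal: "ideal trace_ideal R"
proof (rule ideal_intro)
  show "trace_ideal \<subseteq> carrier R" unfolding trace_ideal_def by blast
  have "dual_sum (\<lambda>_. \<zero>) \<and> (\<forall>x\<in>carrier R. \<zero> = \<zero> \<otimes> x)" using dual_sum.zero by simp
  then show "\<zero> \<in> trace_ideal" unfolding trace_ideal_def by blast
  fix a assume "a \<in> trace_ideal"
  then obtain \<theta> where a: "a \<in> carrier R" "dual_sum \<theta>" "\<forall>x\<in>carrier R. \<theta> x = a \<otimes> x" unfolding trace_ideal_def by blast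
  { fix b assume "b \<in> trace_ideal"
    then obtain \<eta> where b: "b \<in> carrier R" "dual_sum \<eta>" "\<forall>x\<in>carrier R. \<eta> x = b \<otimes> x" unfolding trace_ideal_def by blast
    obtain \<zeta> where "dual_sum \<zeta>" "\<forall>x\<in>carrier R. \<zeta> x = \<theta> x \<oplus> \<eta> x" using dual_sum_plus[OF a(2) b(2)] by blast
    then have "dual_sum \<zeta> \<and> (\<forall>x\<in>carrier R. \<zeta> x = (a \<oplus> b) \<otimes> x)" using a b by (simp add: l_distr)
    then show "a \<oplus> b \<in> trace_ideal" unfolding trace_ideal_def using a b by blast }
  fix r assume r: "r \<in> carrier R"
  obtain \<zeta> where "dual_sum \<zeta>" "\<forall>x\<in>carrier R. \<zeta> x = r \<otimes> \<theta> x" using dual_sum_scale[OF a(2) r] by blast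
  then have "dual_sum \<zeta> \<and> (\<forall>x\<in>carrier R. \<zeta> x = (r \<otimes> a) \<otimes> x)" using a r by (simp add: m_assoc)
  then show "r \<otimes> a \<in> trace_ideal" unfolding trace_ideal_def using a r by blast
qed

end

section \<open>Lifting dual sums from a localization, up to a denominator\<close>

locale localized_power = noetherian_cring + localization_at +
  fixes n :: nat and \<Gamma>
  assumes loc_cring: "cring Loc" and n_pos: "n > 0"
    and power_endo: "(\<lambda>x. x [^] n) \<in> ring_hom R R"
    and loc_power_endo: "(\<lambda>x. x [^]\<^bsub>Loc\<^esub> n) \<in> ring_hom Loc Loc"
    and gen: "ring_endo.generates R (\<lambda>x. x [^] n) \<Gamma>"
begin

sublocale E: ring_endo R "\<lambda>x. x [^] n"
  by unfold_locales (rule power_endo)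

sublocale L: cring Loc by (rule loc_cring)

sublocale EL: ring_endo Loc "\<lambda>x. x [^]\<^bsub>Loc\<^esub> n"
  by unfold_locales (rule loc_power_endo)

lemma hom_closed: "x \<in> carrier R \<Longrightarrow> to_loc x \<in> carrier Loc" using ring_hom_closed[OF to_loc_hom] .
lemma hom_add: "x \<in> carrier R \<Longrightarrow> y \<in> carrier R \<Longrightarrow> to_loc (x \<oplus> y) = to_loc x \<oplus>\<^bsub>Loc\<^esub> to_loc y" using ring_hom_add[OF to_loc_hom] .
lemma hom_mult: "x \<in> carrier R \<Longrightarrow> y \<in> carrier R \<Longrightarrow> to_loc (x \<otimes> y) = to_loc x \<otimes>\<^bsub>Loc\<^esub> to_loc y" using ring_hom_mult[OF to_loc_hom] .
lemma hom_one: "to_loc \<one> = \<one>\<^bsub>Loc\<^esub>" using ring_hom_one[OF to_loc_hom] .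
lemma hom_zero: "to_loc \<zero> = \<zero>\<^bsub>Loc\<^esub>" using ring_hom_zero[OF to_loc_hom ring_axioms L.ring_axioms] .
lemma hom_power: "x \<in> carrier R \<Longrightarrow> to_loc (x [^] n) = to_loc x [^]\<^bsub>Loc\<^esub> n"
  by (rule hom_pow[OF loc_cring to_loc_hom])

lemma loc_generates: "EL.generates (to_loc ` \<Gamma>)"
proof -
  have \<Gamma>: "finite \<Gamma>" "\<Gamma> \<subseteq> carrier R" using gen unfolding E.generates_def by auto
  have \<Gamma>': "finite (to_loc ` \<Gamma>)" "to_loc ` \<Gamma> \<subseteq> carrier Loc" using \<Gamma> hom_closed by auto
  define W where "W = {EL.combination (to_loc ` \<Gamma>) a | a. a \<in> to_loc ` \<Gamma> \<rightarrow> carrier Loc}"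
  have Wscale: "r [^]\<^bsub>Loc\<^esub> n \<otimes>\<^bsub>Loc\<^esub> w \<in> W" if r: "r \<in> carrier Loc" and w: "w \<in> W" for r w
  proof -
    obtain a where a: "a \<in> to_loc ` \<Gamma> \<rightarrow> carrier Loc" "w = EL.combination (to_loc ` \<Gamma>) a" using w unfolding W_def by blast
    have "(\<lambda>g. r \<otimes>\<^bsub>Loc\<^esub> a g) \<in> to_loc ` \<Gamma> \<rightarrow> carrier Loc" using r a by auto
    then show ?thesis unfolding W_def a(2) EL.combination_scale[OF \<Gamma>' a(1) r, symmetric] by blast
  qed
  have Wsingle: "to_loc g \<in> W" if g: "g \<in> \<Gamma>" for g
  proof -
    have "EL.combination (to_loc ` \<Gamma>) (\<lambda>k. if k = to_loc g then \<one>\<^bsub>Loc\<^esub> else \<zero>\<^bsub>Loc\<^esub>) = to_loc g"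
      using EL.combination_single[OF \<Gamma>', of "to_loc g" "\<one>\<^bsub>Loc\<^esub>"] g \<Gamma> hom_closed by auto
    then show ?thesis unfolding W_def
      by (intro CollectI exI[of _ "\<lambda>k. if k = to_loc g then \<one>\<^bsub>Loc\<^esub> else \<zero>\<^bsub>Loc\<^esub>"]) auto
  qed
  have Wadd: "w \<oplus>\<^bsub>Loc\<^esub> w' \<in> W" if w: "w \<in> W" "w' \<in> W" for w w'
  proof -
    obtain a b where ab: "a \<in> to_loc ` \<Gamma> \<rightarrow> carrier Loc" "w = EL.combination (to_loc ` \<Gamma>) a"
      "b \<in> to_loc ` \<Gamma> \<rightarrow> carrier Loc" "w' = EL.combination (to_loc ` \<Gamma>) b" using w unfolding W_def by blast
    have "(\<lambda>g. a g \<oplus>\<^bsub>Loc\<^esub> b g) \<in> to_loc ` \<Gamma> \<rightarrow> carrier Loc" using ab by auto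
    then show ?thesis unfolding W_def ab(2,4) EL.combination_add[OF \<Gamma>'(2) ab(1,3), symmetric] by blast
  qed
  have Wzero: "\<zero>\<^bsub>Loc\<^esub> \<in> W"
  proof -
    have "EL.combination (to_loc ` \<Gamma>) (\<lambda>_. \<zero>\<^bsub>Loc\<^esub>) = \<zero>\<^bsub>Loc\<^esub>"
      unfolding EL.combination_def using \<Gamma>'(2)
      by (intro trans[OF L.finsum_cong' L.finsum_zero]) auto
    then show ?thesis unfolding W_def by force
  qed
  have W: "to_loc x \<in> W" if x: "x \<in> carrier R" for x
    using gen x
  proof (rule E.generates_induct)
    show "to_loc \<zero> \<in> W" using Wzero hom_zero by simp
  qed (auto simp: hom_add hom_mult hom_power Wsingle Wadd Wscale hom_closed)
  have "x \<in> W" if x: "x \<in> carrier Loc" for x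
  proof -
    obtain a t where at: "a \<in> carrier R" "t \<in> carrier R - P" "to_loc t \<otimes>\<^bsub>Loc\<^esub> x = to_loc a" using loc_elem[OF x] .
    obtain v where v: "v \<in> carrier Loc" "v \<otimes>\<^bsub>Loc\<^esub> to_loc t = \<one>\<^bsub>Loc\<^esub>" using to_loc_unit[OF at(2)] .
    have tc: "t \<in> carrier R" "to_loc t \<in> carrier Loc" "to_loc a \<in> carrier Loc" using at hom_closed by auto
    obtain k where k: "n = Suc k" using n_pos by (cases n) auto
    have 1: "t [^] k \<otimes> a \<in> carrier R" using tc at by simp
    \<comment> \<open>A scalar acts through its n-th power, so the denominator \<open>t\<close> must
      become t^n: one writes a/t as t^(n-1) a / t^n. This is where n > 0 enters.\<close>
    have "x = (v \<otimes>\<^bsub>Loc\<^esub> to_loc t) [^]\<^bsub>Loc\<^esub> n \<otimes>\<^bsub>Loc\<^esub> x" using v x by simp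
    also have "\<dots> = v [^]\<^bsub>Loc\<^esub> n \<otimes>\<^bsub>Loc\<^esub> (to_loc t [^]\<^bsub>Loc\<^esub> k \<otimes>\<^bsub>Loc\<^esub> (to_loc t \<otimes>\<^bsub>Loc\<^esub> x))"
      using v(1) tc x unfolding k by (simp add: L.nat_pow_distrib L.m_ac)
    also have "\<dots> = v [^]\<^bsub>Loc\<^esub> n \<otimes>\<^bsub>Loc\<^esub> to_loc (t [^] k \<otimes> a)"
      unfolding at(3) using tc at by (simp add: hom_mult hom_pow[OF loc_cring to_loc_hom])
    finally show ?thesis using Wscale[OF v(1) W[OF 1]] by simp
  qed
  then show ?thesis unfolding EL.generates_def W_def using \<Gamma>' by blast
qed

text \<open>The kernel of \<open>to_loc\<close> is the saturation of the zero ideal, so finite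
  generation gives one \<open>u\<close> that annihilates it. Multiplying by \<open>u\<close> turns
  equalities of fractions into equalities in R.\<close>

lemma kernel_killed: obtains u where "u \<in> carrier R - P"
  "\<forall>x\<in>carrier R. \<forall>y\<in>carrier R. to_loc x = to_loc y \<longrightarrow> u \<otimes> x = u \<otimes> y"
proof -
  have "saturation P {\<zero>} \<subseteq> saturation P {\<zero>}" by blast
  then obtain u where u: "u \<in> carrier R - P" "\<forall>x\<in>saturation P {\<zero>}. u \<otimes> x \<in> {\<zero>}"
    by (rule uniform_denominator[OF P saturation_props(1)[OF P zeroideal] zeroideal])
  show ?thesis
  proof (rule that[OF u(1)], intro ballI impI)
    fix x y assume xy: "x \<in> carrier R" "y \<in> carrier R" "to_loc x = to_loc y"
    then obtain v where v: "v \<in> carrier R - P" "v \<otimes> x = v \<otimes> y" using to_loc_eq_iff by blast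
    have "v \<otimes> (x \<ominus> y) = \<zero>" using v xy S_carr[OF v(1)] by (simp add: minus_eq r_distr r_minus r_neg)
    then have "x \<ominus> y \<in> saturation P {\<zero>}" using v xy by (intro saturationI[of _ v]) auto
    then have "u \<otimes> (x \<ominus> y) = \<zero>" using u(2) by blast
    then have "u \<otimes> x \<ominus> u \<otimes> y = \<zero>" using xy S_carr[OF u(1)] by (simp add: minus_eq r_distr r_minus)
    then show "u \<otimes> x = u \<otimes> y" using xy S_carr[OF u(1)] by (simp add: r_right_minus_eq)
  qed
qed

text \<open>Homomorphisms from a finitely generated module descend along localization up to a
  denominator: \<open>c\<close> clears the denominators of the values on the generators, and hence
  of all values.\<close>

lemma lift_functional:
  assumes \<phi>: "EL.functional \<phi>"
  shows "\<exists>c\<in>carrier R - P. \<exists>\<psi>. E.functional \<psi> \<and>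
    (\<forall>x\<in>carrier R. to_loc (\<psi> x) = to_loc c \<otimes>\<^bsub>Loc\<^esub> \<phi> (to_loc x))"
proof -
  note f = EL.functionalD[OF \<phi>]
  have \<Gamma>: "finite \<Gamma>" "\<Gamma> \<subseteq> carrier R" using gen unfolding E.generates_def by auto
  have "\<exists>c\<in>carrier R - P. \<forall>g\<in>\<Gamma>. \<exists>b\<in>carrier R. to_loc c \<otimes>\<^bsub>Loc\<^esub> \<phi> (to_loc g) = to_loc b"
    using \<Gamma>
  proof (induction \<Gamma>)
    case empty then show ?case using one_S by blast
  next
    case (insert g \<Gamma>)
    then obtain c where c: "c \<in> carrier R - P" "\<forall>g\<in>\<Gamma>. \<exists>b\<in>carrier R. to_loc c \<otimes>\<^bsub>Loc\<^esub> \<phi> (to_loc g) = to_loc b" by auto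
    obtain a t where at: "a \<in> carrier R" "t \<in> carrier R - P" "to_loc t \<otimes>\<^bsub>Loc\<^esub> \<phi> (to_loc g) = to_loc a"
      using loc_elem[OF f(1)[OF hom_closed]] insert.prems by auto
    have cc: "c \<in> carrier R" "t \<in> carrier R" using c at by auto
    have "\<exists>b\<in>carrier R. to_loc (c \<otimes> t) \<otimes>\<^bsub>Loc\<^esub> \<phi> (to_loc k) = to_loc b" if k: "k \<in> insert g \<Gamma>" for k
    proof -
      have kc: "\<phi> (to_loc k) \<in> carrier Loc" using k insert.prems f(1) hom_closed by auto
      show ?thesis
      proof (cases "k = g")
        case True
        have "to_loc (c \<otimes> t) \<otimes>\<^bsub>Loc\<^esub> \<phi> (to_loc k) = to_loc c \<otimes>\<^bsub>Loc\<^esub> to_loc a"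
          using True at(3) cc kc hom_closed by (simp add: hom_mult L.m_assoc)
        also have "\<dots> = to_loc (c \<otimes> a)" using cc at by (simp add: hom_mult)
        finally show ?thesis using cc at(1) by blast
      next
        case False
        then obtain b where b: "b \<in> carrier R" "to_loc c \<otimes>\<^bsub>Loc\<^esub> \<phi> (to_loc k) = to_loc b" using c(2) k by blast
        have "to_loc (c \<otimes> t) \<otimes>\<^bsub>Loc\<^esub> \<phi> (to_loc k) = to_loc t \<otimes>\<^bsub>Loc\<^esub> (to_loc c \<otimes>\<^bsub>Loc\<^esub> \<phi> (to_loc k))"
          using cc kc hom_closed by (simp add: hom_mult L.m_ac)
        also have "\<dots> = to_loc (t \<otimes> b)" using cc b by (simp add: hom_mult)
        finally show ?thesis using cc b(1) by blast
      qed
    qed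
    then show ?case using prime_compl_mult[OF P c(1) at(2)] by blast
  qed
  then obtain c where c: "c \<in> carrier R - P" "\<forall>g\<in>\<Gamma>. \<exists>b\<in>carrier R. to_loc c \<otimes>\<^bsub>Loc\<^esub> \<phi> (to_loc g) = to_loc b" by blast
  have cc: "c \<in> carrier R" "to_loc c \<in> carrier Loc" using c hom_closed by auto
  have "\<exists>b. b \<in> carrier R \<and> to_loc b = to_loc c \<otimes>\<^bsub>Loc\<^esub> \<phi> (to_loc x)" if x: "x \<in> carrier R" for x
    using gen x
  proof (rule E.generates_induct)
    show "\<exists>b. b \<in> carrier R \<and> to_loc b = to_loc c \<otimes>\<^bsub>Loc\<^esub> \<phi> (to_loc \<zero>)"
      using cc f(4) by (intro exI[of _ \<zero>]) (simp add: hom_zero)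
    show "\<exists>b. b \<in> carrier R \<and> to_loc b = to_loc c \<otimes>\<^bsub>Loc\<^esub> \<phi> (to_loc g)" if "g \<in> \<Gamma>" for g
      using c(2) that by force
    fix x y assume xy: "x \<in> carrier R" "y \<in> carrier R"
      "\<exists>b. b \<in> carrier R \<and> to_loc b = to_loc c \<otimes>\<^bsub>Loc\<^esub> \<phi> (to_loc x)" "\<exists>b. b \<in> carrier R \<and> to_loc b = to_loc c \<otimes>\<^bsub>Loc\<^esub> \<phi> (to_loc y)"
    then obtain b d where "b \<in> carrier R" "to_loc b = to_loc c \<otimes>\<^bsub>Loc\<^esub> \<phi> (to_loc x)"
      "d \<in> carrier R" "to_loc d = to_loc c \<otimes>\<^bsub>Loc\<^esub> \<phi> (to_loc y)" by blast
    then show "\<exists>b. b \<in> carrier R \<and> to_loc b = to_loc c \<otimes>\<^bsub>Loc\<^esub> \<phi> (to_loc (x \<oplus> y))"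
      using xy(1,2) cc f hom_closed by (intro exI[of _ "b \<oplus> d"]) (simp add: hom_add L.r_distr)
  next
    fix r x assume rx: "r \<in> carrier R" "x \<in> carrier R" "\<exists>b. b \<in> carrier R \<and> to_loc b = to_loc c \<otimes>\<^bsub>Loc\<^esub> \<phi> (to_loc x)"
    then obtain b where b: "b \<in> carrier R" "to_loc b = to_loc c \<otimes>\<^bsub>Loc\<^esub> \<phi> (to_loc x)" by blast
    then show "\<exists>b. b \<in> carrier R \<and> to_loc b = to_loc c \<otimes>\<^bsub>Loc\<^esub> \<phi> (to_loc (r [^] n \<otimes> x))"
      using rx cc f hom_closed
      by (intro exI[of _ "r \<otimes> b"]) (simp add: hom_mult hom_power L.m_lcomm)
  qed
  then obtain \<beta> where \<beta>: "\<And>x. x \<in> carrier R \<Longrightarrow> \<beta> x \<in> carrier R \<and> to_loc (\<beta> x) = to_loc c \<otimes>\<^bsub>Loc\<^esub> \<phi> (to_loc x)" by metis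
  \<comment> \<open>The numerators \<beta> are chosen pointwise and respect the operations only up
    to the kernel of \<open>to_loc\<close>; the factor \<open>u\<close> removes this defect.\<close>
  obtain u where u: "u \<in> carrier R - P"
    "\<forall>x\<in>carrier R. \<forall>y\<in>carrier R. to_loc x = to_loc y \<longrightarrow> u \<otimes> x = u \<otimes> y" using kernel_killed .
  have uc: "u \<in> carrier R" using u by blast
  have "E.functional (\<lambda>x. u \<otimes> \<beta> x)" unfolding E.functional_def
  proof (intro conjI ballI)
    show "(\<lambda>x. u \<otimes> \<beta> x) \<in> carrier R \<rightarrow> carrier R" using \<beta> uc by auto
    fix x assume x: "x \<in> carrier R"
    { fix y assume y: "y \<in> carrier R"
      have "to_loc (\<beta> (x \<oplus> y)) = to_loc (\<beta> x \<oplus> \<beta> y)" using x y \<beta> cc f hom_closed by (simp add: hom_add L.r_distr)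
      then have "u \<otimes> \<beta> (x \<oplus> y) = u \<otimes> (\<beta> x \<oplus> \<beta> y)" using u(2) x y \<beta> by simp
      then show "u \<otimes> \<beta> (x \<oplus> y) = u \<otimes> \<beta> x \<oplus> u \<otimes> \<beta> y" using x y \<beta> uc by (simp add: r_distr) }
    { fix r assume r: "r \<in> carrier R"
      have "to_loc (\<beta> (r [^] n \<otimes> x)) = to_loc (r \<otimes> \<beta> x)"
        using x r \<beta> cc f hom_closed by (simp add: hom_mult hom_power L.m_lcomm)
      then have "u \<otimes> \<beta> (r [^] n \<otimes> x) = u \<otimes> (r \<otimes> \<beta> x)" using u(2) x r \<beta> by simp
      then show "u \<otimes> \<beta> (r [^] n \<otimes> x) = r \<otimes> (u \<otimes> \<beta> x)" using x r \<beta> uc by (simp add: m_lcomm) }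
  qed
  moreover have "\<forall>x\<in>carrier R. to_loc (u \<otimes> \<beta> x) = to_loc (u \<otimes> c) \<otimes>\<^bsub>Loc\<^esub> \<phi> (to_loc x)"
    using \<beta> uc cc f hom_closed by (simp add: hom_mult L.m_assoc)
  ultimately show ?thesis using prime_compl_mult[OF P u(1) c(1)] by blast
qed

text \<open>A denominator \<open>d\<close> of a functional turns into d^n, because its values enter
  through the n-th power. With \<open>t\<close> from the element \<open>g\<close> and
  \<open>c\<close> from the remaining sum, the common factor is d^n t c.\<close>

lemma lift_dual_sum:
  assumes "EL.dual_sum \<theta>"
  shows "\<exists>c\<in>carrier R - P. \<exists>\<eta>. E.dual_sum \<eta> \<and>
    (\<forall>x\<in>carrier R. to_loc (\<eta> x) = to_loc c \<otimes>\<^bsub>Loc\<^esub> \<theta> (to_loc x))"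
  using assms
proof (induction rule: EL.dual_sum.induct)
  case zero
  have "E.dual_sum (\<lambda>_. \<zero>) \<and> (\<forall>x\<in>carrier R. to_loc \<zero> = to_loc \<one> \<otimes>\<^bsub>Loc\<^esub> \<zero>\<^bsub>Loc\<^esub>)"
    using E.dual_sum.zero by (simp add: hom_zero hom_one)
  then show ?case using one_S by blast
next
  case (add \<theta> \<phi> g)
  obtain c \<eta> where c: "c \<in> carrier R - P" "E.dual_sum \<eta>" "\<forall>x\<in>carrier R. to_loc (\<eta> x) = to_loc c \<otimes>\<^bsub>Loc\<^esub> \<theta> (to_loc x)"
    using add.IH by blast
  obtain d \<psi> where d: "d \<in> carrier R - P" "E.functional \<psi>" "\<forall>x\<in>carrier R. to_loc (\<psi> x) = to_loc d \<otimes>\<^bsub>Loc\<^esub> \<phi> (to_loc x)"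
    using lift_functional[OF add.hyps(2)] by blast
  obtain a t where at: "a \<in> carrier R" "t \<in> carrier R - P" "to_loc t \<otimes>\<^bsub>Loc\<^esub> g = to_loc a" using loc_elem[OF add.hyps(3)] .
  have cc: "c \<in> carrier R" "d \<in> carrier R" "t \<in> carrier R" using c d at by auto
  note f = EL.functionalD[OF add.hyps(2)] and fp = E.functionalD[OF d(2)]
  have dn: "d [^] n \<in> carrier R - P" for n :: nat
  proof (induction n)
    case 0 show ?case using one_S by simp
  next
    case (Suc n) then show ?case using prime_compl_mult[OF P Suc d(1)] by simp
  qed
  obtain \<zeta> where z: "E.dual_sum \<zeta>" "\<forall>x\<in>carrier R. \<zeta> x = (d [^] n \<otimes> t) \<otimes> \<eta> x"
    using E.dual_sum_scale[OF c(2), of "d [^] n \<otimes> t"] cc by auto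
  have ca: "c \<otimes> a \<in> carrier R" using cc at by simp
  have "E.dual_sum (\<lambda>x. \<psi> x [^] n \<otimes> (c \<otimes> a) \<oplus> \<zeta> x)" using E.dual_sum.add[OF z(1) d(2) ca] .
  moreover have "to_loc (\<psi> x [^] n \<otimes> (c \<otimes> a) \<oplus> \<zeta> x) =
      to_loc (d [^] n \<otimes> t \<otimes> c) \<otimes>\<^bsub>Loc\<^esub> (\<phi> (to_loc x) [^]\<^bsub>Loc\<^esub> n \<otimes>\<^bsub>Loc\<^esub> g \<oplus>\<^bsub>Loc\<^esub> \<theta> (to_loc x))" if x: "x \<in> carrier R" for x
  proof -
    have c1: "\<psi> x \<in> carrier R" "\<eta> x \<in> carrier R" "\<phi> (to_loc x) \<in> carrier Loc" "\<theta> (to_loc x) \<in> carrier Loc"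
      using x fp(1) f(1) hom_closed E.dual_sum_closed[OF c(2)] EL.dual_sum_closed[OF add.hyps(1)] by auto
    note c2 = c1 cc at(1) add.hyps(3) hom_closed[OF cc(1)] hom_closed[OF cc(2)] hom_closed[OF cc(3)]
    have "to_loc (\<psi> x [^] n \<otimes> (c \<otimes> a) \<oplus> \<zeta> x) =
      (to_loc d \<otimes>\<^bsub>Loc\<^esub> \<phi> (to_loc x)) [^]\<^bsub>Loc\<^esub> n \<otimes>\<^bsub>Loc\<^esub> (to_loc c \<otimes>\<^bsub>Loc\<^esub> (to_loc t \<otimes>\<^bsub>Loc\<^esub> g))
      \<oplus>\<^bsub>Loc\<^esub> (to_loc d [^]\<^bsub>Loc\<^esub> n \<otimes>\<^bsub>Loc\<^esub> to_loc t) \<otimes>\<^bsub>Loc\<^esub> (to_loc c \<otimes>\<^bsub>Loc\<^esub> \<theta> (to_loc x))"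
      using c2 x z(2) c(3) d(3) at(3) by (simp add: hom_add hom_mult hom_power)
    also have "\<dots> = (to_loc d [^]\<^bsub>Loc\<^esub> n \<otimes>\<^bsub>Loc\<^esub> to_loc t \<otimes>\<^bsub>Loc\<^esub> to_loc c) \<otimes>\<^bsub>Loc\<^esub>
       (\<phi> (to_loc x) [^]\<^bsub>Loc\<^esub> n \<otimes>\<^bsub>Loc\<^esub> g \<oplus>\<^bsub>Loc\<^esub> \<theta> (to_loc x))"
      using c2 by (simp add: L.nat_pow_distrib L.r_distr L.m_ac)
    finally show ?thesis using c2 by (simp add: hom_mult hom_power)
  qed
  ultimately show ?case using prime_compl_mult[OF P prime_compl_mult[OF P dn at(2)] c(1)] by blast
qed

lemma trace_ideal_not_le:
  assumes "EL.projective" shows "\<not> E.trace_ideal \<subseteq> P"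
proof -
  obtain \<theta> where t: "EL.dual_sum \<theta>" "\<forall>x\<in>carrier Loc. \<theta> x = x" using assms unfolding EL.projective_def by blast
  obtain c \<eta> where c: "c \<in> carrier R - P" "E.dual_sum \<eta>" "\<forall>x\<in>carrier R. to_loc (\<eta> x) = to_loc c \<otimes>\<^bsub>Loc\<^esub> \<theta> (to_loc x)"
    using lift_dual_sum[OF t(1)] by blast
  obtain u where u: "u \<in> carrier R - P"
    "\<forall>x\<in>carrier R. \<forall>y\<in>carrier R. to_loc x = to_loc y \<longrightarrow> u \<otimes> x = u \<otimes> y" using kernel_killed .
  have cc: "c \<in> carrier R" "u \<in> carrier R" using c u by auto
  obtain \<zeta> where z: "E.dual_sum \<zeta>" "\<forall>x\<in>carrier R. \<zeta> x = u \<otimes> \<eta> x" using E.dual_sum_scale[OF c(2) cc(2)] by blast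
  have "\<zeta> x = (u \<otimes> c) \<otimes> x" if x: "x \<in> carrier R" for x
  proof -
    have "to_loc (\<eta> x) = to_loc (c \<otimes> x)" using c(3) t(2) x hom_closed cc by (simp add: hom_mult)
    then have "u \<otimes> \<eta> x = u \<otimes> (c \<otimes> x)" using u(2) x cc E.dual_sum_closed[OF c(2)] by simp
    then show ?thesis using z x cc by (simp add: m_assoc)
  qed
  then have "u \<otimes> c \<in> E.trace_ideal" unfolding E.trace_ideal_def using cc z(1) by blast
  then show ?thesis using prime_compl_mult[OF P u(1) c(1)] by blast
qed

end

text \<open>Projectivity amounts to 1 lying in the trace ideal. At a maximal ideal \<open>P\<close>
  the localization is regular local, so its Frobenius has a basis, and clearing denominators in the
  dual basis produces an element of the trace ideal outside \<open>P\<close>. So no maximal ideal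
  contains the trace ideal.\<close>

theorem kunz:
  fixes R (structure)
  assumes reg: "regular_ring R" and p: "normalization_semidom_class.prime (p::nat)" and char: "[p] \<cdot> \<one> = \<zero>"
    and gen: "ring_endo.generates R (\<lambda>x. x [^] p) \<Gamma>"
  shows "ring_endo.projective R (\<lambda>x. x [^] p)"
proof -
  interpret cring R using reg unfolding regular_ring_def by blast
  interpret noetherian_ring R using reg unfolding regular_ring_def by blast
  interpret noetherian_cring R by unfold_locales
  have hom: "(\<lambda>x. x [^] p) \<in> ring_hom R R" by (rule frobenius_hom[OF p char])
  interpret E: ring_endo R "\<lambda>x. x [^] p" by unfold_locales (rule hom)
  have "\<one> \<in> E.trace_ideal"
  proof (rule ccontr)
    assume "\<one> \<notin> E.trace_ideal"
    then obtain P where maxP: "maximalideal P R" "E.trace_ideal \<subseteq> P" using exists_maximalideal[OF E.trace_ideal_ideal] by blast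
    have Pp: "primeideal P R" using maximalideal_prime[OF maxP(1)] .
    interpret localization_at R P
      by (intro localization_at.intro cring_axioms localization_at_axioms.intro Pp)
    have rl: "regular_local_ring Loc" using reg Pp unfolding regular_ring_def by blast
    then obtain \<mm> G where "regular_local Loc \<mm> G" using regular_local_ring_imp_regular_local by blast
    then interpret rl: regular_local Loc \<mm> G .
    have "[p] \<cdot>\<^bsub>Loc\<^esub> \<one>\<^bsub>Loc\<^esub> = \<zero>\<^bsub>Loc\<^esub>"
      using hom_add_pow_one[OF rl.is_cring to_loc_hom, of p] char
        ring_hom_zero[OF to_loc_hom ring_axioms rl.ring_axioms] by simp
    then have lhom: "(\<lambda>x. x [^]\<^bsub>Loc\<^esub> p) \<in> ring_hom Loc Loc" by (rule rl.frobenius_hom[OF p])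
    have p0: "p > 0" using p prime_gt_0_nat by blast
    interpret power_endo Loc \<mm> G p
      by (intro power_endo.intro rl.regular_local_axioms power_endo_axioms.intro p0 lhom)
    interpret lp: localized_power R P p \<Gamma>
      by (intro localized_power.intro noetherian_cring_axioms localization_at_axioms
          localized_power_axioms.intro rl.is_cring p0 hom lhom gen)
    have "ring_endo.projective Loc (\<lambda>x. x [^]\<^bsub>Loc\<^esub> p)" using projective_if_finite[OF lp.loc_generates] .
    then show False using lp.trace_ideal_not_le maxP(2) by blast
  qed
  then obtain \<theta> where "E.dual_sum \<theta>" "\<forall>x\<in>carrier R. \<theta> x = \<one> \<otimes> x" unfolding E.trace_ideal_def by blast
  then show ?thesis unfolding E.projective_def by (intro exI[of _ \<theta>]) auto
qed

section \<open>Bracket powers along a projective endomorphism\<close>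

context ring_endo
begin

definition bracket :: "'a set \<Rightarrow> 'a set" where
  "bracket J = Idl (s ` J)"

lemma bracket_ideal: "ideal J R \<Longrightarrow> ideal (bracket J) R"
  unfolding bracket_def using idealD(2) by (intro genideal_ideal) auto

lemma bracket_mem: "ideal J R \<Longrightarrow> x \<in> J \<Longrightarrow> s x \<in> bracket J"
  unfolding bracket_def using genideal_self[of "s ` J"] idealD(2) by auto

lemma bracket_least: "ideal K R \<Longrightarrow> s ` J \<subseteq> K \<Longrightarrow> bracket J \<subseteq> K"
  unfolding bracket_def by (rule genideal_minimal)

lemma bracket_mono: "ideal K R \<Longrightarrow> J \<subseteq> K \<Longrightarrow> bracket J \<subseteq> bracket K"
  using bracket_mem by (intro bracket_least bracket_ideal) auto

lemma one_mem_bracket: "\<one> \<in> bracket (carrier R)"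
  using bracket_mem[OF oneideal one_closed] by simp

lemma functional_bracket:
  assumes "functional \<phi>" "ideal J R" "x \<in> bracket J" shows "\<phi> x \<in> J"
proof -
  note f = functionalD[OF assms(1)] and J = idealD[OF assms(2)]
  \<comment> \<open>A functional is linear only over the image of \<open>s\<close>; quantifying over
    all multiples r x is what makes this set an ideal.\<close>
  let ?W = "{x \<in> carrier R. \<forall>r\<in>carrier R. \<phi> (r \<otimes> x) \<in> J}"
  have "bracket J \<subseteq> ?W"
  proof (rule bracket_least)
    show "ideal ?W R"
      using f J by (intro ideal_intro) (auto simp: r_distr m_assoc[symmetric])
    show "s ` J \<subseteq> ?W"
    proof (intro subsetI, elim imageE)
      fix x y assume "x = s y" "y \<in> J"
      then show "x \<in> ?W" using f J by (auto simp: m_comm)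
    qed
  qed
  then have "x \<in> carrier R" "\<phi> (\<one> \<otimes> x) \<in> J" using assms(3) by blast+
  then show ?thesis by simp
qed

text \<open>Dual bases multiply: from pairs (\<phi>, g) for \<open>s\<close> and (\<psi>, k) for
  \<open>t\<close> one obtains the functional \<psi> after \<phi> with element s(k) g. The map
  \<open>u\<close> agrees with the composite only on the carrier, as powers and iterates do.\<close>

lemma projective_compose:
  assumes t: "ring_endo R t" "ring_endo.projective R t" and u: "ring_endo R u" "\<And>x. x \<in> carrier R \<Longrightarrow> u x = s (t x)"
    and proj: projective
  shows "ring_endo.projective R u"
proof -
  interpret T: ring_endo R t by fact
  interpret U: ring_endo R u by fact
  have fc: "U.functional (\<lambda>x. \<psi> (\<phi> x))" if "functional \<phi>" "T.functional \<psi>" for \<phi> \<psi>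
    using functionalD[OF that(1)] T.functionalD[OF that(2)] u(2) unfolding U.functional_def by auto
  have 1: "\<exists>\<eta>. U.dual_sum \<eta> \<and> (\<forall>x\<in>carrier R. \<eta> x = s (\<theta> (\<phi> x)) \<otimes> g)"
    if "T.dual_sum \<theta>" "functional \<phi>" "g \<in> carrier R" for \<theta> \<phi> g
    using that
  proof (induction rule: T.dual_sum.induct)
    case zero then show ?case using U.dual_sum.zero by (intro exI[of _ "\<lambda>_. \<zero>"]) auto
  next
    case (add \<theta> \<psi> k)
    then obtain \<eta> where e: "U.dual_sum \<eta>" "\<forall>x\<in>carrier R. \<eta> x = s (\<theta> (\<phi> x)) \<otimes> g" by blast
    note f = functionalD[OF add(5)] and f' = T.functionalD[OF add(2)]
    have kg: "s k \<otimes> g \<in> carrier R" using add by simp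
    have eq: "u (\<psi> (\<phi> x)) \<otimes> (s k \<otimes> g) \<oplus> \<eta> x = s (t (\<psi> (\<phi> x)) \<otimes> k \<oplus> \<theta> (\<phi> x)) \<otimes> g" if x: "x \<in> carrier R" for x
      using x e(2) f f' add(3,6) T.dual_sum_closed[OF add(1)] by (simp add: s_add s_mult l_distr m_assoc u(2))
    show ?case
      by (intro exI[of _ "\<lambda>x. u (\<psi> (\<phi> x)) \<otimes> (s k \<otimes> g) \<oplus> \<eta> x"] conjI ballI eq
          U.dual_sum.add[OF e(1) fc[OF add(5,2)] kg])
  qed
  obtain \<theta>t where \<theta>t: "T.dual_sum \<theta>t" "\<forall>x\<in>carrier R. \<theta>t x = x" using t(2) unfolding T.projective_def by blast
  have 2: "\<exists>\<eta>. U.dual_sum \<eta> \<and> (\<forall>x\<in>carrier R. \<eta> x = \<theta> x)" if "dual_sum \<theta>" for \<theta>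
    using that
  proof (induction rule: dual_sum.induct)
    case zero then show ?case using U.dual_sum.zero by (intro exI[of _ "\<lambda>_. \<zero>"]) auto
  next
    case (add \<theta> \<phi> g)
    obtain \<eta> where e: "U.dual_sum \<eta>" "\<forall>x\<in>carrier R. \<eta> x = \<theta> x" using add by blast
    obtain \<zeta> where z: "U.dual_sum \<zeta>" "\<forall>x\<in>carrier R. \<zeta> x = s (\<theta>t (\<phi> x)) \<otimes> g" using 1[OF \<theta>t(1) add(2,3)] by blast
    obtain \<xi> where "U.dual_sum \<xi>" "\<forall>x\<in>carrier R. \<xi> x = \<zeta> x \<oplus> \<eta> x" using U.dual_sum_plus[OF z(1) e(1)] by blast
    then show ?case using e(2) z(2) \<theta>t(2) functionalD(1)[OF add(2)] by (intro exI[of _ \<xi>]) auto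
  qed
  obtain \<theta> where "dual_sum \<theta>" "\<forall>x\<in>carrier R. \<theta> x = x" using proj unfolding projective_def by blast
  then show ?thesis using 2[of \<theta>] unfolding U.projective_def by auto
qed

lemma projective_id: "ring_endo.projective R (\<lambda>x. x)"
proof -
  have eq: "\<forall>x\<in>carrier R. x \<otimes> \<one> \<oplus> \<zero> = x" by simp
  interpret I: ring_endo R "\<lambda>x. x" by unfold_locales (rule ring_hom_memI, auto)
  have "I.functional (\<lambda>x. x)" unfolding I.functional_def by auto
  from I.dual_sum.add[OF I.dual_sum.zero this one_closed]
  have "I.dual_sum (\<lambda>x. x \<otimes> \<one> \<oplus> \<zero>)" .
  then show ?thesis unfolding I.projective_def using eq by blast
qed

lemma funpow_endo: "ring_endo R (s ^^ n)"
proof unfold_locales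
  show "s ^^ n \<in> ring_hom R R"
  proof (induction n)
    case 0 show ?case by (rule ring_hom_memI) auto
  next
    case (Suc n)
    show ?case using ring_hom_closed[OF Suc] ring_hom_add[OF Suc] ring_hom_mult[OF Suc] ring_hom_one[OF Suc]
      by (intro ring_hom_memI) (auto simp: s_add s_mult)
  qed
qed

end

section \<open>Flatness via functionals, and smallest roots\<close>

locale projective_endo = ring_endo +
  assumes projective: projective
begin

text \<open>The dual basis recovers \<open>x\<close> as the sum of the s(\<phi> x) g. Bracket
  membership thereby becomes a family of conditions on \<open>J\<close>, which commutes with colons
  and with arbitrary intersections.\<close>

lemma mem_bracket_iff:
  assumes "ideal J R" "x \<in> carrier R"
  shows "x \<in> bracket J \<longleftrightarrow> (\<forall>\<phi>. functional \<phi> \<longrightarrow> \<phi> x \<in> J)"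
proof
  assume *: "\<forall>\<phi>. functional \<phi> \<longrightarrow> \<phi> x \<in> J"
  obtain \<theta> where t: "dual_sum \<theta>" "\<forall>x\<in>carrier R. \<theta> x = x" using projective unfolding projective_def by blast
  have "\<theta> x \<in> bracket J" using t(1)
  proof (induction rule: dual_sum.induct)
    case zero then show ?case using idealD(3)[OF bracket_ideal[OF assms(1)]] .
  next
    case (add \<theta> \<phi> g)
    have "s (\<phi> x) \<in> bracket J" using * add(2) bracket_mem[OF assms(1)] by blast
    then show ?case using add idealD(4,8)[OF bracket_ideal[OF assms(1)]] by blast
  qed
  then show "x \<in> bracket J" using t(2) assms(2) by simp
qed (use functional_bracket assms in blast)

text \<open>The flatness of \<open>s\<close>, in the form (J^[s] : s(r)) = (J : r)^[s]: every
  functional pulls s(r) out as \<open>r\<close>.\<close>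

lemma bracket_colon:
  assumes "ideal J R" "r \<in> carrier R" "x \<in> carrier R"
  shows "s r \<otimes> x \<in> bracket J \<longleftrightarrow> x \<in> bracket (colon J r)"
proof -
  have "\<phi> (s r \<otimes> x) \<in> J \<longleftrightarrow> \<phi> x \<in> colon J r" if "functional \<phi>" for \<phi>
    unfolding functionalD(3)[OF that assms(2,3)] colon_def
    using functionalD(1)[OF that assms(3)] assms(2) by (simp add: m_comm)
  moreover have "s r \<otimes> x \<in> carrier R" using assms by simp
  ultimately show ?thesis using assms by (simp add: mem_bracket_iff colon_ideal)
qed

lemma one_mem_bracketD:
  assumes "ideal J R" "\<one> \<in> bracket J" "\<And>x. x \<in> J \<Longrightarrow> s x \<in> J" shows "\<one> \<in> J"
  using bracket_least[OF assms(1), of J] assms by blast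

definition root :: "'a \<Rightarrow> 'a set" where
  "root x = \<Inter>{J. ideal J R \<and> x \<in> bracket J}"

text \<open>Testing by functionals shows that brackets commute with arbitrary intersections, so the
  intersection of all candidates is again a candidate. The third claim is the adjunction between
  roots and brackets, the form in which roots are used.\<close>

lemma root:
  assumes "x \<in> carrier R"
  shows "ideal (root x) R" "x \<in> bracket (root x)" "\<And>J. ideal J R \<Longrightarrow> root x \<subseteq> J \<longleftrightarrow> x \<in> bracket J"
proof -
  have "x \<in> bracket (carrier R)"
    using idealD(8)[OF bracket_ideal[OF oneideal] one_mem_bracket assms] assms by simp
  then have ne: "{J. ideal J R \<and> x \<in> bracket J} \<noteq> {}" using oneideal by blast
  show i: "ideal (root x) R" unfolding root_def by (rule i_Intersect) (use ne in auto)
  show m: "x \<in> bracket (root x)" unfolding mem_bracket_iff[OF i assms]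
    unfolding root_def using functional_bracket by blast
  show "root x \<subseteq> J \<longleftrightarrow> x \<in> bracket J" if J: "ideal J R" for J
    using m bracket_mono[OF J, of "root x"] J unfolding root_def by blast
qed

end

lemma (in projective_endo) funpow_projective: "projective_endo R (s ^^ n)"
proof -
  have "ring_endo.projective R (s ^^ n)"
  proof (induction n)
    case 0
    have "s ^^ 0 = (\<lambda>x. x)" by auto
    then show ?case using projective_id by simp
  next
    case (Suc n)
    show ?case by (rule projective_compose[OF funpow_endo Suc funpow_endo _ projective]) simp
  qed
  then show ?thesis using funpow_endo[of n] by (simp add: projective_endo_def projective_endo_axioms_def)
qed

lemma (in ring_endo) bracket_compose:
  assumes "ring_endo R t" "ring_endo R u" "\<And>x. x \<in> carrier R \<Longrightarrow> u x = s (t x)" "ideal J R"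
  shows "ring_endo.bracket R u J = bracket (ring_endo.bracket R t J)"
proof -
  interpret T: ring_endo R t by fact
  interpret U: ring_endo R u by fact
  show ?thesis
  proof
    have "u ` J \<subseteq> bracket (T.bracket J)"
      using assms(3) idealD(2)[OF assms(4)] bracket_mem[OF T.bracket_ideal[OF assms(4)] T.bracket_mem[OF assms(4)]] by auto
    then show "U.bracket J \<subseteq> bracket (T.bracket J)"
      by (intro U.bracket_least bracket_ideal T.bracket_ideal assms(4))
    have "T.bracket J \<subseteq> {x \<in> carrier R. s x \<in> U.bracket J}"
      using assms(3) idealD(2)[OF assms(4)] U.bracket_mem[OF assms(4)]
      by (intro T.bracket_least preimage_ideal U.bracket_ideal assms(4)) auto
    then show "bracket (T.bracket J) \<subseteq> U.bracket J"
      by (intro bracket_least U.bracket_ideal assms(4)) blast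
  qed
qed

section \<open>Stabilization of descending chains of roots\<close>

text \<open>The argument is Gabber's: the annihilators of the successive quotients of the chain ascend;
  if their limit were proper, the chain would be locally of finite length at a minimal prime of it.\<close>

lemma (in projective_endo) root_chain_stable:
  assumes noeth: "noetherian_cring R" and f: "f \<in> carrier R"
    and square: "\<And>x. x \<in> carrier R \<Longrightarrow> \<exists>y\<in>carrier R. s x = x \<otimes> x \<otimes> y"
    and J: "\<And>n. ideal (J n) R" "\<And>n. J (Suc n) \<subseteq> J n"
    and adj: "\<And>n K. ideal K R \<Longrightarrow> J (Suc n) \<subseteq> K \<longleftrightarrow> (\<forall>x\<in>J n. f \<otimes> x \<in> bracket K)"
  obtains N where "\<forall>n\<ge>N. J n = J N"
proof -
  interpret noetherian_cring R by fact
  note Ji = idealD[OF J(1)] and Jc = idealD(2)[OF J(1)]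
  have fJ: "f \<otimes> x \<in> bracket (J (Suc n))" if "x \<in> J n" for n x using adj[OF J(1)] that by blast
  \<comment> \<open>The annihilators of the successive quotients of the chain.\<close>
  define A where "A n = {a \<in> carrier R. \<forall>x\<in>J n. a \<otimes> x \<in> J (Suc n)}" for n
  have Ai: "ideal (A n) R" for n
    using Ji Jc unfolding A_def by (intro ideal_intro) (auto simp: l_distr m_assoc)
  have Ainc: "A n \<subseteq> A (Suc n)" for n
  proof
    fix a assume a: "a \<in> A n"
    then have ac: "a \<in> carrier R" unfolding A_def by blast
    obtain y where y: "y \<in> carrier R" "s a = a \<otimes> a \<otimes> y" using square[OF ac] by blast
    \<comment> \<open>By the adjunction it is enough that s(a) f x lies in the bracket of
      \<open>J (Suc (Suc n))\<close> for \<open>x\<close> in \<open>J n\<close>. This holds because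
      s(a) is a multiple of \<open>a\<close> and a x is already in \<open>J (Suc n)\<close>.\<close>
    have "J (Suc n) \<subseteq> colon (J (Suc (Suc n))) a"
      unfolding adj[OF colon_ideal[OF J(1) ac]]
    proof
      fix x assume x: "x \<in> J n"
      have xc: "x \<in> carrier R" using x Jc by blast
      have ax: "a \<otimes> x \<in> J (Suc n)" using a x unfolding A_def by blast
      have "s a \<otimes> (f \<otimes> x) = (a \<otimes> y) \<otimes> (f \<otimes> (a \<otimes> x))" unfolding y(2) using ac y xc f by (simp add: m_ac)
      also have "\<dots> \<in> bracket (J (Suc (Suc n)))"
        using idealD(7)[OF bracket_ideal[OF J(1)] fJ[OF ax], of "a \<otimes> y"] ac y by simp
      finally show "f \<otimes> x \<in> bracket (colon (J (Suc (Suc n))) a)" using bracket_colon[OF J(1) ac] f xc by simp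
    qed
    then show "a \<in> A (Suc n)" using ac Jc unfolding A_def colon_def by (auto simp: m_comm)
  qed
  obtain N where N: "\<forall>n\<ge>N. A n = A N"
    by (rule ascending_stable[of A, OF Ai Ainc], rule that, blast)
  have "\<one> \<in> A N"
  proof (rule ccontr)
    assume "\<one> \<notin> A N"
    then obtain P' where P': "maximalideal P' R" "A N \<subseteq> P'" using exists_maximalideal[OF Ai] by blast
    obtain P where P: "minimal_prime_over (A N) P"
      using exists_minimal_prime[OF P'(2) maximalideal_prime[OF P'(1)]] by blast
    then have Pp: "primeideal P R" "A N \<subseteq> P"
      and Pmin: "\<And>Q. primeideal Q R \<Longrightarrow> A N \<subseteq> Q \<Longrightarrow> Q \<subseteq> P \<Longrightarrow> Q = P" unfolding minimal_prime_over_def by auto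
    \<comment> \<open>The exponent two is uniform in \<open>k\<close>. One factor \<open>x\<close>
      takes \<open>J N\<close> into \<open>J (Suc N)\<close>; the adjunction and the divisibility of
      s(x) by x^2 make the other take \<open>J (Suc N)\<close> into
      \<open>J (Suc (N + k))\<close>.\<close>
    have sq: "\<forall>y\<in>J N. (x \<otimes> x) \<otimes> y \<in> J (N + k)" if x: "x \<in> A N" for x k
    proof (induction k)
      case 0 show ?case using x Ji(7)[of _ N] unfolding A_def by auto
    next
      case (Suc k)
      have xc: "x \<in> carrier R" using x unfolding A_def by blast
      obtain z where z: "z \<in> carrier R" "s x = x \<otimes> x \<otimes> z" using square[OF xc] by blast
      have sub: "J (Suc N) \<subseteq> colon (J (Suc (N + k))) x"
        unfolding adj[OF colon_ideal[OF J(1) xc]]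
      proof
        fix y assume y: "y \<in> J N"
        have yc: "y \<in> carrier R" using y Jc by blast
        have "s x \<otimes> (f \<otimes> y) = z \<otimes> (f \<otimes> (x \<otimes> x \<otimes> y))" unfolding z(2) using xc yc z(1) f by (simp add: m_ac)
        also have "\<dots> \<in> bracket (J (Suc (N + k)))"
          using idealD(7)[OF bracket_ideal[OF J(1)] fJ z(1)] Suc y by blast
        finally show "f \<otimes> y \<in> bracket (colon (J (Suc (N + k))) x)" using bracket_colon[OF J(1) xc] f yc by simp
      qed
      show ?case
      proof
        fix y assume y: "y \<in> J N"
        have yc: "y \<in> carrier R" using y Jc by blast
        have "x \<otimes> y \<in> colon (J (Suc (N + k))) x" using sub x y unfolding A_def by blast
        then show "(x \<otimes> x) \<otimes> y \<in> J (N + Suc k)" unfolding colon_def using xc yc by (simp add: m_ac)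
      qed
    qed
    \<comment> \<open>By \<open>sq\<close>, a prime containing the annihilator of J N / B contains
      \<open>A N\<close>, so \<open>P\<close> is minimal over this annihilator and the chain is
      locally stationary at \<open>P\<close>.\<close>
    define B where "B = (\<Inter>k. J (N + k))"
    have B: "ideal B R" unfolding B_def by (rule i_Intersect) (use J in auto)
    have "locally_artinian P B (J N)"
    proof (rule locally_artinianI[OF Pp(1) B _ J(1)])
      show "B \<subseteq> J N" unfolding B_def by (metis INT_lower UNIV_I add_0_right)
      fix Q assume Q: "primeideal Q R" "Q \<subseteq> P" "\<forall>r\<in>carrier R. (\<forall>m\<in>J N. r \<otimes> m \<in> B) \<longrightarrow> r \<in> Q"
      have "A N \<subseteq> Q"
      proof
        fix x assume x: "x \<in> A N"
        then have xc: "x \<in> carrier R" unfolding A_def by blast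
        have "x \<otimes> x \<in> Q" using Q(3) sq[OF x] xc unfolding B_def by blast
        then show "x \<in> Q" using primeD(3)[OF Q(1) xc xc] by blast
      qed
      then show "Q = P" using Pmin Q by blast
    qed
    then obtain n0 where n0: "\<forall>n\<ge>n0. J (N + n) \<subseteq> saturation P (J (N + Suc n))"
    proof (rule locally_artinianE)
      fix n
      show "ideal (J (N + n)) R" "J (N + Suc n) \<subseteq> J (N + n)" using J by auto
      show "B \<subseteq> J (N + n)" unfolding B_def by blast
      show "J (N + n) \<subseteq> J N" by (rule lift_Suc_antimono_le[of J, OF J(2)]) simp
    qed
    \<comment> \<open>Local stationarity gives one \<open>u\<close> outside \<open>P\<close>
      annihilating a successive quotient; but that annihilator is \<open>A N\<close>, which lies in
      \<open>P\<close>.\<close>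
    then have "J (N + n0) \<subseteq> saturation P (J (Suc (N + n0)))" by simp
    then obtain u where u: "u \<in> carrier R - P" "\<forall>x\<in>J (N + n0). u \<otimes> x \<in> J (Suc (N + n0))"
      using uniform_denominator[OF Pp(1) J(1) J(1)] by blast
    then have "u \<in> A (N + n0)" unfolding A_def by blast
    moreover have "A (N + n0) = A N" using N le_add1 by blast
    ultimately show False using Pp(2) u(1) by blast
  qed
  have "J n = J N" if "n \<ge> N" for n
    using that
  proof (induction rule: dec_induct)
    case (step n)
    have "\<one> \<in> A n" using N step(1) \<open>\<one> \<in> A N\<close> by blast
    then have "J n \<subseteq> J (Suc n)" using Jc unfolding A_def by (auto simp: subset_iff)
    then show ?case using J(2)[of n] step by auto
  qed simp
  then show ?thesis using that by blast
qed

section \<open>Test ideals\<close>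

locale frobenius_projective = noetherian_cring +
  fixes p :: nat
  assumes p_ge_2: "p \<ge> 2" and frobenius_endo: "(\<lambda>x. x [^] p) \<in> ring_hom R R"
    and frobenius_projective: "ring_endo.projective R (\<lambda>x. x [^] p)"
begin

lemma level: "projective_endo R (\<lambda>x. x [^] (p ^ e))"
proof -
  have endo: "ring_endo R (\<lambda>x. x [^] (p ^ e))" for e by unfold_locales (rule power_hom[OF frobenius_endo])
  interpret F: ring_endo R "\<lambda>x. x [^] p" by unfold_locales (rule frobenius_endo)
  have "ring_endo.projective R (\<lambda>x. x [^] (p ^ e))"
  proof (induction e)
    case 0
    interpret O: ring_endo R "\<lambda>x. x [^] (p ^ 0)" by (rule endo)
    have "O.functional (\<lambda>x. x)" unfolding O.functional_def by auto
    from O.dual_sum.add[OF O.dual_sum.zero this one_closed]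
    have "O.dual_sum (\<lambda>x. x [^] (p ^ 0) \<otimes> \<one> \<oplus> \<zero>)" .
    moreover have "\<forall>x\<in>carrier R. x [^] (p ^ 0) \<otimes> \<one> \<oplus> \<zero> = x" by simp
    ultimately show ?case unfolding O.projective_def by blast
  next
    case (Suc e)
    show ?case
      by (rule F.projective_compose[OF endo Suc endo _ frobenius_projective]) (simp add: nat_pow_pow mult.commute)
  qed
  then show ?thesis using endo by (simp add: projective_endo_def projective_endo_axioms_def)
qed

abbreviation br :: "nat \<Rightarrow> 'a set \<Rightarrow> 'a set" where
  "br e J \<equiv> bracket_power R J (p ^ e)"

lemma br_eq: "br e J = ring_endo.bracket R (\<lambda>x. x [^] (p ^ e)) J"
proof -
  interpret E: projective_endo R "\<lambda>x. x [^] (p ^ e)" by (rule level)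
  show ?thesis unfolding bracket_power_def E.bracket_def by (simp add: Setcompr_eq_image)
qed

lemma br_ideal: "ideal J R \<Longrightarrow> ideal (br e J) R"
proof -
  interpret E: projective_endo R "\<lambda>x. x [^] (p ^ e)" by (rule level)
  show "ideal J R \<Longrightarrow> ideal (br e J) R" unfolding br_eq by (rule E.bracket_ideal)
qed

lemma br_colon:
  assumes "ideal J R" "r \<in> carrier R" "x \<in> carrier R"
  shows "r [^] (p ^ e) \<otimes> x \<in> br e J \<longleftrightarrow> x \<in> br e (colon J r)"
proof -
  interpret E: projective_endo R "\<lambda>x. x [^] (p ^ e)" by (rule level)
  show ?thesis unfolding br_eq by (rule E.bracket_colon[OF assms])
qed

lemma br_br: "ideal J R \<Longrightarrow> br (e + k) J = br k (br e J)"
proof -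
  assume J: "ideal J R"
  interpret E: projective_endo R "\<lambda>x. x [^] (p ^ e)" by (rule level)
  interpret K: projective_endo R "\<lambda>x. x [^] (p ^ k)" by (rule level)
  interpret EK: projective_endo R "\<lambda>x. x [^] (p ^ (e + k))" by (rule level)
  show ?thesis unfolding br_eq
    by (rule K.bracket_compose[OF E.ring_endo_axioms EK.ring_endo_axioms _ J]) (simp add: nat_pow_pow power_add)
qed

lemma one_mem_br_iff: "ideal J R \<Longrightarrow> \<one> \<in> br e J \<longleftrightarrow> J = carrier R"
proof -
  assume J: "ideal J R"
  interpret E: projective_endo R "\<lambda>x. x [^] (p ^ e)" by (rule level)
  obtain m where m: "p ^ e = Suc m" using p_ge_2 by (metis not0_implies_Suc not_numeral_le_zero power_not_zero)
  have "x [^] (p ^ e) \<in> J" if "x \<in> J" for x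
    unfolding m using idealD(7)[OF J that, of "x [^] m"] idealD(2)[OF J that] by simp
  then have "\<one> \<in> br e J \<Longrightarrow> \<one> \<in> J" unfolding br_eq using E.one_mem_bracketD[OF J] by blast
  moreover have "\<one> \<in> J \<Longrightarrow> \<one> \<in> br e J" unfolding br_eq using E.bracket_mem[OF J, of \<one>] by simp
  ultimately show ?thesis using ideal.one_imp_carrier[OF J] by blast
qed

text \<open>Moving the power out as a colon reduces the claim to 1 lying in a bracket power, which
  happens only for the unit ideal. It makes roots independent of the level at which they are
  computed.\<close>

lemma power_mem_br_iff:
  assumes "ideal J R" "x \<in> carrier R"
  shows "x [^] (p ^ k) \<in> br (e + k) J \<longleftrightarrow> x \<in> br e J"
proof -
  have "x [^] (p ^ k) \<in> br (e + k) J \<longleftrightarrow> x [^] (p ^ k) \<otimes> \<one> \<in> br k (br e J)" using assms br_br by simp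
  also have "\<dots> \<longleftrightarrow> \<one> \<in> br k (colon (br e J) x)" using br_colon[OF br_ideal[OF assms(1)] assms(2)] by simp
  also have "\<dots> \<longleftrightarrow> colon (br e J) x = carrier R"
    using one_mem_br_iff[OF colon_ideal[OF br_ideal[OF assms(1)] assms(2)]] .
  also have "\<dots> \<longleftrightarrow> x \<in> br e J"
    using idealD(7)[OF br_ideal[OF assms(1)]] assms(2) one_closed unfolding colon_def by fastforce
  finally show ?thesis .
qed

section \<open>Roots at the levels p^e and test ideals as their limits\<close>

definition rt :: "'a \<Rightarrow> nat \<Rightarrow> 'a set" where
  "rt g e = projective_endo.root R (\<lambda>x. x [^] (p ^ e)) g"

lemma rt:
  assumes "g \<in> carrier R"
  shows "ideal (rt g e) R" "\<And>J. ideal J R \<Longrightarrow> rt g e \<subseteq> J \<longleftrightarrow> g \<in> br e J"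
proof -
  interpret E: projective_endo R "\<lambda>x. x [^] (p ^ e)" by (rule level)
  show "ideal (rt g e) R" "\<And>J. ideal J R \<Longrightarrow> rt g e \<subseteq> J \<longleftrightarrow> g \<in> br e J"
    unfolding rt_def br_eq using E.root[OF assms] by auto
qed

lemma rt_mem: "g \<in> carrier R \<Longrightarrow> g \<in> br e (rt g e)"
  using rt by blast

lemma rt_smallest: "g \<in> carrier R \<Longrightarrow> is_smallest_root R g (p ^ e) J \<longleftrightarrow> J = rt g e"
  unfolding is_smallest_root_def using rt(1)[of g e] rt(2)[of g] rt_mem[of g e] by blast

lemma rt_eqI:
  assumes "g \<in> carrier R" "h \<in> carrier R" "\<And>J. ideal J R \<Longrightarrow> g \<in> br e J \<longleftrightarrow> h \<in> br k J"
  shows "rt g e = rt h k"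
  using rt[OF assms(1)] rt[OF assms(2)] assms(3) by (metis subset_antisym subset_refl)

lemma rt_power: "g \<in> carrier R \<Longrightarrow> rt (g [^] (p ^ k)) (e + k) = rt g e"
  by (rule rt_eqI) (auto simp: power_mem_br_iff)

lemma rt_antimono:
  assumes "f \<in> carrier R" "a \<le> (b::nat)" shows "rt (f [^] b) e \<subseteq> rt (f [^] a) e"
proof -
  have "f [^] b = f [^] (b - a) \<otimes> f [^] a" using assms by (simp add: nat_pow_mult)
  then have "f [^] b \<in> br e (rt (f [^] a) e)"
    using idealD(7)[OF br_ideal[OF rt(1)] rt_mem] assms by simp
  then show ?thesis using rt assms by simp
qed

abbreviation expo :: "real \<Rightarrow> nat \<Rightarrow> nat" where
  "expo \<alpha> e \<equiv> nat \<lceil>\<alpha> * real p ^ e\<rceil>"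

text \<open>Rounding up first and then multiplying by \<open>p\<close> gives at least the rounded
  exponent of the next level. Hence the roots ascend with \<open>e\<close>, and noetherianity makes
  the test ideal well defined.\<close>

lemma rt_expo_incr:
  assumes f: "f \<in> carrier R" and \<alpha>: "\<alpha> \<ge> 0"
  shows "rt (f [^] expo \<alpha> e) e \<subseteq> rt (f [^] expo \<alpha> (Suc e)) (Suc e)"
proof -
  have "\<alpha> * real p ^ Suc e \<le> real_of_int (\<lceil>\<alpha> * real p ^ e\<rceil> * int p)"
    using mult_right_mono[OF le_of_int_ceiling[of "\<alpha> * real p ^ e"], of "real p"] by (simp add: mult_ac)
  then have "\<lceil>\<alpha> * real p ^ Suc e\<rceil> \<le> \<lceil>\<alpha> * real p ^ e\<rceil> * int p" by (simp only: ceiling_le_iff)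
  then have "expo \<alpha> (Suc e) \<le> expo \<alpha> e * p"
    using \<alpha> by (metis nat_int nat_mult_distrib_neg nat_mono nat_mult_distrib zero_le_ceiling le_less_trans
        mult_nonneg_nonneg of_nat_0_le_iff zero_le_power neg_less_0_iff_less less_le_trans zero_less_one)
  then have "rt (f [^] (expo \<alpha> e * p)) (Suc e) \<subseteq> rt (f [^] expo \<alpha> (Suc e)) (Suc e)" using rt_antimono[OF f] by blast
  moreover have "rt (f [^] (expo \<alpha> e * p)) (Suc e) = rt (f [^] expo \<alpha> e) e"
    using rt_power[of "f [^] expo \<alpha> e" 1 e] f by (simp add: nat_pow_pow)
  ultimately show ?thesis by simp
qed

lemma test_ideal_eventually:
  assumes f: "f \<in> carrier R" and \<alpha>: "\<alpha> \<ge> 0"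
  shows "\<forall>\<^sub>F e in sequentially. test_ideal R p f \<alpha> = rt (f [^] expo \<alpha> e) e"
proof -
  have fe: "f [^] expo \<alpha> e \<in> carrier R" for e using f by simp
  obtain N where N: "\<forall>e\<ge>N. rt (f [^] expo \<alpha> e) e = rt (f [^] expo \<alpha> N) N"
    by (rule ascending_stable[of "\<lambda>e. rt (f [^] expo \<alpha> e) e", OF rt(1)[OF fe] rt_expo_incr[OF f \<alpha>]],
        rule that, blast)
  define J where "J = rt (f [^] expo \<alpha> N) N"
  have ev: "\<forall>\<^sub>F e in sequentially. is_smallest_root R (f [^] expo \<alpha> e) (p ^ e) J"
    unfolding eventually_sequentially rt_smallest[OF fe] J_def using N by metis
  have "test_ideal R p f \<alpha> = J" unfolding test_ideal_def
  proof (rule the_equality)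
    show "\<forall>\<^sub>F e in sequentially. is_smallest_root R (f [^] expo \<alpha> e) (p ^ e) J" by (rule ev)
    fix J' assume "\<forall>\<^sub>F e in sequentially. is_smallest_root R (f [^] expo \<alpha> e) (p ^ e) J'"
    with ev have "\<forall>\<^sub>F e in sequentially. J' = J"
      by eventually_elim (simp only: rt_smallest[OF fe])
    then show "J' = J" by simp
  qed
  then show ?thesis unfolding eventually_sequentially J_def using N by metis
qed

lemma test_ideal_antimono:
  assumes f: "f \<in> carrier R" and "0 \<le> \<alpha>" "\<alpha> \<le> \<beta>"
  shows "test_ideal R p f \<beta> \<subseteq> test_ideal R p f \<alpha>"
proof -
  have "\<forall>\<^sub>F e in sequentially. test_ideal R p f \<beta> \<subseteq> test_ideal R p f \<alpha>"
    using test_ideal_eventually[OF f assms(2)] test_ideal_eventually[OF f order_trans[OF assms(2,3)]]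
  proof eventually_elim
    case (elim e)
    have "expo \<alpha> e \<le> expo \<beta> e" using assms by (intro nat_mono ceiling_mono mult_right_mono) auto
    then show ?case unfolding elim by (rule rt_antimono[OF f])
  qed
  then show ?thesis by simp
qed

text \<open>From level \<open>k\<close> on the exponent is the integer m p^(e-k), so rounding does
  nothing and every such level returns the same root.\<close>

lemma test_ideal_rational:
  assumes f: "f \<in> carrier R"
  shows "test_ideal R p f (real m / real p ^ k) = rt (f [^] m) k"
proof -
  have "\<forall>\<^sub>F e in sequentially. test_ideal R p f (real m / real p ^ k) = rt (f [^] m) k"
    using test_ideal_eventually[OF f, of "real m / real p ^ k", simplified] eventually_ge_at_top[of k]
  proof eventually_elim
    case (elim e)
    have "real m / real p ^ k * real p ^ e = real (m * p ^ (e - k))"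
    proof -
      have "real p ^ e = real p ^ k * real p ^ (e - k)" using elim(2) by (simp add: power_add[symmetric])
      then show ?thesis using p_ge_2 by simp
    qed
    then have "expo (real m / real p ^ k) e = m * p ^ (e - k)" by (metis ceiling_of_nat nat_int)
    then have "test_ideal R p f (real m / real p ^ k) = rt (f [^] (m * p ^ (e - k))) e" using elim(1) by simp
    also have "\<dots> = rt (f [^] m) k" using rt_power[of "f [^] m" "e - k" k] f elim(2) by (simp add: nat_pow_pow)
    finally show ?case .
  qed
  then show ?thesis by simp
qed

text \<open>\<open>chain f d e\<close> is \<open>\<tau>(f\<^bsup>(1+q+\<dots>+q^(e-1))/q^e\<^esup>)\<close> for \<open>q = p^d\<close>.\<close>

definition chain :: "'a \<Rightarrow> nat \<Rightarrow> nat \<Rightarrow> 'a set" where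
  "chain f d e = rt (f [^] (\<Sum>i<e. (p ^ d) ^ i)) (d * e)"

lemma chain_ideal: "f \<in> carrier R \<Longrightarrow> ideal (chain f d e) R"
  unfolding chain_def by (simp add: rt)

lemma chain_le_iff:
  "f \<in> carrier R \<Longrightarrow> ideal J R \<Longrightarrow> chain f d e \<subseteq> J \<longleftrightarrow> f [^] (\<Sum>i<e. (p ^ d) ^ i) \<in> br (d * e) J"
  unfolding chain_def by (simp add: rt)

text \<open>The exponent grows by its new top term q^e, and the factor f^(q^e) passes through the
  bracket of level d e as a colon by \<open>f\<close>. So each ideal of the chain is the
  level-\<open>d\<close> root of \<open>f\<close> times its predecessor, which is the adjunction
  behind the stabilization argument.\<close>

lemma chain_Suc_le_iff:
  assumes f: "f \<in> carrier R" and J: "ideal J R"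
  shows "chain f d (Suc e) \<subseteq> J \<longleftrightarrow> (\<forall>x\<in>chain f d e. f \<otimes> x \<in> br d J)"
proof -
  let ?s = "\<Sum>i<e. (p ^ d) ^ i"
  have "chain f d (Suc e) \<subseteq> J \<longleftrightarrow> f [^] (?s + p ^ (d * e)) \<in> br (d + d * e) J"
    unfolding chain_le_iff[OF f J] by (simp add: power_mult)
  also have "\<dots> \<longleftrightarrow> f [^] p ^ (d * e) \<otimes> f [^] ?s \<in> br (d * e) (br d J)"
    using f J by (simp add: br_br nat_pow_mult add.commute)
  also have "\<dots> \<longleftrightarrow> chain f d e \<subseteq> colon (br d J) f"
    using f by (simp add: br_colon[OF br_ideal[OF J]] chain_le_iff colon_ideal br_ideal[OF J])
  also have "\<dots> \<longleftrightarrow> (\<forall>x\<in>chain f d e. f \<otimes> x \<in> br d J)"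
    using f idealD(2)[OF chain_ideal[OF f]] unfolding colon_def by (auto simp: m_comm)
  finally show ?thesis .
qed

lemma chain_decr: assumes f: "f \<in> carrier R" shows "chain f d (Suc e) \<subseteq> chain f d e"
proof (induction e)
  case 0
  have i: "ideal (chain f d 0) R" by (rule chain_ideal[OF f])
  have "f [^] (\<Sum>i<0::nat. (p ^ d) ^ i) \<in> br (d * 0) (chain f d 0)"
    by (rule iffD1[OF chain_le_iff[OF f i] subset_refl])
  then have "\<one> \<in> br (d * 0) (chain f d 0)" by (simp only: lessThan_0 sum.empty nat_pow_0)
  then have "chain f d 0 = carrier R" using one_mem_br_iff[OF i] by blast
  then show ?case using idealD(1)[OF chain_ideal[OF f]] by simp
next
  case (Suc e)
  have "\<forall>x\<in>chain f d e. f \<otimes> x \<in> br d (chain f d (Suc e))" using chain_Suc_le_iff[OF f chain_ideal[OF f]] by blast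
  then show ?case using Suc chain_Suc_le_iff[OF f chain_ideal[OF f]] by blast
qed

lemma chain_stable:
  assumes f: "f \<in> carrier R" and d: "d > 0"
  obtains N where "\<forall>n\<ge>N. chain f d n = chain f d N"
proof -
  interpret E: projective_endo R "\<lambda>x. x [^] (p ^ d)" by (rule level)
  show ?thesis
  proof (rule E.root_chain_stable[of f "chain f d", OF noetherian_cring_axioms f _ chain_ideal[OF f] chain_decr[OF f] _ that])
    fix x assume x: "x \<in> carrier R"
    \<comment> \<open>The exponent must be at least two for x^(p^d) to be divisible by x^2; this is
      where d > 0 enters.\<close>
    have "2 \<le> p ^ d" using p_ge_2 d by (metis One_nat_def Suc_leI le_trans power_increasing power_one_right
      one_le_numeral)
    then obtain m where m: "p ^ d = m + 2" by (metis add.commute le_Suc_ex)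
    show "\<exists>y\<in>carrier R. x [^] p ^ d = x \<otimes> x \<otimes> y"
      unfolding m using x by (intro bexI[of _ "x [^] m"]) (simp_all add: numeral_2_eq_2 m_ac)
  next
    fix n K assume "ideal K R"
    then show "chain f d (Suc n) \<subseteq> K \<longleftrightarrow> (\<forall>x\<in>chain f d n. f \<otimes> x \<in> E.bracket K)"
      using chain_Suc_le_iff[OF f] br_eq by simp
  qed
qed

lemma test_ideal_chain:
  assumes "f \<in> carrier R"
  shows "test_ideal R p f ((\<Sum>i<e. real (p ^ d) ^ i) / real (p ^ d) ^ e) = chain f d e"
  using test_ideal_rational[OF assms, of "\<Sum>i<e. (p ^ d) ^ i" "d * e"] unfolding chain_def
  by (simp add: power_mult)

lemma q_gt_1: "d > 0 \<Longrightarrow> real (p ^ d) > 1"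
  using p_ge_2 by (metis Suc_1 Suc_le_lessD of_nat_1 of_nat_less_iff one_less_power)

lemma partial_geometric:
  assumes "d > 0"
  shows "(\<Sum>i<e. real (p ^ d) ^ i) / real (p ^ d) ^ e = (1 - (1 / real (p ^ d)) ^ e) / (real (p ^ d) - 1)"
proof -
  have "(\<Sum>i<e. q ^ i) / q ^ e = (1 - (1 / q) ^ e) / (q - 1)" if q: "q > 1" for q :: real
  proof -
    have "(\<Sum>i<e. q ^ i) = (q ^ e - 1) / (q - 1)" using q by (intro geometric_sum) auto
    then show ?thesis using q by (simp add: divide_simps power_one_over)
  qed
  then show ?thesis using q_gt_1[OF assms] by blast
qed

lemma test_ideal_limit_le_chain:
  assumes f: "f \<in> carrier R" and d: "d > 0"
  shows "test_ideal R p f (1 / (real (p ^ d) - 1)) \<subseteq> chain f d e"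
proof -
  note q = q_gt_1[OF d]
  have "(1 - (1 / real (p ^ d)) ^ e) / (real (p ^ d) - 1) \<le> 1 / (real (p ^ d) - 1)"
    using q by (intro divide_right_mono) auto
  then have "(\<Sum>i<e. real (p ^ d) ^ i) / real (p ^ d) ^ e \<le> 1 / (real (p ^ d) - 1)"
    unfolding partial_geometric[OF d] .
  moreover have "0 \<le> (\<Sum>i<e. real (p ^ d) ^ i) / real (p ^ d) ^ e"
    by (intro divide_nonneg_nonneg sum_nonneg) auto
  ultimately show ?thesis unfolding test_ideal_chain[OF f, symmetric] by (rule test_ideal_antimono[OF f, rotated])
qed

text \<open>The exponents \<alpha> e are strictly below 1/(q-1) and tend to it. Convergence passes
  from trivial chain ideals to the bound on the supremum; strictness gives the converse.\<close>

lemma f_pure_threshold_ge_iff: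
  assumes f: "f \<in> carrier R" and d: "d > 0"
  shows "f_pure_threshold R p f \<ge> ereal (1 / (real (p ^ d) - 1)) \<longleftrightarrow> (\<forall>e. chain f d e = carrier R)"
proof -
  define q where "q = real (p ^ d)"
  have q: "q > 1" unfolding q_def by (rule q_gt_1[OF d])
  define \<alpha> where "\<alpha> e = (\<Sum>i<e. q ^ i) / q ^ e" for e
  have \<alpha>: "\<alpha> e = (1 - (1 / q) ^ e) / (q - 1)" for e unfolding \<alpha>_def q_def by (rule partial_geometric[OF d])
  have \<alpha>0: "\<alpha> e \<ge> 0" for e unfolding \<alpha>_def using q by (intro divide_nonneg_nonneg sum_nonneg) auto
  have \<alpha>c: "test_ideal R p f (\<alpha> e) = chain f d e" for e unfolding \<alpha>_def q_def by (rule test_ideal_chain[OF f])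
  have lim: "\<alpha> \<longlonglongrightarrow> (1 - 0) / (q - 1)"
    unfolding \<alpha> using q by (intro tendsto_intros LIMSEQ_realpow_zero) (auto simp: field_simps)
  show ?thesis unfolding q_def[symmetric]
  proof
    assume *: "\<forall>e. chain f d e = carrier R"
    have "ereal (\<alpha> e) \<le> f_pure_threshold R p f" for e
      unfolding f_pure_threshold_def by (rule Sup_upper) (use * \<alpha>0 \<alpha>c in auto)
    moreover have "(\<lambda>e. ereal (\<alpha> e)) \<longlonglongrightarrow> ereal (1 / (q - 1))" using lim by simp
    ultimately show "ereal (1 / (q - 1)) \<le> f_pure_threshold R p f"
      by (meson LIMSEQ_le_const2)
  next
    assume *: "ereal (1 / (q - 1)) \<le> f_pure_threshold R p f"
    show "\<forall>e. chain f d e = carrier R"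
    proof
      fix e
      \<comment> \<open>Being strictly below the supremum, \<alpha> e is exceeded by some exponent
        with trivial test ideal, and test ideals decrease with the exponent.\<close>
      have "\<alpha> e < 1 / (q - 1)" unfolding \<alpha> using q by (intro divide_strict_right_mono) auto
      then have "ereal (\<alpha> e) < f_pure_threshold R p f" using * by (metis ereal_less_eq(3) less_le_trans less_ereal.simps(1))
      then obtain \<beta> where b: "\<beta> \<ge> 0" "test_ideal R p f \<beta> = carrier R" "\<alpha> e < \<beta>"
        unfolding f_pure_threshold_def less_Sup_iff by auto
      then have "carrier R \<subseteq> chain f d e" using test_ideal_antimono[OF f \<alpha>0[of e], of \<beta>] \<alpha>c by auto
      then show "chain f d e = carrier R" using idealD(1)[OF chain_ideal[OF f]] by blast
    qed
  qed
qed

end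

section \<open>Quotient modules and free modules\<close>

text \<open>One transport principle for both coset modules and subquotients: as \<open>g\<close> is
  onto, the axioms of \<open>T\<close> follow once the operations are computed on
  representatives.\<close>

lemma module_image:
  fixes R (structure)
  assumes M: "module R M"
    and car: "carrier T = g ` carrier M"
    and add: "\<And>x y. x \<in> carrier M \<Longrightarrow> y \<in> carrier M \<Longrightarrow> g x \<oplus>\<^bsub>T\<^esub> g y = g (x \<oplus>\<^bsub>M\<^esub> y)"
    and zero: "\<zero>\<^bsub>T\<^esub> = g \<zero>\<^bsub>M\<^esub>"
    and smult: "\<And>a x. a \<in> carrier R \<Longrightarrow> x \<in> carrier M \<Longrightarrow> a \<odot>\<^bsub>T\<^esub> g x = g (a \<odot>\<^bsub>M\<^esub> x)"
  shows "module R T"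
proof -
  interpret M: module R M by fact
  show ?thesis
  proof (rule moduleI)
    show "cring R" by (rule M.R.is_cring)
    show "abelian_group T"
    proof (rule abelian_groupI)
      fix x assume "x \<in> carrier T"
      then obtain x' where x: "x' \<in> carrier M" "x = g x'" using car by blast
      have "g (\<ominus>\<^bsub>M\<^esub> x') \<oplus>\<^bsub>T\<^esub> x = \<zero>\<^bsub>T\<^esub>" using x by (simp add: add zero M.M.l_neg)
      then show "\<exists>y\<in>carrier T. y \<oplus>\<^bsub>T\<^esub> x = \<zero>\<^bsub>T\<^esub>" using x car by (intro bexI[of _ "g (\<ominus>\<^bsub>M\<^esub> x')"]) auto
    qed (auto simp: car add zero M.M.a_ac)
  qed (auto simp: car add smult M.smult_l_distr M.smult_r_distr M.smult_assoc1)
qed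

context module
begin

lemma submoduleD:
  assumes "submodule N R M"
  shows "N \<subseteq> carrier M" "\<And>x. x \<in> N \<Longrightarrow> x \<in> carrier M" "\<zero>\<^bsub>M\<^esub> \<in> N"
    "\<And>x y. x \<in> N \<Longrightarrow> y \<in> N \<Longrightarrow> x \<oplus>\<^bsub>M\<^esub> y \<in> N" "\<And>x. x \<in> N \<Longrightarrow> \<ominus>\<^bsub>M\<^esub> x \<in> N"
    "\<And>x y. x \<in> N \<Longrightarrow> y \<in> N \<Longrightarrow> x \<ominus>\<^bsub>M\<^esub> y \<in> N"
    "\<And>a x. a \<in> carrier R \<Longrightarrow> x \<in> N \<Longrightarrow> a \<odot>\<^bsub>M\<^esub> x \<in> N"
proof -
  note E = submoduleE[OF assms]
  show "N \<subseteq> carrier M" "\<And>x. x \<in> N \<Longrightarrow> x \<in> carrier M" "\<And>x y. x \<in> N \<Longrightarrow> y \<in> N \<Longrightarrow> x \<oplus>\<^bsub>M\<^esub> y \<in> N"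
    "\<And>x. x \<in> N \<Longrightarrow> \<ominus>\<^bsub>M\<^esub> x \<in> N" "\<And>a x. a \<in> carrier R \<Longrightarrow> x \<in> N \<Longrightarrow> a \<odot>\<^bsub>M\<^esub> x \<in> N"
    using E by auto
  then show "\<And>x y. x \<in> N \<Longrightarrow> y \<in> N \<Longrightarrow> x \<ominus>\<^bsub>M\<^esub> y \<in> N" by (simp add: M.minus_eq)
  obtain x where "x \<in> N" using E(2) by blast
  then have "\<zero> \<odot>\<^bsub>M\<^esub> x \<in> N" "x \<in> carrier M" using E(1,4) by auto
  then show "\<zero>\<^bsub>M\<^esub> \<in> N" by simp
qed

lemma submodule_intro:
  assumes "N \<subseteq> carrier M" "\<zero>\<^bsub>M\<^esub> \<in> N" "\<And>x y. x \<in> N \<Longrightarrow> y \<in> N \<Longrightarrow> x \<oplus>\<^bsub>M\<^esub> y \<in> N"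
    "\<And>a x. a \<in> carrier R \<Longrightarrow> x \<in> N \<Longrightarrow> a \<odot>\<^bsub>M\<^esub> x \<in> N"
  shows "submodule N R M"
proof (rule submoduleI)
  fix x assume x: "x \<in> N"
  then have "\<ominus>\<^bsub>M\<^esub> x = (\<ominus> \<one>) \<odot>\<^bsub>M\<^esub> x" using assms(1) by (auto simp: smult_l_minus)
  then show "\<ominus>\<^bsub>M\<^esub> x \<in> N" using assms(4) x by simp
qed (use assms in auto)

lemma coset_eq_iff:
  assumes N: "submodule N R M" and xy: "x \<in> carrier M" "y \<in> carrier M"
  shows "N +>\<^bsub>M\<^esub> x = N +>\<^bsub>M\<^esub> y \<longleftrightarrow> x \<ominus>\<^bsub>M\<^esub> y \<in> N"
proof
  note N' = submoduleD[OF N]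
  assume "N +>\<^bsub>M\<^esub> x = N +>\<^bsub>M\<^esub> y"
  moreover have "\<zero>\<^bsub>M\<^esub> \<oplus>\<^bsub>M\<^esub> x \<in> N +>\<^bsub>M\<^esub> x" using N' xy by (intro M.a_rcosI) auto
  ultimately have "x \<in> N +>\<^bsub>M\<^esub> y" using xy by simp
  then obtain n where n: "n \<in> N" "x = n \<oplus>\<^bsub>M\<^esub> y" unfolding a_r_coset_def' by blast
  have "x \<ominus>\<^bsub>M\<^esub> y = n" using n xy N'(2) by (simp add: M.minus_eq M.a_assoc M.r_neg)
  then show "x \<ominus>\<^bsub>M\<^esub> y \<in> N" using n by simp
next
  note N' = submoduleD[OF N]
  assume d: "x \<ominus>\<^bsub>M\<^esub> y \<in> N"
  have "x = (x \<ominus>\<^bsub>M\<^esub> y) \<oplus>\<^bsub>M\<^esub> y" using xy by (simp add: M.minus_eq M.a_assoc M.l_neg)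
  then have "x \<in> N +>\<^bsub>M\<^esub> y" using d N' xy by (metis M.a_rcosI)
  then show "N +>\<^bsub>M\<^esub> x = N +>\<^bsub>M\<^esub> y"
    using M.a_repr_independence[of x N y] xy(2) submodule.axioms(1)[OF N] by simp
qed

lemma mem_coset_iff:
  assumes N: "submodule N R M" and y: "y \<in> carrier M"
  shows "x \<in> N +>\<^bsub>M\<^esub> y \<longleftrightarrow> x \<in> carrier M \<and> N +>\<^bsub>M\<^esub> x = N +>\<^bsub>M\<^esub> y"
proof
  note N' = submoduleD[OF N]
  assume x: "x \<in> N +>\<^bsub>M\<^esub> y"
  then have "x \<in> carrier M" using N' y unfolding a_r_coset_def' by auto
  then show "x \<in> carrier M \<and> N +>\<^bsub>M\<^esub> x = N +>\<^bsub>M\<^esub> y"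
    using M.a_repr_independence[OF x y submodule.axioms(1)[OF N]] by simp
next
  note N' = submoduleD[OF N]
  assume x: "x \<in> carrier M \<and> N +>\<^bsub>M\<^esub> x = N +>\<^bsub>M\<^esub> y"
  then have "\<zero>\<^bsub>M\<^esub> \<oplus>\<^bsub>M\<^esub> x \<in> N +>\<^bsub>M\<^esub> x" using N' by (intro M.a_rcosI) auto
  then show "x \<in> N +>\<^bsub>M\<^esub> y" using x by simp
qed

lemma quot_props:
  assumes N: "submodule N R M"
  shows "carrier (quot_module M N) = (\<lambda>x. N +>\<^bsub>M\<^esub> x) ` carrier M"
    "\<zero>\<^bsub>quot_module M N\<^esub> = N +>\<^bsub>M\<^esub> \<zero>\<^bsub>M\<^esub>"
    "\<And>x y. x \<in> carrier M \<Longrightarrow> y \<in> carrier M \<Longrightarrow>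
      (N +>\<^bsub>M\<^esub> x) \<oplus>\<^bsub>quot_module M N\<^esub> (N +>\<^bsub>M\<^esub> y) = N +>\<^bsub>M\<^esub> (x \<oplus>\<^bsub>M\<^esub> y)"
    "\<And>a x. a \<in> carrier R \<Longrightarrow> x \<in> carrier M \<Longrightarrow> a \<odot>\<^bsub>quot_module M N\<^esub> (N +>\<^bsub>M\<^esub> x) = N +>\<^bsub>M\<^esub> (a \<odot>\<^bsub>M\<^esub> x)"
    "module R (quot_module M N)"
proof -
  note N' = submoduleD[OF N]
  interpret A: abelian_subgroup N M
    by (rule abelian_subgroupI3[OF additive_subgroup.intro[OF submodule.axioms(1)[OF N]] M.abelian_group_axioms])
  show 1: "carrier (quot_module M N) = (\<lambda>x. N +>\<^bsub>M\<^esub> x) ` carrier M"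
    unfolding quot_module_def A_RCOSETS_def' by auto
  show 2: "\<zero>\<^bsub>quot_module M N\<^esub> = N +>\<^bsub>M\<^esub> \<zero>\<^bsub>M\<^esub>"
    unfolding quot_module_def using N' by simp
  show 3: "\<And>x y. x \<in> carrier M \<Longrightarrow> y \<in> carrier M \<Longrightarrow>
      (N +>\<^bsub>M\<^esub> x) \<oplus>\<^bsub>quot_module M N\<^esub> (N +>\<^bsub>M\<^esub> y) = N +>\<^bsub>M\<^esub> (x \<oplus>\<^bsub>M\<^esub> y)"
    unfolding quot_module_def by (simp add: A.a_rcos_sum)
  show 4: "a \<odot>\<^bsub>quot_module M N\<^esub> (N +>\<^bsub>M\<^esub> x) = N +>\<^bsub>M\<^esub> (a \<odot>\<^bsub>M\<^esub> x)" if ax: "a \<in> carrier R" "x \<in> carrier M" for a x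
  proof -
    have const: "N +>\<^bsub>M\<^esub> (a \<odot>\<^bsub>M\<^esub> y) = N +>\<^bsub>M\<^esub> (a \<odot>\<^bsub>M\<^esub> x)" if y: "y \<in> N +>\<^bsub>M\<^esub> x" for y
    proof -
      have yc: "y \<in> carrier M" "y \<ominus>\<^bsub>M\<^esub> x \<in> N" using y ax coset_eq_iff[OF N] mem_coset_iff[OF N ax(2)] by auto
      have "a \<odot>\<^bsub>M\<^esub> y \<ominus>\<^bsub>M\<^esub> a \<odot>\<^bsub>M\<^esub> x = a \<odot>\<^bsub>M\<^esub> (y \<ominus>\<^bsub>M\<^esub> x)"
        using ax yc by (simp add: M.minus_eq smult_r_distr smult_r_minus)
      then show ?thesis using coset_eq_iff[OF N] ax yc N'(7) by simp
    qed
    have "x \<in> N +>\<^bsub>M\<^esub> x" using mem_coset_iff[OF N ax(2)] ax by blast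
    then have "(\<Union>y\<in>N +>\<^bsub>M\<^esub> x. N +>\<^bsub>M\<^esub> (a \<odot>\<^bsub>M\<^esub> y)) = N +>\<^bsub>M\<^esub> (a \<odot>\<^bsub>M\<^esub> x)"
      by (intro SUP_eq_const) (blast, rule const)
    then show ?thesis unfolding quot_module_def by simp
  qed
  show "module R (quot_module M N)"
    by (rule module_image[OF module_axioms 1 3 2 4])
qed

lemma coset_zero_iff:
  assumes "submodule N R M" "x \<in> carrier M"
  shows "N +>\<^bsub>M\<^esub> x = \<zero>\<^bsub>quot_module M N\<^esub> \<longleftrightarrow> x \<in> N"
proof -
  have "\<zero>\<^bsub>M\<^esub> \<oplus>\<^bsub>M\<^esub> \<zero>\<^bsub>M\<^esub> = \<zero>\<^bsub>M\<^esub>" by simp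
  then have "\<ominus>\<^bsub>M\<^esub> \<zero>\<^bsub>M\<^esub> = \<zero>\<^bsub>M\<^esub>" by (rule M.minus_equality) simp_all
  then have "x \<ominus>\<^bsub>M\<^esub> \<zero>\<^bsub>M\<^esub> = x" unfolding M.minus_eq using assms(2) by (metis M.r_zero)
  then show ?thesis using assms by (simp add: quot_props coset_eq_iff)
qed

lemma submodule_gen:
  assumes "S \<subseteq> carrier M"
  shows "submodule (submodule_gen R M S) R M" "S \<subseteq> submodule_gen R M S"
    "\<And>N. submodule N R M \<Longrightarrow> S \<subseteq> N \<Longrightarrow> submodule_gen R M S \<subseteq> N"
proof -
  show "submodule (submodule_gen R M S) R M" unfolding submodule_gen_def
  proof (rule submodule_intro)
    show "\<Inter>{N. submodule N R M \<and> S \<subseteq> N} \<subseteq> carrier M" using carrier_is_submodule assms by blast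
  qed (auto simp: submoduleD)
qed (auto simp: submodule_gen_def)

end

lemma (in cring) ring_module: "module R (ring_module R)"
proof (rule moduleI)
  show "cring R" by (rule is_cring)
  show "abelian_group (ring_module R)"
  proof (rule abelian_groupI)
    fix x assume "x \<in> carrier (ring_module R)"
    then show "\<exists>y\<in>carrier (ring_module R). y \<oplus>\<^bsub>ring_module R\<^esub> x = \<zero>\<^bsub>ring_module R\<^esub>"
      unfolding ring_module_def by (intro bexI[of _ "\<ominus> x"]) (auto simp: l_neg)
  qed (auto simp: ring_module_def a_ac)
qed (auto simp: ring_module_def l_distr r_distr m_assoc)

lemma (in cring) ring_module_simps [simp]:
  "carrier (ring_module R) = carrier R" "x \<oplus>\<^bsub>ring_module R\<^esub> y = x \<oplus> y" "\<zero>\<^bsub>ring_module R\<^esub> = \<zero>"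
  "x \<odot>\<^bsub>ring_module R\<^esub> y = x \<otimes> y"
  by (simp_all add: ring_module_def)

lemma (in cring) ring_module_neg: "\<ominus>\<^bsub>ring_module R\<^esub> x = \<ominus> x" "x \<ominus>\<^bsub>ring_module R\<^esub> y = x \<ominus> y"
  by (simp_all add: ring_module_def a_minus_def a_inv_def m_inv_def)

lemma (in cring) ring_submodule_iff: "submodule I R (ring_module R) \<longleftrightarrow> ideal I R"
proof -
  interpret RM: module R "ring_module R" by (rule ring_module)
  show ?thesis
  proof
    assume "submodule I R (ring_module R)"
    from RM.submoduleD[OF this] show "ideal I R" by (intro ideal_intro) auto
  next
    assume "ideal I R"
    from idealD[OF this] show "submodule I R (ring_module R)" by (intro RM.submodule_intro) auto
  qed
qed

lemma (in cring) free_module: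
  fixes B :: "'m set"
  shows "module R (free_module R B)"
proof (rule moduleI)
  have fin: "finite {m. v m \<oplus> w m \<noteq> \<zero>}" if "finite {m. v m \<noteq> \<zero>}" "finite {m. w m \<noteq> \<zero>}" for v w :: "'m \<Rightarrow> 'a"
    by (rule finite_subset[OF _ finite_UnI[OF that]]) auto
  have fin': "finite {m. a \<otimes> v m \<noteq> \<zero>}" if "finite {m. v m \<noteq> \<zero>}" "a \<in> carrier R" for v :: "'m \<Rightarrow> 'a" and a
    by (rule finite_subset[OF _ that(1)]) (use that in auto)
  have c: "v m \<in> carrier R" if "v \<in> carrier (free_module R B)" for v m
    using that unfolding free_module_def by (cases "m \<in> B") auto
  show "cring R" by (rule is_cring)
  show "abelian_group (free_module R B)"
  proof (rule abelian_groupI)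
    fix v w assume vw: "v \<in> carrier (free_module R B)" "w \<in> carrier (free_module R B)"
    then show "v \<oplus>\<^bsub>free_module R B\<^esub> w \<in> carrier (free_module R B)"
      using fin[of v w] unfolding free_module_def by auto
    show "v \<oplus>\<^bsub>free_module R B\<^esub> w = w \<oplus>\<^bsub>free_module R B\<^esub> v"
      using c[OF vw(1)] c[OF vw(2)] unfolding free_module_def by (auto simp: a_comm)
    fix u assume "u \<in> carrier (free_module R B)"
    then show "v \<oplus>\<^bsub>free_module R B\<^esub> w \<oplus>\<^bsub>free_module R B\<^esub> u = v \<oplus>\<^bsub>free_module R B\<^esub> (w \<oplus>\<^bsub>free_module R B\<^esub> u)"
      using c[OF vw(1)] c[OF vw(2)] c[of u] unfolding free_module_def by (auto simp: a_assoc)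
  next
    fix v assume v: "v \<in> carrier (free_module R B)"
    show "\<zero>\<^bsub>free_module R B\<^esub> \<oplus>\<^bsub>free_module R B\<^esub> v = v" using c[OF v] unfolding free_module_def by auto
    have "(\<lambda>m. \<ominus> \<one> \<otimes> v m) \<in> carrier (free_module R B)"
      using v fin'[of v "\<ominus> \<one>"] unfolding free_module_def by auto
    moreover have "(\<lambda>m. \<ominus> \<one> \<otimes> v m) \<oplus>\<^bsub>free_module R B\<^esub> v = \<zero>\<^bsub>free_module R B\<^esub>"
      using c[OF v] unfolding free_module_def by (auto simp: l_minus l_neg)
    ultimately show "\<exists>y\<in>carrier (free_module R B). y \<oplus>\<^bsub>free_module R B\<^esub> v = \<zero>\<^bsub>free_module R B\<^esub>" by blast
  qed (auto simp: free_module_def)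
  fix a v assume av: "a \<in> carrier R" "v \<in> carrier (free_module R B)"
  show "a \<odot>\<^bsub>free_module R B\<^esub> v \<in> carrier (free_module R B)"
    using av fin'[of v a] unfolding free_module_def by auto
  { fix w assume w: "w \<in> carrier (free_module R B)"
    show "a \<odot>\<^bsub>free_module R B\<^esub> (v \<oplus>\<^bsub>free_module R B\<^esub> w) =
        a \<odot>\<^bsub>free_module R B\<^esub> v \<oplus>\<^bsub>free_module R B\<^esub> a \<odot>\<^bsub>free_module R B\<^esub> w"
      using c[OF av(2)] c[OF w] av unfolding free_module_def by (auto simp: r_distr) }
  { fix b assume b: "b \<in> carrier R"
    show "(a \<oplus> b) \<odot>\<^bsub>free_module R B\<^esub> v = a \<odot>\<^bsub>free_module R B\<^esub> v \<oplus>\<^bsub>free_module R B\<^esub> b \<odot>\<^bsub>free_module R B\<^esub> v"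
      "(a \<otimes> b) \<odot>\<^bsub>free_module R B\<^esub> v = a \<odot>\<^bsub>free_module R B\<^esub> (b \<odot>\<^bsub>free_module R B\<^esub> v)"
      using c[OF av(2)] av b unfolding free_module_def by (auto simp: l_distr m_assoc) }
next
  fix v assume v: "v \<in> carrier (free_module R B)"
  have "v m \<in> carrier R" for m using v unfolding free_module_def by (cases "m \<in> B") auto
  then show "\<one> \<odot>\<^bsub>free_module R B\<^esub> v = v" unfolding free_module_def by simp
qed

section \<open>Base change\<close>

locale base_change_data = ring_endo R s + X: module R X
  for R :: "('a, 'x) ring_scheme" (structure) and s and X :: "('a, 'c, 'y) module_scheme" (structure)
begin

abbreviation "F \<equiv> free_module R (carrier X)"
abbreviation "rels \<equiv> base_change_rels R s X"
abbreviation "BC \<equiv> base_change R s X"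
abbreviation "tens a m \<equiv> tensor R s X a m"

sublocale F: module R F by (rule free_module)

lemma F_simps:
  "v \<oplus>\<^bsub>F\<^esub> w = (\<lambda>m. v m \<oplus>\<^bsub>R\<^esub> w m)" "\<zero>\<^bsub>F\<^esub> = (\<lambda>_. \<zero>\<^bsub>R\<^esub>)" "a \<odot>\<^bsub>F\<^esub> v = (\<lambda>m. a \<otimes>\<^bsub>R\<^esub> v m)"
  by (simp_all add: free_module_def)

lemma F_carrier: "v \<in> carrier F \<longleftrightarrow> (\<forall>m\<in>carrier X. v m \<in> carrier R) \<and> (\<forall>m. m \<notin> carrier X \<longrightarrow> v m = \<zero>\<^bsub>R\<^esub>) \<and>
    finite {m. v m \<noteq> \<zero>\<^bsub>R\<^esub>}"
  by (simp add: free_module_def)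

lemma F_coeff: "v \<in> carrier F \<Longrightarrow> v m \<in> carrier R"
  unfolding F_carrier by (cases "m \<in> carrier X") auto

lemma single_F: "m \<in> carrier X \<Longrightarrow> a \<in> carrier R \<Longrightarrow> single R m a \<in> carrier F"
  unfolding F_carrier single_def
  by (auto intro: finite_subset[of _ "{m}"] split: if_splits)

lemma single_add: "a \<in> carrier R \<Longrightarrow> b \<in> carrier R \<Longrightarrow> single R m (a \<oplus>\<^bsub>R\<^esub> b) = single R m a \<oplus>\<^bsub>F\<^esub> single R m b"
  unfolding F_simps single_def by auto

lemma single_smult: "a \<in> carrier R \<Longrightarrow> b \<in> carrier R \<Longrightarrow> a \<odot>\<^bsub>F\<^esub> single R m b = single R m (a \<otimes>\<^bsub>R\<^esub> b)"
  unfolding F_simps single_def by auto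

abbreviation "gens \<equiv>
  {single R (m \<oplus>\<^bsub>X\<^esub> m') \<one>\<^bsub>R\<^esub> \<ominus>\<^bsub>F\<^esub> (single R m \<one>\<^bsub>R\<^esub> \<oplus>\<^bsub>F\<^esub> single R m' \<one>\<^bsub>R\<^esub>) | m m'. m \<in> carrier X \<and> m' \<in> carrier X} \<union>
  {single R (r \<odot>\<^bsub>X\<^esub> m) \<one>\<^bsub>R\<^esub> \<ominus>\<^bsub>F\<^esub> (s r \<odot>\<^bsub>F\<^esub> single R m \<one>\<^bsub>R\<^esub>) | r m. r \<in> carrier R \<and> m \<in> carrier X}"

lemma gens_F: "gens \<subseteq> carrier F"
  by (auto intro!: F.M.minus_closed F.M.a_closed F.smult_closed single_F X.smult_closed)

lemma rels_def': "rels = submodule_gen R F gens"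
  unfolding base_change_rels_def Let_def ..

lemma rels: "submodule rels R F" and gens_rels: "gens \<subseteq> rels"
  and rels_least: "\<And>N. submodule N R F \<Longrightarrow> gens \<subseteq> N \<Longrightarrow> rels \<subseteq> N"
  unfolding rels_def' using F.submodule_gen[OF gens_F] by auto

lemma BC_eq: "BC = quot_module F rels"
  unfolding base_change_def ..

lemma BC_module: "module R BC"
  unfolding BC_eq by (rule F.quot_props(5)[OF rels])

sublocale BC: module R BC by (rule BC_module)

lemma tens_closed [simp, intro]: "a \<in> carrier R \<Longrightarrow> m \<in> carrier X \<Longrightarrow> tens a m \<in> carrier BC"
  unfolding tensor_def BC_eq F.quot_props(1)[OF rels] using single_F by blast

lemma tens_add_left:
  "a \<in> carrier R \<Longrightarrow> b \<in> carrier R \<Longrightarrow> m \<in> carrier X \<Longrightarrow> tens (a \<oplus>\<^bsub>R\<^esub> b) m = tens a m \<oplus>\<^bsub>BC\<^esub> tens b m"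
  unfolding tensor_def BC_eq by (simp add: F.quot_props(3)[OF rels] single_F single_add)

lemma tens_smult:
  "a \<in> carrier R \<Longrightarrow> b \<in> carrier R \<Longrightarrow> m \<in> carrier X \<Longrightarrow> a \<odot>\<^bsub>BC\<^esub> tens b m = tens (a \<otimes>\<^bsub>R\<^esub> b) m"
  unfolding tensor_def BC_eq by (simp add: F.quot_props(4)[OF rels] single_F single_smult)

lemma tens_add_right:
  assumes "a \<in> carrier R" "m \<in> carrier X" "m' \<in> carrier X"
  shows "tens a (m \<oplus>\<^bsub>X\<^esub> m') = tens a m \<oplus>\<^bsub>BC\<^esub> tens a m'"
proof -
  have s: "single R m \<one>\<^bsub>R\<^esub> \<in> carrier F" "single R m' \<one>\<^bsub>R\<^esub> \<in> carrier F" "single R (m \<oplus>\<^bsub>X\<^esub> m') \<one>\<^bsub>R\<^esub> \<in> carrier F"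
    using assms single_F by auto
  have "single R (m \<oplus>\<^bsub>X\<^esub> m') \<one>\<^bsub>R\<^esub> \<ominus>\<^bsub>F\<^esub> (single R m \<one>\<^bsub>R\<^esub> \<oplus>\<^bsub>F\<^esub> single R m' \<one>\<^bsub>R\<^esub>) \<in> rels"
    using gens_rels assms by blast
  then have "tens \<one>\<^bsub>R\<^esub> (m \<oplus>\<^bsub>X\<^esub> m') = tens \<one>\<^bsub>R\<^esub> m \<oplus>\<^bsub>BC\<^esub> tens \<one>\<^bsub>R\<^esub> m'"
    unfolding tensor_def BC_eq using s by (simp add: F.quot_props(3)[OF rels] F.coset_eq_iff[OF rels])
  then have "a \<odot>\<^bsub>BC\<^esub> tens \<one>\<^bsub>R\<^esub> (m \<oplus>\<^bsub>X\<^esub> m') = a \<odot>\<^bsub>BC\<^esub> (tens \<one>\<^bsub>R\<^esub> m \<oplus>\<^bsub>BC\<^esub> tens \<one>\<^bsub>R\<^esub> m')" by simp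
  then show ?thesis using assms by (simp add: BC.smult_r_distr tens_smult)
qed

lemma tens_balanced:
  assumes "a \<in> carrier R" "r \<in> carrier R" "m \<in> carrier X"
  shows "tens a (r \<odot>\<^bsub>X\<^esub> m) = tens (a \<otimes>\<^bsub>R\<^esub> s r) m"
proof -
  have s: "single R m \<one>\<^bsub>R\<^esub> \<in> carrier F" "single R (r \<odot>\<^bsub>X\<^esub> m) \<one>\<^bsub>R\<^esub> \<in> carrier F"
    using assms single_F by auto
  have "single R (r \<odot>\<^bsub>X\<^esub> m) \<one>\<^bsub>R\<^esub> \<ominus>\<^bsub>F\<^esub> (s r \<odot>\<^bsub>F\<^esub> single R m \<one>\<^bsub>R\<^esub>) \<in> rels"
    using gens_rels assms by blast
  then have "tens \<one>\<^bsub>R\<^esub> (r \<odot>\<^bsub>X\<^esub> m) = s r \<odot>\<^bsub>BC\<^esub> tens \<one>\<^bsub>R\<^esub> m"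
    unfolding tensor_def BC_eq using s assms by (simp add: F.quot_props(4)[OF rels] F.coset_eq_iff[OF rels])
  then have "a \<odot>\<^bsub>BC\<^esub> tens \<one>\<^bsub>R\<^esub> (r \<odot>\<^bsub>X\<^esub> m) = a \<odot>\<^bsub>BC\<^esub> (s r \<odot>\<^bsub>BC\<^esub> tens \<one>\<^bsub>R\<^esub> m)" by simp
  then show ?thesis using assms by (simp add: tens_smult)
qed

lemma tens_zero: "m \<in> carrier X \<Longrightarrow> tens \<zero>\<^bsub>R\<^esub> m = \<zero>\<^bsub>BC\<^esub>"
  using tens_smult[of "\<zero>\<^bsub>R\<^esub>" "\<zero>\<^bsub>R\<^esub>" m] by simp

lemma F_induct:
  assumes v: "v \<in> carrier F" and z: "Q \<zero>\<^bsub>F\<^esub>"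
    and step: "\<And>a m w. \<lbrakk>a \<in> carrier R; m \<in> carrier X; w \<in> carrier F; w m = \<zero>\<^bsub>R\<^esub>; Q w\<rbrakk> \<Longrightarrow> Q (single R m a \<oplus>\<^bsub>F\<^esub> w)"
  shows "Q v"
proof -
  have "finite A \<Longrightarrow> v \<in> carrier F \<Longrightarrow> {m. v m \<noteq> \<zero>\<^bsub>R\<^esub>} \<subseteq> A \<Longrightarrow> Q v" for A and v :: "'c \<Rightarrow> 'a"
  proof (induction A arbitrary: v rule: finite_induct)
    case empty
    then have "v = \<zero>\<^bsub>F\<^esub>" unfolding F_simps by auto
    then show ?case using z by simp
  next
    case (insert m A)
    show ?case
    proof (cases "v m = \<zero>\<^bsub>R\<^esub>")
      case True
      then show ?thesis using insert by (intro insert.IH) auto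
    next
      case False
      then have m: "m \<in> carrier X" using insert.prems unfolding F_carrier by blast
      let ?w = "v(m := \<zero>\<^bsub>R\<^esub>)"
      have w: "?w \<in> carrier F" using insert.prems(1) unfolding F_carrier
        by (auto intro: finite_subset[of _ "{m. v m \<noteq> \<zero>\<^bsub>R\<^esub>}"])
      have "Q ?w" using insert.prems(2) by (intro insert.IH w) auto
      then have "Q (single R m (v m) \<oplus>\<^bsub>F\<^esub> ?w)" using step[of "v m" m ?w] m w F_coeff[OF insert.prems(1)] by simp
      moreover have "single R m (v m) \<oplus>\<^bsub>F\<^esub> ?w = v" unfolding F_simps single_def
        using F_coeff[OF insert.prems(1)] by auto
      ultimately show ?thesis by simp
    qed
  qed
  then show ?thesis using v unfolding F_carrier by blast
qed

lemma BC_rep: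
  assumes "U \<in> carrier BC" obtains v where "v \<in> carrier F" "U = rels +>\<^bsub>F\<^esub> v"
  using assms unfolding BC_eq F.quot_props(1)[OF rels] by blast

lemma BC_induct:
  assumes U: "U \<in> carrier BC" and z: "Q \<zero>\<^bsub>BC\<^esub>"
    and tens: "\<And>a m. a \<in> carrier R \<Longrightarrow> m \<in> carrier X \<Longrightarrow> Q (tens a m)"
    and add: "\<And>U V. \<lbrakk>U \<in> carrier BC; V \<in> carrier BC; Q U; Q V\<rbrakk> \<Longrightarrow> Q (U \<oplus>\<^bsub>BC\<^esub> V)"
  shows "Q U"
proof -
  obtain v where v: "v \<in> carrier F" "U = rels +>\<^bsub>F\<^esub> v" using BC_rep[OF U] .
  have "Q (rels +>\<^bsub>F\<^esub> v)" using v(1)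
  proof (rule F_induct)
    show "Q (rels +>\<^bsub>F\<^esub> \<zero>\<^bsub>F\<^esub>)" using z unfolding BC_eq F.quot_props(2)[OF rels] .
    fix a m w assume h: "a \<in> carrier R" "m \<in> carrier X" "w \<in> carrier F" "Q (rels +>\<^bsub>F\<^esub> w)"
    have "rels +>\<^bsub>F\<^esub> (single R m a \<oplus>\<^bsub>F\<^esub> w) = tens a m \<oplus>\<^bsub>BC\<^esub> (rels +>\<^bsub>F\<^esub> w)"
      unfolding tensor_def BC_eq using h single_F by (simp add: F.quot_props(3)[OF rels])
    moreover have "rels +>\<^bsub>F\<^esub> w \<in> carrier BC" unfolding BC_eq F.quot_props(1)[OF rels] using h by blast
    ultimately show "Q (rels +>\<^bsub>F\<^esub> (single R m a \<oplus>\<^bsub>F\<^esub> w))" using add tens h by simp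
  qed
  then show ?thesis using v by simp
qed

text \<open>With \<open>\<rho> = id\<close> this covers \<open>R\<close>-linear extensions; other \<open>\<rho>\<close> are needed for
  \<^const>\<open>base_change_comp\<close>, whose inner extension is only semilinear.\<close>

definition balanced :: "('a, 't, 'z) module_scheme \<Rightarrow> ('a \<Rightarrow> 'a) \<Rightarrow> ('a \<Rightarrow> 'c \<Rightarrow> 't) \<Rightarrow> bool" where
  "balanced T \<rho> k \<longleftrightarrow> (\<forall>a\<in>carrier R. \<forall>m\<in>carrier X. k a m \<in> carrier T \<and>
     (\<forall>b\<in>carrier R. \<rho> b \<in> carrier R \<and> k (a \<oplus>\<^bsub>R\<^esub> b) m = k a m \<oplus>\<^bsub>T\<^esub> k b m \<and> k (b \<otimes>\<^bsub>R\<^esub> a) m = \<rho> b \<odot>\<^bsub>T\<^esub> k a m) \<and>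
     (\<forall>m'\<in>carrier X. k a (m \<oplus>\<^bsub>X\<^esub> m') = k a m \<oplus>\<^bsub>T\<^esub> k a m') \<and>
     (\<forall>r\<in>carrier R. k a (r \<odot>\<^bsub>X\<^esub> m) = k (a \<otimes>\<^bsub>R\<^esub> s r) m))"

text \<open>The universal property of the base change, in a semilinear version. The finite sum
  \<open>L\<close> is defined on the free module and kills the relations, so the representative
  selected by \<open>SOME\<close> is immaterial.\<close>

lemma tensor_ext:
  assumes T: "module R T" and k: "balanced T \<rho> k"
  shows "\<And>U. U \<in> carrier BC \<Longrightarrow> tensor_ext R T k U \<in> carrier T"
    "\<And>a m. a \<in> carrier R \<Longrightarrow> m \<in> carrier X \<Longrightarrow> tensor_ext R T k (tens a m) = k a m"
    "\<And>U V. U \<in> carrier BC \<Longrightarrow> V \<in> carrier BC \<Longrightarrow>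
      tensor_ext R T k (U \<oplus>\<^bsub>BC\<^esub> V) = tensor_ext R T k U \<oplus>\<^bsub>T\<^esub> tensor_ext R T k V"
    "\<And>a U. a \<in> carrier R \<Longrightarrow> U \<in> carrier BC \<Longrightarrow> tensor_ext R T k (a \<odot>\<^bsub>BC\<^esub> U) = \<rho> a \<odot>\<^bsub>T\<^esub> tensor_ext R T k U"
    "tensor_ext R T k \<zero>\<^bsub>BC\<^esub> = \<zero>\<^bsub>T\<^esub>"
proof -
  interpret T: module R T by fact
  have k: "\<And>a m. a \<in> carrier R \<Longrightarrow> m \<in> carrier X \<Longrightarrow> k a m \<in> carrier T"
    "\<And>a b m. a \<in> carrier R \<Longrightarrow> b \<in> carrier R \<Longrightarrow> m \<in> carrier X \<Longrightarrow> k (a \<oplus>\<^bsub>R\<^esub> b) m = k a m \<oplus>\<^bsub>T\<^esub> k b m"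
    "\<And>a b m. a \<in> carrier R \<Longrightarrow> b \<in> carrier R \<Longrightarrow> m \<in> carrier X \<Longrightarrow> k (b \<otimes>\<^bsub>R\<^esub> a) m = \<rho> b \<odot>\<^bsub>T\<^esub> k a m"
    "\<And>a m m'. a \<in> carrier R \<Longrightarrow> m \<in> carrier X \<Longrightarrow> m' \<in> carrier X \<Longrightarrow> k a (m \<oplus>\<^bsub>X\<^esub> m') = k a m \<oplus>\<^bsub>T\<^esub> k a m'"
    "\<And>a r m. a \<in> carrier R \<Longrightarrow> r \<in> carrier R \<Longrightarrow> m \<in> carrier X \<Longrightarrow> k a (r \<odot>\<^bsub>X\<^esub> m) = k (a \<otimes>\<^bsub>R\<^esub> s r) m"
    using k unfolding balanced_def by blast+
  have \<rho>: "\<And>b. b \<in> carrier R \<Longrightarrow> carrier X \<noteq> {} \<Longrightarrow> \<rho> b \<in> carrier R"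
    using assms(2) unfolding balanced_def by (metis one_closed all_not_in_conv)
  have ne: "carrier X \<noteq> {}" using X.M.zero_closed by blast
  have k0: "k \<zero>\<^bsub>R\<^esub> m = \<zero>\<^bsub>T\<^esub>" if "m \<in> carrier X" for m
  proof -
    have "k \<zero>\<^bsub>R\<^esub> m \<oplus>\<^bsub>T\<^esub> k \<zero>\<^bsub>R\<^esub> m = k \<zero>\<^bsub>R\<^esub> m" using k(2)[of "\<zero>\<^bsub>R\<^esub>" "\<zero>\<^bsub>R\<^esub>" m] that by simp
    then show ?thesis using k(1) that by (metis zero_closed T.M.add.r_cancel_one')
  qed
  define L where "L v = finsum T (\<lambda>m. k (v m) m) {m. v m \<noteq> \<zero>\<^bsub>R\<^esub>}" for v
  have sub: "{m. v m \<noteq> \<zero>\<^bsub>R\<^esub>} \<subseteq> carrier X" "finite {m. v m \<noteq> \<zero>\<^bsub>R\<^esub>}" if "v \<in> carrier F" for v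
    using that unfolding F_carrier by auto
  \<comment> \<open>Sums over different supports can be compared only over a common finite index
    set; the added terms vanish.\<close>
  have Lsup: "L v = finsum T (\<lambda>m. k (v m) m) A" if "v \<in> carrier F" "finite A" "{m. v m \<noteq> \<zero>\<^bsub>R\<^esub>} \<subseteq> A" "A \<subseteq> carrier X" for v A
    unfolding L_def using that k0 k(1) F_coeff[OF that(1)]
    by (intro T.M.add.finprod_mono_neutral_cong_left) auto
  have Lc: "L v \<in> carrier T" if "v \<in> carrier F" for v
    unfolding L_def using sub(1)[OF that] k(1) F_coeff[OF that] by (intro T.M.finsum_closed) auto
  have Ladd: "L (v \<oplus>\<^bsub>F\<^esub> w) = L v \<oplus>\<^bsub>T\<^esub> L w" if v: "v \<in> carrier F" and w: "w \<in> carrier F" for v w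
  proof -
    let ?A = "{m. v m \<noteq> \<zero>\<^bsub>R\<^esub>} \<union> {m. w m \<noteq> \<zero>\<^bsub>R\<^esub>}"
    have A: "finite ?A" "?A \<subseteq> carrier X" using sub v w by auto
    have vw: "v \<oplus>\<^bsub>F\<^esub> w \<in> carrier F" using v w by (rule F.M.a_closed)
    have "L (v \<oplus>\<^bsub>F\<^esub> w) = finsum T (\<lambda>m. k ((v \<oplus>\<^bsub>F\<^esub> w) m) m) ?A"
      using A by (intro Lsup[OF vw]) (auto simp: F_simps)
    also have "\<dots> = finsum T (\<lambda>m. k (v m) m \<oplus>\<^bsub>T\<^esub> k (w m) m) ?A"
      using A(2) k F_coeff[OF v] F_coeff[OF w] by (intro T.M.finsum_cong') (auto simp: F_simps subset_iff)
    also have "\<dots> = finsum T (\<lambda>m. k (v m) m) ?A \<oplus>\<^bsub>T\<^esub> finsum T (\<lambda>m. k (w m) m) ?A"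
      using A(2) k F_coeff[OF v] F_coeff[OF w] by (intro T.M.finsum_addf) (auto simp: subset_iff)
    also have "\<dots> = L v \<oplus>\<^bsub>T\<^esub> L w" using A by (simp add: Lsup[OF v, of ?A] Lsup[OF w, of ?A])
    finally show ?thesis .
  qed
  have Lsmult: "L (a \<odot>\<^bsub>F\<^esub> v) = \<rho> a \<odot>\<^bsub>T\<^esub> L v" if a: "a \<in> carrier R" and v: "v \<in> carrier F" for a v
  proof -
    let ?A = "{m. v m \<noteq> \<zero>\<^bsub>R\<^esub>}"
    have av: "a \<odot>\<^bsub>F\<^esub> v \<in> carrier F" using a v by (rule F.smult_closed)
    have "L (a \<odot>\<^bsub>F\<^esub> v) = finsum T (\<lambda>m. k ((a \<odot>\<^bsub>F\<^esub> v) m) m) ?A"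
      using sub[OF v] a by (intro Lsup[OF av]) (auto simp: F_simps)
    also have "\<dots> = finsum T (\<lambda>m. \<rho> a \<odot>\<^bsub>T\<^esub> k (v m) m) ?A"
      using sub(1)[OF v] k F_coeff[OF v] a \<rho>[OF a ne] by (intro T.M.finsum_cong') (auto simp: F_simps subset_iff)
    also have "\<dots> = \<rho> a \<odot>\<^bsub>T\<^esub> L v" unfolding L_def using sub[OF v] k F_coeff[OF v] \<rho>[OF a ne]
      by (intro T.finsum_smult_ldistr[symmetric]) (auto simp: subset_iff)
    finally show ?thesis .
  qed
  have Lsingle: "L (single R m a) = k a m" if a: "a \<in> carrier R" and m: "m \<in> carrier X" for a m
  proof -
    have "L (single R m a) = finsum T (\<lambda>x. k (single R m a x) x) {m}"
      using m by (intro Lsup single_F a) (auto simp: single_def)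
    also have "\<dots> = k a m" using a m k(1) by (simp add: single_def)
    finally show ?thesis .
  qed
  have L0: "L \<zero>\<^bsub>F\<^esub> = \<zero>\<^bsub>T\<^esub>" unfolding L_def F_simps by simp
  have Lneg: "L (v \<ominus>\<^bsub>F\<^esub> w) = \<zero>\<^bsub>T\<^esub>" if "v \<in> carrier F" "w \<in> carrier F" "L v = L w" for v w
  proof -
    have "L (v \<ominus>\<^bsub>F\<^esub> w) \<oplus>\<^bsub>T\<^esub> L w = L ((v \<ominus>\<^bsub>F\<^esub> w) \<oplus>\<^bsub>F\<^esub> w)" using that Ladd by simp
    also have "(v \<ominus>\<^bsub>F\<^esub> w) \<oplus>\<^bsub>F\<^esub> w = v" using that(1,2) by (simp add: F.M.minus_eq F.M.a_assoc F.M.l_neg)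
    finally have eq: "L (v \<ominus>\<^bsub>F\<^esub> w) \<oplus>\<^bsub>T\<^esub> L w = L w" using that by simp
    have c: "L (v \<ominus>\<^bsub>F\<^esub> w) \<in> carrier T" "L w \<in> carrier T" using that by (simp_all add: Lc)
    have "L (v \<ominus>\<^bsub>F\<^esub> w) = (L (v \<ominus>\<^bsub>F\<^esub> w) \<oplus>\<^bsub>T\<^esub> L w) \<oplus>\<^bsub>T\<^esub> \<ominus>\<^bsub>T\<^esub> L w"
      using c by (simp add: T.M.a_assoc T.M.r_neg)
    then show ?thesis unfolding eq using c by (simp add: T.M.r_neg)
  qed
  \<comment> \<open>The two kinds of generators of the relations are killed by additivity and by
    balancedness of \<open>k\<close>, respectively.\<close>
  have "rels \<subseteq> {v \<in> carrier F. L v = \<zero>\<^bsub>T\<^esub>}"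
  proof (rule rels_least)
    show "submodule {v \<in> carrier F. L v = \<zero>\<^bsub>T\<^esub>} R F"
      using Ladd Lsmult L0 \<rho> ne by (intro F.submodule_intro) auto
    have "L (single R (m \<oplus>\<^bsub>X\<^esub> m') \<one>\<^bsub>R\<^esub>) = L (single R m \<one>\<^bsub>R\<^esub> \<oplus>\<^bsub>F\<^esub> single R m' \<one>\<^bsub>R\<^esub>)"
      if "m \<in> carrier X" "m' \<in> carrier X" for m m'
      using that k(4) by (simp add: Ladd single_F Lsingle)
    moreover have "L (single R (r \<odot>\<^bsub>X\<^esub> m) \<one>\<^bsub>R\<^esub>) = L (s r \<odot>\<^bsub>F\<^esub> single R m \<one>\<^bsub>R\<^esub>)"
      if "r \<in> carrier R" "m \<in> carrier X" for r m
      using that k(5)[of "\<one>\<^bsub>R\<^esub>" r m] by (simp add: single_smult Lsingle)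
    ultimately show "gens \<subseteq> {v \<in> carrier F. L v = \<zero>\<^bsub>T\<^esub>}"
      using gens_F by (auto intro!: Lneg single_F F.M.a_closed F.smult_closed X.smult_closed)
  qed
  then have Lrel: "L v = L w" if "v \<in> carrier F" "w \<in> carrier F" "v \<ominus>\<^bsub>F\<^esub> w \<in> rels" for v w
  proof -
    have "L (v \<ominus>\<^bsub>F\<^esub> w) = \<zero>\<^bsub>T\<^esub>" using \<open>rels \<subseteq> _\<close> that(3) by blast
    moreover have "v = (v \<ominus>\<^bsub>F\<^esub> w) \<oplus>\<^bsub>F\<^esub> w" using that(1,2) by (simp add: F.M.minus_eq F.M.a_assoc F.M.l_neg)
    ultimately have "L v = \<zero>\<^bsub>T\<^esub> \<oplus>\<^bsub>T\<^esub> L w" using Ladd[of "v \<ominus>\<^bsub>F\<^esub> w" w] that by simp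
    then show ?thesis using Lc that by simp
  qed
  have ext: "tensor_ext R T k (rels +>\<^bsub>F\<^esub> v) = L v" if v: "v \<in> carrier F" for v
  proof -
    have "v \<in> rels +>\<^bsub>F\<^esub> v" using F.mem_coset_iff[OF rels v] v by blast
    then have "(SOME w. w \<in> rels +>\<^bsub>F\<^esub> v) \<in> rels +>\<^bsub>F\<^esub> v"
      by (rule someI[of "\<lambda>w. w \<in> rels +>\<^bsub>F\<^esub> v"])
    then have w: "(SOME w. w \<in> rels +>\<^bsub>F\<^esub> v) \<in> carrier F"
      "rels +>\<^bsub>F\<^esub> (SOME w. w \<in> rels +>\<^bsub>F\<^esub> v) = rels +>\<^bsub>F\<^esub> v"
      by (simp_all add: F.mem_coset_iff[OF rels v])
    have "L (SOME w. w \<in> rels +>\<^bsub>F\<^esub> v) = L v"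
      by (rule Lrel[OF w(1) v iffD1[OF F.coset_eq_iff[OF rels w(1) v] w(2)]])
    then show ?thesis unfolding tensor_ext_def Let_def L_def .
  qed
  { fix U assume U: "U \<in> carrier BC"
    obtain v where v: "v \<in> carrier F" "U = rels +>\<^bsub>F\<^esub> v" using BC_rep[OF U] .
    show "tensor_ext R T k U \<in> carrier T" using v ext Lc by simp
    { fix V assume V: "V \<in> carrier BC"
      obtain w where w: "w \<in> carrier F" "V = rels +>\<^bsub>F\<^esub> w" using BC_rep[OF V] .
      have "U \<oplus>\<^bsub>BC\<^esub> V = rels +>\<^bsub>F\<^esub> (v \<oplus>\<^bsub>F\<^esub> w)" using v w unfolding BC_eq by (simp add: F.quot_props(3)[OF rels])
      then show "tensor_ext R T k (U \<oplus>\<^bsub>BC\<^esub> V) = tensor_ext R T k U \<oplus>\<^bsub>T\<^esub> tensor_ext R T k V"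
        using v w ext Ladd by simp }
    { fix a assume a: "a \<in> carrier R"
      have "a \<odot>\<^bsub>BC\<^esub> U = rels +>\<^bsub>F\<^esub> (a \<odot>\<^bsub>F\<^esub> v)" using v a unfolding BC_eq by (simp add: F.quot_props(4)[OF rels])
      then show "tensor_ext R T k (a \<odot>\<^bsub>BC\<^esub> U) = \<rho> a \<odot>\<^bsub>T\<^esub> tensor_ext R T k U"
        using v a ext Lsmult by simp } }
  show "tensor_ext R T k (tens a m) = k a m" if "a \<in> carrier R" "m \<in> carrier X" for a m
    unfolding tensor_def using that ext single_F Lsingle by simp
  show "tensor_ext R T k \<zero>\<^bsub>BC\<^esub> = \<zero>\<^bsub>T\<^esub>"
    unfolding BC_eq F.quot_props(2)[OF rels] using ext[of "\<zero>\<^bsub>F\<^esub>"] L0 by simp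
qed

end

text \<open>Base change reads only carrier, addition and scalar multiplication. This identifies the
  base changes of records that differ in type or structural map, such as a sheaf and its underlying
  module.\<close>

lemma base_change_cong:
  assumes "carrier X = carrier Y" "add X = add Y" "smult X = smult Y"
  shows "base_change R s X = base_change R s Y" "tensor R s X = tensor R s Y"
proof -
  have "base_change_rels R s X = base_change_rels R s Y"
    unfolding base_change_rels_def Let_def assms ..
  then show "base_change R s X = base_change R s Y" "tensor R s X = tensor R s Y"
    unfolding base_change_def tensor_def fun_eq_iff using assms(1) by auto
qed

section \<open>Subquotients of the ring\<close>

text \<open>A module identified with \<open>J/K\<close> through \<open>h\<close>.\<close>

locale presented = cring R for R :: "('a, 'x) ring_scheme" (structure) +
  fixes X :: "('a, 'c, 'y) module_scheme" and h :: "'a \<Rightarrow> 'c" and J K :: "'a set"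
  assumes J: "ideal J R" and K: "ideal K R" and KJ: "K \<subseteq> J"
    and car: "carrier X = h ` J"
    and h_add: "\<And>y z. y \<in> J \<Longrightarrow> z \<in> J \<Longrightarrow> h y \<oplus>\<^bsub>X\<^esub> h z = h (y \<oplus> z)"
    and h_zero: "\<zero>\<^bsub>X\<^esub> = h \<zero>"
    and h_smult: "\<And>a y. a \<in> carrier R \<Longrightarrow> y \<in> J \<Longrightarrow> a \<odot>\<^bsub>X\<^esub> h y = h (a \<otimes> y)"
    and h_ker: "\<And>y. y \<in> J \<Longrightarrow> h y = \<zero>\<^bsub>X\<^esub> \<longleftrightarrow> y \<in> K"
begin

lemma is_module: "module R X"
proof -
  have "submodule J R (ring_module R)" using J ring_submodule_iff by blast
  then have M: "module R ((ring_module R)\<lparr>carrier := J\<rparr>)"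
    by (rule submodule.submodule_is_module[OF _ ring_module])
  show ?thesis
    by (rule module_image[OF M, of X h]) (simp_all add: car h_add h_zero h_smult)
qed

sublocale X: module R X by (rule is_module)

lemma h_closed: "y \<in> J \<Longrightarrow> h y \<in> carrier X" using car by blast

lemma h_eq_iff: assumes "y \<in> J" "z \<in> J" shows "h y = h z \<longleftrightarrow> y \<ominus> z \<in> K"
proof -
  note Ji = idealD[OF J]
  have d: "y \<ominus> z \<in> J" using Ji(6) assms .
  have "y = (y \<ominus> z) \<oplus> z" using assms Ji(2) by algebra
  then have eq: "h y = h (y \<ominus> z) \<oplus>\<^bsub>X\<^esub> h z" using h_add[OF d assms(2)] by simp
  have c: "h (y \<ominus> z) \<in> carrier X" "h z \<in> carrier X" using h_closed d assms by auto
  have "h y = h z \<longleftrightarrow> h (y \<ominus> z) = \<zero>\<^bsub>X\<^esub>"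
  proof
    assume "h y = h z"
    have "h (y \<ominus> z) = (h (y \<ominus> z) \<oplus>\<^bsub>X\<^esub> h z) \<oplus>\<^bsub>X\<^esub> \<ominus>\<^bsub>X\<^esub> h z" using c by (simp add: X.M.a_assoc X.M.r_neg)
    then show "h (y \<ominus> z) = \<zero>\<^bsub>X\<^esub>" using eq \<open>h y = h z\<close> c by (simp add: X.M.r_neg)
  qed (use eq c in simp)
  then show ?thesis using h_ker[OF d] by simp
qed

lemma sub_submodule: assumes "ideal J' R" "J' \<subseteq> J" shows "submodule (h ` J') R X"
proof -
  note J' = idealD[OF assms(1)]
  show ?thesis
  proof (rule X.submodule_intro)
    show "h ` J' \<subseteq> carrier X" using assms(2) car by blast
    show "\<zero>\<^bsub>X\<^esub> \<in> h ` J'" using h_zero J'(3) by blast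
    fix x assume "x \<in> h ` J'"
    then obtain y where y: "y \<in> J'" "x = h y" by blast
    { fix z assume "z \<in> h ` J'"
      then obtain w where w: "w \<in> J'" "z = h w" by blast
      have "x \<oplus>\<^bsub>X\<^esub> z = h (y \<oplus> w)" using y w assms(2) h_add by blast
      then show "x \<oplus>\<^bsub>X\<^esub> z \<in> h ` J'" using J'(4) y w by blast }
    fix a assume a: "a \<in> carrier R"
    have "a \<odot>\<^bsub>X\<^esub> x = h (a \<otimes> y)" using y a assms(2) h_smult by blast
    then show "a \<odot>\<^bsub>X\<^esub> x \<in> h ` J'" using J'(7) y a by blast
  qed
qed

lemma submodule_preimage:
  assumes N: "submodule N R X"
  obtains J' where "ideal J' R" "K \<subseteq> J'" "J' \<subseteq> J" "N = h ` J'"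
proof
  note N' = X.submoduleD[OF N] and Ji = idealD[OF J]
  show "ideal {y \<in> J. h y \<in> N} R"
  proof (rule ideal_intro)
    show "{y \<in> J. h y \<in> N} \<subseteq> carrier R" "\<zero> \<in> {y \<in> J. h y \<in> N}" using Ji(1,3) N'(3) h_zero by auto
    fix a assume a: "a \<in> {y \<in> J. h y \<in> N}"
    { fix b assume b: "b \<in> {y \<in> J. h y \<in> N}"
      then show "a \<oplus> b \<in> {y \<in> J. h y \<in> N}" using a Ji(4) N'(4)[of "h a" "h b"] h_add by auto }
    fix r assume r: "r \<in> carrier R"
    then show "r \<otimes> a \<in> {y \<in> J. h y \<in> N}" using a Ji(7) N'(7)[of r "h a"] h_smult by auto
  qed
  show "K \<subseteq> {y \<in> J. h y \<in> N}"
  proof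
    fix y assume "y \<in> K"
    then have "y \<in> J" "h y = \<zero>\<^bsub>X\<^esub>" using KJ h_ker by blast+
    then show "y \<in> {y \<in> J. h y \<in> N}" using N'(3) by simp
  qed
  show "{y \<in> J. h y \<in> N} \<subseteq> J" by blast
  show "N = h ` {y \<in> J. h y \<in> N}" using N'(1) car by auto
qed

lemma finitely_generated: assumes "noetherian_ring R" shows "fg_module R X"
proof -
  obtain A where A: "A \<subseteq> carrier R" "finite A" "J = Idl A"
    using noetherian_ring.finetely_gen[OF assms J] by blast
  have AJ: "A \<subseteq> J" unfolding A(3) by (rule genideal_self[OF A(1)])
  have S: "h ` A \<subseteq> carrier X" using AJ car by blast
  note gen = X.submodule_gen[OF S]
  obtain J' where J': "ideal J' R" "K \<subseteq> J'" "J' \<subseteq> J" "submodule_gen R X (h ` A) = h ` J'"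
    using submodule_preimage[OF gen(1)] by blast
  have "A \<subseteq> J'"
  proof
    fix a assume a: "a \<in> A"
    then obtain y where y: "y \<in> J'" "h a = h y" using gen(2) J'(4) by blast
    have "a \<ominus> y \<in> K" using h_eq_iff[of a y] y a AJ J'(3) by blast
    then have "a \<ominus> y \<in> J'" using J'(2) by blast
    then show "a \<in> J'" using ideal_cancel(3)[OF J'(1) y(1)] a A(1) by blast
  qed
  then have "J \<subseteq> J'" unfolding A(3) by (rule genideal_minimal[OF J'(1)])
  then have "submodule_gen R X (h ` A) = carrier X" using J'(3,4) car by blast
  then show ?thesis unfolding fg_module_def using is_module S A(2) by blast
qed

end

locale presented_base_change = projective_endo R s + presented R X h J K
  for R :: "('a, 'x) ring_scheme" (structure) and s and X :: "('a, 'c, 'y) module_scheme" and h J K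
begin

sublocale base_change_data R s X by unfold_locales

sublocale RM: module R "ring_module R" by (rule ring_module)

abbreviation "Q \<equiv> quot_module (ring_module R) (bracket K)"

definition cls :: "'a \<Rightarrow> 'a set" where "cls r = bracket K +>\<^bsub>ring_module R\<^esub> r"

lemma bK: "ideal (bracket K) R" by (rule bracket_ideal[OF K])

lemma bK_sub: "submodule (bracket K) R (ring_module R)" using bK ring_submodule_iff by blast

lemma Q_module: "module R Q" by (rule RM.quot_props(5)[OF bK_sub])

sublocale Q: module R Q by (rule Q_module)

lemma cls_closed [simp]: "r \<in> carrier R \<Longrightarrow> cls r \<in> carrier Q"
  unfolding cls_def RM.quot_props(1)[OF bK_sub] by simp

lemma cls_add: "r \<in> carrier R \<Longrightarrow> t \<in> carrier R \<Longrightarrow> cls r \<oplus>\<^bsub>Q\<^esub> cls t = cls (r \<oplus> t)"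
  unfolding cls_def using RM.quot_props(3)[OF bK_sub] by simp

lemma cls_smult: "a \<in> carrier R \<Longrightarrow> r \<in> carrier R \<Longrightarrow> a \<odot>\<^bsub>Q\<^esub> cls r = cls (a \<otimes> r)"
  unfolding cls_def using RM.quot_props(4)[OF bK_sub] by simp

lemma cls_zero: "\<zero>\<^bsub>Q\<^esub> = cls \<zero>"
  unfolding cls_def using RM.quot_props(2)[OF bK_sub] by simp

lemma cls_eq_iff: "r \<in> carrier R \<Longrightarrow> t \<in> carrier R \<Longrightarrow> cls r = cls t \<longleftrightarrow> r \<ominus> t \<in> bracket K"
  unfolding cls_def using RM.coset_eq_iff[OF bK_sub] by (simp add: ring_module_neg)

lemma cls_eq_zero_iff: "r \<in> carrier R \<Longrightarrow> cls r = \<zero>\<^bsub>Q\<^esub> \<longleftrightarrow> r \<in> bracket K"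
  unfolding cls_def using RM.coset_zero_iff[OF bK_sub] by simp

definition lift :: "'c \<Rightarrow> 'a" where "lift x = (SOME y. y \<in> J \<and> h y = x)"

lemma lift: "y \<in> J \<Longrightarrow> lift (h y) \<in> J \<and> h (lift (h y)) = h y"
  unfolding lift_def by (rule someI_ex) blast

definition pairing :: "'a \<Rightarrow> 'c \<Rightarrow> 'a set" where "pairing a x = cls (a \<otimes> s (lift x))"

lemma pairing: assumes a: "a \<in> carrier R" and y: "y \<in> J" shows "pairing a (h y) = cls (a \<otimes> s y)"
proof -
  have l: "lift (h y) \<in> J" "lift (h y) \<ominus> y \<in> K" using lift[OF y] h_eq_iff[of "lift (h y)" y] y by auto
  have c: "lift (h y) \<in> carrier R" "y \<in> carrier R" using l y idealD(2)[OF J] by auto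
  have "a \<otimes> s (lift (h y)) \<ominus> a \<otimes> s y = a \<otimes> s (lift (h y) \<ominus> y)"
    using a c s_closed[OF c(1)] s_closed[OF c(2)] unfolding s_minus[OF c] by algebra
  also have "\<dots> \<in> bracket K" using idealD(7)[OF bK bracket_mem[OF K l(2)] a] .
  finally show ?thesis unfolding pairing_def using a c by (simp add: cls_eq_iff)
qed

text \<open>The map \<open>s\<^sup>*(J/K) \<rightarrow> R/K\<^bsup>[s]\<^esup>\<close>, \<open>a \<otimes> y \<mapsto> a s(y)\<close>.\<close>

definition theta :: "('c \<Rightarrow> 'a) set \<Rightarrow> 'a set" where "theta = tensor_ext R Q pairing"

lemma balanced_pairing: "balanced Q (\<lambda>r. r) pairing"
proof -
  note Ji = idealD[OF J]
  have "pairing a (h y) \<in> carrier Q" if "a \<in> carrier R" "y \<in> J" for a y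
    using that Ji(2) by (simp add: pairing)
  moreover have "pairing (a \<oplus> b) (h y) = pairing a (h y) \<oplus>\<^bsub>Q\<^esub> pairing b (h y)"
    "pairing (b \<otimes> a) (h y) = b \<odot>\<^bsub>Q\<^esub> pairing a (h y)" if "a \<in> carrier R" "b \<in> carrier R" "y \<in> J" for a b y
    using that Ji(2) by (simp_all add: pairing cls_add cls_smult l_distr m_assoc)
  moreover have "pairing a (h y \<oplus>\<^bsub>X\<^esub> h z) = pairing a (h y) \<oplus>\<^bsub>Q\<^esub> pairing a (h z)"
    if "a \<in> carrier R" "y \<in> J" "z \<in> J" for a y z
    using that Ji(2,4) by (simp add: pairing cls_add h_add s_add r_distr)
  moreover have "pairing a (r \<odot>\<^bsub>X\<^esub> h y) = pairing (a \<otimes> s r) (h y)"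
    if "a \<in> carrier R" "r \<in> carrier R" "y \<in> J" for a r y
    using that Ji(2,7) by (simp add: pairing h_smult s_mult m_assoc)
  ultimately show ?thesis unfolding balanced_def car by auto
qed

lemmas theta = tensor_ext[OF Q_module balanced_pairing, folded theta_def]

lemma theta_tens: "a \<in> carrier R \<Longrightarrow> y \<in> J \<Longrightarrow> theta (tens a (h y)) = cls (a \<otimes> s y)"
  using theta(2) h_closed pairing by simp

lemma BC_induct':
  assumes U: "U \<in> carrier BC"
    and tens: "\<And>a y. a \<in> carrier R \<Longrightarrow> y \<in> J \<Longrightarrow> S (tens a (h y))"
    and add: "\<And>U V. \<lbrakk>U \<in> carrier BC; V \<in> carrier BC; S U; S V\<rbrakk> \<Longrightarrow> S (U \<oplus>\<^bsub>BC\<^esub> V)"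
  shows "S U"
  using U
proof (rule BC_induct)
  have "S (tens \<zero> (h \<zero>))" using tens idealD(3)[OF J] by simp
  then show "S \<zero>\<^bsub>BC\<^esub>" using tens_zero h_closed idealD(3)[OF J] by simp
qed (use tens add car in auto)

lemma tens_zero_right: "a \<in> carrier R \<Longrightarrow> tens a \<zero>\<^bsub>X\<^esub> = \<zero>\<^bsub>BC\<^esub>"
  using tens_balanced[of a \<zero> "\<zero>\<^bsub>X\<^esub>"] tens_zero[of "\<zero>\<^bsub>X\<^esub>"] by simp

text \<open>Summing g \<otimes> h(\<phi> r) over the dual basis gives a map from the bracket of
  \<open>J\<close> back to the base change. Keeping \<theta> in the statement makes the induction
  possible; for \<theta> = id this map undoes \<open>theta\<close>, and so yields
  injectivity.\<close>

lemma dual_sum_lift: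
  assumes "dual_sum \<theta>"
  shows "\<exists>\<epsilon>. (\<forall>r\<in>bracket J. \<epsilon> r \<in> carrier BC) \<and>
    (\<forall>r\<in>bracket J. \<forall>t\<in>bracket J. \<epsilon> (r \<oplus> t) = \<epsilon> r \<oplus>\<^bsub>BC\<^esub> \<epsilon> t) \<and>
    (\<forall>a\<in>carrier R. \<forall>y\<in>J. \<epsilon> (a \<otimes> s y) = tens (\<theta> a) (h y)) \<and> (\<forall>r\<in>bracket K. \<epsilon> r = \<zero>\<^bsub>BC\<^esub>)"
  using assms
proof (induction rule: dual_sum.induct)
  case zero
  show ?case using tens_zero h_closed by (intro exI[of _ "\<lambda>_. \<zero>\<^bsub>BC\<^esub>"]) auto
next
  case (add \<theta> \<phi> g)
  obtain \<epsilon> where "(\<forall>r\<in>bracket J. \<epsilon> r \<in> carrier BC) \<and>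
    (\<forall>r\<in>bracket J. \<forall>t\<in>bracket J. \<epsilon> (r \<oplus> t) = \<epsilon> r \<oplus>\<^bsub>BC\<^esub> \<epsilon> t) \<and>
    (\<forall>a\<in>carrier R. \<forall>y\<in>J. \<epsilon> (a \<otimes> s y) = tens (\<theta> a) (h y)) \<and> (\<forall>r\<in>bracket K. \<epsilon> r = \<zero>\<^bsub>BC\<^esub>)"
    using add.IH ..
  then have e: "\<And>r. r \<in> bracket J \<Longrightarrow> \<epsilon> r \<in> carrier BC"
    "\<And>r t. r \<in> bracket J \<Longrightarrow> t \<in> bracket J \<Longrightarrow> \<epsilon> (r \<oplus> t) = \<epsilon> r \<oplus>\<^bsub>BC\<^esub> \<epsilon> t"
    "\<And>a y. a \<in> carrier R \<Longrightarrow> y \<in> J \<Longrightarrow> \<epsilon> (a \<otimes> s y) = tens (\<theta> a) (h y)"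
    "\<And>r. r \<in> bracket K \<Longrightarrow> \<epsilon> r = \<zero>\<^bsub>BC\<^esub>" by simp_all
  note f = functionalD[OF add(2)] and g = add(3)
  have bJ: "ideal (bracket J) R" by (rule bracket_ideal[OF J])
  have fJ: "\<phi> r \<in> J" if "r \<in> bracket J" for r using functional_bracket[OF add(2) J that] .
  define \<eta> where "\<eta> r = tens g (h (\<phi> r)) \<oplus>\<^bsub>BC\<^esub> \<epsilon> r" for r
  have c: "tens g (h (\<phi> r)) \<in> carrier BC" if "r \<in> bracket J" for r using fJ[OF that] h_closed g by simp
  show ?case
  proof (intro exI[of _ \<eta>] conjI ballI)
    fix r assume r: "r \<in> bracket J"
    show "\<eta> r \<in> carrier BC" unfolding \<eta>_def using c[OF r] e(1)[OF r] by simp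
    fix t assume t: "t \<in> bracket J"
    have rt: "r \<in> carrier R" "t \<in> carrier R" using r t idealD(2)[OF bJ] by auto
    have "tens g (h (\<phi> (r \<oplus> t))) = tens g (h (\<phi> r)) \<oplus>\<^bsub>BC\<^esub> tens g (h (\<phi> t))"
      using f(2)[OF rt] fJ[OF r] fJ[OF t] g h_closed by (simp add: h_add[symmetric] tens_add_right)
    then show "\<eta> (r \<oplus> t) = \<eta> r \<oplus>\<^bsub>BC\<^esub> \<eta> t" unfolding \<eta>_def e(2)[OF r t]
      using c[OF r] c[OF t] e(1)[OF r] e(1)[OF t] by (simp add: BC.M.a_ac)
  next
    fix a y assume a: "a \<in> carrier R" and y: "y \<in> J"
    have yc: "y \<in> carrier R" using y idealD(2)[OF J] by blast
    have "\<phi> (a \<otimes> s y) = \<phi> a \<otimes> y" using f(3)[OF yc a] a yc f(1)[OF a] by (simp add: m_comm)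
    then have "tens g (h (\<phi> (a \<otimes> s y))) = tens (s (\<phi> a) \<otimes> g) (h y)"
      using tens_balanced[OF g f(1)[OF a] h_closed[OF y]] h_smult[OF f(1)[OF a] y] g f(1)[OF a] by (simp add: m_comm)
    then show "\<eta> (a \<otimes> s y) = tens (s (\<phi> a) \<otimes> g \<oplus> \<theta> a) (h y)"
      unfolding \<eta>_def e(3)[OF a y] using tens_add_left f(1)[OF a] g dual_sum_closed[OF add(1) a] h_closed[OF y] by simp
  next
    fix r assume r: "r \<in> bracket K"
    have "\<phi> r \<in> K" using functional_bracket[OF add(2) K r] .
    then have "h (\<phi> r) = \<zero>\<^bsub>X\<^esub>" using h_ker KJ by blast
    then show "\<eta> r = \<zero>\<^bsub>BC\<^esub>" unfolding \<eta>_def using e(4)[OF r] tens_zero_right[OF g] by simp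
  qed
qed

lemma theta_inverse:
  obtains \<epsilon> where "\<forall>r\<in>bracket K. \<epsilon> r = \<zero>\<^bsub>BC\<^esub>"
    "\<forall>U\<in>carrier BC. \<exists>r\<in>bracket J. theta U = cls r \<and> U = \<epsilon> r"
proof -
  obtain \<theta> where t: "dual_sum \<theta>" "\<forall>x\<in>carrier R. \<theta> x = x" using projective unfolding projective_def by blast
  obtain \<epsilon> where e: "\<forall>r\<in>bracket J. \<epsilon> r \<in> carrier BC"
    "\<forall>r\<in>bracket J. \<forall>t\<in>bracket J. \<epsilon> (r \<oplus> t) = \<epsilon> r \<oplus>\<^bsub>BC\<^esub> \<epsilon> t"
    "\<forall>a\<in>carrier R. \<forall>y\<in>J. \<epsilon> (a \<otimes> s y) = tens (\<theta> a) (h y)" "\<forall>r\<in>bracket K. \<epsilon> r = \<zero>\<^bsub>BC\<^esub>"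
    using dual_sum_lift[OF t(1)] by blast
  have bJ: "ideal (bracket J) R" by (rule bracket_ideal[OF J])
  have "\<exists>r\<in>bracket J. theta U = cls r \<and> U = \<epsilon> r" if "U \<in> carrier BC" for U
    using that
  proof (rule BC_induct')
    fix a y assume ay: "a \<in> carrier R" "y \<in> J"
    have "a \<otimes> s y \<in> bracket J" using idealD(7)[OF bJ bracket_mem[OF J ay(2)] ay(1)] .
    moreover have "tens a (h y) = \<epsilon> (a \<otimes> s y)" using e(3) t(2) ay by simp
    ultimately show "\<exists>r\<in>bracket J. theta (tens a (h y)) = cls r \<and> tens a (h y) = \<epsilon> r"
      using theta_tens[OF ay] by blast
  next
    fix U V assume UV: "U \<in> carrier BC" "V \<in> carrier BC" "\<exists>r\<in>bracket J. theta U = cls r \<and> U = \<epsilon> r"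
      "\<exists>r\<in>bracket J. theta V = cls r \<and> V = \<epsilon> r"
    then obtain r t where r: "r \<in> bracket J" "theta U = cls r" "U = \<epsilon> r"
      and t: "t \<in> bracket J" "theta V = cls t" "V = \<epsilon> t" by blast
    have "theta (U \<oplus>\<^bsub>BC\<^esub> V) = cls (r \<oplus> t)" using theta(3)[OF UV(1,2)] r t idealD(2)[OF bJ] by (simp add: cls_add)
    moreover have "U \<oplus>\<^bsub>BC\<^esub> V = \<epsilon> (r \<oplus> t)" using e(2) r t by simp
    ultimately show "\<exists>r\<in>bracket J. theta (U \<oplus>\<^bsub>BC\<^esub> V) = cls r \<and> U \<oplus>\<^bsub>BC\<^esub> V = \<epsilon> r"
      using idealD(4)[OF bJ r(1) t(1)] by blast
  qed
  then have "\<forall>U\<in>carrier BC. \<exists>r\<in>bracket J. theta U = cls r \<and> U = \<epsilon> r" by blast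
  then show ?thesis by (rule that[OF e(4)])
qed

lemma theta_range: "U \<in> carrier BC \<Longrightarrow> \<exists>r\<in>bracket J. theta U = cls r"
  using theta_inverse by metis

lemma theta_eq_zero: assumes "U \<in> carrier BC" shows "theta U = \<zero>\<^bsub>Q\<^esub> \<longleftrightarrow> U = \<zero>\<^bsub>BC\<^esub>"
proof
  assume z: "theta U = \<zero>\<^bsub>Q\<^esub>"
  obtain \<epsilon> where e: "\<forall>r\<in>bracket K. \<epsilon> r = \<zero>\<^bsub>BC\<^esub>"
    "\<forall>U\<in>carrier BC. \<exists>r\<in>bracket J. theta U = cls r \<and> U = \<epsilon> r" using theta_inverse .
  obtain r where r: "r \<in> bracket J" "theta U = cls r" "U = \<epsilon> r" using e(2) assms by blast
  have "r \<in> carrier R" using r(1) idealD(2)[OF bracket_ideal[OF J]] by blast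
  then have "r \<in> bracket K" using z r(2) cls_eq_zero_iff by metis
  then show "U = \<zero>\<^bsub>BC\<^esub>" using e(1) r(3) by simp
qed (simp add: theta(5))

lemma theta_inj: assumes "U \<in> carrier BC" "V \<in> carrier BC" "theta U = theta V" shows "U = V"
proof -
  have m: "\<ominus> \<one> \<odot>\<^bsub>BC\<^esub> V = \<ominus>\<^bsub>BC\<^esub> V" "\<ominus> \<one> \<odot>\<^bsub>Q\<^esub> theta V = \<ominus>\<^bsub>Q\<^esub> theta V"
    using assms(2) theta(1) by (simp_all add: BC.smult_l_minus Q.smult_l_minus)
  have "theta (U \<oplus>\<^bsub>BC\<^esub> \<ominus>\<^bsub>BC\<^esub> V) = theta U \<oplus>\<^bsub>Q\<^esub> \<ominus>\<^bsub>Q\<^esub> theta V"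
    using theta(3)[of U "\<ominus>\<^bsub>BC\<^esub> V"] theta(4)[of "\<ominus> \<one>" V] assms(1,2) m by simp
  also have "\<dots> = \<zero>\<^bsub>Q\<^esub>" using assms theta(1) by (simp add: Q.M.r_neg)
  finally have "U \<ominus>\<^bsub>BC\<^esub> V = \<zero>\<^bsub>BC\<^esub>" using theta_eq_zero[of "U \<oplus>\<^bsub>BC\<^esub> \<ominus>\<^bsub>BC\<^esub> V"] assms by (simp add: BC.M.minus_eq)
  then have eq: "U \<oplus>\<^bsub>BC\<^esub> \<ominus>\<^bsub>BC\<^esub> V = \<zero>\<^bsub>BC\<^esub>" by (simp add: BC.M.minus_eq)
  have "U = (U \<oplus>\<^bsub>BC\<^esub> \<ominus>\<^bsub>BC\<^esub> V) \<oplus>\<^bsub>BC\<^esub> V" using assms by (simp add: BC.M.a_assoc BC.M.l_neg)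
  then show ?thesis unfolding eq using assms by simp
qed

text \<open>With \<open>theta_range\<close> and \<open>theta_inj\<close> this identifies s^*(J/K)
  with the bracket of \<open>J\<close> modulo the bracket of \<open>K\<close>. It supplies the
  inverse images needed to restrict a structural map to a subsheaf.\<close>

lemma theta_surj: "r \<in> bracket J \<Longrightarrow> \<exists>U\<in>carrier BC. theta U = cls r"
proof -
  note bJ = bracket_ideal[OF J]
  let ?W = "{r \<in> carrier R. \<exists>U\<in>carrier BC. theta U = cls r}"
  have "bracket J \<subseteq> ?W"
  proof (rule bracket_least)
    show "ideal ?W R"
    proof (rule ideal_intro)
      show "?W \<subseteq> carrier R" by blast
      show "\<zero> \<in> ?W" using theta(5) cls_zero BC.M.zero_closed by auto
      fix r assume r: "r \<in> ?W"
      then obtain U where U: "U \<in> carrier BC" "theta U = cls r" by blast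
      { fix t assume t: "t \<in> ?W"
        then obtain V where V: "V \<in> carrier BC" "theta V = cls t" by blast
        have "theta (U \<oplus>\<^bsub>BC\<^esub> V) = cls (r \<oplus> t)" using theta(3) U V r t by (simp add: cls_add)
        then show "r \<oplus> t \<in> ?W" using U V r t BC.M.a_closed by blast }
      fix a assume a: "a \<in> carrier R"
      have "theta (a \<odot>\<^bsub>BC\<^esub> U) = cls (a \<otimes> r)" using theta(4) U r a by (simp add: cls_smult)
      then show "a \<otimes> r \<in> ?W" using U r a BC.smult_closed by blast
    qed
    show "s ` J \<subseteq> ?W"
    proof (intro subsetI, elim imageE)
      fix x y assume xy: "x = s y" "y \<in> J"
      have "y \<in> carrier R" using xy idealD(2)[OF J] by blast
      then have "theta (tens \<one> (h y)) = cls x" using theta_tens[OF one_closed xy(2)] xy by simp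
      then show "x \<in> ?W" using xy \<open>y \<in> carrier R\<close> h_closed tens_closed by blast
    qed
  qed
  then show "r \<in> bracket J \<Longrightarrow> \<exists>U\<in>carrier BC. theta U = cls r" by blast
qed

end

text \<open>A map J/K \<rightarrow> J'/K' induced by inclusion stays so after base change: in the
  coordinates of \<open>theta\<close> the same representative \<open>r\<close> serves both sides, as
  is checked on pure tensors. Subsheaves use it with K = K', images with J = J'.\<close>

lemma base_change_map_functorial:
  assumes A: "presented_base_change R s X h J K" and B: "presented_base_change R s Y k J' K'"
    and sub: "J \<subseteq> J'" "K \<subseteq> K'" and g: "\<And>y. y \<in> J \<Longrightarrow> g (h y) = k y"
    and U: "U \<in> carrier (base_change R s X)"
  shows "base_change_map R s Y g U \<in> carrier (base_change R s Y)"
    "\<And>r. r \<in> carrier R \<Longrightarrow> presented_base_change.theta R s h J K U = presented_base_change.cls R s K r \<Longrightarrow>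
      presented_base_change.theta R s k J' K' (base_change_map R s Y g U) = presented_base_change.cls R s K' r"
proof -
  interpret A: presented_base_change R s X h J K by fact
  interpret B: presented_base_change R s Y k J' K' by fact
  have gc: "g x \<in> carrier Y" if "x \<in> carrier X" for x using that g sub(1) B.h_closed unfolding A.car by auto
  have bal: "A.balanced B.BC (\<lambda>r. r) (\<lambda>a m. B.tens a (g m))"
  proof -
    have "g (h y \<oplus>\<^bsub>X\<^esub> h z) = g (h y) \<oplus>\<^bsub>Y\<^esub> g (h z)" if "y \<in> J" "z \<in> J" for y z
      using that sub(1) g A.h_add B.h_add A.idealD(4)[OF A.J] by (simp add: subset_iff)
    moreover have "g (a \<odot>\<^bsub>X\<^esub> h y) = a \<odot>\<^bsub>Y\<^esub> g (h y)" if "a \<in> carrier R" "y \<in> J" for a y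
      using that sub(1) g A.h_smult B.h_smult A.idealD(7)[OF A.J] by (simp add: subset_iff)
    ultimately have ga: "g (x \<oplus>\<^bsub>X\<^esub> z) = g x \<oplus>\<^bsub>Y\<^esub> g z" "g (a \<odot>\<^bsub>X\<^esub> x) = a \<odot>\<^bsub>Y\<^esub> g x"
      if "x \<in> carrier X" "z \<in> carrier X" "a \<in> carrier R" for x z a
      using that unfolding A.car by auto
    show ?thesis unfolding A.balanced_def
      using gc ga by (auto simp: B.tens_add_left B.tens_smult B.tens_add_right B.tens_balanced)
  qed
  note ext = A.tensor_ext[OF B.BC_module bal, folded base_change_map_def]
  show "base_change_map R s Y g U \<in> carrier (base_change R s Y)" using ext(1)[OF U] .
  have KK: "A.bracket K \<subseteq> A.bracket K'" by (rule A.bracket_mono[OF B.K sub(2)])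
  have "\<exists>t\<in>carrier R. A.theta U = A.cls t \<and> B.theta (base_change_map R s Y g U) = B.cls t"
    using U
  proof (rule A.BC_induct')
    fix a y assume ay: "a \<in> carrier R" "y \<in> J"
    have "y \<in> J'" "y \<in> carrier R" using ay sub(1) A.idealD(2)[OF A.J] by auto
    then have "A.theta (A.tens a (h y)) = A.cls (a \<otimes>\<^bsub>R\<^esub> s y)"
      "B.theta (base_change_map R s Y g (A.tens a (h y))) = B.cls (a \<otimes>\<^bsub>R\<^esub> s y)"
      using ay A.theta_tens B.theta_tens ext(2)[OF ay(1) A.h_closed[OF ay(2)]] g by auto
    then show "\<exists>t\<in>carrier R. A.theta (A.tens a (h y)) = A.cls t \<and> B.theta (base_change_map R s Y g (A.tens a (h y))) = B.cls t"
      using ay \<open>y \<in> carrier R\<close> by (intro bexI[of _ "a \<otimes>\<^bsub>R\<^esub> s y"]) auto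
  next
    fix U V assume UV: "U \<in> carrier A.BC" "V \<in> carrier A.BC"
      "\<exists>t\<in>carrier R. A.theta U = A.cls t \<and> B.theta (base_change_map R s Y g U) = B.cls t"
      "\<exists>t\<in>carrier R. A.theta V = A.cls t \<and> B.theta (base_change_map R s Y g V) = B.cls t"
    then obtain t u where t: "t \<in> carrier R" "A.theta U = A.cls t" "B.theta (base_change_map R s Y g U) = B.cls t"
      and u: "u \<in> carrier R" "A.theta V = A.cls u" "B.theta (base_change_map R s Y g V) = B.cls u" by blast
    have "A.theta (U \<oplus>\<^bsub>A.BC\<^esub> V) = A.cls (t \<oplus>\<^bsub>R\<^esub> u)"
      "B.theta (base_change_map R s Y g (U \<oplus>\<^bsub>A.BC\<^esub> V)) = B.cls (t \<oplus>\<^bsub>R\<^esub> u)"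
      using A.theta(3)[OF UV(1,2)] ext(3)[OF UV(1,2)] B.theta(3)[OF ext(1)[OF UV(1)] ext(1)[OF UV(2)]] t u
      by (auto simp: A.cls_add B.cls_add)
    then show "\<exists>t\<in>carrier R. A.theta (U \<oplus>\<^bsub>A.BC\<^esub> V) = A.cls t \<and> B.theta (base_change_map R s Y g (U \<oplus>\<^bsub>A.BC\<^esub> V)) = B.cls t"
      using t u by (intro bexI[of _ "t \<oplus>\<^bsub>R\<^esub> u"]) auto
  qed
  then obtain t where t: "t \<in> carrier R" "A.theta U = A.cls t" "B.theta (base_change_map R s Y g U) = B.cls t" by blast
  fix r assume r: "r \<in> carrier R" "A.theta U = A.cls r"
  then have "t \<ominus>\<^bsub>R\<^esub> r \<in> A.bracket K'" using t A.cls_eq_iff[OF t(1) r(1)] KK by auto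
  then show "B.theta (base_change_map R s Y g U) = B.cls r" using t r B.cls_eq_iff by simp
qed

section \<open>Gamma sheaves presented as subquotients of the ring\<close>

text \<open>Under \<open>s\<^sup>*(J/K) \<subseteq> R/K\<^bsup>[s]\<^esup>\<close> the structural map is multiplication by \<open>f\<close>.\<close>

locale presented_sheaf = presented_base_change R s X h J K
  for R :: "('a, 'x) ring_scheme" (structure) and s and X :: "('a, 'c) gamma_sheaf" and h J K +
  fixes f
  assumes f: "f \<in> carrier R"
    and gam_closed: "\<And>y. y \<in> J \<Longrightarrow> gam X (h y) \<in> carrier (base_change R s X)"
    and theta_gam: "\<And>y. y \<in> J \<Longrightarrow> presented_base_change.theta R s h J K (gam X (h y)) =
      presented_base_change.cls R s K (f \<otimes> y)"
begin

lemma level: "presented_base_change R (s ^^ n) X h J K"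
  by (intro presented_base_change.intro funpow_projective presented_axioms)

abbreviation "th n \<equiv> presented_base_change.theta R (s ^^ n) h J K"
abbreviation "cl n \<equiv> presented_base_change.cls R (s ^^ n) K"
abbreviation "brk n \<equiv> ring_endo.bracket R (s ^^ n)"
abbreviation "BCn n \<equiv> base_change R (s ^^ n) X"

text \<open>\<open>nrm n = f s(f) \<dots> s\<^sup>n\<^sup>-\<^sup>1(f)\<close> is the factor by which \<open>\<gamma>\<^sup>n\<close> multiplies.\<close>

primrec nrm :: "nat \<Rightarrow> 'a" where
  "nrm 0 = \<one>"
| "nrm (Suc n) = (s ^^ n) f \<otimes> nrm n"

lemma funpow_closed: "x \<in> carrier R \<Longrightarrow> (s ^^ n) x \<in> carrier R"
  by (induction n) auto

lemma nrm_closed [simp]: "nrm n \<in> carrier R"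
  using f funpow_closed by (induction n) auto

lemma fK: "y \<in> K \<Longrightarrow> f \<otimes> y \<in> bracket K"
proof -
  assume y: "y \<in> K"
  have yJ: "y \<in> J" "\<zero> \<in> J" "y \<in> carrier R" using y KJ idealD(2,3)[OF J] by auto
  have "h y = h \<zero>" using y yJ h_ker h_zero by simp
  then have "cls (f \<otimes> y) = cls (f \<otimes> \<zero>)" using theta_gam[OF yJ(1)] theta_gam[OF yJ(2)] by simp
  then show "f \<otimes> y \<in> bracket K" using f yJ cls_eq_iff[of "f \<otimes> y" \<zero>] by (simp add: minus_eq)
qed

lemma fJ: "y \<in> J \<Longrightarrow> f \<otimes> y \<in> bracket J"
proof -
  assume y: "y \<in> J"
  have c: "y \<in> carrier R" using y idealD(2)[OF J] by blast
  obtain r where r: "r \<in> bracket J" "theta (gam X (h y)) = cls r" using theta_range[OF gam_closed[OF y]] by blast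
  have rc: "r \<in> carrier R" using r idealD(2)[OF bracket_ideal[OF J]] by blast
  have "f \<otimes> y \<ominus> r \<in> bracket J"
    using r theta_gam[OF y] cls_eq_iff[of "f \<otimes> y" r] rc f c bracket_mono[OF J KJ] by auto
  then show "f \<otimes> y \<in> bracket J" using ideal_cancel(3)[OF bracket_ideal[OF J] r(1)] f c by simp
qed

lemma gam_carrier: "x \<in> carrier X \<Longrightarrow> gam X x \<in> carrier BC"
  using gam_closed car by auto

lemma gam_add:
  assumes "x \<in> carrier X" "x' \<in> carrier X"
  shows "gam X (x \<oplus>\<^bsub>X\<^esub> x') = gam X x \<oplus>\<^bsub>BC\<^esub> gam X x'"
proof -
  obtain y z where y: "y \<in> J" "x = h y" and z: "z \<in> J" "x' = h z" using assms car by auto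
  have yz: "y \<oplus> z \<in> J" "y \<in> carrier R" "z \<in> carrier R" using y z idealD(2,4)[OF J] by auto
  show ?thesis
  proof (rule theta_inj)
    show "gam X (x \<oplus>\<^bsub>X\<^esub> x') \<in> carrier BC" "gam X x \<oplus>\<^bsub>BC\<^esub> gam X x' \<in> carrier BC"
      using gam_carrier assms by auto
    show "theta (gam X (x \<oplus>\<^bsub>X\<^esub> x')) = theta (gam X x \<oplus>\<^bsub>BC\<^esub> gam X x')"
      using y z yz f by (simp add: h_add theta_gam theta(3) gam_closed cls_add r_distr)
  qed
qed

lemma gam_smult:
  assumes "a \<in> carrier R" "x \<in> carrier X"
  shows "gam X (a \<odot>\<^bsub>X\<^esub> x) = a \<odot>\<^bsub>BC\<^esub> gam X x"
proof -
  obtain y where y: "y \<in> J" "x = h y" using assms car by auto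
  have ay: "a \<otimes> y \<in> J" "y \<in> carrier R" using y assms idealD(2,7)[OF J] by auto
  show ?thesis
  proof (rule theta_inj)
    show "gam X (a \<odot>\<^bsub>X\<^esub> x) \<in> carrier BC" "a \<odot>\<^bsub>BC\<^esub> gam X x \<in> carrier BC"
      using gam_carrier assms by auto
    show "theta (gam X (a \<odot>\<^bsub>X\<^esub> x)) = theta (a \<odot>\<^bsub>BC\<^esub> gam X x)"
      using y ay f assms by (simp add: h_smult theta_gam theta(4) gam_closed cls_smult m_lcomm)
  qed
qed

lemma funpow_Suc_apply: "(s ^^ Suc n) x = (s ^^ n) (s x)"
  by (simp add: funpow_swap1)

lemma brk_Suc: "ideal I R \<Longrightarrow> brk (Suc n) I = brk n (bracket I)"
proof -
  interpret N: ring_endo R "s ^^ n" by (rule funpow_endo)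
  show "ideal I R \<Longrightarrow> brk (Suc n) I = brk n (bracket I)"
    by (rule N.bracket_compose[OF ring_endo_axioms funpow_endo funpow_Suc_apply])
qed

text \<open>In the coordinates of \<open>theta\<close> the transition map is multiplication by
  s^n(f). The proof follows a pure tensor through the base-changed structural map and the canonical
  isomorphism, and then removes the dependence on the representative.\<close>

lemma gamma_step:
  notes funpow.simps [simp del]
  assumes U: "U \<in> carrier (BCn n)"
  shows "gamma_step R s X n U \<in> carrier (BCn (Suc n))"
    "\<And>r. r \<in> carrier R \<Longrightarrow> th n U = cl n r \<Longrightarrow> th (Suc n) (gamma_step R s X n U) = cl (Suc n) ((s ^^ n) f \<otimes> r)"
proof -
  interpret N: presented_base_change R "s ^^ n" X h J K by (rule level)
  interpret N1: presented_base_change R "s ^^ Suc n" X h J K by (rule level)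
  interpret B: base_change_data R "s ^^ n" BC by unfold_locales
  note Jc = idealD(2)[OF J]
  have balg: "N.balanced B.BC (\<lambda>r. r) (\<lambda>a m. B.tens a (gam X m))"
    unfolding N.balanced_def using gam_carrier
    by (auto simp: gam_add gam_smult B.tens_add_left B.tens_add_right B.tens_smult B.tens_balanced)
  note bcm = N.tensor_ext[OF B.BC_module balg, folded base_change_map_def]
  \<comment> \<open>The inner extension sends b \<otimes> m to s^n(b) \<otimes> m, so it is only
    s^n-semilinear; the outer extension below is linear again.\<close>
  have bali: "balanced N1.BC (s ^^ n) (\<lambda>b m. N1.tens ((s ^^ n) b) m)"
    unfolding balanced_def
    by (auto simp: N.s_add N.s_mult N1.tens_add_left N1.tens_add_right N1.tens_smult N1.tens_balanced funpow_Suc_apply)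
  define inner where "inner = tensor_ext R N1.BC (\<lambda>b m. N1.tens ((s ^^ n) b) m)"
  note inn = tensor_ext[OF N1.BC_module bali, folded inner_def]
  have balo: "B.balanced N1.BC (\<lambda>r. r) (\<lambda>a V. a \<odot>\<^bsub>N1.BC\<^esub> inner V)"
    unfolding B.balanced_def
    by (auto simp: inn N1.BC.smult_l_distr N1.BC.smult_r_distr N1.BC.smult_assoc1)
  define comp where "comp = tensor_ext R N1.BC (\<lambda>a V. a \<odot>\<^bsub>N1.BC\<^esub> inner V)"
  note cmp = B.tensor_ext[OF N1.BC_module balo, folded comp_def]
  have step: "gamma_step R s X n V = comp (base_change_map R (s ^^ n) BC (gam X) V)" for V
    unfolding gamma_step_def base_change_comp_def Let_def funpow_Suc_right[symmetric] comp_def inner_def by simp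
  show c: "gamma_step R s X n U \<in> carrier (BCn (Suc n))" unfolding step using cmp(1) bcm(1) U by blast
  have in1: "\<exists>v\<in>carrier R. theta V = cls v \<and> N1.theta (inner V) = N1.cls ((s ^^ n) v)" if "V \<in> carrier BC" for V
    using that
  proof (rule BC_induct')
    fix b z assume bz: "b \<in> carrier R" "z \<in> J"
    have "N1.theta (inner (tens b (h z))) = N1.cls ((s ^^ n) (b \<otimes> s z))"
      using bz Jc h_closed by (simp add: inn N1.theta_tens N.s_mult funpow_Suc_apply)
    then show "\<exists>v\<in>carrier R. theta (tens b (h z)) = cls v \<and> N1.theta (inner (tens b (h z))) = N1.cls ((s ^^ n) v)"
      using bz Jc theta_tens by (intro bexI[of _ "b \<otimes> s z"]) auto
  next
    fix V W assume VW: "V \<in> carrier BC" "W \<in> carrier BC"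
      "\<exists>v\<in>carrier R. theta V = cls v \<and> N1.theta (inner V) = N1.cls ((s ^^ n) v)"
      "\<exists>v\<in>carrier R. theta W = cls v \<and> N1.theta (inner W) = N1.cls ((s ^^ n) v)"
    then obtain v w where v: "v \<in> carrier R" "theta V = cls v" "N1.theta (inner V) = N1.cls ((s ^^ n) v)"
      and w: "w \<in> carrier R" "theta W = cls w" "N1.theta (inner W) = N1.cls ((s ^^ n) w)" by blast
    then show "\<exists>v\<in>carrier R. theta (V \<oplus>\<^bsub>BC\<^esub> W) = cls v \<and> N1.theta (inner (V \<oplus>\<^bsub>BC\<^esub> W)) = N1.cls ((s ^^ n) v)"
      using VW(1,2) by (intro bexI[of _ "v \<oplus> w"]) (simp_all add: theta(3) cls_add inn N1.theta(3) N1.cls_add N.s_add)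
  qed
  \<comment> \<open>Two representatives differ by the bracket of \<open>K\<close>, which s^n carries
    into the next iterated bracket, so the value does not depend on the one chosen.\<close>
  have in2: "N1.theta (inner V) = N1.cls ((s ^^ n) v)" if V: "V \<in> carrier BC" "v \<in> carrier R" "theta V = cls v" for V v
  proof -
    obtain w where w: "w \<in> carrier R" "theta V = cls w" "N1.theta (inner V) = N1.cls ((s ^^ n) w)" using in1[OF V(1)] by blast
    have "w \<ominus> v \<in> bracket K" using V w cls_eq_iff by simp
    then have "(s ^^ n) (w \<ominus> v) \<in> brk (Suc n) K" unfolding brk_Suc[OF K] by (rule N.bracket_mem[OF bK])
    then have "(s ^^ n) w \<ominus> (s ^^ n) v \<in> N1.bracket K" using w V by (simp add: N.s_minus)
    then show ?thesis using w V N1.cls_eq_iff by simp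
  qed
  have main: "\<exists>r\<in>carrier R. N.theta U = N.cls r \<and> N1.theta (gamma_step R s X n U) = N1.cls ((s ^^ n) f \<otimes> r)"
    unfolding step using U
  proof (rule N.BC_induct')
    fix a y assume ay: "a \<in> carrier R" "y \<in> J"
    have yc: "y \<in> carrier R" using ay Jc by blast
    have "N1.theta (comp (base_change_map R (s ^^ n) BC (gam X) (N.tens a (h y)))) = N1.cls (a \<otimes> (s ^^ n) (f \<otimes> y))"
      using ay h_closed gam_closed in2[OF gam_closed[OF ay(2)] _ theta_gam[OF ay(2)]] f yc
      by (simp add: bcm cmp inn N1.theta(4) N1.cls_smult)
    also have "a \<otimes> (s ^^ n) (f \<otimes> y) = (s ^^ n) f \<otimes> (a \<otimes> (s ^^ n) y)"
      using ay yc f by (simp add: N.s_mult m_lcomm)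
    finally show "\<exists>r\<in>carrier R. N.theta (N.tens a (h y)) = N.cls r \<and>
        N1.theta (comp (base_change_map R (s ^^ n) BC (gam X) (N.tens a (h y)))) = N1.cls ((s ^^ n) f \<otimes> r)"
      using ay yc N.theta_tens by (intro bexI[of _ "a \<otimes> (s ^^ n) y"]) auto
  next
    fix V W assume VW: "V \<in> carrier N.BC" "W \<in> carrier N.BC"
      "\<exists>r\<in>carrier R. N.theta V = N.cls r \<and> N1.theta (comp (base_change_map R (s ^^ n) BC (gam X) V)) = N1.cls ((s ^^ n) f \<otimes> r)"
      "\<exists>r\<in>carrier R. N.theta W = N.cls r \<and> N1.theta (comp (base_change_map R (s ^^ n) BC (gam X) W)) = N1.cls ((s ^^ n) f \<otimes> r)"
    then obtain v w where v: "v \<in> carrier R" "N.theta V = N.cls v"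
        "N1.theta (comp (base_change_map R (s ^^ n) BC (gam X) V)) = N1.cls ((s ^^ n) f \<otimes> v)"
      and w: "w \<in> carrier R" "N.theta W = N.cls w"
        "N1.theta (comp (base_change_map R (s ^^ n) BC (gam X) W)) = N1.cls ((s ^^ n) f \<otimes> w)" by blast
    have cV: "base_change_map R (s ^^ n) BC (gam X) V \<in> carrier B.BC" "base_change_map R (s ^^ n) BC (gam X) W \<in> carrier B.BC"
      using bcm(1) VW by auto
    show "\<exists>r\<in>carrier R. N.theta (V \<oplus>\<^bsub>N.BC\<^esub> W) = N.cls r \<and>
        N1.theta (comp (base_change_map R (s ^^ n) BC (gam X) (V \<oplus>\<^bsub>N.BC\<^esub> W))) = N1.cls ((s ^^ n) f \<otimes> r)"
      using v w VW(1,2) f cV cmp(1) by (intro bexI[of _ "v \<oplus> w"])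
        (simp_all add: N.theta(3) N.cls_add bcm(3) cmp(3) N1.theta(3) N1.cls_add r_distr)
  qed
  then obtain t where t: "t \<in> carrier R" "N.theta U = N.cls t" "N1.theta (gamma_step R s X n U) = N1.cls ((s ^^ n) f \<otimes> t)" by blast
  fix r assume r: "r \<in> carrier R" "th n U = cl n r"
  have "N.cls t = N.cls r" using t(2) r(2) by (rule trans[OF sym])
  then have "t \<ominus> r \<in> N.bracket K" using N.cls_eq_iff[OF t(1) r(1)] by blast
  \<comment> \<open>The identity is known for one representative \<open>t\<close>. For another one
    the difference is absorbed because \<open>f\<close> maps \<open>K\<close> into its bracket, a
    fact moved to level \<open>n\<close> by the colon formula.\<close>
  moreover have "N.bracket K \<subseteq> N.bracket (colon (bracket K) f)"
    using fK f idealD(2)[OF K] by (intro N.bracket_mono colon_ideal bK f) (auto simp: colon_def m_comm)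
  ultimately have "(s ^^ n) f \<otimes> (t \<ominus> r) \<in> N.bracket (bracket K)"
    using N.bracket_colon[OF bK f] t(1) r(1) by blast
  then have "(s ^^ n) f \<otimes> t \<ominus> (s ^^ n) f \<otimes> r \<in> N1.bracket K"
    unfolding brk_Suc[OF K, symmetric] using t r f by (simp add: minus_eq r_distr r_minus)
  then show "th (Suc n) (gamma_step R s X n U) = cl (Suc n) ((s ^^ n) f \<otimes> r)"
    using t r f N1.cls_eq_iff by simp
qed

lemma gamma_power:
  notes funpow.simps(2) [simp del]
  assumes "y \<in> J"
  shows "gamma_power R s X n (h y) \<in> carrier (BCn n) \<and> th n (gamma_power R s X n (h y)) = cl n (nrm n \<otimes> y)"
proof (induction n)
  case 0
  interpret N: presented_base_change R "s ^^ 0" X h J K by (rule level)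
  have "N.theta (N.tens \<one> (h y)) = N.cls (\<one> \<otimes> (s ^^ 0) y)" by (rule N.theta_tens[OF one_closed assms])
  moreover have "(s ^^ 0) y = y" "gamma_power R s X 0 (h y) = N.tens \<one> (h y)" by simp_all
  moreover have "N.tens \<one> (h y) \<in> carrier N.BC" using N.tens_closed[OF one_closed h_closed[OF assms]] .
  ultimately show ?case by (simp only: nrm.simps simp_thms)
next
  case (Suc n)
  have yc: "y \<in> carrier R" using assms idealD(2)[OF J] by blast
  show ?case using gamma_step[of "gamma_power R s X n (h y)" n] Suc yc f funpow_closed[OF f, of n]
    by (simp add: m_assoc)
qed

text \<open>\<open>theta\<close> at level \<open>n\<close> detects zero, so the vanishing of
  \<gamma>^n is membership of its multiplier's products in the iterated bracket of
  \<open>K\<close>.\<close>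

lemma nilpotent_iff:
  "nilpotent_sheaf R s X \<longleftrightarrow> (\<exists>n>0. \<forall>y\<in>J. nrm n \<otimes> y \<in> brk n K)"
proof -
  have "gamma_power R s X n (h y) = \<zero>\<^bsub>BCn n\<^esub> \<longleftrightarrow> nrm n \<otimes> y \<in> brk n K" if y: "y \<in> J" for n y
  proof -
    interpret N: presented_base_change R "s ^^ n" X h J K by (rule level)
    show ?thesis using gamma_power[OF y, of n] N.theta_eq_zero[of "gamma_power R s X n (h y)"]
      N.cls_eq_zero_iff[of "nrm n \<otimes> y"] y idealD(2)[OF J] by simp
  qed
  then show ?thesis unfolding nilpotent_sheaf_def car by simp
qed

lemma sub_sheaf_simps:
  "carrier (sub_sheaf R s X N) = N" "add (sub_sheaf R s X N) = add X" "zero (sub_sheaf R s X N) = zero X"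
  "smult (sub_sheaf R s X N) = smult X"
  "gam (sub_sheaf R s X N) = (\<lambda>x. inv_into (carrier (base_change R s (X\<lparr>carrier := N\<rparr>))) (base_change_map R s X id) (gam X x))"
  by (simp_all add: sub_sheaf_def)

lemma sub_presented:
  assumes J': "ideal J' R" "K \<subseteq> J'" "J' \<subseteq> J" and Y: "carrier Y = h ` J'" "add Y = add X" "zero Y = zero X" "smult Y = smult X"
  shows "presented_base_change R s Y h J' K"
proof (intro presented_base_change.intro projective_endo_axioms presented.intro cring_axioms presented_axioms.intro J' K)
  show "h y \<oplus>\<^bsub>Y\<^esub> h z = h (y \<oplus> z)" if "y \<in> J'" "z \<in> J'" for y z
    using h_add[OF subsetD[OF J'(3) that(1)] subsetD[OF J'(3) that(2)]] Y by simp
  show "a \<odot>\<^bsub>Y\<^esub> h y = h (a \<otimes> y)" if "a \<in> carrier R" "y \<in> J'" for a y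
    using h_smult[OF that(1) subsetD[OF J'(3) that(2)]] Y by simp
  show "(h y = \<zero>\<^bsub>Y\<^esub>) = (y \<in> K)" if "y \<in> J'" for y
    using h_ker[OF subsetD[OF J'(3) that]] Y by simp
qed (use Y h_zero in auto)

text \<open>The condition f J' \<subseteq> J'^[s] provides an inverse image of \<gamma>(h y) through
  \<open>theta_surj\<close>, and \<open>theta_inj\<close> confirms that it maps to \<gamma>(h y);
  the choice made by \<open>inv_into\<close> is therefore legitimate.\<close>

lemma sub_sheaf_presented:
  assumes J': "ideal J' R" "K \<subseteq> J'" "J' \<subseteq> J" and fJ': "\<And>y. y \<in> J' \<Longrightarrow> f \<otimes> y \<in> bracket J'"
  shows "presented_sheaf R s (sub_sheaf R s X (h ` J')) h J' K f"
    "y \<in> J' \<Longrightarrow> gam X (h y) = base_change_map R s X id (gam (sub_sheaf R s X (h ` J')) (h y))"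
proof -
  let ?S = "sub_sheaf R s X (h ` J')" and ?Y = "X\<lparr>carrier := h ` J'\<rparr>"
  have bc: "base_change R s ?Y = base_change R s ?S"
    by (rule base_change_cong) (simp_all add: sub_sheaf_simps)
  interpret S: presented_base_change R s ?S h J' K
    by (rule sub_presented[OF J']) (simp_all add: sub_sheaf_simps)
  note fun' = base_change_map_functorial[OF S.presented_base_change_axioms presented_base_change_axioms J'(3) subset_refl, of id]
  have gS: "gam ?S (h y) \<in> carrier S.BC \<and> base_change_map R s X id (gam ?S (h y)) = gam X (h y)" if y: "y \<in> J'" for y
  proof -
    have yJ: "y \<in> J" "y \<in> carrier R" using y J'(3) idealD(2)[OF J] by auto
    obtain U where U: "U \<in> carrier S.BC" "S.theta U = S.cls (f \<otimes> y)" using S.theta_surj[OF fJ'[OF y]] by blast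
    have "theta (base_change_map R s X id U) = cls (f \<otimes> y)" using fun'(2)[OF _ U(1) _ U(2)] f yJ by simp
    then have "base_change_map R s X id U = gam X (h y)"
      using theta_inj[OF fun'(1)[OF _ U(1)] gam_closed[OF yJ(1)]] theta_gam[OF yJ(1)] by simp
    then have "gam X (h y) \<in> base_change_map R s X id ` carrier S.BC" using U(1) by blast
    then show ?thesis unfolding sub_sheaf_simps(5) bc by (auto simp: inv_into_into f_inv_into_f)
  qed
  show "y \<in> J' \<Longrightarrow> gam X (h y) = base_change_map R s X id (gam ?S (h y))" using gS by simp
  show "presented_sheaf R s ?S h J' K f"
  proof (intro presented_sheaf.intro S.presented_base_change_axioms presented_sheaf_axioms.intro f)
    fix y assume y: "y \<in> J'"
    then have yJ: "y \<in> J" "y \<in> carrier R" using J'(3) idealD(2)[OF J] by auto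
    show g: "gam ?S (h y) \<in> carrier S.BC" using gS[OF y] by blast
    obtain r where r: "r \<in> bracket J'" "S.theta (gam ?S (h y)) = S.cls r" using S.theta_range[OF g] by blast
    have rc: "r \<in> carrier R" using r idealD(2)[OF bracket_ideal[OF J'(1)]] by blast
    have "cls r = theta (gam X (h y))" using fun'(2)[OF _ g rc r(2)] gS[OF y] by simp
    then show "S.theta (gam ?S (h y)) = S.cls (f \<otimes> y)" using r(2) theta_gam[OF yJ(1)] by simp
  qed
qed

lemma is_gamma_subsheaf:
  assumes "noetherian_ring R" and J': "ideal J' R" "K \<subseteq> J'" "J' \<subseteq> J" and fJ': "\<And>y. y \<in> J' \<Longrightarrow> f \<otimes> y \<in> bracket J'"
  shows "gamma_subsheaf R s X (h ` J')"
proof -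
  interpret S: presented_sheaf R s "sub_sheaf R s X (h ` J')" h J' K f by (rule sub_sheaf_presented[OF J' fJ'])
  have "id \<in> linear_maps R (sub_sheaf R s X (h ` J')) X"
    unfolding linear_maps_def using J'(3) car by (auto simp: sub_sheaf_simps)
  moreover have "gam (sub_sheaf R s X (h ` J')) \<in> linear_maps R (sub_sheaf R s X (h ` J')) S.BC"
    unfolding linear_maps_def using S.gam_carrier S.gam_add S.gam_smult by auto
  ultimately show ?thesis
    unfolding gamma_subsheaf_def coherent_gamma_sheaf_def gamma_morphism_def
    using sub_submodule[OF J'(1,3)] S.finitely_generated[OF assms(1)] sub_sheaf_presented(2)[OF J' fJ']
    by (auto simp: sub_sheaf_simps)
qed

text \<open>The converse direction: when the inclusion is a morphism, f y agrees modulo the bracket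
  of \<open>K\<close> with an element of the bracket of \<open>J'\<close>, and the latter bracket
  contains the former.\<close>

lemma gamma_subsheafE:
  assumes N: "gamma_subsheaf R s X N"
  obtains J' where "ideal J' R" "K \<subseteq> J'" "J' \<subseteq> J" "N = h ` J'" "\<forall>y\<in>J'. f \<otimes> y \<in> bracket J'"
proof -
  have sm: "submodule N R X" using N unfolding gamma_subsheaf_def by blast
  obtain J' where J': "ideal J' R" "K \<subseteq> J'" "J' \<subseteq> J" "N = h ` J'" using submodule_preimage[OF sm] .
  interpret S: presented_base_change R s "sub_sheaf R s X (h ` J')" h J' K
    by (rule sub_presented[OF J'(1-3)]) (simp_all add: sub_sheaf_simps)
  have "f \<otimes> y \<in> bracket J'" if y: "y \<in> J'" for y
  proof -
    have yJ: "y \<in> J" "y \<in> carrier R" using y J'(3) idealD(2)[OF J] by auto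
    have g: "gam (sub_sheaf R s X (h ` J')) (h y) \<in> carrier S.BC"
      using N y unfolding gamma_subsheaf_def coherent_gamma_sheaf_def linear_maps_def J'(4)
      by (auto simp: sub_sheaf_simps)
    have e: "gam X (h y) = base_change_map R s X id (gam (sub_sheaf R s X (h ` J')) (h y))"
      using N y unfolding gamma_subsheaf_def gamma_morphism_def J'(4) by (auto simp: sub_sheaf_simps)
    obtain r where r: "r \<in> bracket J'" "S.theta (gam (sub_sheaf R s X (h ` J')) (h y)) = S.cls r" using S.theta_range[OF g] by blast
    have rc: "r \<in> carrier R" using r idealD(2)[OF bracket_ideal[OF J'(1)]] by blast
    have "theta (gam X (h y)) = cls r"
      using base_change_map_functorial(2)[OF S.presented_base_change_axioms presented_base_change_axioms J'(3) subset_refl _ g rc r(2), of id] e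
      by simp
    then have "f \<otimes> y \<ominus> r \<in> bracket K" using theta_gam[OF yJ(1)] cls_eq_iff[of "f \<otimes> y" r] f yJ rc by simp
    then have "f \<otimes> y \<ominus> r \<in> bracket J'" using bracket_mono[OF J'(1,2)] by blast
    then show ?thesis using ideal_cancel(3)[OF bracket_ideal[OF J'(1)] r(1)] f yJ by simp
  qed
  then show ?thesis using that[OF J'] by blast
qed

text \<open>Covers quotients and the image in the colimit alike. The structural map of an image is
  defined through a chosen preimage; two preimages differ by \<open>K'\<close>, and f K' \<subseteq>
  K'^[s] makes the choice harmless.\<close>

lemma image_sheaf_presented:
  assumes K': "ideal K' R" "K \<subseteq> K'" "K' \<subseteq> J" and fK': "\<And>y. y \<in> K' \<Longrightarrow> f \<otimes> y \<in> bracket K'"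
    and g_add: "\<And>y z. y \<in> J \<Longrightarrow> z \<in> J \<Longrightarrow> g (h y) \<oplus>\<^bsub>T\<^esub> g (h z) = g (h (y \<oplus> z))"
    and g_zero: "\<zero>\<^bsub>T\<^esub> = g (h \<zero>)"
    and g_smult: "\<And>a y. a \<in> carrier R \<Longrightarrow> y \<in> J \<Longrightarrow> a \<odot>\<^bsub>T\<^esub> g (h y) = g (h (a \<otimes> y))"
    and g_ker: "\<And>y. y \<in> J \<Longrightarrow> g (h y) = \<zero>\<^bsub>T\<^esub> \<longleftrightarrow> y \<in> K'"
  shows "presented_sheaf R s (image_sheaf R s X T g) (\<lambda>y. g (h y)) J K' f"
proof -
  let ?I = "T\<lparr>carrier := g ` carrier X\<rparr>" and ?S = "image_sheaf R s X T g"
  have simps: "carrier ?S = g ` carrier X" "add ?S = add T" "zero ?S = zero T" "smult ?S = smult T"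
    "gam ?S = (\<lambda>y. base_change_map R s ?I g (gam X (inv_into (carrier X) g y)))"
    unfolding image_sheaf_def Let_def by (simp_all add: module.defs gamma_sheaf.defs)
  interpret S: presented_base_change R s ?S "\<lambda>y. g (h y)" J K'
    by (intro presented_base_change.intro projective_endo_axioms presented.intro cring_axioms presented_axioms.intro J K'(1,3))
      (use g_add g_zero g_smult g_ker car in \<open>auto simp: simps\<close>)
  interpret I: presented_base_change R s ?I "\<lambda>y. g (h y)" J K'
    by (intro presented_base_change.intro projective_endo_axioms presented.intro cring_axioms presented_axioms.intro J K'(1,3))
      (use g_add g_zero g_smult g_ker car in auto)
  have bc: "base_change R s ?I = base_change R s ?S"
    by (rule base_change_cong) (simp_all add: simps)
  note fun' = base_change_map_functorial[OF presented_base_change_axioms I.presented_base_change_axioms subset_refl K'(2), of g]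
  show ?thesis
  proof (intro presented_sheaf.intro S.presented_base_change_axioms presented_sheaf_axioms.intro f)
    fix y assume y: "y \<in> J"
    have "g (h y) \<in> g ` carrier X" using h_closed[OF y] by blast
    then have inv: "inv_into (carrier X) g (g (h y)) \<in> carrier X" "g (inv_into (carrier X) g (g (h y))) = g (h y)"
      by (auto intro: inv_into_into f_inv_into_f)
    then obtain z where z: "z \<in> J" "inv_into (carrier X) g (g (h y)) = h z" using car by auto
    have gz: "g (h z) = g (h y)" using inv(2) z(2) by simp
    have c: "y \<in> carrier R" "z \<in> carrier R" using y z idealD(2)[OF J] by auto
    have gS: "gam ?S (g (h y)) = base_change_map R s ?I g (gam X (h z))" unfolding simps z(2) ..
    show "gam ?S (g (h y)) \<in> carrier S.BC" unfolding gS using fun'(1)[OF refl gam_closed[OF z(1)]] bc by simp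
    have "I.theta (gam ?S (g (h y))) = I.cls (f \<otimes> z)"
      unfolding gS using fun'(2)[OF refl gam_closed[OF z(1)] _ theta_gam[OF z(1)]] f c by simp
    moreover have "z \<ominus> y \<in> K'" using I.h_eq_iff[OF z(1) y] gz by simp
    then have "f \<otimes> (z \<ominus> y) \<in> bracket K'" by (rule fK')
    then have "f \<otimes> z \<ominus> f \<otimes> y \<in> bracket K'" using f c by (simp add: minus_eq r_distr r_minus)
    ultimately show "S.theta (gam ?S (g (h y))) = S.cls (f \<otimes> y)" using f c I.cls_eq_iff by simp
  qed
qed

lemma quot_sheaf_presented:
  assumes J': "ideal J' R" "K \<subseteq> J'" "J' \<subseteq> J" and fJ': "\<And>y. y \<in> J' \<Longrightarrow> f \<otimes> y \<in> bracket J'"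
  shows "presented_sheaf R s (quot_sheaf R s X (h ` J')) (\<lambda>y. h ` J' +>\<^bsub>X\<^esub> h y) J J' f"
proof -
  have N: "submodule (h ` J') R X" by (rule sub_submodule[OF J'(1,3)])
  note q = X.quot_props[OF N]
  note Ji = idealD[OF J]
  show ?thesis unfolding quot_sheaf_def
  proof (rule image_sheaf_presented[OF J' fJ'])
    fix y assume y: "y \<in> J"
    show "(h ` J' +>\<^bsub>X\<^esub> h y) \<oplus>\<^bsub>quot_module X (h ` J')\<^esub> (h ` J' +>\<^bsub>X\<^esub> h z) = h ` J' +>\<^bsub>X\<^esub> h (y \<oplus> z)" if z: "z \<in> J" for z
      using q(3)[OF h_closed[OF y] h_closed[OF z]] h_add[OF y z] by simp
    show "a \<odot>\<^bsub>quot_module X (h ` J')\<^esub> (h ` J' +>\<^bsub>X\<^esub> h y) = h ` J' +>\<^bsub>X\<^esub> h (a \<otimes> y)" if a: "a \<in> carrier R" for a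
      using q(4)[OF a h_closed[OF y]] h_smult[OF a y] by simp
    have "h y \<in> h ` J' \<longleftrightarrow> y \<in> J'"
    proof
      assume "h y \<in> h ` J'"
      then obtain w where w: "w \<in> J'" "h y = h w" by blast
      then have "y \<ominus> w \<in> J'" using h_eq_iff[of y w] y J'(2,3) by blast
      then show "y \<in> J'" using ideal_cancel(3)[OF J'(1) w(1)] y Ji(2) by blast
    qed blast
    then show "(h ` J' +>\<^bsub>X\<^esub> h y = \<zero>\<^bsub>quot_module X (h ` J')\<^esub>) = (y \<in> J')"
      using X.coset_zero_iff[OF N h_closed[OF y]] by simp
  qed (assumption, rule q(2)[unfolded h_zero])
qed

lemma coherent: "noetherian_ring R \<Longrightarrow> coherent_gamma_sheaf R s X"
  unfolding coherent_gamma_sheaf_def linear_maps_def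
  using finitely_generated gam_carrier gam_add gam_smult by auto

end

section \<open>Direct limits\<close>

locale directed_system = cring R for R (structure) +
  fixes T :: "nat \<Rightarrow> ('a, 'c, 'y) module_scheme" and t :: "nat \<Rightarrow> 'c \<Rightarrow> 'c"
  assumes T_module: "\<And>n. module R (T n)"
    and t_closed: "\<And>n x. x \<in> carrier (T n) \<Longrightarrow> t n x \<in> carrier (T (Suc n))"
    and t_add: "\<And>n x y. x \<in> carrier (T n) \<Longrightarrow> y \<in> carrier (T n) \<Longrightarrow> t n (x \<oplus>\<^bsub>T n\<^esub> y) = t n x \<oplus>\<^bsub>T (Suc n)\<^esub> t n y"
    and t_smult: "\<And>n a x. a \<in> carrier R \<Longrightarrow> x \<in> carrier (T n) \<Longrightarrow> t n (a \<odot>\<^bsub>T n\<^esub> x) = a \<odot>\<^bsub>T (Suc n)\<^esub> t n x"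
begin

abbreviation "class \<equiv> limit_class T t"

lemma push_closed: "x \<in> carrier (T n) \<Longrightarrow> push t n i x \<in> carrier (T (n + i))"
  using t_closed by (induction i) auto

lemma push_add:
  "x \<in> carrier (T n) \<Longrightarrow> y \<in> carrier (T n) \<Longrightarrow> push t n i (x \<oplus>\<^bsub>T n\<^esub> y) = push t n i x \<oplus>\<^bsub>T (n + i)\<^esub> push t n i y"
  using t_add push_closed by (induction i) auto

lemma push_smult:
  "a \<in> carrier R \<Longrightarrow> x \<in> carrier (T n) \<Longrightarrow> push t n i (a \<odot>\<^bsub>T n\<^esub> x) = a \<odot>\<^bsub>T (n + i)\<^esub> push t n i x"
  using t_smult push_closed by (induction i) auto

lemma push_push: "push t (n + i) j (push t n i x) = push t n (i + j) x"
  by (induction j) (simp_all add: add.assoc)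

lemma class_sub:
  assumes "n + i = m + j" "push t n i x = push t m j y"
  shows "class n x \<subseteq> class m y"
proof
  fix kz assume "kz \<in> class n x"
  then obtain k z a b where kz: "kz = (k, z)" "z \<in> carrier (T k)" "n + a = k + b" "push t n a x = push t k b z"
    unfolding limit_class_def by auto
  have "push t m (j + a) y = push t (n + i) a (push t n i x)" using push_push[of m j a y] assms by simp
  also have "\<dots> = push t (k + b) i (push t k b z)" using push_push[of n i a x] push_push[of n a i x] kz(3,4) by (simp add: add.commute)
  also have "\<dots> = push t k (b + i) z" by (rule push_push)
  finally have "push t m (j + a) y = push t k (b + i) z" .
  moreover have "m + (j + a) = k + (b + i)" using assms(1) kz(3) by simp
  ultimately show "kz \<in> class m y" unfolding limit_class_def kz(1) using kz(2) by blast
qed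

lemma class_eqI: "n + i = m + j \<Longrightarrow> push t n i x = push t m j y \<Longrightarrow> class n x = class m y"
  using class_sub[of n i m j x y] class_sub[of m j n i y x] by auto

lemma mem_class_self: "x \<in> carrier (T n) \<Longrightarrow> (n, x) \<in> class n x"
  unfolding limit_class_def by blast

lemma class_zero_eq_iff:
  assumes "x \<in> carrier (T 0)" "y \<in> carrier (T 0)"
  shows "class 0 x = class 0 y \<longleftrightarrow> (\<exists>i. push t 0 i x = push t 0 i y)"
proof
  assume "class 0 x = class 0 y"
  then have "(0, x) \<in> class 0 y" using mem_class_self[OF assms(1)] by simp
  then obtain i where "push t 0 i y = push t 0 i x" unfolding limit_class_def by auto
  then show "\<exists>i. push t 0 i x = push t 0 i y" by metis
next
  assume "\<exists>i. push t 0 i x = push t 0 i y"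
  then obtain i where "push t 0 i x = push t 0 i y" ..
  then show "class 0 x = class 0 y" by (rule class_eqI[OF refl])
qed

text \<open>Only classes coming from stage 0 occur in the image of M in the colimit. Arbitrary
  representatives sit at different stages, so both are pushed to a common stage and compared
  there.\<close>

lemma limit_add:
  assumes x: "x \<in> carrier (T 0)" and y: "y \<in> carrier (T 0)"
  shows "class 0 x \<oplus>\<^bsub>direct_limit T t\<^esub> class 0 y = class 0 (x \<oplus>\<^bsub>T 0\<^esub> y)"
proof -
  have *: "class (n + m) (push t n m x' \<oplus>\<^bsub>T (n + m)\<^esub> push t m n y') = class 0 (x \<oplus>\<^bsub>T 0\<^esub> y)"
    if x': "(n, x') \<in> class 0 x" and y': "(m, y') \<in> class 0 y" for n m x' y'
  proof -
    obtain i where i: "x' \<in> carrier (T n)" "push t 0 (n + i) x = push t n i x'"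
      using x' unfolding limit_class_def by auto
    obtain j where j: "y' \<in> carrier (T m)" "push t 0 (m + j) y = push t m j y'"
      using y' unfolding limit_class_def by auto
    have cx: "push t n m x' \<in> carrier (T (n + m))" and cy: "push t m n y' \<in> carrier (T (n + m))"
      using push_closed[OF i(1), of m] push_closed[OF j(1), of n] by (simp_all add: add.commute)
    have "push t (n + m) (i + j) (push t n m x') = push t 0 (n + m + (i + j)) x"
      using push_push[of n m "i + j" x'] push_push[of n i "m + j" x'] push_push[of 0 "n + i" "m + j" x] i(2)
      by (simp add: ac_simps)
    moreover have "push t (n + m) (i + j) (push t m n y') = push t 0 (n + m + (i + j)) y"
      using push_push[of m n "i + j" y'] push_push[of m j "n + i" y'] push_push[of 0 "m + j" "n + i" y] j(2)
      by (simp add: ac_simps)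
    ultimately have "push t (n + m) (i + j) (push t n m x' \<oplus>\<^bsub>T (n + m)\<^esub> push t m n y') = push t 0 (n + m + (i + j)) (x \<oplus>\<^bsub>T 0\<^esub> y)"
      using push_add[OF cx cy, of "i + j"] push_add[OF x y, of "n + m + (i + j)"] by simp
    then show ?thesis by (intro class_eqI) auto
  qed
  have "(\<Union>U\<in>class 0 x. \<Union>V\<in>class 0 y. class (fst U + fst V)
      (push t (fst U) (fst V) (snd U) \<oplus>\<^bsub>T (fst U + fst V)\<^esub> push t (fst V) (fst U) (snd V))) = class 0 (x \<oplus>\<^bsub>T 0\<^esub> y)"
  proof (intro SUP_eq_const)
    show "class 0 x \<noteq> {}" "class 0 y \<noteq> {}" using mem_class_self[OF x] mem_class_self[OF y] by blast+
    fix U V assume "U \<in> class 0 x" "V \<in> class 0 y"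
    then show "class (fst U + fst V)
      (push t (fst U) (fst V) (snd U) \<oplus>\<^bsub>T (fst U + fst V)\<^esub> push t (fst V) (fst U) (snd V)) = class 0 (x \<oplus>\<^bsub>T 0\<^esub> y)"
      by (intro *) simp_all
  qed
  then show ?thesis unfolding direct_limit_def by (simp add: case_prod_unfold)
qed

lemma limit_smult:
  assumes a: "a \<in> carrier R" and x: "x \<in> carrier (T 0)"
  shows "a \<odot>\<^bsub>direct_limit T t\<^esub> class 0 x = class 0 (a \<odot>\<^bsub>T 0\<^esub> x)"
proof -
  have *: "class n (a \<odot>\<^bsub>T n\<^esub> x') = class 0 (a \<odot>\<^bsub>T 0\<^esub> x)" if x': "(n, x') \<in> class 0 x" for n x'
  proof -
    obtain i where i: "x' \<in> carrier (T n)" "push t 0 (n + i) x = push t n i x'"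
      using x' unfolding limit_class_def by auto
    have "push t n i (a \<odot>\<^bsub>T n\<^esub> x') = push t 0 (n + i) (a \<odot>\<^bsub>T 0\<^esub> x)"
      using push_smult[OF a i(1), of i] push_smult[OF a x, of "n + i"] i(2) by simp
    then show ?thesis by (intro class_eqI) auto
  qed
  have "(\<Union>U\<in>class 0 x. class (fst U) (a \<odot>\<^bsub>T (fst U)\<^esub> snd U)) = class 0 (a \<odot>\<^bsub>T 0\<^esub> x)"
  proof (rule SUP_eq_const)
    show "class 0 x \<noteq> {}" using mem_class_self[OF x] by blast
    fix U assume "U \<in> class 0 x"
    then show "class (fst U) (a \<odot>\<^bsub>T (fst U)\<^esub> snd U) = class 0 (a \<odot>\<^bsub>T 0\<^esub> x)" by (intro *) simp
  qed
  then show ?thesis unfolding direct_limit_def by (simp add: case_prod_unfold)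
qed

end

section \<open>The image in the colimit and its smallest nil-isomorphic subsheaf\<close>

context presented_sheaf
begin

lemma gamma_system: "directed_system R BCn (gamma_step R s X)"
proof (intro directed_system.intro cring_axioms directed_system_axioms.intro)
  fix n
  interpret N: presented_base_change R "s ^^ n" X h J K by (rule level)
  interpret N1: presented_base_change R "s ^^ Suc n" X h J K by (rule level)
  have fn: "(s ^^ n) f \<in> carrier R" using f by (rule funpow_closed)
  have ex: "\<exists>u\<in>carrier R. N.theta U = N.cls u" if "U \<in> carrier (BCn n)" for U
    using N.theta_range[OF that] idealD(2)[OF N.bracket_ideal[OF J]] by blast
  show "module R (BCn n)" by (rule N.BC_module)
  fix U assume U: "U \<in> carrier (BCn n)"
  show gU: "gamma_step R s X n U \<in> carrier (BCn (Suc n))" by (rule gamma_step(1)[OF U])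
  obtain u where u: "u \<in> carrier R" "N.theta U = N.cls u" using ex[OF U] by blast
  note thU = gamma_step(2)[OF U u]
  { fix V assume V: "V \<in> carrier (BCn n)"
    note gV = gamma_step(1)[OF V]
    obtain v where v: "v \<in> carrier R" "N.theta V = N.cls v" using ex[OF V] by blast
    note thV = gamma_step(2)[OF V v]
    have UV: "U \<oplus>\<^bsub>BCn n\<^esub> V \<in> carrier (BCn n)" using U V by (rule N.BC.M.a_closed)
    have uv: "u \<oplus> v \<in> carrier R" using u v by simp
    have "N.theta (U \<oplus>\<^bsub>BCn n\<^esub> V) = N.cls (u \<oplus> v)" using N.theta(3)[OF U V] u v by (simp add: N.cls_add)
    from gamma_step(2)[OF UV uv this]
    have 1: "N1.theta (gamma_step R s X n (U \<oplus>\<^bsub>BCn n\<^esub> V)) = N1.cls ((s ^^ n) f \<otimes> (u \<oplus> v))" .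
    have "N1.theta (gamma_step R s X n U \<oplus>\<^bsub>N1.BC\<^esub> gamma_step R s X n V) = N1.cls ((s ^^ n) f \<otimes> u \<oplus> (s ^^ n) f \<otimes> v)"
      unfolding N1.theta(3)[OF gU gV] thU thV using fn u v by (intro N1.cls_add) auto
    then have 2: "N1.theta (gamma_step R s X n U \<oplus>\<^bsub>N1.BC\<^esub> gamma_step R s X n V) = N1.cls ((s ^^ n) f \<otimes> (u \<oplus> v))"
      using fn u v by (simp only: r_distr)
    show "gamma_step R s X n (U \<oplus>\<^bsub>BCn n\<^esub> V) = gamma_step R s X n U \<oplus>\<^bsub>BCn (Suc n)\<^esub> gamma_step R s X n V"
      by (rule N1.theta_inj[OF gamma_step(1)[OF UV] N1.BC.M.a_closed[OF gU gV] trans[OF 1 sym[OF 2]]]) }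
  { fix a assume a: "a \<in> carrier R"
    have aU: "a \<odot>\<^bsub>BCn n\<^esub> U \<in> carrier (BCn n)" using a U by (rule N.BC.smult_closed)
    have au: "a \<otimes> u \<in> carrier R" using a u by simp
    have "N.theta (a \<odot>\<^bsub>BCn n\<^esub> U) = N.cls (a \<otimes> u)" using N.theta(4)[OF a U] u a by (simp add: N.cls_smult)
    from gamma_step(2)[OF aU au this]
    have 1: "N1.theta (gamma_step R s X n (a \<odot>\<^bsub>BCn n\<^esub> U)) = N1.cls ((s ^^ n) f \<otimes> (a \<otimes> u))" .
    have "N1.theta (a \<odot>\<^bsub>N1.BC\<^esub> gamma_step R s X n U) = N1.cls (a \<otimes> ((s ^^ n) f \<otimes> u))"
      unfolding N1.theta(4)[OF a gU] thU using fn u a by (intro N1.cls_smult) auto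
    then have 2: "N1.theta (a \<odot>\<^bsub>N1.BC\<^esub> gamma_step R s X n U) = N1.cls ((s ^^ n) f \<otimes> (a \<otimes> u))"
      using fn u a by (simp only: m_lcomm)
    show "gamma_step R s X n (a \<odot>\<^bsub>BCn n\<^esub> U) = a \<odot>\<^bsub>BCn (Suc n)\<^esub> gamma_step R s X n U"
      by (rule N1.theta_inj[OF gamma_step(1)[OF aU] N1.BC.smult_closed[OF a gU] trans[OF 1 sym[OF 2]]]) }
qed

text \<open>The preimage in \<open>J\<close> of the kernel of the canonical map from J/K to the
  colimit: an element dies there exactly when it dies at a finite stage.\<close>

definition torsion :: "'a set" where
  "torsion = {y \<in> J. \<exists>i. nrm i \<otimes> y \<in> brk i K}"

lemma push_gamma: "push (gamma_step R s X) 0 i (gamma_power R s X 0 x) = gamma_power R s X i x"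
  by (induction i) auto

lemma to_colimit_eq: "to_colimit R s X x = limit_class BCn (gamma_step R s X) 0 (gamma_power R s X 0 x)"
  unfolding to_colimit_def by simp

text \<open>Splitting off the lowest factor instead of the highest leaves a value of
  \<open>s\<close>, which functionals can pull out.\<close>

lemma nrm_Suc: "nrm (Suc i) = f \<otimes> s (nrm i)"
proof (induction i)
  case 0 then show ?case using f by simp
next
  case (Suc i)
  have c: "(s ^^ i) f \<in> carrier R" using funpow_closed[OF f] .
  have "nrm (Suc (Suc i)) = s ((s ^^ i) f) \<otimes> (f \<otimes> s (nrm i))" using Suc by simp
  also have "\<dots> = f \<otimes> s (nrm (Suc i))" using c f by (simp add: s_mult m_lcomm)
  finally show ?case .
qed

lemma bracket_brk: "ideal I R \<Longrightarrow> brk (Suc n) I = bracket (brk n I)"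
  by (rule bracket_compose[OF funpow_endo funpow_endo]) auto

text \<open>An element killed by \<gamma>^i is killed by the next power too: f K \<subseteq> K^[s],
  transported to level \<open>i\<close> by the colon formula. This makes torsion exponents of two
  elements comparable.\<close>

lemma nrm_mem_Suc:
  assumes "y \<in> carrier R" "nrm i \<otimes> y \<in> brk i K" shows "nrm (Suc i) \<otimes> y \<in> brk (Suc i) K"
proof -
  interpret N: projective_endo R "s ^^ i" by (rule funpow_projective)
  have "N.bracket K \<subseteq> N.bracket (colon (bracket K) f)"
    using fK f idealD(2)[OF K] by (intro N.bracket_mono colon_ideal bK f) (auto simp: colon_def m_comm)
  then have "nrm i \<otimes> y \<in> N.bracket (colon (bracket K) f)" using assms(2) by blast
  then have "(s ^^ i) f \<otimes> (nrm i \<otimes> y) \<in> N.bracket (bracket K)" using N.bracket_colon[OF bK f] assms(1) by simp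
  then show ?thesis unfolding brk_Suc[OF K] using assms(1) funpow_closed[OF f, of i] by (simp add: m_assoc)
qed

lemma torsion_ideal: "ideal torsion R"
proof -
  note Ji = idealD[OF J]
  have bi: "ideal (brk n K) R" for n
  proof -
    interpret N: ring_endo R "s ^^ n" by (rule funpow_endo)
    show ?thesis by (rule N.bracket_ideal[OF K])
  qed
  have up: "nrm (i + k) \<otimes> y \<in> brk (i + k) K" if "y \<in> carrier R" "nrm i \<otimes> y \<in> brk i K" for i k y
    using that nrm_mem_Suc by (induction k) (auto simp del: nrm.simps funpow.simps)
  show ?thesis
  proof (rule ideal_intro)
    show "torsion \<subseteq> carrier R" using Ji(1) unfolding torsion_def by blast
    have "nrm 0 \<otimes> \<zero> \<in> brk 0 K" using idealD(3)[OF bi[of 0]] by simp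
    then show "\<zero> \<in> torsion" using Ji(3) unfolding torsion_def by blast
    fix a assume "a \<in> torsion"
    then obtain i where a: "a \<in> J" "a \<in> carrier R" "nrm i \<otimes> a \<in> brk i K" using Ji(2) unfolding torsion_def by blast
    { fix b assume "b \<in> torsion"
      then obtain k where b: "b \<in> J" "b \<in> carrier R" "nrm k \<otimes> b \<in> brk k K" using Ji(2) unfolding torsion_def by blast
      have "nrm (i + k) \<otimes> a \<in> brk (i + k) K" "nrm (i + k) \<otimes> b \<in> brk (i + k) K"
        using up[OF a(2,3), of k] up[OF b(2,3), of i] by (simp_all add: add.commute)
      then have "nrm (i + k) \<otimes> (a \<oplus> b) \<in> brk (i + k) K" using idealD(4)[OF bi] a b by (simp add: r_distr)
      then show "a \<oplus> b \<in> torsion" using Ji(4) a b unfolding torsion_def by blast }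
    fix r assume r: "r \<in> carrier R"
    have "nrm i \<otimes> (r \<otimes> a) \<in> brk i K" using idealD(7)[OF bi a(3) r] a r by (simp add: m_lcomm)
    then show "r \<otimes> a \<in> torsion" using Ji(7) a r unfolding torsion_def by blast
  qed
qed

text \<open>By \<open>nrm_Suc\<close>, a functional \<phi> turns
  \<open>nrm (Suc i) \<otimes> y\<close> into \<open>nrm i \<otimes> \<phi> (f \<otimes> y)\<close>
  and removes one bracket. So every \<phi>(f y) is torsion with exponent \<open>i\<close>, and
  bracket membership is tested by functionals.\<close>

lemma f_torsion: assumes "y \<in> torsion" shows "f \<otimes> y \<in> bracket torsion"
proof -
  obtain i where y: "y \<in> J" "y \<in> carrier R" "nrm i \<otimes> y \<in> brk i K" using assms idealD(2)[OF J] unfolding torsion_def by blast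
  interpret N: ring_endo R "s ^^ i" by (rule funpow_endo)
  have fy: "f \<otimes> y \<in> carrier R" using f y by simp
  show ?thesis unfolding mem_bracket_iff[OF torsion_ideal fy]
  proof (intro allI impI)
    fix \<phi> assume phi: "functional \<phi>"
    have "nrm i \<otimes> \<phi> (f \<otimes> y) = \<phi> (nrm (Suc i) \<otimes> y)"
      unfolding nrm_Suc using functionalD(3)[OF phi nrm_closed fy, of i] f y by (simp add: m_ac)
    also have "\<dots> \<in> brk i K"
      using functional_bracket[OF phi N.bracket_ideal[OF K]] nrm_mem_Suc[OF y(2,3)] unfolding bracket_brk[OF K] by blast
    finally show "\<phi> (f \<otimes> y) \<in> torsion"
      unfolding torsion_def using functional_bracket[OF phi J fJ[OF y(1)]] by blast
  qed
qed

lemma upper_presented: "presented_sheaf R s (upper_sheaf R s X) (\<lambda>y. to_colimit R s X (h y)) J torsion f"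
proof -
  interpret D: directed_system R BCn "gamma_step R s X" by (rule gamma_system)
  interpret N: presented_base_change R "s ^^ 0" X h J K by (rule level)
  have g0: "gamma_power R s X 0 x = N.tens \<one> x" for x by simp
  have c0: "gamma_power R s X 0 (h y) \<in> carrier (BCn 0)" if "y \<in> J" for y using gamma_power[OF that, of 0] by blast
  note Ji = idealD[OF J]
  show ?thesis unfolding upper_sheaf_def
  proof (rule image_sheaf_presented[OF torsion_ideal _ _ f_torsion])
    show "K \<subseteq> torsion"
    proof
      fix y assume y: "y \<in> K"
      then have "nrm 0 \<otimes> y \<in> brk 0 K" using N.bracket_mem[OF K y] idealD(2)[OF K] by simp
      then show "y \<in> torsion" using y KJ unfolding torsion_def by blast
    qed
    show "torsion \<subseteq> J" unfolding torsion_def by blast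
    have z0: "gamma_power R s X 0 (h \<zero>) = \<zero>\<^bsub>BCn 0\<^esub>"
      unfolding g0 h_zero[symmetric] by (rule N.tens_zero_right[OF one_closed])
    have zero: "\<zero>\<^bsub>gamma_colimit R s X\<^esub> = to_colimit R s X (h \<zero>)"
      unfolding to_colimit_eq z0 gamma_colimit_def direct_limit_def by simp
    show "\<zero>\<^bsub>gamma_colimit R s X\<^esub> = to_colimit R s X (h \<zero>)" by (rule zero)
    fix y assume y: "y \<in> J"
    { fix z assume z: "z \<in> J"
      have "gamma_power R s X 0 (h (y \<oplus> z)) = gamma_power R s X 0 (h y) \<oplus>\<^bsub>BCn 0\<^esub> gamma_power R s X 0 (h z)"
        unfolding g0 h_add[OF y z, symmetric] by (rule N.tens_add_right[OF one_closed h_closed[OF y] h_closed[OF z]])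
      then show "to_colimit R s X (h y) \<oplus>\<^bsub>gamma_colimit R s X\<^esub> to_colimit R s X (h z) = to_colimit R s X (h (y \<oplus> z))"
        unfolding to_colimit_eq gamma_colimit_def D.limit_add[OF c0[OF y] c0[OF z]] by simp }
    { fix a assume a: "a \<in> carrier R"
      have "gamma_power R s X 0 (h (a \<otimes> y)) = a \<odot>\<^bsub>BCn 0\<^esub> gamma_power R s X 0 (h y)"
        unfolding g0 h_smult[OF a y, symmetric] using N.tens_balanced[OF one_closed a h_closed[OF y]]
          N.tens_smult[OF a one_closed h_closed[OF y]] a by simp
      then show "a \<odot>\<^bsub>gamma_colimit R s X\<^esub> to_colimit R s X (h y) = to_colimit R s X (h (a \<otimes> y))"
        unfolding to_colimit_eq gamma_colimit_def D.limit_smult[OF a c0[OF y]] by simp }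
    have "gamma_power R s X i (h y) = gamma_power R s X i (h \<zero>) \<longleftrightarrow> nrm i \<otimes> y \<in> brk i K" for i
    proof -
      interpret I: presented_base_change R "s ^^ i" X h J K by (rule level)
      note py = gamma_power[OF y, of i] and p0 = gamma_power[OF Ji(3), of i]
      have "gamma_power R s X i (h y) = gamma_power R s X i (h \<zero>) \<longleftrightarrow>
        I.theta (gamma_power R s X i (h y)) = I.theta (gamma_power R s X i (h \<zero>))"
        by (rule iffI[OF arg_cong[of _ _ I.theta] I.theta_inj[OF conjunct1[OF py] conjunct1[OF p0]]])
      also have "\<dots> \<longleftrightarrow> I.cls (nrm i \<otimes> y) = I.cls \<zero>" using py p0 by simp
      also have "\<dots> \<longleftrightarrow> nrm i \<otimes> y \<in> brk i K" using I.cls_eq_zero_iff[of "nrm i \<otimes> y"] I.cls_zero Ji(2)[OF y] by simp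
      finally show ?thesis .
    qed
    then show "(to_colimit R s X (h y) = \<zero>\<^bsub>gamma_colimit R s X\<^esub>) = (y \<in> torsion)"
      unfolding zero to_colimit_eq D.class_zero_eq_iff[OF c0[OF y] c0[OF Ji(3)]] push_gamma torsion_def using y by simp
  qed
qed

text \<open>The kernel of the inclusion is the zero module, presented as K/K. Nilpotency asks for a
  positive exponent, and exponent one works.\<close>

lemma kernel_nilpotent:
  assumes J': "ideal J' R" "K \<subseteq> J'" "J' \<subseteq> J" and fJ': "\<And>y. y \<in> J' \<Longrightarrow> f \<otimes> y \<in> bracket J'"
  shows "nilpotent_sheaf R s (sub_sheaf R s (sub_sheaf R s X (h ` J')) {x \<in> carrier (sub_sheaf R s X (h ` J')). id x = \<zero>\<^bsub>X\<^esub>})"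
proof -
  interpret S: presented_sheaf R s "sub_sheaf R s X (h ` J')" h J' K f by (rule sub_sheaf_presented(1)[OF J' fJ'])
  have eq: "{x \<in> carrier (sub_sheaf R s X (h ` J')). id x = \<zero>\<^bsub>X\<^esub>} = h ` K"
    unfolding sub_sheaf_simps
  proof (intro equalityI subsetI)
    fix x assume "x \<in> {x \<in> h ` J'. id x = \<zero>\<^bsub>X\<^esub>}"
    then obtain y where y: "y \<in> J'" "x = h y" "h y = \<zero>\<^bsub>X\<^esub>" by auto
    then have "y \<in> K" using h_ker[OF subsetD[OF J'(3) y(1)]] by blast
    then show "x \<in> h ` K" using y(2) by blast
  next
    fix x assume "x \<in> h ` K"
    then obtain y where y: "y \<in> K" "x = h y" by blast
    have "x \<in> h ` J'" using y J'(2) by blast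
    moreover have "h y = \<zero>\<^bsub>X\<^esub>" using h_ker[OF subsetD[OF KJ y(1)]] y(1) by blast
    ultimately show "x \<in> {x \<in> h ` J'. id x = \<zero>\<^bsub>X\<^esub>}" using y(2) by simp
  qed
  interpret S2: presented_sheaf R s "sub_sheaf R s (sub_sheaf R s X (h ` J')) (h ` K)" h K K f
    by (rule S.sub_sheaf_presented(1)[OF K subset_refl J'(2) fK])
  have "\<forall>y\<in>K. nrm 1 \<otimes> y \<in> brk 1 K" using fK f by simp
  then show ?thesis unfolding eq S2.nilpotent_iff by (intro exI[of _ 1]) simp
qed

lemma quotient_nilpotent_iff:
  assumes J': "ideal J' R" "K \<subseteq> J'" "J' \<subseteq> J" and fJ': "\<And>y. y \<in> J' \<Longrightarrow> f \<otimes> y \<in> bracket J'"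
  shows "nilpotent_sheaf R s (quot_sheaf R s X (h ` J')) \<longleftrightarrow> (\<exists>n>0. \<forall>y\<in>J. nrm n \<otimes> y \<in> brk n J')"
proof -
  interpret Q: presented_sheaf R s "quot_sheaf R s X (h ` J')" "\<lambda>y. h ` J' +>\<^bsub>X\<^esub> h y" J J' f
    by (rule quot_sheaf_presented[OF J' fJ'])
  show ?thesis by (rule Q.nilpotent_iff)
qed

lemma nil_isomorphism_iff:
  assumes noeth: "noetherian_ring R"
    and J': "ideal J' R" "K \<subseteq> J'" "J' \<subseteq> J" and fJ': "\<And>y. y \<in> J' \<Longrightarrow> f \<otimes> y \<in> bracket J'"
  shows "nil_isomorphism R s (sub_sheaf R s X (h ` J')) X id \<longleftrightarrow> (\<exists>n>0. \<forall>y\<in>J. nrm n \<otimes> y \<in> brk n J')"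
  using kernel_nilpotent[OF J' fJ'] is_gamma_subsheaf[OF noeth J' fJ'] quotient_nilpotent_iff[OF J' fJ']
  unfolding nil_isomorphism_def gamma_subsheaf_def by (simp add: sub_sheaf_simps(1))

lemma ideal_mem_all_iff:
  assumes "J = carrier R" "ideal I R" shows "(\<forall>y\<in>J. nrm n \<otimes> y \<in> brk n I) \<longleftrightarrow> nrm n \<in> brk n I"
proof -
  interpret N: ring_endo R "s ^^ n" by (rule funpow_endo)
  show ?thesis using assms(1) idealD(8)[OF N.bracket_ideal[OF assms(2)]] r_one[OF nrm_closed] one_closed by metis
qed

text \<open>Subsheaves correspond to ideals between \<open>K\<close> and \<open>J\<close>, and those
  with nilpotent quotient contain \<open>C\<close>. As \<open>C\<close> itself may fail to contain
  \<open>K\<close>, the least of them is C + K, which has the same image under \<open>h\<close> as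
  \<open>C\<close>.\<close>

lemma lower_carrier:
  assumes noeth: "noetherian_ring R" and J: "J = carrier R"
    and C: "ideal C R" "\<And>y. y \<in> C \<Longrightarrow> f \<otimes> y \<in> bracket C" "n > 0" "nrm n \<in> brk n C"
    and least: "\<And>I m. ideal I R \<Longrightarrow> nrm m \<in> brk m I \<Longrightarrow> C \<subseteq> I"
  shows "carrier (lower_sheaf R s X) = h ` C"
proof -
  define D where "D = C <+>\<^bsub>R\<^esub> K"
  note Ki = idealD[OF K] and Ci = idealD[OF C(1)]
  have D: "ideal D R" unfolding D_def by (rule add_ideals[OF C(1) K])
  have mem: "x \<in> D \<longleftrightarrow> (\<exists>c\<in>C. \<exists>k\<in>K. x = c \<oplus> k)" for x unfolding D_def set_add_def' by auto
  have CD: "C \<subseteq> D"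
  proof
    fix c assume c: "c \<in> C"
    then have "c = c \<oplus> \<zero>" using Ci(2) by simp
    then show "c \<in> D" using iffD2[OF mem] c Ki(3) by blast
  qed
  have KD: "K \<subseteq> D"
  proof
    fix k assume k: "k \<in> K"
    then have "k = \<zero> \<oplus> k" using Ki(2) by simp
    then show "k \<in> D" using iffD2[OF mem] k Ci(3) by blast
  qed
  have DJ: "D \<subseteq> J" using idealD(1)[OF D] J by simp
  have fD: "f \<otimes> y \<in> bracket D" if yD: "y \<in> D" for y
  proof -
    obtain c k where y: "c \<in> C" "k \<in> K" "y = c \<oplus> k" using iffD1[OF mem yD] by blast
    have "f \<otimes> c \<in> bracket D" "f \<otimes> k \<in> bracket D"
      using C(2)[OF y(1)] fK[OF y(2)] bracket_mono[OF D CD] bracket_mono[OF D KD] by auto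
    then show ?thesis using idealD(4)[OF bracket_ideal[OF D]] f y Ci(2) Ki(2) by (simp add: r_distr)
  qed
  interpret N: ring_endo R "s ^^ n" by (rule funpow_endo)
  have nD: "nrm n \<in> brk n D" using C(4) N.bracket_mono[OF D CD] by blast
  have "(LEAST N. gamma_subsheaf R s X N \<and> nil_isomorphism R s (sub_sheaf R s X N) X id) = h ` D"
  proof (rule Least_equality)
    show "gamma_subsheaf R s X (h ` D) \<and> nil_isomorphism R s (sub_sheaf R s X (h ` D)) X id"
      using is_gamma_subsheaf[OF noeth D KD DJ fD] nil_isomorphism_iff[OF noeth D KD DJ fD]
        ideal_mem_all_iff[OF J D] nD C(3) by blast
    fix N assume N: "gamma_subsheaf R s X N \<and> nil_isomorphism R s (sub_sheaf R s X N) X id"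
    obtain J' where J': "ideal J' R" "K \<subseteq> J'" "J' \<subseteq> J" "N = h ` J'" "\<forall>y\<in>J'. f \<otimes> y \<in> bracket J'"
      using gamma_subsheafE N by blast
    then obtain m where "nrm m \<in> brk m J'"
      using nil_isomorphism_iff[OF noeth J'(1-3)] N ideal_mem_all_iff[OF J J'(1)] by blast
    then have "C \<subseteq> J'" using least J'(1) by blast
    have "D \<subseteq> J'"
    proof
      fix x assume "x \<in> D"
      then obtain c k where "c \<in> C" "k \<in> K" "x = c \<oplus> k" using iffD1[OF mem] by blast
      then show "x \<in> J'" using \<open>C \<subseteq> J'\<close> J'(2) idealD(4)[OF J'(1)] by blast
    qed
    then show "h ` D \<subseteq> N" using J'(4) by blast
  qed
  then have "carrier (lower_sheaf R s X) = h ` D" unfolding lower_sheaf_def by (simp add: sub_sheaf_simps(1))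
  also have "h ` D = h ` C"
  proof
    show "h ` D \<subseteq> h ` C"
    proof
      fix x assume "x \<in> h ` D"
      then obtain c k where ck: "c \<in> C" "k \<in> K" "x = h (c \<oplus> k)" using iffD1[OF mem] by blast
      have cc: "c \<in> carrier R" "k \<in> carrier R" using ck Ci(2) Ki(2) by auto
      have "(c \<oplus> k) \<ominus> c = k" using cc by algebra
      then have "h (c \<oplus> k) = h c" using h_eq_iff[of "c \<oplus> k" c] ck(2) cc J by simp
      then show "x \<in> h ` C" using ck by blast
    qed
  qed (use CD in blast)
  finally show ?thesis .
qed

end

lemma (in ring_endo) bracket_zero: "bracket {\<zero>} = {\<zero>}"
  using bracket_least[OF zeroideal, of "{\<zero>}"] idealD(3)[OF bracket_ideal[OF zeroideal]] by auto

lemma (in projective_endo) principal_presented: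
  assumes f: "f \<in> carrier R"
  shows "presented_sheaf R s (principal_sheaf R s f) (\<lambda>x. x) (carrier R) {\<zero>} f"
proof -
  let ?X = "principal_sheaf R s f"
  have simps: "carrier ?X = carrier R" "add ?X = add R" "zero ?X = \<zero>" "smult ?X = mult R"
    "gam ?X = (\<lambda>r. tensor R s (ring_module R) (f \<otimes> r) \<one>)"
    unfolding principal_sheaf_def by (simp_all add: module.defs gamma_sheaf.defs ring_module_def)
  interpret X: presented_base_change R s ?X "\<lambda>x. x" "carrier R" "{\<zero>}"
    by (intro presented_base_change.intro projective_endo_axioms presented.intro cring_axioms presented_axioms.intro oneideal zeroideal)
      (simp_all add: simps)
  have t: "tensor R s (ring_module R) = tensor R s ?X"
    by (rule base_change_cong(2)) (simp_all add: simps ring_module_def)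
  show ?thesis
  proof (intro presented_sheaf.intro X.presented_base_change_axioms presented_sheaf_axioms.intro f)
    fix y assume y: "y \<in> carrier R"
    then show "gam ?X y \<in> carrier X.BC" unfolding simps t using f by (intro X.tens_closed) (auto simp: simps)
    show "X.theta (gam ?X y) = X.cls (f \<otimes> y)" unfolding simps t using f y X.theta_tens[of "f \<otimes> y" \<one>] by simp
  qed
qed

text \<open>For d > 0 a q-th power is a p-th power of a p^(d-1)-th power, so generators over the
  q-th powers also generate over the p-th powers.\<close>

lemma finite_endomorphism_generates:
  fixes R (structure)
  assumes R: "cring R" and p: "(\<lambda>x. x [^] (p::nat)) \<in> ring_hom R R" and d: "d > 0"
    and fin: "finite_endomorphism R (frobenius R (p ^ d))"
  shows "\<exists>\<Gamma>. ring_endo.generates R (\<lambda>x. x [^] p) \<Gamma>"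
proof -
  interpret cring R by fact
  interpret E: ring_endo R "\<lambda>x. x [^] p" by unfold_locales (rule p)
  let ?M = "(ring_module R)\<lparr>smult := (\<lambda>a x. frobenius R (p ^ d) a \<otimes> x)\<rparr>"
  obtain \<Gamma> where \<Gamma>: "module R ?M" "\<Gamma> \<subseteq> carrier ?M" "finite \<Gamma>" "submodule_gen R ?M \<Gamma> = carrier ?M"
    using fin unfolding finite_endomorphism_def fg_module_def by blast
  interpret M: module R ?M by fact
  have c: "\<Gamma> \<subseteq> carrier R" using \<Gamma>(2) by simp
  define W where "W = {E.combination \<Gamma> a | a. a \<in> \<Gamma> \<rightarrow> carrier R}"
  obtain k where k: "d = Suc k" using d by (cases d) auto
  have frob: "frobenius R (p ^ d) a = (a [^] (p ^ k)) [^] p" if "a \<in> carrier R" for a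
    unfolding frobenius_def k using that by (simp add: nat_pow_pow mult.commute)
  have "submodule W R ?M"
  proof (rule M.submodule_intro)
    show "W \<subseteq> carrier ?M" unfolding W_def using c E.combination_closed by auto
    have "E.combination \<Gamma> (\<lambda>_. \<zero>) = \<zero>" unfolding E.combination_def using c
      by (intro trans[OF finsum_cong' finsum_zero]) (auto simp: subset_iff)
    then show "\<zero>\<^bsub>?M\<^esub> \<in> W" unfolding W_def by force
    fix x assume "x \<in> W"
    then obtain a where a: "a \<in> \<Gamma> \<rightarrow> carrier R" "x = E.combination \<Gamma> a" unfolding W_def by blast
    { fix y assume "y \<in> W"
      then obtain b where b: "b \<in> \<Gamma> \<rightarrow> carrier R" "y = E.combination \<Gamma> b" unfolding W_def by blast
      have "x \<oplus>\<^bsub>?M\<^esub> y = E.combination \<Gamma> (\<lambda>g. a g \<oplus> b g)" using E.combination_add[OF c a(1) b(1)] a b by simp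
      moreover have "(\<lambda>g. a g \<oplus> b g) \<in> \<Gamma> \<rightarrow> carrier R" using a b by auto
      ultimately show "x \<oplus>\<^bsub>?M\<^esub> y \<in> W" unfolding W_def by blast }
    fix r assume r: "r \<in> carrier R"
    have "r \<odot>\<^bsub>?M\<^esub> x = E.combination \<Gamma> (\<lambda>g. r [^] (p ^ k) \<otimes> a g)"
      using E.combination_scale[OF \<Gamma>(3) c a(1), of "r [^] (p ^ k)"] r frob[OF r] a by simp
    moreover have "(\<lambda>g. r [^] (p ^ k) \<otimes> a g) \<in> \<Gamma> \<rightarrow> carrier R" using a r by auto
    ultimately show "r \<odot>\<^bsub>?M\<^esub> x \<in> W" unfolding W_def by blast
  qed
  moreover have "\<Gamma> \<subseteq> W"
  proof
    fix g assume g: "g \<in> \<Gamma>"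
    then have "E.combination \<Gamma> (\<lambda>x. if x = g then \<one> else \<zero>) = g"
      using E.combination_single[OF \<Gamma>(3) c g one_closed] c by auto
    then show "g \<in> W" unfolding W_def by (intro CollectI exI[of _ "\<lambda>x. if x = g then \<one> else \<zero>"]) auto
  qed
  ultimately have "carrier ?M \<subseteq> W" using M.submodule_gen(3)[OF \<Gamma>(2)] \<Gamma>(4) by simp
  then have "E.generates \<Gamma>" unfolding E.generates_def W_def using \<Gamma>(3) c by auto
  then show ?thesis by blast
qed

section \<open>Minimal gamma sheaves and test ideals\<close>

text \<open>By the colon formula, s(x) = 0 puts 1 into the bracket of the annihilator of
  \<open>x\<close>. That bracket is contained in the annihilator, so x = 0.\<close>

lemma (in projective_endo) reduced:
  assumes "x \<in> carrier R" "s x = \<zero>" "\<And>y I. ideal I R \<Longrightarrow> y \<in> I \<Longrightarrow> s y \<in> I" shows "x = \<zero>"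
proof -
  have "s x \<otimes> \<one> \<in> bracket {\<zero>}" using assms bracket_zero by simp
  then have "\<one> \<in> bracket (colon {\<zero>} x)" using bracket_colon[OF zeroideal assms(1)] by simp
  then have "\<one> \<in> colon {\<zero>} x"
    using one_mem_bracketD[OF colon_ideal[OF zeroideal assms(1)]] assms(3) colon_ideal[OF zeroideal assms(1)] by blast
  then show ?thesis using assms(1) unfolding colon_def by simp
qed

context frobenius_projective
begin

lemma frobenius_projective_endo: "projective_endo R (frobenius R (p ^ d))"
proof -
  have "frobenius R (p ^ d) = (\<lambda>x. x [^] (p ^ d))" unfolding frobenius_def by (rule ext) simp
  then show ?thesis using level[of d] by simp
qed

lemma frobenius_funpow: "x \<in> carrier R \<Longrightarrow> (frobenius R (p ^ d) ^^ n) x = x [^] (p ^ (d * n))"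
proof (induction n)
  case (Suc n)
  then show ?case by (simp add: frobenius_def nat_pow_pow power_add mult.commute)
qed simp

lemma bracket_funpow:
  assumes "ideal I R"
  shows "ring_endo.bracket R (frobenius R (p ^ d) ^^ n) I = br (d * n) I"
proof -
  interpret F: projective_endo R "frobenius R (p ^ d)" by (rule frobenius_projective_endo)
  interpret N: ring_endo R "frobenius R (p ^ d) ^^ n" by (rule F.funpow_endo)
  have "(frobenius R (p ^ d) ^^ n) ` I = {x [^] (p ^ (d * n)) | x. x \<in> I}"
    using frobenius_funpow idealD(2)[OF assms] by (auto simp: image_def)
  then show ?thesis unfolding N.bracket_def bracket_power_def by simp
qed

lemma bracket_frobenius: "ideal I R \<Longrightarrow> ring_endo.bracket R (frobenius R (p ^ d)) I = br d I"
  using bracket_funpow[where n = 1] by simp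

lemma nrm_eq:
  assumes "presented_sheaf R (frobenius R (p ^ d)) X h J K f"
  shows "presented_sheaf.nrm R (frobenius R (p ^ d)) f n = f [^] (\<Sum>i<n. (p ^ d) ^ i)"
proof -
  interpret X: presented_sheaf R "frobenius R (p ^ d)" X h J K f by fact
  show ?thesis
  proof (induction n)
    case (Suc n)
    then show ?case using X.f
      by (simp add: frobenius_funpow nat_pow_mult power_mult add.commute del: funpow.simps)
  qed simp
qed

lemma nrm_mem_iff:
  assumes "presented_sheaf R (frobenius R (p ^ d)) X h J K f" "ideal I R"
  shows "presented_sheaf.nrm R (frobenius R (p ^ d)) f n \<in> ring_endo.bracket R (frobenius R (p ^ d) ^^ n) I \<longleftrightarrow> chain f d n \<subseteq> I"
  unfolding nrm_eq[OF assms(1)] bracket_funpow[OF assms(2)]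
  using chain_le_iff[of f I d n] assms(2) presented_sheaf.f[OF assms(1)] by blast

text \<open>The torsion ideal annihilates the chain, and \<open>R\<close> is reduced.\<close>

lemma torsion_int_chain:
  assumes f: "f \<in> carrier R" and x: "x \<in> chain f d n" "f [^] (\<Sum>i<n. (p ^ d) ^ i) \<otimes> x = \<zero>"
  shows "x = \<zero>"
proof -
  let ?g = "f [^] (\<Sum>i<n. (p ^ d) ^ i)"
  have xc: "x \<in> carrier R" using x(1) idealD(2)[OF chain_ideal[OF f]] by blast
  obtain m where m: "p ^ (d * n) = Suc m" using p_ge_2 by (metis not0_implies_Suc not_numeral_le_zero power_not_zero)
  have z: "br e {\<zero>} = {\<zero>}" for e
  proof -
    interpret E: projective_endo R "\<lambda>x. x [^] (p ^ e)" by (rule level)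
    show ?thesis unfolding br_eq by (rule E.bracket_zero)
  qed
  \<comment> \<open>Since the power of \<open>x\<close> has positive exponent, it kills
    \<open>?g\<close> as well. The colon formula then turns this into: \<open>chain f d n\<close>
    annihilates \<open>x\<close>, so x^2 = 0 because \<open>x\<close> lies in that ideal.\<close>
  have "x [^] (p ^ (d * n)) \<otimes> ?g = x [^] m \<otimes> (?g \<otimes> x)" unfolding m using xc f by (simp add: m_ac)
  also have "\<dots> = \<zero>" using x(2) xc by simp
  finally have "x [^] (p ^ (d * n)) \<otimes> ?g \<in> br (d * n) {\<zero>}" using z by simp
  then have "?g \<in> br (d * n) (colon {\<zero>} x)" using br_colon[OF zeroideal xc] f by simp
  then have "chain f d n \<subseteq> colon {\<zero>} x" using chain_le_iff[OF f colon_ideal[OF zeroideal xc]] by blast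
  then have xx: "x \<otimes> x = \<zero>" using x(1) unfolding colon_def by blast
  interpret E: projective_endo R "\<lambda>x. x [^] (p ^ 1)" by (rule level)
  obtain k where k: "p = Suc (Suc k)" using p_ge_2 by (metis add_2_eq_Suc le_Suc_ex)
  show ?thesis
  proof (rule E.reduced[OF xc])
    have "x [^] (p ^ 1) = x [^] k \<otimes> (x \<otimes> x)" unfolding k using xc by (simp add: m_assoc)
    then show "x [^] (p ^ 1) = \<zero>" using xx xc by simp
    show "y [^] (p ^ 1) \<in> I" if I: "ideal I R" "y \<in> I" for y I
      unfolding k using idealD(7)[OF I, of "y [^] Suc k"] idealD(2)[OF I] by simp
  qed
qed

end

text \<open>The carrier of \<open>min_sheaf\<close> consists of classes in a colimit, so its
  identification with an ideal of R is the restriction of \<open>to_colimit\<close>, and the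
  inclusion of the limiting test ideal becomes an injection into it. All three claims refer to the
  stable value \<open>C\<close> of the chain: the minimal sheaf is the image of \<open>C\<close>,
  every chain ideal contains \<open>C\<close>, and M is minimal exactly when C = R.\<close>

theorem proposition3p5:
  fixes R :: "('a, 'x) ring_scheme"
    and p d q :: nat
    and \<sigma> :: "'a \<Rightarrow> 'a"
    and \<kappa> F\<^sub>q :: "'a set"
    and f :: 'a
    and M :: "('a, 'a) gamma_sheaf"
  assumes "normalization_semidom_class.prime p" and "[p] \<cdot>\<^bsub>R\<^esub> \<one>\<^bsub>R\<^esub> = \<zero>\<^bsub>R\<^esub>"
    and "d > 0" and "q = p ^ d" and "\<sigma> = frobenius R q"
    and "regular_ring R" and "finite_endomorphism R \<sigma>"
    and "subfield \<kappa> R" and "subfield F\<^sub>q R" and "card F\<^sub>q = q" and "F\<^sub>q \<subseteq> \<kappa>"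
    and "f \<in> carrier R" and "M = principal_sheaf R \<sigma> f"
  shows "(\<forall>\<^sub>F e in sequentially.
            bij_betw (to_colimit R \<sigma> M) (test_ideal R p f ((\<Sum>i<e. real q ^ i) / real q ^ e))
              (carrier (min_sheaf R \<sigma> M))) \<and>
         (inj_on (to_colimit R \<sigma> M) (test_ideal R p f (1 / (real q - 1))) \<and>
          to_colimit R \<sigma> M ` test_ideal R p f (1 / (real q - 1)) \<subseteq> carrier (min_sheaf R \<sigma> M)) \<and>
         (f_pure_threshold R p f \<ge> ereal (1 / (real q - 1)) \<longleftrightarrow> minimal_sheaf R \<sigma> M)"
proof -
  interpret cring R using assms(6) unfolding regular_ring_def by blast
  interpret noetherian_ring R using assms(6) unfolding regular_ring_def by blast
  interpret noetherian_cring R by unfold_locales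
  have hom: "(\<lambda>x. x [^]\<^bsub>R\<^esub> p) \<in> ring_hom R R" by (rule frobenius_hom[OF assms(1,2)])
  obtain \<Gamma> where "ring_endo.generates R (\<lambda>x. x [^]\<^bsub>R\<^esub> p) \<Gamma>"
    using finite_endomorphism_generates[OF is_cring hom assms(3)] assms(4,5,7) by blast
  then have "ring_endo.projective R (\<lambda>x. x [^]\<^bsub>R\<^esub> p)" by (rule kunz[OF assms(6,1,2)])
  then interpret frobenius_projective R p
    by (intro frobenius_projective.intro noetherian_cring_axioms frobenius_projective_axioms.intro
        prime_ge_2_nat[OF assms(1)] hom)
  have \<sigma>: "\<sigma> = frobenius R (p ^ d)" using assms(4,5) by simp
  note f = assms(12) and d = assms(3)
  interpret S: projective_endo R \<sigma> unfolding \<sigma> by (rule frobenius_projective_endo)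
  let ?tc = "to_colimit R \<sigma> M"
  interpret M: presented_sheaf R \<sigma> M "\<lambda>x. x" "carrier R" "{\<zero>\<^bsub>R\<^esub>}" f
    unfolding assms(13) by (rule S.principal_presented[OF f])
  interpret U: presented_sheaf R \<sigma> "upper_sheaf R \<sigma> M" ?tc "carrier R" M.torsion f
    by (rule M.upper_presented)
  obtain N where N: "\<forall>n\<ge>N. chain f d n = chain f d N" using chain_stable[OF f d] by blast
  define C where "C = chain f d N"
  have C: "ideal C R" unfolding C_def by (rule chain_ideal[OF f])
  have Cn: "chain f d n = C" if "n \<ge> N" for n using N that unfolding C_def by blast
  have nrm_iff: "M.nrm n \<in> M.brk n I \<longleftrightarrow> chain f d n \<subseteq> I" if "ideal I R" for n I
    using nrm_mem_iff[OF M.presented_sheaf_axioms[unfolded \<sigma>] that] unfolding \<sigma> .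
  have C_le: "C \<subseteq> chain f d n" for n
    using lift_Suc_antimono_le[of "chain f d", OF chain_decr[OF f], of n "n + N"] Cn[of "n + N"] by simp
  have fC: "f \<otimes>\<^bsub>R\<^esub> y \<in> S.bracket C" if "y \<in> C" for y
    using chain_Suc_le_iff[OF f C, of d N] Cn[of "Suc N"] that bracket_frobenius[OF C] unfolding \<sigma> C_def by simp
  \<comment> \<open>Nilpotency needs a positive exponent, hence \<open>Suc N\<close> rather than
    \<open>N\<close>, which may be 0.\<close>
  have nC: "M.nrm (Suc N) \<in> M.brk (Suc N) C" using nrm_iff[OF C, of "Suc N"] Cn[of "Suc N"] by simp
  have least: "C \<subseteq> I" if "ideal I R" "M.nrm m \<in> M.brk m I" for I m
    using C_le[of m] nrm_iff[OF that(1), of m] that(2) by blast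
  have min_carrier: "carrier (min_sheaf R \<sigma> M) = ?tc ` C"
    unfolding min_sheaf_def
    by (rule U.lower_carrier[OF noetherian_ring_axioms refl C fC _ nC least]) simp_all
  \<comment> \<open>Torsion of exponent \<open>i\<close> meets \<open>chain f d i\<close> trivially,
    and \<open>C\<close> lies in every chain ideal, so the argument works for whichever exponent
    occurs.\<close>
  have tors: "x = \<zero>\<^bsub>R\<^esub>" if x: "x \<in> C" "x \<in> M.torsion" for x
  proof -
    obtain i where i: "x \<in> carrier R" "M.nrm i \<otimes>\<^bsub>R\<^esub> x \<in> M.brk i {\<zero>\<^bsub>R\<^esub>}" using x(2) unfolding M.torsion_def by blast
    interpret I: ring_endo R "\<sigma> ^^ i" by (rule S.funpow_endo)
    have "f [^]\<^bsub>R\<^esub> (\<Sum>j<i. (p ^ d) ^ j) \<otimes>\<^bsub>R\<^esub> x = \<zero>\<^bsub>R\<^esub>"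
      using i(2) I.bracket_zero nrm_eq[OF M.presented_sheaf_axioms[unfolded \<sigma>], of i] unfolding \<sigma> by simp
    then show ?thesis using torsion_int_chain[OF f] C_le[of i] x(1) by blast
  qed
  have inj: "inj_on ?tc C"
  proof (rule inj_onI)
    fix x y assume xy: "x \<in> C" "y \<in> C" "?tc x = ?tc y"
    have c: "x \<in> carrier R" "y \<in> carrier R" using xy idealD(2)[OF C] by auto
    have "x \<ominus>\<^bsub>R\<^esub> y \<in> M.torsion" using U.h_eq_iff[OF c] xy(3) by blast
    then have "x \<ominus>\<^bsub>R\<^esub> y = \<zero>\<^bsub>R\<^esub>" using tors[OF idealD(6)[OF C xy(1,2)]] by blast
    then show "x = y" using c by (simp add: r_right_minus_eq)
  qed
  have part1: "\<forall>\<^sub>F e in sequentially. bij_betw ?tc (test_ideal R p f ((\<Sum>i<e. real q ^ i) / real q ^ e))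
      (carrier (min_sheaf R \<sigma> M))"
    using eventually_ge_at_top[of N]
  proof eventually_elim
    case (elim e)
    show ?case unfolding assms(4) test_ideal_chain[OF f] Cn[OF elim] bij_betw_def min_carrier using inj by blast
  qed
  have \<tau>C: "test_ideal R p f (1 / (real q - 1)) \<subseteq> C"
    unfolding assms(4) C_def by (rule test_ideal_limit_le_chain[OF f d])
  have all_iff: "(\<forall>e. chain f d e = carrier R) \<longleftrightarrow> C = carrier R"
    using C_le idealD(1)[OF chain_ideal[OF f]] unfolding C_def by (metis subset_antisym)
  have zero: "\<zero>\<^bsub>M\<^esub> = \<zero>\<^bsub>R\<^esub>" by (rule M.h_zero)
  have carM: "carrier M = carrier R" using M.car by simp
  have "minimal_sheaf R \<sigma> M \<longleftrightarrow> C = carrier R"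
  proof
    assume min: "minimal_sheaf R \<sigma> M"
    have zC: "{\<zero>\<^bsub>R\<^esub>} \<subseteq> C" using idealD(3)[OF C] by blast
    have sub: "gamma_subsheaf R \<sigma> M C"
      using M.is_gamma_subsheaf[OF noetherian_ring_axioms C zC idealD(1)[OF C] fC] by simp
    have "nilpotent_sheaf R \<sigma> (quot_sheaf R \<sigma> M C)"
    proof -
      have "\<forall>y\<in>carrier R. M.nrm (Suc N) \<otimes>\<^bsub>R\<^esub> y \<in> M.brk (Suc N) C"
        by (rule iffD2[OF M.ideal_mem_all_iff[OF refl C] nC])
      then have "nilpotent_sheaf R \<sigma> (quot_sheaf R \<sigma> M ((\<lambda>x. x) ` C))"
        by (intro iffD2[OF M.quotient_nilpotent_iff[OF C zC idealD(1)[OF C] fC]] exI[of _ "Suc N"] conjI zero_less_Suc)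
      then show ?thesis by simp
    qed
    then show "C = carrier R" using min sub carM unfolding minimal_sheaf_def by blast
  next
    assume CR: "C = carrier R"
    show "minimal_sheaf R \<sigma> M" unfolding minimal_sheaf_def
    proof (intro conjI allI impI M.coherent noetherian_ring_axioms; elim conjE)
      fix L assume L: "gamma_subsheaf R \<sigma> M L"
      obtain J' where "ideal J' R" "{\<zero>\<^bsub>R\<^esub>} \<subseteq> J'" "J' \<subseteq> carrier R" "L = (\<lambda>x. x) ` J'" "\<forall>y\<in>J'. f \<otimes>\<^bsub>R\<^esub> y \<in> S.bracket J'"
        by (rule M.gamma_subsheafE[OF L])
      then have J': "ideal L R" "{\<zero>\<^bsub>R\<^esub>} \<subseteq> L" "L \<subseteq> carrier R" "\<And>y. y \<in> L \<Longrightarrow> f \<otimes>\<^bsub>R\<^esub> y \<in> S.bracket L" by auto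
      { assume nil: "nilpotent_sheaf R \<sigma> (sub_sheaf R \<sigma> M L)"
        interpret L: presented_sheaf R \<sigma> "sub_sheaf R \<sigma> M L" "\<lambda>x. x" L "{\<zero>\<^bsub>R\<^esub>}" f
          using M.sub_sheaf_presented(1)[OF J'] by simp
        obtain n where "\<forall>y\<in>L. M.nrm n \<otimes>\<^bsub>R\<^esub> y \<in> M.brk n {\<zero>\<^bsub>R\<^esub>}" using nil L.nilpotent_iff by blast
        \<comment> \<open>A nilpotent subsheaf is torsion, and as C = R the torsion meets all of R
          trivially.\<close>
        then have "L \<subseteq> M.torsion" using J'(3) unfolding M.torsion_def by blast
        then have zeroL: "x = \<zero>\<^bsub>R\<^esub>" if "x \<in> L" for x
          using tors[of x] subsetD[OF _ that] J'(3) unfolding CR by metis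
        show "L = {\<zero>\<^bsub>M\<^esub>}" unfolding zero
        proof
          show "L \<subseteq> {\<zero>\<^bsub>R\<^esub>}"
          proof
            fix x assume "x \<in> L"
            then show "x \<in> {\<zero>\<^bsub>R\<^esub>}" by (simp only: zeroL singleton_iff)
          qed
        qed (rule J'(2)) }
      { assume "nilpotent_sheaf R \<sigma> (quot_sheaf R \<sigma> M L)"
        then have "nilpotent_sheaf R \<sigma> (quot_sheaf R \<sigma> M ((\<lambda>x. x) ` L))" by simp
        then obtain n where "\<forall>y\<in>carrier R. M.nrm n \<otimes>\<^bsub>R\<^esub> y \<in> M.brk n L"
          using iffD1[OF M.quotient_nilpotent_iff[OF J']] by blast
        then have "M.nrm n \<in> M.brk n L" by (rule iffD1[OF M.ideal_mem_all_iff[OF refl J'(1)]])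
        \<comment> \<open>The quotient by \<open>L\<close> being nilpotent, \<open>L\<close>
          contains the least such ideal \<open>C\<close>, here the whole ring.\<close>
        then have "C \<subseteq> L" by (rule least[OF J'(1)])
        then show "L = carrier M" using CR J'(3) carM by simp }
    qed
  qed
  then have part3: "f_pure_threshold R p f \<ge> ereal (1 / (real q - 1)) \<longleftrightarrow> minimal_sheaf R \<sigma> M"
    using f_pure_threshold_ge_iff[OF f d] all_iff unfolding assms(4) by blast
  have part2: "?tc ` test_ideal R p f (1 / (real q - 1)) \<subseteq> carrier (min_sheaf R \<sigma> M)"
    unfolding min_carrier by (rule image_mono[OF \<tau>C])
  show ?thesis by (intro conjI part1 inj_on_subset[OF inj \<tau>C] part2 part3)
qed

end
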